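(* Let $V\subset\mathbf{R}$ be a $\mathbf{Q}$-vector subspace and let $X$ be a polyhedral complex in $\mathbf{R}^n$ every cell of which is a $(\mathbf{Z},V)$-polytope. Then there exists a polyhedral complex $X'$ which refines $X$ such that every cell of $X'$ is a $(\mathbf{Z},V)$-polytope and a product of semistable simplices.
   Context: A $V$-affine function on $\mathbf{R}^n$ is a function $x\mapsto v+\sum_i a_ix_i$ with $v\in V$ and $a_i\in\mathbf{Z}$. A $(\mathbf{Z},V)$-polytope in $\mathbf{R}^n$ is a (nonempty) bounded set defined by finitely many inequalities $f_j\ge0$ with $f_j$ $V$-affine; equivalently, a polytope whose vertices lie in $V^n$ and whose edges have rational directions. A polyhedral complex is a finite collection of $k$-dimensional polytopes (for a fixed $k$) in $\mathbf{R}^n$, called cells, such that the intersection of any two cells is a face of both (the empty set counts as a face). $X'$ refines $X$ if every cell of $X'$ is contained in a cell of $X$ and $X'$ and $X$ have the same union of cells. Products of semistable simplices (polystable polytopes): for $m\ge0$ and $\pi\in V$, $\pi>0$, put $\Delta_m(\pi)=\{t\in\mathbf{R}^m: t_i\ge0,\ \sum_i t_i\le\pi\}$. A $(\mathbf{Z},V)$-polytope $P\subset\mathbf{R}^n$ is a semistable simplex if there is a transformation $x\mapsto Ax+v$ with $A\in\mathrm{GL}_n(\mathbf{Z})$, $v\in V^n$, taking $P$ onto $\Delta_m(\pi)\times\{0\}\subset\mathbf{R}^m\times\mathbf{R}^{n-m}$ for some $m,\pi$. It is a product of semistable simplices (as a polytope with this integral $V$-affine structure) if there is such a transformation taking $P$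 onto $\Delta_{m_1}(\pi_1)\times\dots\times\Delta_{m_l}(\pi_l)\times\{0\}$ for some $l\ge0$, $m_i\ge0$ and $\pi_i\in V$, $\pi_i>0$. *)

theory Defs
  imports "HOL-Analysis.Analysis"
begin

definition rat_subspace :: "real set \<Rightarrow> bool" where
  "rat_subspace V \<longleftrightarrow> module.subspace (\<lambda>(q::rat) (x::real). of_rat q * x) V"

lemma module_rat_real: "module (\<lambda>(q::rat) (x::real). of_rat q * x)"
  by unfold_locales (simp_all add: algebra_simps of_rat_add of_rat_mult)

lemma rat_subspace_iff:
  "rat_subspace V \<longleftrightarrow> 0 \<in> V \<and> (\<forall>x\<in>V. \<forall>y\<in>V. x + y \<in> V) \<and> (\<forall>q. \<forall>x\<in>V. of_rat q * x \<in> V)"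
  unfolding rat_subspace_def by (rule module.subspace_def[OF module_rat_real])

definition V_affine :: "real set \<Rightarrow> (real^'n \<Rightarrow> real) \<Rightarrow> bool" where
  "V_affine V f \<longleftrightarrow>
     (\<exists>v\<in>V. \<exists>a::int^'n. f = (\<lambda>x. v + (\<Sum>i\<in>UNIV. of_int (a $ i) * x $ i)))"

definition ZV_polytope :: "real set \<Rightarrow> (real^'n) set \<Rightarrow> bool" where
  "ZV_polytope V P \<longleftrightarrow>
     P \<noteq> {} \<and> bounded P \<and>
     (\<exists>F. finite F \<and> (\<forall>f\<in>F. V_affine V f) \<and> P = {x. \<forall>f\<in>F. 0 \<le> f x})"

text \<open>
  Polyhedral complexes are pure: only the cells of the common dimension \<open>k\<close> are listed, not
  their proper faces. \<^const>\<open>face_of\<close> admits the empty set and the whole polytope as faces.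
\<close>

definition polyhedral_complex :: "(real^'n) set set \<Rightarrow> bool" where
  "polyhedral_complex X \<longleftrightarrow>
     finite X \<and>
     (\<exists>k::nat. \<forall>P\<in>X. polytope P \<and> aff_dim P = int k) \<and>
     (\<forall>P\<in>X. \<forall>Q\<in>X. (P \<inter> Q) face_of P \<and> (P \<inter> Q) face_of Q)"

definition refines_complex :: "(real^'n) set set \<Rightarrow> (real^'n) set set \<Rightarrow> bool" where
  "refines_complex X' X \<longleftrightarrow> (\<forall>P\<in>X'. \<exists>Q\<in>X. P \<subseteq> Q) \<and> \<Union>X' = \<Union>X"

text \<open>
  The standard polystable polytope
  \<open>\<Delta>\<^bsub>m\<^sub>1\<^esub>(\<pi>\<^sub>1) \<times> \<dots> \<times> \<Delta>\<^bsub>m\<^sub>l\<^esub>(\<pi>\<^sub>l) \<times> {0}\<close>.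
  The index type of the coordinates carries no order, so the decomposition
  \<open>\<real>\<^sup>n = \<real>\<^bsup>m\<^sub>1\<^esup> \<times> \<dots> \<times> \<real>\<^bsup>m\<^sub>l\<^esup> \<times> \<real>\<^bsup>r\<^esup>\<close> is given by pairwise disjoint blocks \<open>J i\<close>
  of coordinates, with \<open>i\<close> ranging over \<open>{..<l}\<close> and \<open>m\<^sub>i\<close> the cardinality of the block
  (possibly zero). Different choices of blocks of the same sizes differ by a permutation of the
  coordinates, which is an element of \<open>GL\<^sub>n(\<int>)\<close>.
\<close>

definition std_polystable :: "nat \<Rightarrow> (nat \<Rightarrow> 'n set) \<Rightarrow> (nat \<Rightarrow> real) \<Rightarrow> (real^'n) set" where
  "std_polystable l J \<pi> =
     {x. (\<forall>i<l. (\<forall>j\<in>J i. 0 \<le> x $ j) \<and> (\<Sum>j\<in>J i. x $ j) \<le> \<pi> i) \<and>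
         (\<forall>j. j \<notin> (\<Union>i<l. J i) \<longrightarrow> x $ j = 0)}"

text \<open>
  \<open>A \<in> GL\<^sub>n(\<int>)\<close> is expressed by \<^const>\<open>invertible\<close> at type \<open>int^'n^'n\<close>: the inverse matrix is
  also integral.
\<close>

definition product_of_semistable_simplices :: "real set \<Rightarrow> (real^'n) set \<Rightarrow> bool" where
  "product_of_semistable_simplices V P \<longleftrightarrow>
     (\<exists>(A::int^'n^'n) (v::real^'n) l J \<pi>.
        invertible A \<and> (\<forall>i. v $ i \<in> V) \<and>
        disjoint_family_on J {..<l} \<and> (\<forall>i<l. \<pi> i \<in> V \<and> 0 < \<pi> i) \<and>
        (\<lambda>x. map_matrix real_of_int A *v x + v) ` P = std_polystable l J \<pi>)"

end

theory Submission
  imports Defs "HOL-Library.Multiset" "HOL-Library.Nat_Bijection"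
begin

text \<open>
  Idea of the proof. Write the constant terms of the affine forms defining \<open>X\<close> as positive combinations
  \<open>\<Sum> \<epsilon> a * e a\<close> with \<open>\<epsilon> a \<in> V\<close> and \<open>e a\<close> rational, and replace the \<open>\<epsilon> a\<close> by variables. Pulling the resulting
  rational cone and slicing at \<open>\<epsilon>\<close> refines \<open>X\<close> by products of simplices: each ray carries one label, and
  the points of the slice are the nonnegative combinations of the rays of a cell in which the weights
  with label \<open>a\<close> add up to \<open>t a \<in> V\<close>.

  Such a cell is a product of semistable simplices as soon as every relation on its rays (weights adding
  up to \<open>0\<close> for every label) with integral image is integral. As in the proof of semistable reduction by
  Kempf, Knudsen, Mumford and Saint-Donat, the lattice of relations is enlarged one element \<open>m\<close> at a time.
  If \<open>d * m\<close> lies in a lattice for which the cells are unimodular, star subdivision at the points of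
  \<open>m + L\<close> leaves relations of order less than \<open>d\<close> modulo integral ones, and an induction on this order applies.

  The rays introduced by a star subdivision have several labels with multiplicities. Decomposing \<open>t\<close> once
  more as a positive combination splits them into single slots, by a staircase triangulation; slots of
  the same size are then merged to single labels along chains in a product order. Both steps are
  unimodular and come down to the unique representation of couplings supported on chains.
\<close>

section \<open>Couplings supported on chains\<close>

text \<open>A cell is standard if the differences of its rays with a common label are linearly
  independent and span a saturated subgroup of Z^n. Independence comes from the uniqueness of
  weights, saturation from the condition on relations. A lower-dimensional cell also needs its edges
  completed to a basis of Z^n. Therefore a whole box [-c, c]^n is refined instead of the union of
  \<open>X\<close>: there every cell is a face of a full-dimensional one. As \<open>c\<close> must
  be a positive element of \<open>V\<close>, the case V = 0 is separate. The obstacle is that sizes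
  in \<open>V\<close> are in general incommensurable, and that a centre of a star subdivision,
  having degrees at several labels, spoils the product structure. Both times the remedy is to write
  real data as a positive combination of rational data on which finitely many linear inequalities
  keep their sign: the position of forms at the vertices of the arrangement at the start, the label
  that limits the weight of a centre later. The elimination behind this and the clearing of
  denominators divide elements of \<open>V\<close> by integers, which is where \<open>V\<close>
  being a Q-vector space enters.\<close>

definition pchain :: "'s set \<Rightarrow> ('s \<Rightarrow> 'l::linorder) set \<Rightarrow> bool" where
  "pchain S K \<longleftrightarrow> (\<forall>J\<in>K. \<forall>J'\<in>K. (\<forall>s\<in>S. J s \<le> J' s) \<or> (\<forall>s\<in>S. J' s \<le> J s))"

lemma pchain_subset: "pchain S K \<Longrightarrow> K' \<subseteq> K \<Longrightarrow> pchain S K'"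
  unfolding pchain_def by blast

lemma pchain_least:
  assumes "pchain S K" "finite K" "K \<noteq> {}"
  shows "\<exists>J0\<in>K. \<forall>J\<in>K. \<forall>s\<in>S. J0 s \<le> J s"
  using assms(2,3,1)
proof (induction K rule: finite_ne_induct)
  case (singleton x)
  then show ?case by simp
next
  case (insert x F)
  obtain J0 where J0: "J0 \<in> F" "\<forall>J\<in>F. \<forall>s\<in>S. J0 s \<le> J s"
    using insert pchain_subset[of S "insert x F" F] by blast
  have "(\<forall>s\<in>S. J0 s \<le> x s) \<or> (\<forall>s\<in>S. x s \<le> J0 s)"
    using insert.prems J0(1) unfolding pchain_def by blast
  then show ?case
  proof
    assume "\<forall>s\<in>S. J0 s \<le> x s" then show ?thesis using J0 by blast
  next
    assume a: "\<forall>s\<in>S. x s \<le> J0 s"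
    have "\<forall>J\<in>insert x F. \<forall>s\<in>S. x s \<le> J s" using a J0(2) by (auto intro: order_trans)
    then show ?thesis by blast
  qed
qed

text \<open>The witness \<open>s\<close> separates the least function from the second least one,
  \<open>J1\<close>; all others lie above \<open>J1\<close>. The marginal at
  \<open>(s, J0 s)\<close> therefore sees the weight of \<open>J0\<close> alone, which is how
  weights are read off below.\<close>

lemma pchain_least_strict:
  assumes ch: "pchain S K" and "finite K" "K \<noteq> {}" and ext: "K \<subseteq> extensional S"
  shows "\<exists>J0\<in>K. (\<forall>J\<in>K. \<forall>s\<in>S. J0 s \<le> J s) \<and>
    (K = {J0} \<or> (\<exists>s\<in>S. \<forall>J\<in>K. J \<noteq> J0 \<longrightarrow> J0 s < J s))"
proof -
  obtain J0 where J0: "J0 \<in> K" "\<forall>J\<in>K. \<forall>s\<in>S. J0 s \<le> J s"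
    using pchain_least[OF ch assms(2,3)] by blast
  have "K = {J0} \<or> (\<exists>s\<in>S. \<forall>J\<in>K. J \<noteq> J0 \<longrightarrow> J0 s < J s)"
  proof (cases "K - {J0} = {}")
    case True then show ?thesis using J0(1) by blast
  next
    case False
    obtain J1 where J1: "J1 \<in> K - {J0}" "\<forall>J\<in>K - {J0}. \<forall>s\<in>S. J1 s \<le> J s"
      using pchain_least[of S "K - {J0}"] pchain_subset[OF ch] False \<open>finite K\<close> by blast
    obtain s where s: "s \<in> S" "J1 s \<noteq> J0 s"
      using J1(1) J0(1) ext extensionalityI[of J1 S J0] by blast
    have "J0 s < J s" if "J \<in> K" "J \<noteq> J0" for J
      using that s J1 J0(2) by (metis DiffD1 insert_Diff insert_iff order_le_less order_less_le_trans J0(1))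
    then show ?thesis using s(1) by blast
  qed
  then show ?thesis using J0 by blast
qed

text \<open>Among couplings of finitely many distributions on chains, exactly one is supported on a chain
  of the product order.\<close>

lemma chain_coupling_exists:
  fixes m :: "'s \<Rightarrow> 'l::linorder \<Rightarrow> real"
  assumes "finite S" "finite L"
    and "\<And>s l. s \<in> S \<Longrightarrow> 0 \<le> m s l"
    and "\<And>s. s \<in> S \<Longrightarrow> (\<Sum>l\<in>L. m s l) = \<epsilon>" and "0 \<le> \<epsilon>"
  shows "\<exists>\<alpha>. (\<forall>J. 0 \<le> \<alpha> J) \<and> (\<forall>J. \<alpha> J \<noteq> 0 \<longrightarrow> J \<in> PiE S (\<lambda>_. L)) \<and> pchain S {J. \<alpha> J \<noteq> 0} \<and>
    (\<Sum>J\<in>PiE S (\<lambda>_. L). \<alpha> J) = \<epsilon> \<and>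
    (\<forall>s\<in>S. \<forall>l\<in>L. (\<Sum>J\<in>PiE S (\<lambda>_. L). \<alpha> J * of_bool (J s = l)) = m s l)"
  using assms(3-5)
\<comment> \<open>Each greedy step exhausts at least one atom of one of the distributions, so the
  number of atoms is the measure.\<close>
proof (induction "\<Sum>s\<in>S. card {l\<in>L. m s l \<noteq> 0}" arbitrary: m \<epsilon> rule: less_induct)
  case less
  let ?P = "PiE S (\<lambda>_. L)"
  have finP: "finite ?P" using assms by (simp add: finite_PiE)
  consider (e) "S = {}" | (z) "\<epsilon> = 0" | (p) "S \<noteq> {}" "\<epsilon> > 0" using less.prems by force
  then show ?case
  proof cases
    case e
    have P: "?P = {\<lambda>_. undefined}" using e by simp
    show ?thesis
      by (rule exI[of _ "\<lambda>J. if J = (\<lambda>_. undefined) then \<epsilon> else 0"])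
         (use less.prems P e in \<open>auto simp: pchain_def\<close>)
  next
    case z
    have "\<forall>s\<in>S. \<forall>l\<in>L. m s l = 0"
      using less.prems z assms(2) by (simp add: sum_nonneg_eq_0_iff)
    then show ?thesis
      by (intro exI[of _ "\<lambda>J. 0"]) (use z in \<open>auto simp: pchain_def\<close>)
  next
    case p
    define U where "U s = {l\<in>L. m s l \<noteq> 0}" for s
    have finU: "finite (U s)" for s using assms(2) by (simp add: U_def)
    have Une: "U s \<noteq> {}" if "s \<in> S" for s
    proof
      assume "U s = {}"
      then have "(\<Sum>l\<in>L. m s l) = 0" by (intro sum.neutral) (auto simp: U_def)
      then show False using less.prems(2)[OF that] p by simp
    qed
    define J0 where "J0 = restrict (\<lambda>s. Min (U s)) S"
    have J0U: "J0 s \<in> U s" if "s \<in> S" for s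
      using Min_in[OF finU Une[OF that]] that by (simp add: J0_def)
    have J0le: "J0 s \<le> l" if "s \<in> S" "l \<in> U s" for s l
      using Min_le[OF finU that(2)] that by (simp add: J0_def)
    have J0P: "J0 \<in> ?P" using J0U by (auto simp: J0_def U_def PiE_def)
    \<comment> \<open>\<open>J0\<close> collects the smallest labels that still carry mass, and
      \<open>\<delta>\<close> is the largest weight it can take without making a marginal
      negative.\<close>
    define \<delta> where "\<delta> = Min ((\<lambda>s. m s (J0 s)) ` S)"
    have d_le: "\<delta> \<le> m s (J0 s)" if "s \<in> S" for s
      unfolding \<delta>_def using that assms(1) by (intro Min_le) auto
    have "\<delta> \<in> (\<lambda>s. m s (J0 s)) ` S" unfolding \<delta>_def using p assms(1) by (intro Min_in) auto
    then obtain s0 where s0: "s0 \<in> S" "\<delta> = m s0 (J0 s0)" by blast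
    have dpos: "\<delta> > 0" using s0 J0U[OF s0(1)] less.prems(1)[OF s0(1), of "J0 s0"] by (simp add: U_def)
    define m' where "m' s l = m s l - (if l = J0 s then \<delta> else 0)" for s l
    have m'nn: "0 \<le> m' s l" if "s \<in> S" for s l
      using that less.prems(1) d_le by (auto simp: m'_def)
    have J0L: "J0 s \<in> L" if "s \<in> S" for s using J0U[OF that] by (simp add: U_def)
    have m'sum: "(\<Sum>l\<in>L. m' s l) = \<epsilon> - \<delta>" if "s \<in> S" for s
      using less.prems(2)[OF that] J0L[OF that] assms(2) by (simp add: m'_def sum_subtractf)
    have e'nn: "0 \<le> \<epsilon> - \<delta>"
      using m'sum[OF s0(1)] sum_nonneg[of L "m' s0"] m'nn[OF s0(1)] by force
    have sub: "{l\<in>L. m' s l \<noteq> 0} \<subseteq> U s" if "s \<in> S" for s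
      using J0U[OF that] by (auto simp: m'_def U_def split: if_splits)
    have strict: "{l\<in>L. m' s0 l \<noteq> 0} \<subset> U s0"
      using sub[OF s0(1)] J0U[OF s0(1)] s0(2) by (auto simp: m'_def)
    have "(\<Sum>s\<in>S. card {l\<in>L. m' s l \<noteq> 0}) < (\<Sum>s\<in>S. card {l\<in>L. m s l \<noteq> 0})"
    proof (rule sum_strict_mono_ex1)
      show "\<forall>x\<in>S. card {l \<in> L. m' x l \<noteq> 0} \<le> card {l \<in> L. m x l \<noteq> 0}"
        using sub finU by (auto simp: U_def intro!: card_mono)
      show "\<exists>a\<in>S. card {l \<in> L. m' a l \<noteq> 0} < card {l \<in> L. m a l \<noteq> 0}"
        using strict finU s0(1) by (intro bexI[of _ s0]) (auto simp: U_def intro!: psubset_card_mono)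
    qed (use assms in auto)
    from less.hyps[OF this m'nn m'sum e'nn]
    obtain \<alpha> where \<alpha>: "\<forall>J. 0 \<le> \<alpha> J" "\<forall>J. \<alpha> J \<noteq> 0 \<longrightarrow> J \<in> ?P" "pchain S {J. \<alpha> J \<noteq> 0}"
      "(\<Sum>J\<in>?P. \<alpha> J) = \<epsilon> - \<delta>"
      "\<And>s l. s \<in> S \<Longrightarrow> l \<in> L \<Longrightarrow> (\<Sum>J\<in>?P. \<alpha> J * of_bool (J s = l)) = m' s l" by blast
    \<comment> \<open>The functions used for the remaining mass only take labels that still carry
      mass, so they lie above \<open>J0\<close>. This keeps the support a chain.\<close>
    have ge: "J0 s \<le> J s" if "\<alpha> J \<noteq> 0" "s \<in> S" for J s
    proof -
      have JP: "J \<in> ?P" using \<alpha>(2) that by blast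
      have JL: "J s \<in> L" using JP that by (auto simp: PiE_def)
      have "\<alpha> J * of_bool (J s = J s) \<le> (\<Sum>J'\<in>?P. \<alpha> J' * of_bool (J' s = J s))"
        by (rule member_le_sum[OF JP _ finP]) (use \<alpha>(1) in auto)
      then have "m' s (J s) > 0" using \<alpha>(5)[OF that(2) JL] \<alpha>(1) that(1) by (metis less_eq_real_def of_bool_eq(2) mult.right_neutral order_less_le_trans)
      then have "J s \<in> U s" using sub[OF that(2)] JL by force
      then show ?thesis using J0le that by blast
    qed
    define \<beta> where "\<beta> J = \<alpha> J + (if J = J0 then \<delta> else 0)" for J
    have "pchain S {J. \<beta> J \<noteq> 0}"
    proof -
      have "{J. \<beta> J \<noteq> 0} \<subseteq> insert J0 {J. \<alpha> J \<noteq> 0}" by (auto simp: \<beta>_def)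
      moreover have "pchain S (insert J0 {J. \<alpha> J \<noteq> 0})"
        using \<alpha>(3) ge unfolding pchain_def by blast
      ultimately show ?thesis by (rule pchain_subset[rotated])
    qed
    moreover have "(\<Sum>J\<in>?P. \<beta> J) = \<epsilon>"
      using \<alpha>(4) J0P finP by (simp add: \<beta>_def sum.distrib)
    moreover have "(\<Sum>J\<in>?P. \<beta> J * of_bool (J s = l)) = m s l" if "s \<in> S" "l \<in> L" for s l
    proof -
      have "(\<Sum>J\<in>?P. \<beta> J * of_bool (J s = l)) =
        (\<Sum>J\<in>?P. \<alpha> J * of_bool (J s = l)) + (\<Sum>J\<in>?P. if J = J0 then \<delta> * of_bool (J0 s = l) else 0)"
        unfolding sum.distrib[symmetric] by (intro sum.cong) (auto simp: \<beta>_def algebra_simps)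
      also have "\<dots> = m' s l + \<delta> * of_bool (J0 s = l)" using \<alpha>(5)[OF that] J0P finP by simp
      also have "\<dots> = m s l" by (auto simp: m'_def)
      finally show ?thesis .
    qed
    moreover have "\<forall>J. 0 \<le> \<beta> J" "\<forall>J. \<beta> J \<noteq> 0 \<longrightarrow> J \<in> ?P"
      using \<alpha>(1,2) dpos J0P by (auto simp: \<beta>_def)
    ultimately show ?thesis by blast
  qed
qed

lemma sum_fun_upd_zero:
  fixes \<alpha> f :: "'a \<Rightarrow> real"
  assumes "finite P" "a \<in> P"
  shows "(\<Sum>J\<in>P. (\<alpha>(a := 0)) J * f J) = (\<Sum>J\<in>P. \<alpha> J * f J) - \<alpha> a * f a"
  using assms by (simp add: sum.remove[of P a])

text \<open>The weight of the least function of the support is one of the given integers: the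
  marginal that isolates it, or the total if it is alone. Removing it preserves the hypotheses.
  Weights of either sign are allowed because the lemma serves relations.\<close>

lemma chain_coupling_integral:
  fixes \<alpha> :: "('s \<Rightarrow> 'l::linorder) \<Rightarrow> real"
  assumes "finite P" "pchain S {J\<in>P. \<alpha> J \<noteq> 0}" "P \<subseteq> extensional S"
    and "(\<Sum>J\<in>P. \<alpha> J) \<in> \<int>"
    and "\<And>s l. s \<in> S \<Longrightarrow> (\<Sum>J\<in>P. \<alpha> J * of_bool (J s = l)) \<in> \<int>"
    and "J \<in> P"
  shows "\<alpha> J \<in> \<int>"
  using assms(2,4-6)
proof (induction "card {J\<in>P. \<alpha> J \<noteq> 0}" arbitrary: \<alpha> J rule: less_induct)
  case less
  let ?K = "{J\<in>P. \<alpha> J \<noteq> 0}"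
  show ?case
  proof (cases "?K = {}")
    case True then show ?thesis using less.prems(4) by force
  next
    case False
    have fK: "finite ?K" and eK: "?K \<subseteq> extensional S" using assms(1,3) by auto
    obtain J0 where J0: "J0 \<in> ?K" "?K = {J0} \<or> (\<exists>s\<in>S. \<forall>J\<in>?K. J \<noteq> J0 \<longrightarrow> J0 s < J s)"
      using bexE[OF pchain_least_strict[OF less.prems(1) fK False eK]] by (metis (no_types, lifting))
    have 1: "\<alpha> J0 \<in> \<int>"
      using J0(2)
    proof
      assume "?K = {J0}"
      then have "(\<Sum>J\<in>P. \<alpha> J) = \<alpha> J0"
        using sum.mono_neutral_right[of P "{J0}" \<alpha>] assms(1) by auto
      then show ?thesis using less.prems(2) by simp
    next
      assume "\<exists>s\<in>S. \<forall>J\<in>?K. J \<noteq> J0 \<longrightarrow> J0 s < J s"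
      then obtain s where s: "s \<in> S" "\<forall>J\<in>?K. J \<noteq> J0 \<longrightarrow> J0 s < J s" by blast
      have "(\<Sum>J\<in>P. \<alpha> J * of_bool (J s = J0 s)) = (\<Sum>J\<in>{J0}. \<alpha> J * of_bool (J s = J0 s))"
        using J0(1) s(2) assms(1) by (intro sum.mono_neutral_right) auto
      then show ?thesis using less.prems(3)[OF s(1), of "J0 s"] by simp
    qed
    let ?\<alpha> = "\<alpha>(J0 := 0)"
    have K': "{J\<in>P. ?\<alpha> J \<noteq> 0} = ?K - {J0}" by auto
    have "card {J\<in>P. ?\<alpha> J \<noteq> 0} < card ?K"
      unfolding K' using J0(1) assms(1) by (intro psubset_card_mono) auto
    moreover have "pchain S {J\<in>P. ?\<alpha> J \<noteq> 0}" using less.prems(1) by (rule pchain_subset) auto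
    moreover have "(\<Sum>J\<in>P. ?\<alpha> J) \<in> \<int>"
    proof -
      have "(\<Sum>J\<in>P. ?\<alpha> J) = (\<Sum>J\<in>P. \<alpha> J) - \<alpha> J0"
        using assms(1) J0(1) by (simp add: sum.remove[of P J0] sum.If_cases Diff_eq)
      then show ?thesis using less.prems(2) 1 by simp
    qed
    moreover have "(\<Sum>J\<in>P. ?\<alpha> J * of_bool (J s = l)) \<in> \<int>" if "s \<in> S" for s l
    proof -
      have "(\<Sum>J\<in>P. ?\<alpha> J * of_bool (J s = l)) = (\<Sum>J\<in>P. \<alpha> J * of_bool (J s = l)) - \<alpha> J0 * of_bool (J0 s = l)"
        using J0(1) by (intro sum_fun_upd_zero[OF assms(1)]) auto
      then show ?thesis using less.prems(3)[OF that, of l] 1 by (auto simp: Ints_diff of_bool_def)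
    qed
    ultimately have "?\<alpha> J \<in> \<int>" using less.hyps less.prems(4) by blast
    then show ?thesis using 1 by (cases "J = J0") auto
  qed
qed

text \<open>By nonnegativity nothing cancels in a marginal, so the least function of a support has
  as its value at \<open>s\<close> the smallest label of positive mass at \<open>s\<close>. Both
  supports thus have the same least function; comparing the marginals or totals that isolate it
  gives equal weights, and it can be removed.\<close>

lemma chain_coupling_unique:
  fixes \<alpha> \<beta> :: "('s \<Rightarrow> 'l::linorder) \<Rightarrow> real"
  assumes "finite P" "P \<subseteq> extensional S"
    and "\<And>J. J \<in> P \<Longrightarrow> 0 \<le> \<alpha> J" "\<And>J. J \<in> P \<Longrightarrow> 0 \<le> \<beta> J"
    and "pchain S {J\<in>P. \<alpha> J \<noteq> 0}" "pchain S {J\<in>P. \<beta> J \<noteq> 0}"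
    and "(\<Sum>J\<in>P. \<alpha> J) = (\<Sum>J\<in>P. \<beta> J)"
    and "\<And>s l. s \<in> S \<Longrightarrow> (\<Sum>J\<in>P. \<alpha> J * of_bool (J s = l)) = (\<Sum>J\<in>P. \<beta> J * of_bool (J s = l))"
    and "J \<in> P"
  shows "\<alpha> J = \<beta> J"
proof -
  define least where "least K J0 \<longleftrightarrow> J0 \<in> K \<and> (\<forall>J\<in>K. \<forall>s\<in>S. J0 s \<le> J s) \<and>
     (K = {J0} \<or> (\<exists>s\<in>S. \<forall>J\<in>K. J \<noteq> J0 \<longrightarrow> J0 s < J s))" for K :: "('s \<Rightarrow> 'l) set" and J0
  have ex: "\<exists>J0. least {J\<in>P. \<gamma> J \<noteq> 0} J0"
    if "pchain S {J\<in>P. \<gamma> J \<noteq> 0}" "{J\<in>P. \<gamma> J \<noteq> 0} \<noteq> {}" for \<gamma> :: "('s \<Rightarrow> 'l) \<Rightarrow> real"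
  proof -
    have "finite {J\<in>P. \<gamma> J \<noteq> 0}" "{J\<in>P. \<gamma> J \<noteq> 0} \<subseteq> extensional S" using assms(1,2) by auto
    from pchain_least_strict[OF that(1) this(1) that(2) this(2)] show ?thesis
      unfolding least_def Bex_def by (elim exE) (rule exI, assumption)
  qed
  have pos: "\<exists>J\<in>P. \<gamma> J \<noteq> 0 \<and> J s = l"
    if "0 < (\<Sum>J\<in>P. \<gamma> J * of_bool (J s = l))" for \<gamma> :: "('s \<Rightarrow> 'l) \<Rightarrow> real" and s l
  proof (rule ccontr)
    assume "\<not> ?thesis"
    then have "(\<Sum>J\<in>P. \<gamma> J * of_bool (J s = l)) = 0" by (intro sum.neutral) auto
    then show False using that by simp
  qed
  have ge: "\<gamma> J \<le> (\<Sum>J'\<in>P. \<gamma> J' * of_bool (J' s = J s))"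
    if "J \<in> P" "\<And>J. J \<in> P \<Longrightarrow> 0 \<le> \<gamma> J" for \<gamma> :: "('s \<Rightarrow> 'l) \<Rightarrow> real" and s J
    using member_le_sum[OF that(1), of "\<lambda>J'. \<gamma> J' * of_bool (J' s = J s)"] that assms(1) by simp
  have leasteq: "J1 = J2 \<and> \<gamma> J1 \<le> \<gamma>' J2"
    if nn: "\<And>J. J \<in> P \<Longrightarrow> 0 \<le> \<gamma> J" "\<And>J. J \<in> P \<Longrightarrow> 0 \<le> \<gamma>' J"
      and tot: "(\<Sum>J\<in>P. \<gamma> J) = (\<Sum>J\<in>P. \<gamma>' J)"
      and eq: "\<And>s l. s \<in> S \<Longrightarrow> (\<Sum>J\<in>P. \<gamma> J * of_bool (J s = l)) = (\<Sum>J\<in>P. \<gamma>' J * of_bool (J s = l))"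
      and l1: "least {J\<in>P. \<gamma> J \<noteq> 0} J1" and l2: "least {J\<in>P. \<gamma>' J \<noteq> 0} J2"
    for \<gamma> \<gamma>' :: "('s \<Rightarrow> 'l) \<Rightarrow> real" and J1 J2
  proof -
    have P1: "J1 \<in> P" "\<gamma> J1 > 0" using l1 nn unfolding least_def by (auto simp: order_less_le)
    have P2: "J2 \<in> P" "\<gamma>' J2 > 0" using l2 nn unfolding least_def by (auto simp: order_less_le)
    have eqs: "J1 s = J2 s" if s: "s \<in> S" for s
    proof (rule antisym)
      have "0 < (\<Sum>J\<in>P. \<gamma> J * of_bool (J s = J2 s))"
        using ge[where s=s and \<gamma>=\<gamma>', OF P2(1) nn(2)] P2(2) eq[OF s] by simp
      then show "J1 s \<le> J2 s" using pos[where \<gamma>=\<gamma> and s=s and l="J2 s"] l1 s unfolding least_def by force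
      have "0 < (\<Sum>J\<in>P. \<gamma>' J * of_bool (J s = J1 s))"
        using ge[where s=s and \<gamma>=\<gamma>, OF P1(1) nn(1)] P1(2) eq[OF s] by simp
      then show "J2 s \<le> J1 s" using pos[where \<gamma>=\<gamma>' and s=s and l="J1 s"] l2 s unfolding least_def by force
    qed
    then have e: "J1 = J2" using P1(1) P2(1) assms(2) by (intro extensionalityI[of _ S]) auto
    have "\<gamma> J1 \<le> \<gamma>' J2"
    proof (cases "{J\<in>P. \<gamma>' J \<noteq> 0} = {J2}")
      case True
      have "(\<Sum>J\<in>P. \<gamma>' J) = \<gamma>' J2"
        using sum.mono_neutral_right[of P "{J2}" \<gamma>'] True assms(1) by auto
      moreover have "\<gamma> J1 \<le> (\<Sum>J\<in>P. \<gamma> J)" using P1 nn assms(1) by (intro member_le_sum) auto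
      ultimately show ?thesis using tot by simp
    next
      case False
      then obtain s where s: "s \<in> S" "\<forall>J\<in>{J\<in>P. \<gamma>' J \<noteq> 0}. J \<noteq> J2 \<longrightarrow> J2 s < J s"
        using l2 unfolding least_def by blast
      have "(\<Sum>J\<in>P. \<gamma>' J * of_bool (J s = J2 s)) = (\<Sum>J\<in>{J2}. \<gamma>' J * of_bool (J s = J2 s))"
        using P2(1) s(2) assms(1) by (intro sum.mono_neutral_right) auto
      then show ?thesis using ge[where s=s and \<gamma>=\<gamma>, OF P1(1) nn(1)] eq[OF s(1)] e by simp
    qed
    then show ?thesis using e by simp
  qed
  show ?thesis
    using assms(3-9)
  proof (induction "card {J\<in>P. \<alpha> J \<noteq> 0}" arbitrary: \<alpha> \<beta> J rule: less_induct)
    case less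
    have zero: "\<forall>J\<in>P. \<gamma> J = 0" if "\<And>J. J \<in> P \<Longrightarrow> 0 \<le> \<gamma> J" "(\<Sum>J\<in>P. \<gamma> J) = 0" for \<gamma> :: "('s \<Rightarrow> 'l) \<Rightarrow> real"
      using that assms(1) by (simp add: sum_nonneg_eq_0_iff)
    show ?case
    proof (cases "{J\<in>P. \<alpha> J \<noteq> 0} = {} \<or> {J\<in>P. \<beta> J \<noteq> 0} = {}")
      case True
      then have "(\<Sum>J\<in>P. \<alpha> J) = 0 \<or> (\<Sum>J\<in>P. \<beta> J) = 0" by (auto intro!: sum.neutral)
      then have h: "(\<Sum>J\<in>P. \<alpha> J) = 0" "(\<Sum>J\<in>P. \<beta> J) = 0" using less.prems(5) by auto
      have "\<forall>J\<in>P. \<alpha> J = 0" by (rule zero[OF _ h(1)]) (rule less.prems(1))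
      moreover have "\<forall>J\<in>P. \<beta> J = 0" by (rule zero[OF _ h(2)]) (rule less.prems(2))
      ultimately have "\<alpha> J = 0" "\<beta> J = 0" using less.prems(7) by simp_all
      then show ?thesis by simp
    next
      case False
      then have ne: "{J\<in>P. \<alpha> J \<noteq> 0} \<noteq> {}" "{J\<in>P. \<beta> J \<noteq> 0} \<noteq> {}" by simp_all
      obtain J1 where l1: "least {J\<in>P. \<alpha> J \<noteq> 0} J1" using ex[OF less.prems(3) ne(1)] by (elim exE)
      obtain J2 where l2: "least {J\<in>P. \<beta> J \<noteq> 0} J2" using ex[OF less.prems(4) ne(2)] by (elim exE)
      note l = l1 l2
      have A: "J1 = J2 \<and> \<alpha> J1 \<le> \<beta> J2"
        by (rule leasteq[OF less.prems(1,2,5,6) l])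
      have B: "J2 = J1 \<and> \<beta> J2 \<le> \<alpha> J1"
        by (rule leasteq[OF less.prems(2,1) less.prems(5)[symmetric] less.prems(6)[symmetric] l2 l1])
      have e: "J1 = J2" "\<alpha> J1 = \<beta> J1" using A B by auto
      have J1: "J1 \<in> P" "\<alpha> J1 \<noteq> 0" using l(1) unfolding least_def by auto
      let ?\<alpha> = "\<alpha>(J1 := 0)" and ?\<beta> = "\<beta>(J1 := 0)"
      have rm: "(\<Sum>J\<in>P. (\<gamma>(J1 := 0)) J * f J) = (\<Sum>J\<in>P. \<gamma> J * f J) - \<gamma> J1 * f J1"
        for \<gamma> :: "('s \<Rightarrow> 'l) \<Rightarrow> real" and f
        by (rule sum_fun_upd_zero[OF assms(1) J1(1)])
      have 1: "card {J\<in>P. ?\<alpha> J \<noteq> 0} < card {J\<in>P. \<alpha> J \<noteq> 0}"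
        using J1 assms(1) by (intro psubset_card_mono) auto
      have 2: "pchain S {J\<in>P. ?\<alpha> J \<noteq> 0}" "pchain S {J\<in>P. ?\<beta> J \<noteq> 0}"
        by (rule pchain_subset[OF less.prems(3)], auto) (rule pchain_subset[OF less.prems(4)], auto)
      have 3: "(\<Sum>J\<in>P. ?\<alpha> J) = (\<Sum>J\<in>P. ?\<beta> J)"
        using rm[of \<alpha> "\<lambda>_. 1"] rm[of \<beta> "\<lambda>_. 1"] less.prems(5) e by simp
      have 4: "(\<Sum>J\<in>P. ?\<alpha> J * of_bool (J s = l)) = (\<Sum>J\<in>P. ?\<beta> J * of_bool (J s = l))" if "s \<in> S" for s l
        using rm[of \<alpha> "\<lambda>J. of_bool (J s = l)"] rm[of \<beta> "\<lambda>J. of_bool (J s = l)"] less.prems(6)[OF that] e by simp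
      have 5: "0 \<le> ?\<alpha> J" "0 \<le> ?\<beta> J" if "J \<in> P" for J
        using less.prems(1,2)[OF that] by auto
      have "?\<alpha> J = ?\<beta> J" by (rule less.hyps[OF 1 5 2 3 4 less.prems(7)])
      then show ?thesis using e by (cases "J = J1") auto
    qed
  qed
qed

section \<open>Greedy fillings and the north-west corner rule\<close>

definition filling :: "'q::linorder set \<Rightarrow> ('q \<Rightarrow> real) \<Rightarrow> ('q \<Rightarrow> real) \<Rightarrow> bool" where
  "filling Q c \<kappa> \<longleftrightarrow> (\<forall>p\<in>Q. 0 \<le> \<kappa> p \<and> \<kappa> p \<le> c p) \<and>
     (\<forall>p\<in>Q. \<forall>p'\<in>Q. p < p' \<longrightarrow> \<kappa> p' \<noteq> 0 \<longrightarrow> \<kappa> p = c p)"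

text \<open>The greatest slot stays empty as long as the others can hold \<open>w\<close>; otherwise
  the others are full and it takes the rest.\<close>

lemma filling_exists:
  fixes Q :: "'q::linorder set"
  assumes "finite Q" "\<And>p. p \<in> Q \<Longrightarrow> 0 \<le> c p" "0 \<le> w" "w \<le> sum c Q"
  shows "\<exists>\<kappa>. filling Q c \<kappa> \<and> sum \<kappa> Q = w"
  using assms
proof (induction Q arbitrary: w rule: finite_linorder_max_induct)
  case empty
  then show ?case by (auto simp: filling_def)
next
  case (insert q Q)
  have q: "q \<notin> Q" using insert by auto
  have upd: "sum (f(q := v)) (insert q Q) = v + sum f Q" for f :: "'q \<Rightarrow> real" and v
  proof -
    have "sum (f(q := v)) Q = sum f Q" by (rule sum.cong) (use q in auto)
    then show ?thesis using q insert.hyps(1) by simp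
  qed
  show ?case
  proof (cases "w \<le> sum c Q")
    case True
    then obtain \<kappa> where k: "filling Q c \<kappa>" "sum \<kappa> Q = w" using insert by auto
    have "filling (insert q Q) c (\<kappa>(q := 0))"
      unfolding filling_def
    proof (intro conjI ballI impI)
      fix p p' assume p: "p \<in> insert q Q" "p' \<in> insert q Q" "p < p'" "(\<kappa>(q := 0)) p' \<noteq> 0"
      then have "p' \<noteq> q" by auto
      then have "p' \<in> Q" "p \<noteq> q" using p insert.hyps(2) by force+
      then have "p \<in> Q" using p by simp
      show "(\<kappa>(q := 0)) p = c p"
        using k(1) p \<open>p' \<in> Q\<close> \<open>p \<in> Q\<close> \<open>p \<noteq> q\<close> \<open>p' \<noteq> q\<close> unfolding filling_def by simp
    qed (use k(1) insert.prems(1) in \<open>auto simp: filling_def\<close>)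
    moreover have "sum (\<kappa>(q := 0)) (insert q Q) = w"
      using upd[of \<kappa> 0] k(2) by simp
    ultimately show ?thesis by blast
  next
    case False
    have "filling (insert q Q) c (c(q := w - sum c Q))"
      unfolding filling_def
    proof (intro conjI ballI impI)
      fix p p' assume p: "p \<in> insert q Q" "p' \<in> insert q Q" "p < p'"
      then have "p \<noteq> q" using insert.hyps(2) by force
      then show "(c(q := w - sum c Q)) p = c p" by simp
    qed (use False insert.prems insert.hyps(1) q in auto)
    moreover have "sum (c(q := w - sum c Q)) (insert q Q) = w"
      using upd[of c "w - sum c Q"] by simp
    ultimately show ?thesis by blast
  qed
qed

text \<open>At the first slot of disagreement the smaller filling is not full, hence vanishes on all
  later slots, and its total is too small.\<close>

lemma filling_unique:
  fixes Q :: "'q::linorder set"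
  assumes Q: "finite Q" and f: "filling Q c \<kappa>" "filling Q c \<kappa>'" and s: "sum \<kappa> Q = sum \<kappa>' Q" and p: "p \<in> Q"
  shows "\<kappa> p = \<kappa>' p"
proof (rule ccontr)
  assume ne: "\<kappa> p \<noteq> \<kappa>' p"
  define D where "D = {p\<in>Q. \<kappa> p \<noteq> \<kappa>' p}"
  define r where "r = Min D"
  have D: "finite D" "D \<noteq> {}" using Q p ne by (auto simp: D_def)
  have r: "r \<in> Q" "\<kappa> r \<noteq> \<kappa>' r" using Min_in[OF D] by (auto simp: r_def D_def)
  have before: "\<kappa> x = \<kappa>' x" if "x \<in> Q" "x < r" for x
  proof -
    have "x \<in> D \<Longrightarrow> r \<le> x" unfolding r_def by (rule Min_le[OF D(1)])
    then show ?thesis using that by (cases "\<kappa> x = \<kappa>' x") (auto simp: D_def)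
  qed
  have aux: False if "filling Q c \<kappa>1" "filling Q c \<kappa>2" "\<kappa>1 r < \<kappa>2 r"
    "\<And>x. x \<in> Q \<Longrightarrow> x < r \<Longrightarrow> \<kappa>1 x = \<kappa>2 x" "sum \<kappa>1 Q = sum \<kappa>2 Q" for \<kappa>1 \<kappa>2
  proof -
    have "\<kappa>1 r < c r" using that r unfolding filling_def by force
    then have z: "\<kappa>1 x = 0" if "x \<in> Q" "r < x" for x
      using \<open>filling Q c \<kappa>1\<close> that r(1) unfolding filling_def by force
    have "sum \<kappa>1 Q < sum \<kappa>2 Q"
    proof (rule sum_strict_mono_ex1[OF Q])
      show "\<forall>x\<in>Q. \<kappa>1 x \<le> \<kappa>2 x"
      proof
        fix x assume x: "x \<in> Q"
        consider "x < r" | "x = r" | "r < x" by fastforce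
        then show "\<kappa>1 x \<le> \<kappa>2 x"
          using that x z by cases (auto simp: filling_def)
      qed
      show "\<exists>a\<in>Q. \<kappa>1 a < \<kappa>2 a" using r that by blast
    qed
    then show False using that by simp
  qed
  show False
    using aux[of \<kappa> \<kappa>'] aux[of \<kappa>' \<kappa>] f s r before by (metis linorder_neqE)
qed

text \<open>The earlier rows together fill the columns greedily up to \<open>\<kappa>\<close>, and
  the last row takes what is left. A column that is touched by earlier rows comes no later than a
  column that they leave unfilled, which gives monotonicity.\<close>

lemma nw_coupling_exists:
  fixes A :: "'a::linorder set" and B :: "'b::linorder set"
  assumes "finite A" "finite B" "\<And>a. a \<in> A \<Longrightarrow> 0 \<le> x a" "\<And>b. b \<in> B \<Longrightarrow> 0 \<le> y b" "sum x A = sum y B"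
  shows "\<exists>f. (\<forall>a b. 0 \<le> f a b) \<and> (\<forall>a b. f a b \<noteq> 0 \<longrightarrow> a \<in> A \<and> b \<in> B) \<and>
    (\<forall>a\<in>A. (\<Sum>b\<in>B. f a b) = x a) \<and> (\<forall>b\<in>B. (\<Sum>a\<in>A. f a b) = (y b :: real)) \<and>
    (\<forall>a b a' b'. f a b \<noteq> 0 \<longrightarrow> f a' b' \<noteq> 0 \<longrightarrow> a < a' \<longrightarrow> b \<le> b')"
  using assms
proof (induction A arbitrary: y rule: finite_linorder_max_induct)
  case empty
  then have "\<forall>b\<in>B. y b = 0" by (simp add: sum_nonneg_eq_0_iff)
  then show ?case by (intro exI[of _ "\<lambda>_ _. 0"]) auto
next
  case (insert q A)
  have q: "q \<notin> A" using insert by auto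
  have "sum x A \<le> sum y B"
    using insert.prems(2)[of q] insert.prems(4) q insert.hyps(1) by simp
  then obtain \<kappa> where k: "filling B y \<kappa>" "sum \<kappa> B = sum x A"
    using filling_exists[of B y "sum x A"] insert.prems by (auto simp: sum_nonneg)
  have "\<exists>f. (\<forall>a b. 0 \<le> f a b) \<and> (\<forall>a b. f a b \<noteq> 0 \<longrightarrow> a \<in> A \<and> b \<in> B) \<and>
    (\<forall>a\<in>A. (\<Sum>b\<in>B. f a b) = x a) \<and> (\<forall>b\<in>B. (\<Sum>a\<in>A. f a b) = \<kappa> b) \<and>
    (\<forall>a b a' b'. f a b \<noteq> 0 \<longrightarrow> f a' b' \<noteq> 0 \<longrightarrow> a < a' \<longrightarrow> b \<le> b')"
    by (rule insert.IH) (use insert.prems k in \<open>auto simp: filling_def\<close>)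
  then obtain f where f: "\<forall>a b. 0 \<le> f a b" "\<forall>a b. f a b \<noteq> 0 \<longrightarrow> a \<in> A \<and> b \<in> B"
    "\<forall>a\<in>A. (\<Sum>b\<in>B. f a b) = x a" "\<forall>b\<in>B. (\<Sum>a\<in>A. f a b) = \<kappa> b"
    "\<forall>a b a' b'. f a b \<noteq> 0 \<longrightarrow> f a' b' \<noteq> 0 \<longrightarrow> a < a' \<longrightarrow> b \<le> b'" by blast
  define h where "h a b = (if a = q then if b \<in> B then y b - \<kappa> b else 0 else f a b)" for a b
  have knz: "\<kappa> b \<noteq> 0" if "f a b \<noteq> 0" for a b
  proof -
    have ab: "a \<in> A" "b \<in> B" using f(2) that by auto
    have "f a b \<le> (\<Sum>a\<in>A. f a b)" using f(1) ab insert.hyps(1) by (intro member_le_sum) auto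
    then show ?thesis using f(1,4) ab that by (metis linorder_not_le order_antisym_conv order_less_le)
  qed
  have "h a b \<noteq> 0 \<longrightarrow> h a' b' \<noteq> 0 \<longrightarrow> a < a' \<longrightarrow> b \<le> b'" for a b a' b'
  proof (intro impI)
    assume as: "h a b \<noteq> 0" "h a' b' \<noteq> 0" "a < a'"
    show "b \<le> b'"
    proof (cases "a' = q")
      case True
      then have b': "b' \<in> B" "\<kappa> b' \<noteq> y b'" using as by (auto simp: h_def split: if_splits)
      have "a \<noteq> q" using as(3) True by simp
      then have fa: "f a b \<noteq> 0" using as(1) by (simp add: h_def)
      then have "b \<in> B" "\<kappa> b \<noteq> 0" using f(2) knz by auto
      then show ?thesis using k(1) b' unfolding filling_def by (metis linorder_not_le)
    next
      case False
      then have "f a' b' \<noteq> 0" using as by (auto simp: h_def)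
      then have "a' \<in> A" using f(2) by blast
      then have "a \<noteq> q" using as(3) insert.hyps(2) by force
      then show ?thesis using as False f(5) by (auto simp: h_def)
    qed
  qed
  moreover have "\<forall>a b. 0 \<le> h a b" using f(1) k(1) by (auto simp: h_def filling_def)
  moreover have "\<forall>a b. h a b \<noteq> 0 \<longrightarrow> a \<in> insert q A \<and> b \<in> B" using f(2) by (auto simp: h_def)
  moreover have "\<forall>a\<in>insert q A. (\<Sum>b\<in>B. h a b) = x a"
  proof
    fix a assume "a \<in> insert q A"
    then consider "a = q" | "a \<in> A" "a \<noteq> q" using q by auto
    then show "(\<Sum>b\<in>B. h a b) = x a"
    proof cases
      case 1
      then have "(\<Sum>b\<in>B. h a b) = sum y B - sum \<kappa> B" by (simp add: h_def sum_subtractf)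
      then show ?thesis using 1 k(2) insert.prems(4) q insert.hyps(1) by simp
    next
      case 2 then show ?thesis using f(3) by (simp add: h_def)
    qed
  qed
  moreover have "\<forall>b\<in>B. (\<Sum>a\<in>insert q A. h a b) = y b"
  proof
    fix b assume b: "b \<in> B"
    have "(\<Sum>a\<in>A. h a b) = (\<Sum>a\<in>A. f a b)" using q by (intro sum.cong) (auto simp: h_def)
    then show "(\<Sum>a\<in>insert q A. h a b) = y b" using f(4) b q insert.hyps(1) by (simp add: h_def)
  qed
  ultimately show ?case by blast
qed

definition nw_mono :: "('a::linorder \<times> 'b::linorder) set \<Rightarrow> bool" where
  "nw_mono K \<longleftrightarrow> (\<forall>(a,b)\<in>K. \<forall>(a',b')\<in>K. a < a' \<longrightarrow> b \<le> b')"

text \<open>The partial column sums over an initial segment of rows are a filling with capacities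
  the full column sums, and the row sums prescribe its total. So these partial sums are determined,
  and an entry is the difference of two of them.\<close>

lemma nw_coupling_unique:
  fixes A :: "'a::linorder set" and B :: "'b::linorder set" and f f' :: "'a \<Rightarrow> 'b \<Rightarrow> real"
  assumes A: "finite A" and B: "finite B"
    and nn: "\<And>a b. a \<in> A \<Longrightarrow> b \<in> B \<Longrightarrow> 0 \<le> f a b" "\<And>a b. a \<in> A \<Longrightarrow> b \<in> B \<Longrightarrow> 0 \<le> f' a b"
    and row: "\<And>a. a \<in> A \<Longrightarrow> (\<Sum>b\<in>B. f a b) = (\<Sum>b\<in>B. f' a b)"
    and col: "\<And>b. b \<in> B \<Longrightarrow> (\<Sum>a\<in>A. f a b) = (\<Sum>a\<in>A. f' a b)"
    and m: "nw_mono {(a,b)\<in>A\<times>B. f a b \<noteq> 0}" "nw_mono {(a,b)\<in>A\<times>B. f' a b \<noteq> 0}"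
    and ab: "a \<in> A" "b \<in> B"
  shows "f a b = f' a b"
proof -
  define pre where "pre g D b = (\<Sum>a\<in>D. g a b)" for g :: "'a \<Rightarrow> 'b \<Rightarrow> real" and D b
  have fl: "filling B (\<lambda>b. \<Sum>a\<in>A. g a b) (pre g {x\<in>A. P x})"
    if nn: "\<And>a b. a \<in> A \<Longrightarrow> b \<in> B \<Longrightarrow> 0 \<le> g a b" and m: "nw_mono {(a,b)\<in>A\<times>B. g a b \<noteq> 0}"
      and P: "\<And>x y. P x \<Longrightarrow> \<not> P y \<Longrightarrow> x < y"
    for g :: "'a \<Rightarrow> 'b \<Rightarrow> real" and P
    unfolding filling_def
  proof (intro conjI ballI impI)
    fix p assume p: "p \<in> B"
    show "0 \<le> pre g {x\<in>A. P x} p" unfolding pre_def using nn p by (intro sum_nonneg) auto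
    show "pre g {x\<in>A. P x} p \<le> (\<Sum>a\<in>A. g a p)" unfolding pre_def using nn p A by (intro sum_mono2) auto
  next
    fix p p' assume p: "p \<in> B" "p' \<in> B" "p < p'" "pre g {x\<in>A. P x} p' \<noteq> 0"
    then obtain x where x: "x \<in> A" "P x" "g x p' \<noteq> 0" unfolding pre_def
      by (metis (mono_tags, lifting) mem_Collect_eq sum.neutral)
    have "g y p = 0" if "y \<in> A" "\<not> P y" for y
    proof (rule ccontr)
      assume "g y p \<noteq> 0"
      then have "p' \<le> p" using m x that p P[OF x(2) that(2)] unfolding nw_mono_def by fastforce
      then show False using p by simp
    qed
    then show "pre g {x\<in>A. P x} p = (\<Sum>a\<in>A. g a p)"
      unfolding pre_def using A by (intro sum.mono_neutral_left) auto
  qed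
  have eq: "pre f {x\<in>A. P x} b = pre f' {x\<in>A. P x} b" if "\<And>x y. P x \<Longrightarrow> \<not> P y \<Longrightarrow> x < y" for P
  proof (rule filling_unique[OF B])
    show "filling B (\<lambda>b. \<Sum>a\<in>A. f a b) (pre f {x\<in>A. P x})" by (rule fl[OF nn(1) m(1) that])
    have "filling B (\<lambda>b. \<Sum>a\<in>A. f' a b) (pre f' {x\<in>A. P x})" by (rule fl[OF nn(2) m(2) that])
    then show "filling B (\<lambda>b. \<Sum>a\<in>A. f a b) (pre f' {x\<in>A. P x})" using col by (simp add: filling_def)
    show "sum (pre f {x\<in>A. P x}) B = sum (pre f' {x\<in>A. P x}) B"
      unfolding pre_def using row by (subst (1 2) sum.swap) simp
  qed (use ab in auto)
  have s: "{x\<in>A. x \<le> a} = insert a {x\<in>A. x < a}" using ab by auto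
  have "pre g {x\<in>A. x \<le> a} b = g a b + pre g {x\<in>A. x < a} b" for g :: "'a \<Rightarrow> 'b \<Rightarrow> real"
    unfolding pre_def s using A by simp
  then show ?thesis using eq[of "\<lambda>x. x \<le> a"] eq[of "\<lambda>x. x < a"] by fastforce
qed

text \<open>In the first nonzero row, the first nonzero entry is alone in its row or alone in its
  column, because a second entry in both would break monotonicity. So it is a row sum or a column
  sum and can be subtracted.\<close>

lemma nw_coupling_integral:
  fixes A :: "'a::linorder set" and B :: "'b::linorder set" and f :: "'a \<Rightarrow> 'b \<Rightarrow> real"
  assumes A: "finite A" and B: "finite B"
    and row: "\<And>a. a \<in> A \<Longrightarrow> (\<Sum>b\<in>B. f a b) \<in> \<int>"
    and col: "\<And>b. b \<in> B \<Longrightarrow> (\<Sum>a\<in>A. f a b) \<in> \<int>"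
    and m: "nw_mono {(a,b)\<in>A\<times>B. f a b \<noteq> 0}"
    and ab: "a \<in> A" "b \<in> B"
  shows "f a b \<in> \<int>"
  using row col m ab
proof (induction "card {(a,b)\<in>A\<times>B. f a b \<noteq> 0}" arbitrary: f a b rule: less_induct)
  case less
  let ?K = "{(a,b)\<in>A\<times>B. f a b \<noteq> 0}"
  have fK: "finite ?K" using A B by (intro finite_subset[of ?K "A \<times> B"]) auto
  show ?case
  proof (cases "?K = {}")
    case True then show ?thesis using less.prems(4,5) by force
  next
    case False
    define a0 where "a0 = Min (fst ` ?K)"
    have "a0 \<in> fst ` ?K" unfolding a0_def using fK False by (intro Min_in) auto
    then obtain b1 where b1: "(a0,b1) \<in> ?K" by auto
    define b0 where "b0 = Min {b. (a0,b) \<in> ?K}"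
    have fb: "finite {b. (a0,b) \<in> ?K}" using B by (rule rev_finite_subset) auto
    have b0: "(a0,b0) \<in> ?K" using Min_in[OF fb] b1 unfolding b0_def by blast
    have amin: "a0 \<le> a" if "(a,b) \<in> ?K" for a b
      unfolding a0_def using fK that by (intro Min_le) force+
    have bmin: "b0 \<le> b" if "(a0,b) \<in> ?K" for b
      unfolding b0_def using fb that by (intro Min_le) auto
    have ab0: "a0 \<in> A" "b0 \<in> B" using b0 by auto
    have 1: "f a0 b0 \<in> \<int>"
    proof (cases "\<exists>b. (a0,b) \<in> ?K \<and> b \<noteq> b0")
      case True
      then obtain b2 where b2: "(a0,b2) \<in> ?K" "b2 \<noteq> b0" by blast
      have "f a b0 = 0" if "a \<in> A" "a \<noteq> a0" for a
      proof (rule ccontr)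
        assume "f a b0 \<noteq> 0"
        then have k: "(a,b0) \<in> ?K" using that ab0 by auto
        then have "a0 < a" using amin that by force
        then have "b2 \<le> b0" using less.prems(3) k b2 unfolding nw_mono_def by fast
        then show False using bmin[OF b2(1)] b2(2) by simp
      qed
      then have "(\<Sum>a\<in>A. f a b0) = (\<Sum>a\<in>{a0}. f a b0)"
        using A ab0 by (intro sum.mono_neutral_right) auto
      then show ?thesis using less.prems(2)[OF ab0(2)] by simp
    next
      case False
      then have "(\<Sum>b\<in>B. f a0 b) = (\<Sum>b\<in>{b0}. f a0 b)"
        using B ab0 by (intro sum.mono_neutral_right) auto
      then show ?thesis using less.prems(1)[OF ab0(1)] by simp
    qed
    define f' where "f' a b = f a b - (if a = a0 \<and> b = b0 then f a0 b0 else 0)" for a b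
    have K': "{(a,b)\<in>A\<times>B. f' a b \<noteq> 0} = ?K - {(a0,b0)}" by (auto simp: f'_def split: if_splits)
    have "card {(a,b)\<in>A\<times>B. f' a b \<noteq> 0} < card ?K"
      unfolding K' using b0 fK by (intro psubset_card_mono) auto
    moreover have "(\<Sum>b\<in>B. f' a b) \<in> \<int>" if "a \<in> A" for a
      using less.prems(1)[OF that] 1 B ab0 by (cases "a = a0") (auto simp: f'_def sum_subtractf)
    moreover have "(\<Sum>a\<in>A. f' a b) \<in> \<int>" if "b \<in> B" for b
      using less.prems(2)[OF that] 1 A ab0 by (cases "b = b0") (auto simp: f'_def sum_subtractf)
    moreover have "nw_mono {(a,b)\<in>A\<times>B. f' a b \<noteq> 0}"
      unfolding K' using less.prems(3) unfolding nw_mono_def by blast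
    ultimately have "f' a b \<in> \<int>" using less.hyps less.prems(4,5) by blast
    then show ?thesis using 1 by (auto simp: f'_def split: if_splits)
  qed
qed

section \<open>Positive decompositions over a rational subspace\<close>

lemma rat_subspace_scale:
  assumes "rat_subspace V" "q \<in> \<rat>" "x \<in> V" shows "q * x \<in> V"
  using assms by (auto simp: rat_subspace_iff elim: Rats_cases)

lemma rat_subspace_add: "rat_subspace V \<Longrightarrow> x \<in> V \<Longrightarrow> y \<in> V \<Longrightarrow> x + y \<in> V"
  by (simp add: rat_subspace_iff)

lemma rat_subspace_0: "rat_subspace V \<Longrightarrow> 0 \<in> V"
  by (simp add: rat_subspace_iff)

lemma rat_subspace_minus: "rat_subspace V \<Longrightarrow> x \<in> V \<Longrightarrow> - x \<in> V"
  using rat_subspace_scale[of V "-1" x] by simp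

lemma rat_subspace_diff: "rat_subspace V \<Longrightarrow> x \<in> V \<Longrightarrow> y \<in> V \<Longrightarrow> x - y \<in> V"
  using rat_subspace_add[of V x "- y"] rat_subspace_minus[of V y] by simp

lemma rat_subspace_sum: "rat_subspace V \<Longrightarrow> (\<And>i. i \<in> I \<Longrightarrow> f i \<in> V) \<Longrightarrow> sum f I \<in> V"
  by (induction I rule: infinite_finite_induct) (auto simp: rat_subspace_0 rat_subspace_add)

definition fun_linear :: "(('i \<Rightarrow> real) \<Rightarrow> real) \<Rightarrow> bool" where
  "fun_linear g \<longleftrightarrow> (\<forall>e e' x y. g (\<lambda>i. x * e i + y * e' i) = x * g e + y * g e')"

lemma fun_linearD: "fun_linear g \<Longrightarrow> g (\<lambda>i. x * e i + y * e' i) = x * g e + y * g e'"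
  by (simp add: fun_linear_def)

lemma fun_linear_zero: "fun_linear g \<Longrightarrow> g (\<lambda>i. 0) = 0"
  using fun_linearD[of g 0 "\<lambda>_. 0" 0 "\<lambda>_. 0"] by simp

text \<open>Weighted generators are kept in a multiset because elimination may produce the same pair
  repeatedly.\<close>

definition wsum :: "(real \<times> ('i \<Rightarrow> real)) multiset \<Rightarrow> 'i \<Rightarrow> real" where
  "wsum ps i = (\<Sum>p\<in>#ps. fst p * snd p i)"

lemma wsum_simps:
  "wsum {#} i = 0" "wsum (add_mset p ps) i = fst p * snd p i + wsum ps i" "wsum (ps + qs) i = wsum ps i + wsum qs i"
  by (simp_all add: wsum_def)

lemma fun_linear_wsum:
  assumes "fun_linear g" shows "g (wsum ps) = (\<Sum>p\<in>#ps. fst p * g (snd p))"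
proof (induction ps)
  case empty
  then show ?case using fun_linear_zero[OF assms] by (simp add: wsum_def[abs_def])
next
  case (add p ps)
  have "wsum (add_mset p ps) = (\<lambda>i. fst p * snd p i + 1 * wsum ps i)" by (simp add: wsum_simps fun_eq_iff)
  then show ?case using add fun_linearD[OF assms, of "fst p" "snd p" 1 "wsum ps"] by simp
qed

text \<open>One step of Fourier-Motzkin elimination: a pair of generators on which \<open>g\<close> has opposite signs
  is replaced by a generator in the kernel of \<open>g\<close> and at most one of the two.\<close>

lemma eliminate_negative:
  fixes ps :: "(real \<times> ('i \<Rightarrow> real)) multiset"
  assumes V: "rat_subspace V" and g: "fun_linear g"
    and C: "\<And>e e' q q'. C e \<Longrightarrow> C e' \<Longrightarrow> q \<in> \<rat> \<Longrightarrow> q' \<in> \<rat> \<Longrightarrow> 0 \<le> q \<Longrightarrow> 0 \<le> q' \<Longrightarrow> C (\<lambda>i. q * e i + q' * e' i)"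
    and Cg: "\<And>e. C e \<Longrightarrow> g e \<in> \<rat>"
    and ps: "\<forall>p\<in>#ps. 0 < fst p \<and> fst p \<in> V \<and> C (snd p)"
    and nn: "0 \<le> g (wsum ps)"
  shows "\<exists>ps'. (\<forall>p\<in>#ps'. 0 < fst p \<and> fst p \<in> V \<and> C (snd p) \<and> 0 \<le> g (snd p)) \<and> wsum ps' = wsum ps"
  using ps nn
proof (induction "size (filter_mset (\<lambda>p. g (snd p) \<noteq> 0) ps)" arbitrary: ps rule: less_induct)
  case less
  show ?case
  proof (cases "\<forall>p\<in>#ps. 0 \<le> g (snd p)")
    case True then show ?thesis using less.prems by blast
  next
    case False
    then obtain n where n: "n \<in># ps" "g (snd n) < 0" by force
    have "\<exists>p\<in>#ps. 0 < g (snd p)"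
    proof (rule ccontr)
      assume "\<not> ?thesis"
      then have le: "\<forall>p\<in>#ps. fst p * g (snd p) \<le> 0"
        using less.prems(1) by (auto simp: not_less mult_nonneg_nonpos order_less_imp_le)
      obtain ps0 where p0: "ps = add_mset n ps0" using n(1) by (meson mset_add)
      have "(\<Sum>p\<in>#ps0. fst p * g (snd p)) \<le> (\<Sum>p\<in>#ps0. 0)"
        by (rule sum_mset_mono) (use le p0 in auto)
      moreover have "fst n * g (snd n) < 0" using n less.prems(1) by (simp add: mult_pos_neg)
      ultimately have "(\<Sum>p\<in>#ps. fst p * g (snd p)) < 0" unfolding p0 by simp
      then show False using less.prems(2) fun_linear_wsum[OF g, of ps] by simp
    qed
    then obtain p where p: "p \<in># ps" "0 < g (snd p)" by blast
    obtain ps1 where ps1: "ps = add_mset n ps1" using n(1) by (meson mset_add)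
    have "p \<in># ps1" using p n ps1 by auto
    then obtain ps0 where ps0: "ps = add_mset n (add_mset p ps0)" using ps1 by (metis mset_add)
    define en where "en = snd n" define ep where "ep = snd p"
    define xn where "xn = fst n" define xp where "xp = fst p"
    define gn where "gn = - g en" define gp where "gp = g ep"
    have pos: "0 < xn" "0 < xp" "xn \<in> V" "xp \<in> V" "C en" "C ep" "0 < gn" "0 < gp"
      using less.prems(1) ps0 n p by (auto simp: en_def ep_def xn_def xp_def gn_def gp_def)
    have rat: "gn \<in> \<rat>" "gp \<in> \<rat>" using Cg pos(5,6) by (auto simp: gn_def gp_def)
    \<comment> \<open>The crosswise combination cancels \<open>g\<close>. Its coefficients are
      values of \<open>g\<close> on the generators, hence rational and positive.\<close>
    define z where "z = (\<lambda>i. gn * ep i + gp * en i)"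
    have z: "C z" "g z = 0"
      using C[OF pos(6,5) rat] pos fun_linearD[OF g, of gn ep gp en]
      by (auto simp: z_def gn_def[symmetric] gp_def[symmetric]) (simp add: gn_def)
    have gen: ?thesis
      if new: "\<forall>q\<in>#new. 0 < fst q \<and> fst q \<in> V \<and> C (snd q)"
        and sm: "size (filter_mset (\<lambda>p. g (snd p) \<noteq> 0) new) < 2"
        and w: "\<And>i. wsum new i = xn * en i + xp * ep i" for new
    proof -
      have w': "wsum (new + ps0) = wsum ps"
        unfolding ps0 using w by (auto simp: fun_eq_iff wsum_simps en_def ep_def xn_def xp_def)
      have "size (filter_mset (\<lambda>p. g (snd p) \<noteq> 0) (new + ps0)) < size (filter_mset (\<lambda>p. g (snd p) \<noteq> 0) ps)"
        unfolding ps0 using sm n p by simp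
      moreover have "\<forall>p\<in>#new + ps0. 0 < fst p \<and> fst p \<in> V \<and> C (snd p)"
        using new less.prems(1) ps0 by auto
      ultimately show ?thesis using less.hyps[of "new + ps0"] less.prems(2) w' by simp
    qed
    show ?thesis
    \<comment> \<open>The sign of \<open>g\<close> on the weighted pair decides which generator is
      used up completely by \<open>z\<close>. The other one keeps the weight \<open>d\<close>, which
      differs from the old weight by a rational multiple of an element of \<open>V\<close>; it is
      dropped if it is \<open>0\<close>, as weights have to be positive.\<close>
    proof (cases "xn * gn \<le> xp * gp")
      case True
      define d where "d = xp - (gn / gp) * xn"
      have d: "0 \<le> d" using True pos by (simp add: d_def field_simps)
      have dV: "d \<in> V" unfolding d_def
        by (intro rat_subspace_diff[OF V] rat_subspace_scale[OF V]) (use pos rat in auto)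
      have q: "0 < xn / gp" "xn / gp \<in> V"
        using pos rat rat_subspace_scale[OF V, of "1 / gp" xn] by auto
      show ?thesis
      proof (rule gen[of "{#(xn / gp, z)#} + (if d = 0 then {#} else {#(d, ep)#})"])
        fix i
        show "wsum ({#(xn / gp, z)#} + (if d = 0 then {#} else {#(d, ep)#})) i = xn * en i + xp * ep i"
        proof -
          have "xn / gp * z i + d * ep i = xn * en i + xp * ep i"
            using pos by (simp add: z_def d_def field_simps)
          then show ?thesis by (cases "d = 0") (auto simp: wsum_simps)
        qed
      qed (use d dV q z pos in auto)
    next
      case False
      define d where "d = xn - (gp / gn) * xp"
      have d: "0 < d" using False pos by (simp add: d_def field_simps)
      have dV: "d \<in> V" unfolding d_def
        by (intro rat_subspace_diff[OF V] rat_subspace_scale[OF V]) (use pos rat in auto)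
      have q: "0 < xp / gn" "xp / gn \<in> V"
        using pos rat rat_subspace_scale[OF V, of "1 / gn" xp] by auto
      show ?thesis
      proof (rule gen[of "{#(xp / gn, z), (d, en)#}"])
        fix i
        show "wsum {#(xp / gn, z), (d, en)#} i = xn * en i + xp * ep i"
          using pos by (simp add: wsum_simps z_def d_def field_simps)
      qed (use d dV q z pos in auto)
    qed
  qed
qed

text \<open>Starting from signed unit vectors with weights \<open>\<bar>t i\<bar>\<close>, the
  conditions in \<open>\<G>\<close> are imposed one at a time. Conditions already imposed survive an
  elimination because new generators are nonnegative combinations of old ones.\<close>

lemma positive_decomposition:
  fixes t :: "'i \<Rightarrow> real"
  assumes V: "rat_subspace V" and I: "finite I" and t: "\<And>i. t i \<in> V" "\<And>i. i \<notin> I \<Longrightarrow> t i = 0"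
    and \<G>: "finite \<G>" "\<And>g. g \<in> \<G> \<Longrightarrow> fun_linear g" "\<And>g e. g \<in> \<G> \<Longrightarrow> (\<And>i. e i \<in> \<rat>) \<Longrightarrow> g e \<in> \<rat>"
      "\<And>g. g \<in> \<G> \<Longrightarrow> 0 \<le> g t"
  shows "\<exists>(k::nat) \<epsilon> e. (\<forall>a<k. 0 < \<epsilon> a \<and> \<epsilon> a \<in> V \<and> (\<forall>i. e a i \<in> \<rat>) \<and> (\<forall>i. i \<notin> I \<longrightarrow> e a i = 0) \<and> (\<forall>g\<in>\<G>. 0 \<le> g (e a))) \<and>
    (\<forall>i. t i = (\<Sum>a<k. \<epsilon> a * e a i))"
proof -
  define C where "C \<G>' e \<longleftrightarrow> (\<forall>i. e i \<in> \<rat>) \<and> (\<forall>i. i \<notin> I \<longrightarrow> e i = 0) \<and> (\<forall>g\<in>\<G>'. 0 \<le> g e)"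
    for \<G>' :: "(('i \<Rightarrow> real) \<Rightarrow> real) set" and e
  have "\<exists>ps. (\<forall>p\<in>#ps. 0 < fst p \<and> fst p \<in> V \<and> C \<G>' (snd p)) \<and> wsum ps = t" if "finite \<G>'" "\<G>' \<subseteq> \<G>" for \<G>'
    using that
  proof (induction \<G>' rule: finite_induct)
    case empty
    define ps where "ps = image_mset (\<lambda>i. (\<bar>t i\<bar>, \<lambda>j. if j = i then sgn (t i) else 0)) (mset_set {i\<in>I. t i \<noteq> 0})"
    have abs: "\<bar>x\<bar> \<in> V" if "x \<in> V" for x using that rat_subspace_minus[OF V that] by (simp add: abs_if)
    have "\<forall>p\<in>#ps. 0 < fst p \<and> fst p \<in> V \<and> C {} (snd p)"
      using t abs I by (auto simp: ps_def C_def sgn_if)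
    moreover have "wsum ps = t"
    proof
      fix j
      have "wsum ps j = (\<Sum>i\<in>{i\<in>I. t i \<noteq> 0}. \<bar>t i\<bar> * (if j = i then sgn (t i) else 0))"
        by (simp add: wsum_def ps_def image_mset.compositionality comp_def sum_unfold_sum_mset)
      also have "\<dots> = (\<Sum>i\<in>{i\<in>I. t i \<noteq> 0}. if j = i then t i else 0)"
        by (intro sum.cong) (auto simp: abs_mult_sgn)
      also have "\<dots> = t j" using I t(2) by (auto simp: sum.delta')
      finally show "wsum ps j = t j" .
    qed
    ultimately show ?case by blast
  next
    case (insert g \<G>')
    then obtain ps where ps: "\<forall>p\<in>#ps. 0 < fst p \<and> fst p \<in> V \<and> C \<G>' (snd p)" "wsum ps = t" by auto
    have g: "g \<in> \<G>" using insert by auto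
    have lin: "fun_linear h" if "h \<in> \<G>'" for h using \<G>(2) that insert.prems by auto
    have "\<exists>ps'. (\<forall>p\<in>#ps'. 0 < fst p \<and> fst p \<in> V \<and> C \<G>' (snd p) \<and> 0 \<le> g (snd p)) \<and> wsum ps' = wsum ps"
    proof (rule eliminate_negative[OF V \<G>(2)[OF g]])
      show "C \<G>' (\<lambda>i. q * e i + q' * e' i)"
        if "C \<G>' e" "C \<G>' e'" "q \<in> \<rat>" "q' \<in> \<rat>" "0 \<le> q" "0 \<le> q'" for e e' q q'
      proof -
        have "0 \<le> h (\<lambda>i. q * e i + q' * e' i)" if h: "h \<in> \<G>'" for h
          using \<open>C \<G>' e\<close> \<open>C \<G>' e'\<close> \<open>0 \<le> q\<close> \<open>0 \<le> q'\<close> h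
          by (simp add: fun_linearD[OF lin[OF h]] C_def)
        then show ?thesis using that unfolding C_def by auto
      qed
      show "g e \<in> \<rat>" if "C \<G>' e" for e using \<G>(3)[OF g] that by (auto simp: C_def)
    qed (use ps \<G>(4)[OF g] in auto)
    then show ?case using ps(2) unfolding C_def by (metis (no_types, lifting) insert_iff)
  qed
  from this[OF \<G>(1) subset_refl]
  obtain ps where ps: "\<forall>p\<in>#ps. 0 < fst p \<and> fst p \<in> V \<and> C \<G> (snd p)" "wsum ps = t" by blast
  obtain xs where xs: "ps = mset xs" by (metis ex_mset)
  have "t i = (\<Sum>a<length xs. fst (xs ! a) * snd (xs ! a) i)" for i
    using ps(2) xs by (auto simp: wsum_def sum_mset_sum_list sum_list_sum_nth fun_eq_iff atLeast0LessThan simp flip: mset_map)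
  moreover have "\<forall>a<length xs. 0 < fst (xs ! a) \<and> fst (xs ! a) \<in> V \<and> C \<G> (snd (xs ! a))"
    using ps(1) xs by auto
  ultimately show ?thesis
    by (intro exI[of _ "length xs"] exI[of _ "\<lambda>a. fst (xs ! a)"] exI[of _ "\<lambda>a. snd (xs ! a)"]) (auto simp: C_def)
qed

section \<open>Subdivisions of slices\<close>

definition supp :: "('r \<Rightarrow> real) \<Rightarrow> 'r set" where
  "supp \<alpha> = {g. \<alpha> g \<noteq> 0}"

definition intvec :: "('r \<Rightarrow> real) set" where
  "intvec = {\<alpha>. \<forall>g. \<alpha> g \<in> \<int>}"

text \<open>Points are encoded by nonnegative weights \<open>\<alpha>\<close> on a finite set \<open>G\<close> of rays, with support in a
  simplicial complex \<open>\<K>\<close>; \<open>deg g s\<close> is the contribution of the ray \<open>g\<close> to the linear condition \<open>s\<close>. The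
  cells are thus the sets of \<open>\<alpha>\<close> in a slice with support in a given \<open>K \<in> \<K>\<close>.\<close>

definition slice :: "'r set \<Rightarrow> 'r set set \<Rightarrow> ('r \<Rightarrow> 's \<Rightarrow> real) \<Rightarrow> ('s \<Rightarrow> real) \<Rightarrow> ('r \<Rightarrow> real) set" where
  "slice G \<K> deg t = {\<alpha>. (\<forall>g. 0 \<le> \<alpha> g) \<and> supp \<alpha> \<in> \<K> \<and> (\<forall>s. (\<Sum>g\<in>G. \<alpha> g * deg g s) = t s)}"

text \<open>The directions of a slice: differences of its points. These are the relations whose
  integrality is at stake.\<close>

definition kern :: "'r set \<Rightarrow> ('r \<Rightarrow> 's \<Rightarrow> real) \<Rightarrow> ('r \<Rightarrow> real) set" where
  "kern G deg = {\<alpha>. supp \<alpha> \<subseteq> G \<and> (\<forall>s. (\<Sum>g\<in>G. \<alpha> g * deg g s) = 0)}"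

definition comb :: "'r set \<Rightarrow> ('r \<Rightarrow> 'h \<Rightarrow> real) \<Rightarrow> ('r \<Rightarrow> real) \<Rightarrow> 'h \<Rightarrow> real" where
  "comb G \<rho> \<alpha> h = (\<Sum>g\<in>G. \<alpha> g * \<rho> g h)"

definition complex :: "'r set \<Rightarrow> 'r set set \<Rightarrow> bool" where
  "complex G \<K> \<longleftrightarrow> finite G \<and> (\<forall>K\<in>\<K>. K \<subseteq> G) \<and> (\<forall>K\<in>\<K>. \<forall>K'\<subseteq>K. K' \<in> \<K>)"

definition udeg :: "('r \<Rightarrow> 's) \<Rightarrow> 'r \<Rightarrow> 's \<Rightarrow> real" where
  "udeg b g s = of_bool (b g = s)"

text \<open>A subdivision expresses new rays by old ones through \<open>\<rho>\<close>, such that \<open>comb\<close> is a bijection of the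
  slices which maps cells into cells.\<close>

definition subdiv :: "'r set \<Rightarrow> 'r set set \<Rightarrow> ('r \<Rightarrow> 's \<Rightarrow> real) \<Rightarrow> ('s \<Rightarrow> real) \<Rightarrow>
    'q set \<Rightarrow> 'q set set \<Rightarrow> ('q \<Rightarrow> 'u \<Rightarrow> real) \<Rightarrow> ('u \<Rightarrow> real) \<Rightarrow> ('q \<Rightarrow> 'r \<Rightarrow> real) \<Rightarrow> bool" where
  "subdiv G \<K> deg t G' \<K>' deg' t' \<rho> \<longleftrightarrow>
     complex G' \<K>' \<and> (\<forall>g\<in>G'. \<forall>h. 0 \<le> \<rho> g h \<and> \<rho> g h \<in> \<rat>) \<and> (\<forall>g\<in>G'. supp (\<rho> g) \<subseteq> G) \<and>
     (\<forall>K\<in>\<K>'. (\<Union>g\<in>K. supp (\<rho> g)) \<in> \<K>) \<and>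
     (\<forall>\<alpha>\<in>kern G' deg'. comb G' \<rho> \<alpha> \<in> kern G deg) \<and>
     (\<forall>\<alpha>\<in>slice G' \<K>' deg' t'. comb G' \<rho> \<alpha> \<in> slice G \<K> deg t) \<and>
     (\<forall>z\<in>slice G \<K> deg t. \<exists>!\<alpha>. \<alpha> \<in> slice G' \<K>' deg' t' \<and> comb G' \<rho> \<alpha> = z)"

text \<open>Together with \<open>integral_on\<close> this says that on each cell the relations with
  image in \<open>L\<close> are exactly the integral ones. One half is tested on cells only and the
  other on all integral relations, so both pass to subcomplexes.\<close>

definition unimod :: "'q set \<Rightarrow> 'q set set \<Rightarrow> ('q \<Rightarrow> 'u \<Rightarrow> real) \<Rightarrow> ('q \<Rightarrow> 'r \<Rightarrow> real) \<Rightarrow> ('r \<Rightarrow> real) set \<Rightarrow> bool" where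
  "unimod G \<K> deg \<rho> L \<longleftrightarrow> (\<forall>\<alpha>\<in>kern G deg. supp \<alpha> \<in> \<K> \<longrightarrow> comb G \<rho> \<alpha> \<in> L \<longrightarrow> \<alpha> \<in> intvec)"

definition integral_on :: "'q set \<Rightarrow> ('q \<Rightarrow> 'u \<Rightarrow> real) \<Rightarrow> ('q \<Rightarrow> 'r \<Rightarrow> real) \<Rightarrow> ('r \<Rightarrow> real) set \<Rightarrow> bool" where
  "integral_on G deg \<rho> L \<longleftrightarrow> (\<forall>\<alpha>\<in>kern G deg. \<alpha> \<in> intvec \<longrightarrow> comb G \<rho> \<alpha> \<in> L)"

lemma complexD:
  assumes "complex G \<K>"
  shows "finite G" "K \<in> \<K> \<Longrightarrow> K \<subseteq> G" "K \<in> \<K> \<Longrightarrow> K' \<subseteq> K \<Longrightarrow> K' \<in> \<K>"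
  using assms by (auto simp: complex_def)

lemma subdivD:
  assumes "subdiv G \<K> deg t G' \<K>' deg' t' \<rho>"
  shows "complex G' \<K>'" "g \<in> G' \<Longrightarrow> 0 \<le> \<rho> g h" "g \<in> G' \<Longrightarrow> \<rho> g h \<in> \<rat>" "g \<in> G' \<Longrightarrow> supp (\<rho> g) \<subseteq> G"
    "K \<in> \<K>' \<Longrightarrow> (\<Union>g\<in>K. supp (\<rho> g)) \<in> \<K>"
    "\<alpha> \<in> kern G' deg' \<Longrightarrow> comb G' \<rho> \<alpha> \<in> kern G deg"
    "\<alpha> \<in> slice G' \<K>' deg' t' \<Longrightarrow> comb G' \<rho> \<alpha> \<in> slice G \<K> deg t"
    "z \<in> slice G \<K> deg t \<Longrightarrow> \<exists>!\<alpha>. \<alpha> \<in> slice G' \<K>' deg' t' \<and> comb G' \<rho> \<alpha> = z"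
  using assms by (simp_all add: subdiv_def)

lemma subdivE:
  assumes "subdiv G \<K> deg t G' \<K>' deg' t' \<rho>" "z \<in> slice G \<K> deg t"
  obtains \<alpha> where "\<alpha> \<in> slice G' \<K>' deg' t'" "comb G' \<rho> \<alpha> = z"
    "\<forall>\<beta>. \<beta> \<in> slice G' \<K>' deg' t' \<longrightarrow> comb G' \<rho> \<beta> = z \<longrightarrow> \<beta> = \<alpha>"
proof (rule ex1E[OF subdivD(8)[OF assms]])
  fix \<alpha> assume a: "\<alpha> \<in> slice G' \<K>' deg' t' \<and> comb G' \<rho> \<alpha> = z"
    "\<forall>y. y \<in> slice G' \<K>' deg' t' \<and> comb G' \<rho> y = z \<longrightarrow> y = \<alpha>"
  have 1: "\<alpha> \<in> slice G' \<K>' deg' t'" "comb G' \<rho> \<alpha> = z" by (rule conjunct1[OF a(1)], rule conjunct2[OF a(1)])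
  have 2: "\<forall>\<beta>. \<beta> \<in> slice G' \<K>' deg' t' \<longrightarrow> comb G' \<rho> \<beta> = z \<longrightarrow> \<beta> = \<alpha>"
    using a(2) by simp
  show thesis by (rule that[OF 1 2])
qed

lemma subdiv_unique:
  assumes "subdiv G \<K> deg t G' \<K>' deg' t' \<rho>" "\<alpha> \<in> slice G' \<K>' deg' t'" "\<beta> \<in> slice G' \<K>' deg' t'"
    "comb G' \<rho> \<alpha> = comb G' \<rho> \<beta>"
  shows "\<alpha> = \<beta>"
proof -
  obtain \<gamma> where g: "\<gamma> \<in> slice G' \<K>' deg' t'" "comb G' \<rho> \<gamma> = comb G' \<rho> \<alpha>"
    and u: "\<forall>\<beta>. \<beta> \<in> slice G' \<K>' deg' t' \<longrightarrow> comb G' \<rho> \<beta> = comb G' \<rho> \<alpha> \<longrightarrow> \<beta> = \<gamma>"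
    by (rule subdivE[OF assms(1) subdivD(7)[OF assms(1,2)]])
  show ?thesis using u[rule_format, OF assms(2) refl] u[rule_format, OF assms(3) assms(4)[symmetric]] by simp
qed

lemma sliceD:
  assumes "\<alpha> \<in> slice G \<K> deg t"
  shows "0 \<le> \<alpha> g" "supp \<alpha> \<in> \<K>" "(\<Sum>g\<in>G. \<alpha> g * deg g s) = t s"
  using assms by (auto simp: slice_def)

lemma comb_comb:
  "comb G \<rho> (comb G' \<rho>' \<alpha>) = comb G' (\<lambda>g. comb G \<rho> (\<rho>' g)) \<alpha>"
proof
  fix h
  have "comb G \<rho> (comb G' \<rho>' \<alpha>) h = (\<Sum>g\<in>G. \<Sum>g'\<in>G'. \<alpha> g' * \<rho>' g' g * \<rho> g h)"
    by (simp add: comb_def sum_distrib_right)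
  also have "\<dots> = (\<Sum>g'\<in>G'. \<Sum>g\<in>G. \<alpha> g' * \<rho>' g' g * \<rho> g h)" by (rule sum.swap)
  also have "\<dots> = comb G' (\<lambda>g. comb G \<rho> (\<rho>' g)) \<alpha> h"
    by (simp add: comb_def sum_distrib_left mult.assoc)
  finally show "comb G \<rho> (comb G' \<rho>' \<alpha>) h = comb G' (\<lambda>g. comb G \<rho> (\<rho>' g)) \<alpha> h" .
qed

lemma comb_nonzeroE:
  assumes "comb G \<rho> \<alpha> h \<noteq> 0"
  obtains g where "g \<in> G" "\<alpha> g \<noteq> 0" "\<rho> g h \<noteq> 0"
  by (rule sum.not_neutral_contains_not_neutral[OF assms[unfolded comb_def]]) (use that in auto)

lemma supp_comb_subset: "supp (comb G \<rho> \<alpha>) \<subseteq> (\<Union>g\<in>supp \<alpha> \<inter> G. supp (\<rho> g))"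
  by (auto simp: supp_def elim!: comb_nonzeroE)

lemma supp_comb_subset': "supp (comb G \<rho> \<alpha>) \<subseteq> (\<Union>g\<in>supp \<alpha>. supp (\<rho> g))"
  by (rule order_trans[OF supp_comb_subset]) auto

lemma supp_comb_nonneg:
  assumes "finite G" "supp \<alpha> \<subseteq> G" "\<And>g. 0 \<le> \<alpha> g" "\<And>g h. g \<in> G \<Longrightarrow> 0 \<le> \<rho> g h"
  shows "supp (comb G \<rho> \<alpha>) = (\<Union>g\<in>supp \<alpha>. supp (\<rho> g))"
proof
  show "supp (comb G \<rho> \<alpha>) \<subseteq> (\<Union>g\<in>supp \<alpha>. supp (\<rho> g))" by (rule supp_comb_subset')
  show "(\<Union>g\<in>supp \<alpha>. supp (\<rho> g)) \<subseteq> supp (comb G \<rho> \<alpha>)"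
  proof
    fix h assume "h \<in> (\<Union>g\<in>supp \<alpha>. supp (\<rho> g))"
    then obtain g where g: "\<alpha> g \<noteq> 0" "\<rho> g h \<noteq> 0" by (auto simp: supp_def)
    then have gG: "g \<in> G" using assms(2) by (auto simp: supp_def)
    have "\<alpha> g * \<rho> g h \<le> comb G \<rho> \<alpha> h" unfolding comb_def
      by (rule member_le_sum[OF gG]) (use assms in auto)
    moreover have "0 < \<alpha> g * \<rho> g h" using g assms(3)[of g] assms(4)[OF gG, of h] by (simp add: order_less_le)
    ultimately show "h \<in> supp (comb G \<rho> \<alpha>)" by (simp add: supp_def)
  qed
qed

lemma kern_lin:
  assumes "\<alpha> \<in> kern G deg" "\<beta> \<in> kern G deg"
  shows "(\<lambda>g. x * \<alpha> g + y * \<beta> g) \<in> kern G deg"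
proof -
  have "(\<Sum>g\<in>G. (x * \<alpha> g + y * \<beta> g) * deg g s) = x * (\<Sum>g\<in>G. \<alpha> g * deg g s) + y * (\<Sum>g\<in>G. \<beta> g * deg g s)" for s
    by (simp add: algebra_simps sum.distrib sum_distrib_left)
  moreover have "supp (\<lambda>g. x * \<alpha> g + y * \<beta> g) \<subseteq> supp \<alpha> \<union> supp \<beta>" by (auto simp: supp_def)
  ultimately show ?thesis using assms by (auto simp: kern_def)
qed

lemma comb_lin: "comb G \<rho> (\<lambda>g. x * \<alpha> g + y * \<beta> g) = (\<lambda>h. x * comb G \<rho> \<alpha> h + y * comb G \<rho> \<beta> h)"
  by (simp add: comb_def algebra_simps sum.distrib sum_distrib_left fun_eq_iff)

lemma subdiv_trans:
  assumes s1: "subdiv G \<K> deg t G' \<K>' deg' t' \<rho>"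
    and s2: "subdiv G' \<K>' deg' t' G'' \<K>'' deg'' t'' \<rho>'"
  shows "subdiv G \<K> deg t G'' \<K>'' deg'' t'' (\<lambda>g. comb G' \<rho> (\<rho>' g))"
proof -
  have c': "complex G' \<K>'" and r: "\<And>g h. g \<in> G' \<Longrightarrow> 0 \<le> \<rho> g h \<and> \<rho> g h \<in> \<rat>" and sr: "\<And>g. g \<in> G' \<Longrightarrow> supp (\<rho> g) \<subseteq> G"
    and K: "\<And>K. K \<in> \<K>' \<Longrightarrow> (\<Union>g\<in>K. supp (\<rho> g)) \<in> \<K>"
    using s1 by (auto simp: subdiv_def)
  have r': "\<And>g h. g \<in> G'' \<Longrightarrow> 0 \<le> \<rho>' g h \<and> \<rho>' g h \<in> \<rat>" and sr': "\<And>g. g \<in> G'' \<Longrightarrow> supp (\<rho>' g) \<subseteq> G'"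
    and K': "\<And>K. K \<in> \<K>'' \<Longrightarrow> (\<Union>g\<in>K. supp (\<rho>' g)) \<in> \<K>'" and c'': "complex G'' \<K>''"
    using s2 by (auto simp: subdiv_def)
  have sc: "supp (comb G' \<rho> (\<rho>' g)) = (\<Union>h\<in>supp (\<rho>' g). supp (\<rho> h))" if "g \<in> G''" for g
    by (rule supp_comb_nonneg) (use c' r r' sr' that in \<open>auto simp: complex_def\<close>)
  show ?thesis
    unfolding subdiv_def
  proof (intro conjI ballI allI)
    show "complex G'' \<K>''" by fact
    show "0 \<le> comb G' \<rho> (\<rho>' g) h" if "g \<in> G''" for g h
      unfolding comb_def using r r' that by (intro sum_nonneg) auto
    show "comb G' \<rho> (\<rho>' g) h \<in> \<rat>" if "g \<in> G''" for g h
      unfolding comb_def using r r' that by (intro Rats_sum) auto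
    show "supp (comb G' \<rho> (\<rho>' g)) \<subseteq> G" if "g \<in> G''" for g
      unfolding sc[OF that] using sr sr'[OF that] by blast
    show "(\<Union>g\<in>K. supp (comb G' \<rho> (\<rho>' g))) \<in> \<K>" if "K \<in> \<K>''" for K
    proof -
      have "(\<Union>g\<in>K. supp (comb G' \<rho> (\<rho>' g))) = (\<Union>g\<in>K. \<Union>h\<in>supp (\<rho>' g). supp (\<rho> h))"
        by (rule SUP_cong[OF refl sc]) (use complexD(2)[OF c'' that] in blast)
      also have "\<dots> = (\<Union>h\<in>(\<Union>g\<in>K. supp (\<rho>' g)). supp (\<rho> h))" by blast
      finally have "(\<Union>g\<in>K. supp (comb G' \<rho> (\<rho>' g))) = (\<Union>h\<in>(\<Union>g\<in>K. supp (\<rho>' g)). supp (\<rho> h))" .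
      then show ?thesis using K[OF K'[OF that]] by simp
    qed
    show "comb G'' (\<lambda>g. comb G' \<rho> (\<rho>' g)) \<alpha> \<in> kern G deg" if "\<alpha> \<in> kern G'' deg''" for \<alpha>
      unfolding comb_comb[symmetric] by (intro subdivD(6,7)[OF s1] subdivD(6,7)[OF s2] that)
    show "comb G'' (\<lambda>g. comb G' \<rho> (\<rho>' g)) \<alpha> \<in> slice G \<K> deg t" if "\<alpha> \<in> slice G'' \<K>'' deg'' t''" for \<alpha>
      unfolding comb_comb[symmetric] by (intro subdivD(6,7)[OF s1] subdivD(6,7)[OF s2] that)
    show "\<exists>!\<alpha>. \<alpha> \<in> slice G'' \<K>'' deg'' t'' \<and> comb G'' (\<lambda>g. comb G' \<rho> (\<rho>' g)) \<alpha> = z"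
      if zs: "z \<in> slice G \<K> deg t" for z
    proof -
      obtain \<beta> where b: "\<beta> \<in> slice G' \<K>' deg' t'" "comb G' \<rho> \<beta> = z"
        and bu: "\<forall>\<gamma>. \<gamma> \<in> slice G' \<K>' deg' t' \<longrightarrow> comb G' \<rho> \<gamma> = z \<longrightarrow> \<gamma> = \<beta>"
        by (rule subdivE[OF s1 zs])
      obtain \<alpha> where a: "\<alpha> \<in> slice G'' \<K>'' deg'' t''" "comb G'' \<rho>' \<alpha> = \<beta>"
        and au: "\<forall>\<gamma>. \<gamma> \<in> slice G'' \<K>'' deg'' t'' \<longrightarrow> comb G'' \<rho>' \<gamma> = \<beta> \<longrightarrow> \<gamma> = \<alpha>"
        by (rule subdivE[OF s2 b(1)])
      have "\<gamma> = \<alpha>" if g: "\<gamma> \<in> slice G'' \<K>'' deg'' t''" "comb G' \<rho> (comb G'' \<rho>' \<gamma>) = z" for \<gamma>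
      proof -
        have "comb G'' \<rho>' \<gamma> \<in> slice G' \<K>' deg' t'" by (rule subdivD(7)[OF s2 g(1)])
        then show ?thesis using bu g au by blast
      qed
      then show ?thesis unfolding comb_comb[symmetric] using a b by blast
    qed
  qed
qed

text \<open>Weights are nonnegative, so the support of the image of a point is the union of the
  supports of its rays. Hence a point lies over \<open>\<K>1\<close> exactly when its cell
  does.\<close>

lemma subdiv_restrict:
  assumes s: "subdiv G \<K> deg t G' \<K>' deg' t' \<rho>" and K1: "\<K>1 \<subseteq> \<K>" "complex G \<K>1"
  shows "subdiv G \<K>1 deg t G' {K\<in>\<K>'. (\<Union>g\<in>K. supp (\<rho> g)) \<in> \<K>1} deg' t' \<rho>"
proof -
  let ?K = "{K\<in>\<K>'. (\<Union>g\<in>K. supp (\<rho> g)) \<in> \<K>1}"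
  have c': "complex G' \<K>'" and r: "\<And>g h. g \<in> G' \<Longrightarrow> 0 \<le> \<rho> g h \<and> \<rho> g h \<in> \<rat>"
    using s by (auto simp: subdiv_def)
  have cc: "complex G' ?K"
    unfolding complex_def
  proof (intro conjI ballI allI impI)
    show "K \<subseteq> G'" if "K \<in> ?K" for K using c' that by (auto simp: complex_def)
    show "K' \<in> ?K" if K: "K \<in> ?K" "K' \<subseteq> K" for K K'
    proof -
      have "(\<Union>g\<in>K'. supp (\<rho> g)) \<subseteq> (\<Union>g\<in>K. supp (\<rho> g))" using K by blast
      then show ?thesis using complexD(3)[OF c'] complexD(3)[OF K1(2)] K by blast
    qed
  qed (use c' in \<open>auto simp: complex_def\<close>)
  have sub: "slice G' ?K deg' t' \<subseteq> slice G' \<K>' deg' t'" by (auto simp: slice_def)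
  have sc: "supp (comb G' \<rho> \<alpha>) = (\<Union>g\<in>supp \<alpha>. supp (\<rho> g))" if "\<alpha> \<in> slice G' \<K>' deg' t'" for \<alpha>
    using that complexD[OF c'] r by (intro supp_comb_nonneg) (auto dest: sliceD)
  have iff: "\<alpha> \<in> slice G' ?K deg' t' \<longleftrightarrow> \<alpha> \<in> slice G' \<K>' deg' t' \<and> supp (comb G' \<rho> \<alpha>) \<in> \<K>1" for \<alpha>
    using sc[of \<alpha>] by (auto simp: slice_def)
  have iff2: "z \<in> slice G \<K>1 deg t \<longleftrightarrow> z \<in> slice G \<K> deg t \<and> supp z \<in> \<K>1" for z
    using K1 by (auto simp: slice_def)
  show ?thesis
    unfolding subdiv_def
  proof (intro conjI ballI allI)
    show "comb G' \<rho> \<alpha> \<in> slice G \<K>1 deg t" if "\<alpha> \<in> slice G' ?K deg' t'" for \<alpha>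
      using that subdivD(7)[OF s, of \<alpha>] unfolding iff iff2 by blast
    show "\<exists>!\<alpha>. \<alpha> \<in> slice G' ?K deg' t' \<and> comb G' \<rho> \<alpha> = z" if "z \<in> slice G \<K>1 deg t" for z
    proof -
      have z: "z \<in> slice G \<K> deg t" "supp z \<in> \<K>1" using that iff2 by auto
      obtain \<alpha> where a: "\<alpha> \<in> slice G' \<K>' deg' t'" "comb G' \<rho> \<alpha> = z"
        "\<forall>\<beta>. \<beta> \<in> slice G' \<K>' deg' t' \<longrightarrow> comb G' \<rho> \<beta> = z \<longrightarrow> \<beta> = \<alpha>" by (rule subdivE[OF s z(1)])
      show ?thesis
      proof (rule ex1I[of _ \<alpha>])
        show "\<alpha> \<in> slice G' ?K deg' t' \<and> comb G' \<rho> \<alpha> = z"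
          unfolding iff a(2) using a(1) z(2) by (intro conjI refl)
        show "\<beta> = \<alpha>" if b: "\<beta> \<in> slice G' ?K deg' t' \<and> comb G' \<rho> \<beta> = z" for \<beta>
          by (rule a(3)[rule_format, OF subsetD[OF sub conjunct1[OF b]] conjunct2[OF b]])
      qed
    qed
  qed (use cc subdivD[OF s] in auto)
qed

text \<open>The matrix \<open>E\<close> turns new degrees into old ones. It settles the conditions
  on \<open>kern\<close> and the map between slices once and for all, so that applications only have
  to show existence and uniqueness of preimages.\<close>

lemma subdivI_deg:
  fixes E :: "'u \<Rightarrow> 's \<Rightarrow> real"
  assumes G: "finite G" and c': "complex G' \<K>'"
    and r: "\<And>g h. g \<in> G' \<Longrightarrow> 0 \<le> \<rho> g h \<and> \<rho> g h \<in> \<rat>" and sr: "\<And>g. g \<in> G' \<Longrightarrow> supp (\<rho> g) \<subseteq> G"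
    and K: "\<And>K. K \<in> \<K>' \<Longrightarrow> (\<Union>g\<in>K. supp (\<rho> g)) \<in> \<K>"
    and E: "\<And>g s. g \<in> G' \<Longrightarrow> (\<Sum>h\<in>G. \<rho> g h * deg h s) = (\<Sum>u\<in>B. deg' g u * E u s)"
    and t: "\<And>s. t s = (\<Sum>u\<in>B. t' u * E u s)"
    and ex: "\<And>z. z \<in> slice G \<K> deg t \<Longrightarrow> \<exists>\<alpha>\<in>slice G' \<K>' deg' t'. comb G' \<rho> \<alpha> = z"
    and un: "\<And>\<alpha> \<beta>. \<alpha> \<in> slice G' \<K>' deg' t' \<Longrightarrow> \<beta> \<in> slice G' \<K>' deg' t' \<Longrightarrow> comb G' \<rho> \<alpha> = comb G' \<rho> \<beta> \<Longrightarrow> \<alpha> = \<beta>"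
  shows "subdiv G \<K> deg t G' \<K>' deg' t' \<rho>"
proof -
  have d: "(\<Sum>h\<in>G. comb G' \<rho> \<alpha> h * deg h s) = (\<Sum>u\<in>B. (\<Sum>g\<in>G'. \<alpha> g * deg' g u) * E u s)" for \<alpha> s
  proof -
    have "(\<Sum>h\<in>G. comb G' \<rho> \<alpha> h * deg h s) = (\<Sum>h\<in>G. \<Sum>g\<in>G'. \<alpha> g * (\<rho> g h * deg h s))"
      by (simp add: comb_def sum_distrib_right mult.assoc)
    also have "\<dots> = (\<Sum>g\<in>G'. \<Sum>h\<in>G. \<alpha> g * (\<rho> g h * deg h s))" by (rule sum.swap)
    also have "\<dots> = (\<Sum>g\<in>G'. \<alpha> g * (\<Sum>u\<in>B. deg' g u * E u s))"
      using E by (simp add: sum_distrib_left[symmetric])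
    also have "\<dots> = (\<Sum>g\<in>G'. \<Sum>u\<in>B. \<alpha> g * deg' g u * E u s)" by (simp add: sum_distrib_left mult.assoc)
    also have "\<dots> = (\<Sum>u\<in>B. \<Sum>g\<in>G'. \<alpha> g * deg' g u * E u s)" by (rule sum.swap)
    finally show ?thesis by (simp add: sum_distrib_right)
  qed
  have sup: "supp (comb G' \<rho> \<alpha>) \<subseteq> G" for \<alpha> using supp_comb_subset[of G' \<rho> \<alpha>] sr by blast
  have sl: "comb G' \<rho> \<alpha> \<in> slice G \<K> deg t" if a: "\<alpha> \<in> slice G' \<K>' deg' t'" for \<alpha>
    unfolding slice_def
  proof (intro CollectI conjI allI)
    show "0 \<le> comb G' \<rho> \<alpha> h" for h
      unfolding comb_def using r sliceD(1)[OF a] by (intro sum_nonneg) auto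
    have "supp (comb G' \<rho> \<alpha>) = (\<Union>g\<in>supp \<alpha>. supp (\<rho> g))"
      by (rule supp_comb_nonneg) (use complexD[OF c'] sliceD[OF a] r in auto)
    then show "supp (comb G' \<rho> \<alpha>) \<in> \<K>" using K[OF sliceD(2)[OF a]] by simp
    show "(\<Sum>g\<in>G. comb G' \<rho> \<alpha> g * deg g s) = t s" for s
      unfolding d t using sliceD(3)[OF a] by simp
  qed
  have kr: "comb G' \<rho> \<alpha> \<in> kern G deg" if "\<alpha> \<in> kern G' deg'" for \<alpha>
    using that sup d by (auto simp: kern_def)
  show ?thesis unfolding subdiv_def using c' r sr K kr sl ex un by blast
qed

lemma unimod_trans:
  assumes s2: "subdiv G' \<K>' deg' t' G'' \<K>'' deg'' t'' \<rho>'"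
    and u1: "unimod G' \<K>' deg' \<rho> L" and u2: "unimod G'' \<K>'' deg'' \<rho>' intvec" and c': "complex G' \<K>'"
  shows "unimod G'' \<K>'' deg'' (\<lambda>g. comb G' \<rho> (\<rho>' g)) L"
  unfolding unimod_def
proof (intro ballI impI)
  fix \<alpha> assume a: "\<alpha> \<in> kern G'' deg''" "supp \<alpha> \<in> \<K>''" "comb G'' (\<lambda>g. comb G' \<rho> (\<rho>' g)) \<alpha> \<in> L"
  have k: "comb G'' \<rho>' \<alpha> \<in> kern G' deg'" using s2 a(1) by (simp add: subdiv_def)
  have "supp (comb G'' \<rho>' \<alpha>) \<subseteq> (\<Union>g\<in>supp \<alpha>. supp (\<rho>' g))" by (rule supp_comb_subset')
  moreover have "(\<Union>g\<in>supp \<alpha>. supp (\<rho>' g)) \<in> \<K>'" using s2 a(2) by (simp add: subdiv_def)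
  ultimately have "supp (comb G'' \<rho>' \<alpha>) \<in> \<K>'" using complexD(3)[OF c'] by blast
  then have "comb G'' \<rho>' \<alpha> \<in> intvec" using u1 k a(3) unfolding unimod_def comb_comb[symmetric] by blast
  then show "\<alpha> \<in> intvec" using u2 a unfolding unimod_def by blast
qed

section \<open>Merging and splitting of slots\<close>

definition cdeg :: "('r \<Rightarrow> 's set) \<Rightarrow> 'r \<Rightarrow> 's \<Rightarrow> real" where
  "cdeg cov g s = of_bool (s \<in> cov g)"

text \<open>A ray of a complex with degrees \<open>cdeg cov\<close> fills the slots in \<open>cov g\<close>. All slots of the same
  class have the same size, and they are merged to a single slot: the new rays of class \<open>a\<close> are the exact
  covers of the slots of class \<open>a\<close>.\<close>

locale merge =
  fixes G :: "'r::linorder set" and \<K> :: "'r set set" and cov :: "'r \<Rightarrow> 's set" and cls :: "'s \<Rightarrow> 'a"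
    and S :: "'s set" and A :: "'a set" and \<epsilon> :: "'a \<Rightarrow> real"
  assumes cG: "complex G \<K>" and finS: "finite S" and finA: "finite A"
    and cov: "g \<in> G \<Longrightarrow> cov g \<subseteq> S" "g \<in> G \<Longrightarrow> cov g \<noteq> {}"
      "g \<in> G \<Longrightarrow> s \<in> cov g \<Longrightarrow> s' \<in> cov g \<Longrightarrow> cls s = cls s'"
    and clsA: "s \<in> S \<Longrightarrow> cls s \<in> A"
    and top: "C \<in> \<K> \<Longrightarrow> g \<in> C \<Longrightarrow> s \<in> cov g \<Longrightarrow> s' \<in> cov g \<Longrightarrow> s \<noteq> s' \<Longrightarrow> h \<in> C \<Longrightarrow> s \<in> cov h \<Longrightarrow> h \<le> g"
    and eps: "a \<in> A \<Longrightarrow> 0 \<le> \<epsilon> a"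
begin

definition Sl :: "'a \<Rightarrow> 's set" where "Sl a = {s\<in>S. cls s = a}"

text \<open>An exact cover is encoded by the function that sends a slot to the ray covering it.
  Covers are then elements of a product of chains, and couplings of the slots apply.\<close>

definition Cov :: "'a \<Rightarrow> ('s \<Rightarrow> 'r) set" where
  "Cov a = {j\<in>PiE (Sl a) (\<lambda>s. {g\<in>G. s \<in> cov g}). \<forall>s\<in>Sl a. \<forall>s'\<in>cov (j s). j s' = j s}"

definition G2 :: "('a \<times> ('s \<Rightarrow> 'r)) set" where "G2 = Sigma A Cov"

definition \<rho>2 :: "'a \<times> ('s \<Rightarrow> 'r) \<Rightarrow> 'r \<Rightarrow> real" where
  "\<rho>2 x g = of_bool (g \<in> snd x ` Sl (fst x))"

definition \<K>2 :: "('a \<times> ('s \<Rightarrow> 'r)) set set" where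
  "\<K>2 = {C. C \<subseteq> G2 \<and> (\<forall>a\<in>A. pchain (Sl a) {j. (a,j) \<in> C}) \<and> (\<Union>x\<in>C. snd x ` Sl (fst x)) \<in> \<K>}"

definition t1 :: "'s \<Rightarrow> real" where "t1 s = (if s \<in> S then \<epsilon> (cls s) else 0)"

definition t2 :: "'a \<Rightarrow> real" where "t2 a = (if a \<in> A then \<epsilon> a else 0)"

lemma finG: "finite G" using cG by (simp add: complex_def)

lemma finSl: "finite (Sl a)" using finS by (simp add: Sl_def)

lemma finPi: "finite (PiE (Sl a) (\<lambda>_. G))"
  using finSl finG by (intro finite_PiE) auto

lemma Cov_PiE: "Cov a \<subseteq> PiE (Sl a) (\<lambda>_. G)"
  unfolding Cov_def PiE_def by auto

lemma finCov: "finite (Cov a)"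
  using finite_subset[OF Cov_PiE finPi] .

lemma Cov_ext: "Cov a \<subseteq> extensional (Sl a)"
  unfolding Cov_def PiE_def by auto

lemma CovD:
  assumes "j \<in> Cov a" "s \<in> Sl a"
  shows "j s \<in> G" "s \<in> cov (j s)" "s' \<in> cov (j s) \<Longrightarrow> j s' = j s"
  using assms unfolding Cov_def PiE_def by auto

lemma finG2: "finite G2" unfolding G2_def using finA finCov by blast

lemma mem_range:
  assumes "j \<in> Cov a" "g \<in> G" "s \<in> cov g"
  shows "g \<in> j ` Sl a \<longleftrightarrow> s \<in> Sl a \<and> j s = g"
proof
  assume "g \<in> j ` Sl a"
  then obtain s' where s': "s' \<in> Sl a" "g = j s'" by blast
  then have "s' \<in> cov g" using CovD[OF assms(1)] by blast
  then have "cls s = a" using cov(3)[OF assms(2,3)] s'(1) by (auto simp: Sl_def)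
  then have "s \<in> Sl a" using cov(1)[OF assms(2)] assms(3) by (auto simp: Sl_def)
  moreover have "j s = g" using CovD(3)[OF assms(1) s'(1)] s'(2) assms(3) by simp
  ultimately show "s \<in> Sl a \<and> j s = g" by simp
qed auto

lemma supp_\<rho>2: "supp (\<rho>2 x) = snd x ` Sl (fst x)"
  by (auto simp: supp_def \<rho>2_def)

text \<open>A cover uses \<open>g\<close> exactly if it assigns \<open>g\<close> to
  \<open>s\<close>, whichever slot \<open>s\<close> of \<open>g\<close> is taken. The weight of
  \<open>g\<close> is thus a marginal at \<open>s\<close>, and merging becomes a coupling
  problem.\<close>

lemma comb_eq:
  assumes "g \<in> G" "s \<in> cov g"
  shows "comb G2 \<rho>2 \<alpha> g = (\<Sum>j\<in>Cov (cls s). \<alpha> (cls s, j) * of_bool (j s = g))"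
proof -
  have sS: "s \<in> S" using cov(1) assms by blast
  have "comb G2 \<rho>2 \<alpha> g = (\<Sum>a\<in>A. \<Sum>j\<in>Cov a. \<alpha> (a,j) * of_bool (g \<in> j ` Sl a))"
    unfolding comb_def G2_def by (subst sum.Sigma[OF finA]) (auto simp: finCov \<rho>2_def case_prod_beta)
  also have "\<dots> = (\<Sum>a\<in>A. if a = cls s then (\<Sum>j\<in>Cov a. \<alpha> (a,j) * of_bool (j s = g)) else 0)"
  proof (intro sum.cong refl)
    fix a
    have "(\<Sum>j\<in>Cov a. \<alpha> (a,j) * of_bool (g \<in> j ` Sl a)) = (\<Sum>j\<in>Cov a. \<alpha> (a,j) * of_bool (s \<in> Sl a \<and> j s = g))"
      using mem_range[OF _ assms] by (intro sum.cong refl) simp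
    then show "(\<Sum>j\<in>Cov a. \<alpha> (a,j) * of_bool (g \<in> j ` Sl a)) = (if a = cls s then (\<Sum>j\<in>Cov a. \<alpha> (a,j) * of_bool (j s = g)) else 0)"
      using sS by (auto simp: Sl_def)
  qed
  also have "\<dots> = (\<Sum>j\<in>Cov (cls s). \<alpha> (cls s, j) * of_bool (j s = g))"
    using clsA[OF sS] finA by simp
  finally show ?thesis .
qed

lemma deg_eq: "(\<Sum>x\<in>G2. \<alpha> x * udeg fst x a) = (if a \<in> A then (\<Sum>j\<in>Cov a. \<alpha> (a,j)) else 0)"
proof -
  have "(\<Sum>x\<in>G2. \<alpha> x * udeg fst x a) = (\<Sum>a'\<in>A. \<Sum>j\<in>Cov a'. \<alpha> (a',j) * of_bool (a' = a))"
    unfolding G2_def by (subst sum.Sigma[OF finA]) (auto simp: finCov udeg_def case_prod_beta)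
  also have "\<dots> = (\<Sum>a'\<in>A. if a' = a then (\<Sum>j\<in>Cov a'. \<alpha> (a',j)) else 0)"
    by (intro sum.cong refl) simp
  finally show ?thesis using finA by simp
qed

lemma marginal_cases:
  assumes "s \<in> Sl a" "a \<in> A"
  shows "(\<Sum>j\<in>Cov a. \<alpha> (a,j) * of_bool (j s = l)) = (if l \<in> G \<and> s \<in> cov l then comb G2 \<rho>2 \<alpha> l else 0)"
proof (cases "l \<in> G \<and> s \<in> cov l")
  case True
  then show ?thesis using comb_eq[of l s \<alpha>] assms by (auto simp: Sl_def)
next
  case False
  then have "(\<Sum>j\<in>Cov a. \<alpha> (a,j) * of_bool (j s = l)) = 0"
    using CovD(1,2)[OF _ assms(1)] by (intro sum.neutral) auto
  then show ?thesis unfolding if_not_P[OF False] .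
qed

lemma complex2: "complex G2 \<K>2"
  unfolding complex_def
proof (intro conjI ballI allI impI finG2)
  show "C \<subseteq> G2" if "C \<in> \<K>2" for C using that by (simp add: \<K>2_def)
  show "C' \<in> \<K>2" if C: "C \<in> \<K>2" "C' \<subseteq> C" for C C'
  proof -
    have "(\<Union>x\<in>C'. snd x ` Sl (fst x)) \<subseteq> (\<Union>x\<in>C. snd x ` Sl (fst x))" using C(2) by blast
    then have "(\<Union>x\<in>C'. snd x ` Sl (fst x)) \<in> \<K>"
      by (rule complexD(3)[OF cG, rotated]) (use C(1) in \<open>simp add: \<K>2_def\<close>)
    moreover have "pchain (Sl a) {j. (a,j) \<in> C'}" if "a \<in> A" for a
    proof (rule pchain_subset)
      show "pchain (Sl a) {j. (a,j) \<in> C}" using C(1) that by (simp add: \<K>2_def)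
    qed (use C(2) in auto)
    ultimately show ?thesis using C by (auto simp: \<K>2_def)
  qed
qed

lemma chain_supp:
  assumes "supp \<alpha> \<in> \<K>2" "a \<in> A"
  shows "pchain (Sl a) {j\<in>Cov a. \<alpha> (a,j) \<noteq> 0}"
proof (rule pchain_subset)
  show "pchain (Sl a) {j. (a,j) \<in> supp \<alpha>}" using assms by (simp add: \<K>2_def)
qed (auto simp: supp_def)

lemma merge_unimod: "unimod G2 \<K>2 (udeg fst) \<rho>2 intvec"
  unfolding unimod_def
proof (intro ballI impI)
  fix \<alpha> assume a: "\<alpha> \<in> kern G2 (udeg fst)" "supp \<alpha> \<in> \<K>2" "comb G2 \<rho>2 \<alpha> \<in> intvec"
  have "\<alpha> x \<in> \<int>" for x
  proof (cases "x \<in> G2")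
    case True
    then obtain c j where x: "x = (c,j)" "c \<in> A" "j \<in> Cov c" by (auto simp: G2_def)
    have "\<alpha> (c,j) \<in> \<int>"
    proof (rule chain_coupling_integral[OF finCov[of c] chain_supp[OF a(2) x(2)] Cov_ext _ _ x(3)])
      show "(\<Sum>j\<in>Cov c. \<alpha> (c, j)) \<in> \<int>"
        using a(1) x(2) deg_eq[of \<alpha> c] by (simp add: kern_def)
      show "(\<Sum>j\<in>Cov c. \<alpha> (c, j) * of_bool (j s = l)) \<in> \<int>" if "s \<in> Sl c" for s l
        using a(3) by (simp add: marginal_cases[OF that x(2)] intvec_def)
    qed
    then show ?thesis using x by simp
  next
    case False
    then have "\<alpha> x = 0" using a(1) by (auto simp: kern_def supp_def)
    then show ?thesis by simp
  qed
  then show "\<alpha> \<in> intvec" by (simp add: intvec_def)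
qed

lemma merge_unique:
  assumes a: "\<alpha> \<in> slice G2 \<K>2 (udeg fst) t2" and b: "\<beta> \<in> slice G2 \<K>2 (udeg fst) t2"
    and eq: "comb G2 \<rho>2 \<alpha> = comb G2 \<rho>2 \<beta>"
  shows "\<alpha> = \<beta>"
proof
  fix x
  show "\<alpha> x = \<beta> x"
  proof (cases "x \<in> G2")
    case True
    then obtain c j where x: "x = (c,j)" "c \<in> A" "j \<in> Cov c" by (auto simp: G2_def)
    have "\<alpha> (c,j) = \<beta> (c,j)"
    proof (rule chain_coupling_unique[OF finCov[of c] Cov_ext _ _
          chain_supp[OF sliceD(2)[OF a] x(2)] chain_supp[OF sliceD(2)[OF b] x(2)] _ _ x(3)])
      show "(\<Sum>j\<in>Cov c. \<alpha> (c, j)) = (\<Sum>j\<in>Cov c. \<beta> (c, j))"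
        using sliceD(3)[OF a, of c] sliceD(3)[OF b, of c] x(2) by (simp add: deg_eq)
      show "(\<Sum>j\<in>Cov c. \<alpha> (c, j) * of_bool (j s = l)) = (\<Sum>j\<in>Cov c. \<beta> (c, j) * of_bool (j s = l))" if "s \<in> Sl c" for s l
        by (simp add: marginal_cases[OF that x(2)] eq)
    qed (use sliceD(1)[OF a] sliceD(1)[OF b] in auto)
    then show ?thesis using x by simp
  next
    case False
    then have "\<alpha> x = 0" "\<beta> x = 0"
      using sliceD(2)[OF a] sliceD(2)[OF b] complexD(2)[OF complex2] by (auto simp: supp_def)
    then show ?thesis by simp
  qed
qed

text \<open>The chain coupling of the slots of one class does not know about rays that cover several
  slots. That it uses such a ray in all of its slots at once is the fact \<open>closed\<close>; it
  holds because by \<open>top\<close> the ray is the greatest label occurring in each of these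
  slots.\<close>

lemma merge_exists:
  assumes z: "z \<in> slice G \<K> (cdeg cov) t1"
  shows "\<exists>\<alpha>\<in>slice G2 \<K>2 (udeg fst) t2. comb G2 \<rho>2 \<alpha> = z"
proof -
  define m where "m s g = (if s \<in> cov g then z g else 0)" for s g
  have znn: "0 \<le> z g" for g using sliceD(1)[OF z] .
  have zK: "supp z \<in> \<K>" using sliceD(2)[OF z] .
  let ?P = "\<lambda>a. PiE (Sl a) (\<lambda>_. G)"
  have "\<exists>\<alpha>. (\<forall>J. 0 \<le> \<alpha> J) \<and> (\<forall>J. \<alpha> J \<noteq> 0 \<longrightarrow> J \<in> ?P a) \<and> pchain (Sl a) {J. \<alpha> J \<noteq> 0} \<and>
    (\<Sum>J\<in>?P a. \<alpha> J) = \<epsilon> a \<and> (\<forall>s\<in>Sl a. \<forall>l\<in>G. (\<Sum>J\<in>?P a. \<alpha> J * of_bool (J s = l)) = m s l)" if "a \<in> A" for a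
  proof (rule chain_coupling_exists[OF finSl finG _ _ eps[OF that]])
    show "0 \<le> m s l" for s l using znn by (simp add: m_def)
    show "(\<Sum>l\<in>G. m s l) = \<epsilon> a" if "s \<in> Sl a" for s
    proof -
      have "(\<Sum>l\<in>G. m s l) = (\<Sum>l\<in>G. z l * cdeg cov l s)" by (intro sum.cong) (auto simp: m_def cdeg_def)
      then show ?thesis using sliceD(3)[OF z, of s] that by (simp add: t1_def Sl_def)
    qed
  qed
  then have "\<forall>a\<in>A. \<exists>\<alpha>. (\<forall>J. 0 \<le> \<alpha> J) \<and> (\<forall>J. \<alpha> J \<noteq> 0 \<longrightarrow> J \<in> ?P a) \<and> pchain (Sl a) {J. \<alpha> J \<noteq> 0} \<and>
    (\<Sum>J\<in>?P a. \<alpha> J) = \<epsilon> a \<and> (\<forall>s\<in>Sl a. \<forall>l\<in>G. (\<Sum>J\<in>?P a. \<alpha> J * of_bool (J s = l)) = m s l)" by blast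
  from bchoice[OF this] obtain \<phi> where \<phi>: "\<forall>a\<in>A. (\<forall>J. 0 \<le> \<phi> a J) \<and> (\<forall>J. \<phi> a J \<noteq> 0 \<longrightarrow> J \<in> ?P a) \<and> pchain (Sl a) {J. \<phi> a J \<noteq> 0} \<and>
    (\<Sum>J\<in>?P a. \<phi> a J) = \<epsilon> a \<and> (\<forall>s\<in>Sl a. \<forall>l\<in>G. (\<Sum>J\<in>?P a. \<phi> a J * of_bool (J s = l)) = m s l)" ..
  have p1: "0 \<le> \<phi> a J" and p2: "\<phi> a J \<noteq> 0 \<Longrightarrow> J \<in> ?P a" and p3: "pchain (Sl a) {J. \<phi> a J \<noteq> 0}"
    and p4: "(\<Sum>J\<in>?P a. \<phi> a J) = \<epsilon> a"
    and p5: "s \<in> Sl a \<Longrightarrow> l \<in> G \<Longrightarrow> (\<Sum>J\<in>?P a. \<phi> a J * of_bool (J s = l)) = m s l"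
    if "a \<in> A" for a J s l using \<phi> that by auto
  have used: "J s \<in> G \<and> s \<in> cov (J s) \<and> z (J s) \<noteq> 0" if "a \<in> A" "\<phi> a J \<noteq> 0" "s \<in> Sl a" for a J s
  proof -
    have JP: "J \<in> ?P a" using p2 that by blast
    have JG: "J s \<in> G" using JP that by (auto simp: PiE_def)
    have "\<phi> a J * of_bool (J s = J s) \<le> (\<Sum>J'\<in>?P a. \<phi> a J' * of_bool (J' s = J s))"
      by (rule member_le_sum[OF JP _ finPi]) (use p1[OF that(1)] in auto)
    then have "0 < m s (J s)" using p5[OF that(1,3) JG] p1[OF that(1), of J] that(2) by simp
    then show ?thesis using JG by (auto simp: m_def split: if_splits)
  qed
  have closed: "J s' = J s" if aA: "a \<in> A" and J: "\<phi> a J \<noteq> 0" and s: "s \<in> Sl a" and s': "s' \<in> cov (J s)" for a J s s'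
  proof (rule ccontr)
    assume ne: "J s' \<noteq> J s"
    define g where "g = J s"
    have g: "g \<in> G" "s \<in> cov g" "z g \<noteq> 0" using used[OF aA J s] by (auto simp: g_def)
    have s'g: "s' \<in> cov g" using s' by (simp add: g_def)
    have s'S: "s' \<in> Sl a" using cov(1)[OF g(1)] cov(3)[OF g(1,2) s'g] s'g s by (auto simp: Sl_def)
    have nss: "s \<noteq> s'" using ne by auto
    have le: "J' u \<le> g" if "\<phi> a J' \<noteq> 0" "u = s \<or> u = s'" for J' u
    proof -
      have u: "u \<in> Sl a" "u \<in> cov g" using that s s'S g s'g by auto
      have "J' u \<in> supp z" "g \<in> supp z" "u \<in> cov (J' u)" using used[OF aA that(1) u(1)] g by (auto simp: supp_def)
      then show ?thesis
        using top[OF zK, of g s s' "J' u"] top[OF zK, of g s' s "J' u"] g(2) s'g nss that(2) by auto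
    qed
    \<comment> \<open>\<open>J\<close> has \<open>g\<close> in slot \<open>s\<close> but a smaller
      label in \<open>s'\<close>. Any \<open>J'\<close> with \<open>g\<close> in slot
      \<open>s'\<close> is then above \<open>J\<close> in the chain, so it has \<open>g\<close> in
      slot \<open>s\<close> too. As \<open>g\<close> has the same mass in both slots, the converse
      follows for all functions of the support, contrary to \<open>J\<close>.\<close>
    have claim: "J' s = g" if J': "\<phi> a J' \<noteq> 0" "J' s' = g" for J'
    proof -
      have "J s' < g" using le[OF J, of s'] ne by (simp add: g_def)
      then have "\<not> (\<forall>s\<in>Sl a. J' s \<le> J s)" using J'(2) s'S by (auto simp: not_le)
      moreover have "(\<forall>s\<in>Sl a. J s \<le> J' s) \<or> (\<forall>s\<in>Sl a. J' s \<le> J s)"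
        using p3[OF aA] J J'(1) unfolding pchain_def by simp
      ultimately have "J s \<le> J' s" using s by blast
      then show ?thesis using le[OF J'(1), of s] by (simp add: g_def)
    qed
    have "(\<Sum>J'\<in>?P a. \<phi> a J' * (of_bool (J' s = g) - of_bool (J' s' = g))) = 0"
      using p5[OF aA s g(1)] p5[OF aA s'S g(1)] g(2) s'g
      by (simp add: right_diff_distrib sum_subtractf m_def)
    moreover have "0 \<le> \<phi> a J' * (of_bool (J' s = g) - of_bool (J' s' = g))" for J'
      using p1[OF aA, of J'] claim[of J'] by (cases "\<phi> a J' = 0") auto
    ultimately have "\<forall>J'\<in>?P a. \<phi> a J' * (of_bool (J' s = g) - of_bool (J' s' = g)) = 0"
      by (subst (asm) sum_nonneg_eq_0_iff[OF finPi])
    from bspec[OF this p2[OF aA J]] show False using J ne by (simp add: g_def)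
  qed
  have inCov: "J \<in> Cov a" if "a \<in> A" "\<phi> a J \<noteq> 0" for a J
  proof -
    have "J \<in> PiE (Sl a) (\<lambda>s. {g\<in>G. s \<in> cov g})"
      using p2[OF that] used[OF that] by (simp add: PiE_iff)
    then show ?thesis unfolding Cov_def using closed[OF that] by simp
  qed
  define \<alpha> where "\<alpha> x = (if fst x \<in> A then \<phi> (fst x) (snd x) else 0)" for x
  have sumP: "(\<Sum>j\<in>Cov a. \<phi> a j * f j) = (\<Sum>j\<in>?P a. \<phi> a j * f j)" if "a \<in> A" for a f
    using inCov[OF that] by (intro sum.mono_neutral_left[OF finPi Cov_PiE]) auto
  have suppz: "supp z \<subseteq> G" using complexD(2)[OF cG zK] .
  have cz: "comb G2 \<rho>2 \<alpha> = z"
  proof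
    fix g
    show "comb G2 \<rho>2 \<alpha> g = z g"
    proof (cases "g \<in> G")
      case True
      then obtain s where s: "s \<in> cov g" using cov(2) by blast
      then have sS: "s \<in> S" "cls s \<in> A" using cov(1)[OF True] clsA by auto
      have "comb G2 \<rho>2 \<alpha> g = (\<Sum>j\<in>Cov (cls s). \<phi> (cls s) j * of_bool (j s = g))"
        using comb_eq[OF True s, of \<alpha>] sS by (simp add: \<alpha>_def)
      also have "\<dots> = m s g" using sumP[OF sS(2)] p5[OF sS(2) _ True, of s] sS by (simp add: Sl_def)
      finally show ?thesis using s by (simp add: m_def)
    next
      case False
      have "comb G2 \<rho>2 \<alpha> g = 0"
        unfolding comb_def
      proof (intro sum.neutral ballI)
        fix x assume "x \<in> G2"
        then have "g \<notin> snd x ` Sl (fst x)" using False CovD(1) by (auto simp: G2_def)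
        then show "\<alpha> x * \<rho>2 x g = 0" by (simp add: \<rho>2_def)
      qed
      then show ?thesis using False suppz by (auto simp: supp_def)
    qed
  qed
  have "\<alpha> \<in> slice G2 \<K>2 (udeg fst) t2"
    unfolding slice_def
  proof (intro CollectI conjI allI)
    show "0 \<le> \<alpha> x" for x using p1 by (simp add: \<alpha>_def)
    show "(\<Sum>g\<in>G2. \<alpha> g * udeg fst g a) = t2 a" for a
      using p4[of a] sumP[of a "\<lambda>_. 1"] by (simp add: deg_eq t2_def \<alpha>_def)
    show "supp \<alpha> \<in> \<K>2"
      unfolding \<K>2_def
    proof (intro CollectI conjI ballI)
      show "supp \<alpha> \<subseteq> G2" using inCov by (auto simp: supp_def \<alpha>_def G2_def split: if_splits)
      show "pchain (Sl a) {j. (a,j) \<in> supp \<alpha>}" if "a \<in> A" for a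
        using p3[OF that] that by (simp add: supp_def \<alpha>_def)
      have "(\<Union>x\<in>supp \<alpha>. snd x ` Sl (fst x)) \<subseteq> supp z"
        using used by (auto simp: supp_def \<alpha>_def split: if_splits)
      then show "(\<Union>x\<in>supp \<alpha>. snd x ` Sl (fst x)) \<in> \<K>" using complexD(3)[OF cG zK] by blast
    qed
  qed
  then show ?thesis using cz by blast
qed

lemma merge_subdiv: "subdiv G \<K> (cdeg cov) t1 G2 \<K>2 (udeg fst) t2 \<rho>2"
proof (rule subdivI_deg[where B = A and E = "\<lambda>a s. of_bool (s \<in> S \<and> cls s = a)", OF finG complex2])
  show "0 \<le> \<rho>2 g h \<and> \<rho>2 g h \<in> \<rat>" for g h by (simp add: \<rho>2_def)
  show "supp (\<rho>2 g) \<subseteq> G" if "g \<in> G2" for g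
    using that CovD(1) by (auto simp: supp_\<rho>2 G2_def)
  show "(\<Union>g\<in>C. supp (\<rho>2 g)) \<in> \<K>" if "C \<in> \<K>2" for C using that by (simp add: supp_\<rho>2 \<K>2_def)
  show "t1 s = (\<Sum>u\<in>A. t2 u * of_bool (s \<in> S \<and> cls s = u))" for s
  proof (cases "s \<in> S")
    case True
    have "(\<Sum>u\<in>A. t2 u * of_bool (s \<in> S \<and> cls s = u)) = (\<Sum>u\<in>A. if u = cls s then t2 u else 0)"
      using True by (intro sum.cong) auto
    then show ?thesis using True clsA finA by (simp add: t1_def t2_def)
  qed (simp add: t1_def)
  show "(\<Sum>h\<in>G. \<rho>2 x h * cdeg cov h s) = (\<Sum>u\<in>A. udeg fst x u * of_bool (s \<in> S \<and> cls s = u))"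
    if x: "x \<in> G2" for x s
  proof -
    obtain a j where xa: "x = (a,j)" "a \<in> A" "j \<in> Cov a" using x by (auto simp: G2_def)
    have r: "(\<Sum>u\<in>A. udeg fst x u * of_bool (s \<in> S \<and> cls s = u)) = of_bool (s \<in> Sl a)"
    proof -
      have "(\<Sum>u\<in>A. udeg fst x u * of_bool (s \<in> S \<and> cls s = u)) = (\<Sum>u\<in>A. if u = a then of_bool (s \<in> S \<and> cls s = a) else 0)"
        by (intro sum.cong) (auto simp: udeg_def xa)
      then show ?thesis using xa(2) finA by (simp add: Sl_def)
    qed
    have "(\<Sum>h\<in>G. \<rho>2 x h * cdeg cov h s) = (\<Sum>h\<in>G. if h = j s then of_bool (s \<in> Sl a) else 0)"
    proof (intro sum.cong refl)
      fix h assume h: "h \<in> G"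
      show "\<rho>2 x h * cdeg cov h s = (if h = j s then of_bool (s \<in> Sl a) else 0)"
      proof (cases "s \<in> cov h")
        case True
        then show ?thesis using mem_range[OF xa(3) h True] by (auto simp: \<rho>2_def cdeg_def xa(1))
      next
        case False
        then show ?thesis using CovD(2)[OF xa(3), of s] by (auto simp: cdeg_def)
      qed
    qed
    also have "\<dots> = of_bool (s \<in> Sl a)" using finG CovD(1)[OF xa(3), of s] by auto
    finally show ?thesis using r by simp
  qed
qed (rule merge_exists, assumption, rule merge_unique)

end

section \<open>Splitting rays with several labels into slots\<close>

abbreviation pc :: "nat \<Rightarrow> nat" where "pc p \<equiv> fst (prod_decode p)"
abbreviation pl :: "nat \<Rightarrow> nat" where "pl p \<equiv> snd (prod_decode p)"

text \<open>Block \<open>i\<close> consists of \<open>e a i\<close> slots of size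
  \<open>\<epsilon> a\<close> for each class \<open>a\<close>. Rays in \<open>G\<close> have one
  label, those in \<open>M\<close> a multidegree \<open>h\<close>. \<open>W \<mu> a\<close> counts
  the groups of slots of class \<open>a\<close> that \<open>\<mu>\<close> may occupy, and
  \<open>i0 \<mu>\<close> is a label whose block is exhausted by these groups in every class; it
  limits the weight of \<open>\<mu>\<close>. \<open>G\<close> precedes \<open>M\<close> so that rays
  covering several slots are the greatest ones.\<close>

locale slots =
  fixes G M :: "nat set" and b :: "nat \<Rightarrow> 'i" and h :: "nat \<Rightarrow> 'i \<Rightarrow> nat" and B :: "'i set"
    and k :: nat and \<epsilon> :: "nat \<Rightarrow> real" and e :: "nat \<Rightarrow> 'i \<Rightarrow> nat" and W :: "nat \<Rightarrow> nat \<Rightarrow> nat" and i0 :: "nat \<Rightarrow> 'i"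
  assumes finG: "finite G" and finM: "finite M" and GM: "\<And>g \<mu>. g \<in> G \<Longrightarrow> \<mu> \<in> M \<Longrightarrow> g < \<mu>"
    and finB: "finite B" and bB: "\<And>g. g \<in> G \<Longrightarrow> b g \<in> B" and hB: "\<And>\<mu> i. \<mu> \<in> M \<Longrightarrow> h \<mu> i \<noteq> 0 \<Longrightarrow> i \<in> B"
    and i0: "\<And>\<mu>. \<mu> \<in> M \<Longrightarrow> i0 \<mu> \<in> B" "\<And>\<mu>. \<mu> \<in> M \<Longrightarrow> 0 < h \<mu> (i0 \<mu>)"
    and W0: "\<And>\<mu> a. \<mu> \<in> M \<Longrightarrow> a < k \<Longrightarrow> e a (i0 \<mu>) = h \<mu> (i0 \<mu>) * W \<mu> a"
    and W: "\<And>\<mu> a i. \<mu> \<in> M \<Longrightarrow> a < k \<Longrightarrow> i \<in> B \<Longrightarrow> h \<mu> i * W \<mu> a \<le> e a i"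
    and eps: "\<And>a. a < k \<Longrightarrow> 0 < \<epsilon> a"
begin

definition deg1 :: "nat \<Rightarrow> 'i \<Rightarrow> real" where
  "deg1 g i = (if g \<in> M then real (h g i) else of_bool (b g = i))"

definition t1 :: "'i \<Rightarrow> real" where
  "t1 i = (if i \<in> B then \<Sum>a<k. \<epsilon> a * real (e a i) else 0)"

definition \<K>1 :: "nat set set" where
  "\<K>1 = {C. C \<subseteq> G \<union> M \<and> (\<forall>\<mu>\<in>C \<inter> M. \<forall>\<nu>\<in>C \<inter> M. \<mu> = \<nu>)}"

text \<open>Slots are pairs of a class and a position, coded as numbers to have the linear order on
  which fillings and staircases rely.\<close>

definition P :: "'i \<Rightarrow> nat set" where "P i = prod_encode ` Sigma {..<k} (\<lambda>a. {..<e a i})"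

definition Q :: "nat \<Rightarrow> nat set" where "Q \<mu> = prod_encode ` Sigma {..<k} (\<lambda>a. {..<W \<mu> a})"

definition S :: "('i \<times> nat) set" where "S = Sigma B P"

text \<open>The slots of block \<open>i\<close> that a weighted ray \<open>(\<mu>, prod_encode (a, q))\<close> fills are the \<open>q\<close>-th group of \<open>h \<mu> i\<close> slots of class \<open>a\<close>.\<close>

definition cov :: "nat \<times> nat \<Rightarrow> ('i \<times> nat) set" where
  "cov x = (if fst x \<in> M
     then {s\<in>S. pc (snd s) = pc (snd x) \<and> h (fst x) (fst s) \<noteq> 0 \<and> pl (snd s) div h (fst x) (fst s) = pl (snd x)}
     else {(b (fst x), snd x)})"

definition R :: "nat \<Rightarrow> nat set" where "R g = (if g \<in> M then Q g else P (b g))"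

definition G1 :: "(nat \<times> nat) set" where "G1 = Sigma (G \<union> M) R"

text \<open>The last two conditions are the traces of two greedy rules. Rays with one label run
  through the slots of their block along a staircase. A ray in \<open>M\<close> fills its groups in
  order, so the slots of a group preceding one in use have no room for other rays.\<close>

definition \<K>' :: "(nat \<times> nat) set set" where
  "\<K>' = {C. C \<subseteq> G1 \<and> fst ` C \<in> \<K>1 \<and>
     (\<forall>x\<in>C. \<forall>y\<in>C. fst x \<notin> M \<longrightarrow> fst y \<notin> M \<longrightarrow> b (fst x) = b (fst y) \<longrightarrow> fst x < fst y \<longrightarrow> snd x \<le> snd y) \<and>
     (\<forall>x\<in>C. \<forall>y\<in>C. fst x \<in> M \<longrightarrow> fst y \<notin> M \<longrightarrow> (\<forall>p\<in>Q (fst x). p < snd x \<longrightarrow> (b (fst y), snd y) \<notin> cov (fst x, p)))}"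

definition \<rho>1 :: "nat \<times> nat \<Rightarrow> nat \<Rightarrow> real" where "\<rho>1 x g = of_bool (g = fst x)"

definition cls :: "'i \<times> nat \<Rightarrow> nat" where "cls s = pc (snd s)"

definition t' :: "'i \<times> nat \<Rightarrow> real" where "t' s = (if s \<in> S then \<epsilon> (cls s) else 0)"

lemma mem_P: "p \<in> P i \<longleftrightarrow> pc p < k \<and> pl p < e (pc p) i"
  and mem_Q: "p \<in> Q \<mu> \<longleftrightarrow> pc p < k \<and> pl p < W \<mu> (pc p)"
  unfolding P_def Q_def by (force intro: rev_image_eqI[of "prod_decode p"] simp: mem_Times_iff)+

lemma disj: "G \<inter> M = {}" using GM by fastforce

lemma finP: "finite (P i)" and finQ: "finite (Q \<mu>)" by (simp_all add: P_def Q_def)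

lemma finS: "finite S" using finB finP by (simp add: S_def)

lemma finR: "finite (R g)" using finP finQ by (simp add: R_def)

lemma finG1: "finite G1" using finG finM finR by (simp add: G1_def)

lemma cG: "complex (G \<union> M) \<K>1" unfolding complex_def \<K>1_def using finG finM by auto

lemma \<K>'_mono:
  assumes "C \<in> \<K>'" "(v,p) \<in> C" "(v',p') \<in> C" "v \<notin> M" "v' \<notin> M" "b v = b v'" "v < v'"
  shows "p \<le> p'"
proof -
  have "\<forall>x\<in>C. \<forall>y\<in>C. fst x \<notin> M \<longrightarrow> fst y \<notin> M \<longrightarrow> b (fst x) = b (fst y) \<longrightarrow> fst x < fst y \<longrightarrow> snd x \<le> snd y"
    using assms(1) by (simp add: \<K>'_def)
  from bspec[OF bspec[OF this assms(2)] assms(3)] show ?thesis using assms(4-7) by simp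
qed

lemma \<K>'_layer:
  assumes "C \<in> \<K>'" "(\<mu>,q') \<in> C" "(v,p) \<in> C" "\<mu> \<in> M" "v \<notin> M" "q \<in> Q \<mu>" "q < q'"
  shows "(b v, p) \<notin> cov (\<mu>,q)"
proof -
  have "\<forall>x\<in>C. \<forall>y\<in>C. fst x \<in> M \<longrightarrow> fst y \<notin> M \<longrightarrow> (\<forall>p\<in>Q (fst x). p < snd x \<longrightarrow> (b (fst y), snd y) \<notin> cov (fst x, p))"
    using assms(1) by (simp add: \<K>'_def)
  from bspec[OF bspec[OF this assms(2)] assms(3)] show ?thesis using assms(4-7) by simp
qed

lemma complex': "complex G1 \<K>'"
  unfolding complex_def
proof (intro conjI ballI allI impI finG1)
  show "C \<subseteq> G1" if "C \<in> \<K>'" for C using that by (simp add: \<K>'_def)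
  show "C' \<in> \<K>'" if C: "C \<in> \<K>'" "C' \<subseteq> C" for C C'
  proof -
    have "fst ` C' \<in> \<K>1" by (rule complexD(3)[OF cG]) (use C in \<open>auto simp: \<K>'_def\<close>)
    then show ?thesis using C unfolding \<K>'_def by blast
  qed
qed

lemma sum_G1: "(\<Sum>x\<in>G1. f x) = (\<Sum>v\<in>G. \<Sum>p\<in>P (b v). f (v,p)) + (\<Sum>\<mu>\<in>M. \<Sum>p\<in>Q \<mu>. f (\<mu>,p))"
  for f :: "_ \<Rightarrow> real"
proof -
  have "(\<Sum>x\<in>G1. f x) = (\<Sum>g\<in>G \<union> M. \<Sum>p\<in>R g. f (g,p))"
    unfolding G1_def by (subst sum.Sigma) (use finG finM finR in auto)
  also have "\<dots> = (\<Sum>g\<in>G. \<Sum>p\<in>R g. f (g,p)) + (\<Sum>g\<in>M. \<Sum>p\<in>R g. f (g,p))"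
    by (rule sum.union_disjoint[OF finG finM disj])
  also have "(\<Sum>g\<in>G. \<Sum>p\<in>R g. f (g,p)) = (\<Sum>v\<in>G. \<Sum>p\<in>P (b v). f (v,p))"
    using disj by (intro sum.cong) (auto simp: R_def)
  also have "(\<Sum>g\<in>M. \<Sum>p\<in>R g. f (g,p)) = (\<Sum>\<mu>\<in>M. \<Sum>p\<in>Q \<mu>. f (\<mu>,p))"
    by (intro sum.cong) (auto simp: R_def)
  finally show ?thesis .
qed

lemma comb_eq:
  shows "v \<in> G \<Longrightarrow> comb G1 \<rho>1 \<alpha> v = (\<Sum>p\<in>P (b v). \<alpha> (v,p))"
    and "\<mu> \<in> M \<Longrightarrow> comb G1 \<rho>1 \<alpha> \<mu> = (\<Sum>p\<in>Q \<mu>. \<alpha> (\<mu>,p))"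
    and "g \<notin> G \<union> M \<Longrightarrow> comb G1 \<rho>1 \<alpha> g = 0"
proof -
  have *: "comb G1 \<rho>1 \<alpha> g = (\<Sum>v\<in>G. if v = g then \<Sum>p\<in>P (b v). \<alpha> (v,p) else 0) + (\<Sum>\<mu>\<in>M. if \<mu> = g then \<Sum>p\<in>Q \<mu>. \<alpha> (\<mu>,p) else 0)" for g
    unfolding comb_def sum_G1 \<rho>1_def by (intro arg_cong2[of _ _ _ _ "(+)"] sum.cong refl) auto
  show "v \<in> G \<Longrightarrow> comb G1 \<rho>1 \<alpha> v = (\<Sum>p\<in>P (b v). \<alpha> (v,p))"
    and "\<mu> \<in> M \<Longrightarrow> comb G1 \<rho>1 \<alpha> \<mu> = (\<Sum>p\<in>Q \<mu>. \<alpha> (\<mu>,p))"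
    and "g \<notin> G \<union> M \<Longrightarrow> comb G1 \<rho>1 \<alpha> g = 0"
    using disj finG finM by (auto simp: *)
qed

definition used :: "(nat \<times> nat \<Rightarrow> real) \<Rightarrow> 'i \<times> nat \<Rightarrow> real" where
  "used \<alpha> s = (\<Sum>\<mu>\<in>M. \<Sum>q\<in>Q \<mu>. \<alpha> (\<mu>,q) * of_bool (s \<in> cov (\<mu>,q)))"

definition Gb :: "'i \<Rightarrow> nat set" where "Gb i = {v\<in>G. b v = i}"

lemma finGb: "finite (Gb i)" using finG by (simp add: Gb_def)

lemma deg_eq:
  assumes "i \<in> B" "p \<in> P i"
  shows "(\<Sum>x\<in>G1. \<alpha> x * cdeg cov x (i,p)) = (\<Sum>v\<in>Gb i. \<alpha> (v,p)) + used \<alpha> (i,p)"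
proof -
  have "(\<Sum>v\<in>G. \<Sum>p'\<in>P (b v). \<alpha> (v,p') * cdeg cov (v,p') (i,p)) = (\<Sum>v\<in>G. if b v = i then \<alpha> (v,p) else 0)"
  proof (intro sum.cong refl)
    fix v assume v: "v \<in> G"
    have "(\<Sum>p'\<in>P (b v). \<alpha> (v,p') * cdeg cov (v,p') (i,p)) = (\<Sum>p'\<in>P (b v). if p' = p then (if b v = i then \<alpha> (v,p) else 0) else 0)"
      using v disj by (intro sum.cong refl) (auto simp: cdeg_def cov_def)
    then show "(\<Sum>p'\<in>P (b v). \<alpha> (v,p') * cdeg cov (v,p') (i,p)) = (if b v = i then \<alpha> (v,p) else 0)"
      using assms finP by auto
  qed
  also have "\<dots> = (\<Sum>v\<in>Gb i. \<alpha> (v,p))"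
    using finG by (simp add: sum.inter_filter[symmetric] Gb_def)
  finally show ?thesis unfolding sum_G1 used_def by (simp add: cdeg_def)
qed

lemma cov_M:
  assumes "\<mu> \<in> M"
  shows "(i,p) \<in> cov (\<mu>,q) \<longleftrightarrow> (i,p) \<in> S \<and> pc p = pc q \<and> h \<mu> i \<noteq> 0 \<and> pl p div h \<mu> i = pl q"
  using assms by (auto simp: cov_def)

lemma cov_unique:
  assumes "\<mu> \<in> M" "s \<in> cov (\<mu>,p)" "s \<in> cov (\<mu>,p')" shows "p = p'"
proof -
  have "prod_decode p = prod_decode p'" using assms by (cases s) (auto simp: cov_M prod_eq_iff)
  then show ?thesis by simp
qed

text \<open>Positions with a given quotient by \<open>h \<mu> i\<close> form an interval of length
  \<open>h \<mu> i\<close>, and \<open>W\<close> guarantees that it fits into the block. The length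
  is what makes the degrees of \<open>\<mu>\<close> come out right.\<close>

lemma cov_group:
  assumes m: "\<mu> \<in> M" and q: "q \<in> Q \<mu>" and i: "i \<in> B"
  shows "{p\<in>P i. (i,p) \<in> cov (\<mu>,q)} = (\<lambda>l. prod_encode (pc q, l)) ` {h \<mu> i * pl q ..< h \<mu> i * (pl q + 1)}"
proof -
  have a: "pc q < k" "pl q < W \<mu> (pc q)" using q by (auto simp: mem_Q)
  have bd: "l < e (pc q) i" if "l < h \<mu> i * (pl q + 1)" for l
  proof -
    have "h \<mu> i * (pl q + 1) \<le> h \<mu> i * W \<mu> (pc q)" using a(2) by (intro mult_le_mono2) simp
    then show ?thesis using W[OF m a(1) i] that by linarith
  qed
  have dv: "h \<mu> i \<noteq> 0 \<and> l div h \<mu> i = pl q \<longleftrightarrow> h \<mu> i * pl q \<le> l \<and> l < h \<mu> i * (pl q + 1)" for l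
  proof (cases "h \<mu> i = 0")
    case False
    have "l div h \<mu> i = pl q \<longleftrightarrow> h \<mu> i * pl q \<le> l \<and> l < h \<mu> i * (pl q + 1)"
    proof
      assume l: "l div h \<mu> i = pl q"
      show "h \<mu> i * pl q \<le> l \<and> l < h \<mu> i * (pl q + 1)"
        unfolding l[symmetric] using dividend_less_times_div[of "h \<mu> i" l] False by simp
    next
      assume "h \<mu> i * pl q \<le> l \<and> l < h \<mu> i * (pl q + 1)"
      then show "l div h \<mu> i = pl q" by (intro div_nat_eqI) (auto simp: mult.commute)
    qed
    then show ?thesis using False by simp
  qed auto
  show ?thesis
  proof (intro equalityI subsetI)
    fix p assume "p \<in> {p\<in>P i. (i,p) \<in> cov (\<mu>,q)}"
    then have c: "pc p = pc q" "h \<mu> i * pl q \<le> pl p \<and> pl p < h \<mu> i * (pl q + 1)"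
      using dv[of "pl p"] by (auto simp: cov_M[OF m])
    have "p = prod_encode (pc q, pl p)" unfolding c(1)[symmetric] by simp
    with c(2) show "p \<in> (\<lambda>l. prod_encode (pc q, l)) ` {h \<mu> i * pl q ..< h \<mu> i * (pl q + 1)}" by auto
  next
    fix p assume "p \<in> (\<lambda>l. prod_encode (pc q, l)) ` {h \<mu> i * pl q ..< h \<mu> i * (pl q + 1)}"
    then obtain l where l: "p = prod_encode (pc q, l)" "h \<mu> i * pl q \<le> l" "l < h \<mu> i * (pl q + 1)" by auto
    then have "p \<in> P i" using bd a by (simp add: mem_P)
    then show "p \<in> {p\<in>P i. (i,p) \<in> cov (\<mu>,q)}" using l dv[of l] i by (simp add: cov_M[OF m] S_def)
  qed
qed

lemma cov_nonempty:
  assumes "\<mu> \<in> M" "q \<in> Q \<mu>"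
  shows "\<exists>s\<in>S. s \<in> cov (\<mu>,q)"
proof -
  have "h \<mu> (i0 \<mu>) * pl q \<in> {h \<mu> (i0 \<mu>) * pl q ..< h \<mu> (i0 \<mu>) * (pl q + 1)}" using i0(2)[OF assms(1)] by simp
  then have "prod_encode (pc q, h \<mu> (i0 \<mu>) * pl q) \<in> {p'\<in>P (i0 \<mu>). (i0 \<mu>,p') \<in> cov (\<mu>,q)}"
    unfolding cov_group[OF assms i0(1)[OF assms(1)]] by blast
  then show ?thesis using i0(1)[OF assms(1)] unfolding S_def by blast
qed

lemma cov_cls: "s \<in> cov (\<mu>,p) \<Longrightarrow> \<mu> \<in> M \<Longrightarrow> s \<in> S \<and> cls s = pc p"
  by (auto simp: cov_def cls_def)

lemma used_one:
  assumes m: "\<mu> \<in> M" and q: "q \<in> Q \<mu>" and s: "s \<in> cov (\<mu>,q)"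
    and other: "\<And>\<nu> p. \<nu> \<in> M \<Longrightarrow> \<nu> \<noteq> \<mu> \<Longrightarrow> p \<in> Q \<nu> \<Longrightarrow> \<alpha> (\<nu>,p) = 0"
  shows "used \<alpha> s = \<alpha> (\<mu>,q)"
proof -
  have "used \<alpha> s = (\<Sum>\<nu>\<in>M. if \<nu> = \<mu> then (\<Sum>p\<in>Q \<mu>. \<alpha> (\<mu>,p) * of_bool (s \<in> cov (\<mu>,p))) else 0)"
    unfolding used_def using other by (intro sum.cong refl) auto
  also have "\<dots> = (\<Sum>p\<in>Q \<mu>. \<alpha> (\<mu>,p) * of_bool (s \<in> cov (\<mu>,p)))" using m finM by simp
  also have "\<dots> = (\<Sum>p\<in>Q \<mu>. if p = q then \<alpha> (\<mu>,q) else 0)"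
  proof (intro sum.cong refl)
    fix p
    show "\<alpha> (\<mu>,p) * of_bool (s \<in> cov (\<mu>,p)) = (if p = q then \<alpha> (\<mu>,q) else 0)"
      using cov_unique[OF m s, of p] s by (cases "s \<in> cov (\<mu>,p)") auto
  qed
  finally show ?thesis using q finQ by simp
qed

lemma used_single:
  assumes C: "supp \<alpha> \<in> \<K>'" and m: "\<mu> \<in> M" and q: "q \<in> Q \<mu>" and nz: "\<alpha> (\<mu>,q') \<noteq> 0" and s: "s \<in> cov (\<mu>,q)"
  shows "used \<alpha> s = \<alpha> (\<mu>,q)"
proof (rule used_one[OF m q s])
  fix \<nu> p assume n: "\<nu> \<in> M" "\<nu> \<noteq> \<mu>"
  show "\<alpha> (\<nu>,p) = 0"
  proof (rule ccontr)
    assume "\<alpha> (\<nu>,p) \<noteq> 0"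
    then have "\<nu> \<in> fst ` supp \<alpha> \<inter> M" "\<mu> \<in> fst ` supp \<alpha> \<inter> M" using nz n m by (force simp: supp_def)+
    moreover have "fst ` supp \<alpha> \<in> \<K>1" using C by (simp add: \<K>'_def)
    ultimately show False using n(2) unfolding \<K>1_def by blast
  qed
qed

text \<open>A slot of an earlier group of \<open>\<mu>\<close> is shared neither with rays of
  \<open>G\<close>, by the last condition on \<open>\<K>'\<close>, nor with other rays of
  \<open>M\<close>. So its total \<open>r s\<close> is the weight of the group. For relations
  \<open>r\<close> is \<open>0\<close>, for points it is the size of the slot.\<close>

lemma layer_full:
  assumes C: "supp \<alpha> \<in> \<K>'" and m: "\<mu> \<in> M" and q: "q \<in> Q \<mu>" and q': "\<alpha> (\<mu>,q') \<noteq> 0" "q < q'"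
    and d: "\<And>s. (\<Sum>x\<in>G1. \<alpha> x * cdeg cov x s) = r s"
  shows "\<exists>s\<in>S. cls s = pc q \<and> \<alpha> (\<mu>,q) = r s"
proof -
  obtain s where s: "s \<in> S" "s \<in> cov (\<mu>,q)" using cov_nonempty[OF m q] by blast
  obtain i p where ip: "s = (i,p)" "i \<in> B" "p \<in> P i" using s(1) by (auto simp: S_def)
  have "\<alpha> (v,p) = 0" if "v \<in> Gb i" for v
  proof (rule ccontr)
    assume "\<alpha> (v,p) \<noteq> 0"
    then have "(v,p) \<in> supp \<alpha>" "(\<mu>,q') \<in> supp \<alpha>" using q' by (auto simp: supp_def)
    moreover have "v \<notin> M" "b v = i" using that disj by (auto simp: Gb_def)
    ultimately have "(b v, p) \<notin> cov (\<mu>,q)" using \<K>'_layer[OF C _ _ m _ q q'(2)] by blast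
    then show False using s(2) ip(1) \<open>b v = i\<close> by simp
  qed
  then have "(\<Sum>v\<in>Gb i. \<alpha> (v,p)) = 0" by (intro sum.neutral) auto
  then have "used \<alpha> s = r s" using deg_eq[OF ip(2,3), of \<alpha>] d[of s] ip(1) by simp
  moreover have "used \<alpha> s = \<alpha> (\<mu>,q)" by (rule used_single[OF C m q q'(1) s(2)])
  ultimately show ?thesis using s cov_cls[OF s(2) m] by force
qed

lemma supp_mono:
  assumes C: "supp \<alpha> \<in> \<K>'"
  shows "nw_mono {(v,p)\<in>Gb i \<times> P i. \<alpha> (v,p) \<noteq> 0}"
proof -
  have "p \<le> p'" if "v \<in> Gb i" "v' \<in> Gb i" "\<alpha> (v,p) \<noteq> 0" "\<alpha> (v',p') \<noteq> 0" "v < v'" for v v' p p'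
  proof -
    have "(v,p) \<in> supp \<alpha>" "(v',p') \<in> supp \<alpha>" "v \<notin> M" "v' \<notin> M" "b v = b v'"
      using that disj by (auto simp: supp_def Gb_def)
    then show ?thesis using \<K>'_mono[OF C] that(5) by blast
  qed
  then show ?thesis unfolding nw_mono_def by auto
qed

lemma slots_unimod: "unimod G1 \<K>' (cdeg cov) \<rho>1 intvec"
  unfolding unimod_def
proof (intro ballI impI)
  fix \<alpha> assume a: "\<alpha> \<in> kern G1 (cdeg cov)" "supp \<alpha> \<in> \<K>'" "comb G1 \<rho>1 \<alpha> \<in> intvec"
  have d: "(\<Sum>x\<in>G1. \<alpha> x * cdeg cov x s) = 0" for s using a(1) unfolding kern_def by blast
  have cz: "comb G1 \<rho>1 \<alpha> g \<in> \<int>" for g using a(3) by (simp add: intvec_def)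
  \<comment> \<open>In a relation every group before a nonzero one has weight \<open>0\<close>, so
    \<open>\<mu>\<close> has at most one nonzero group, whose weight is the coordinate of the image
    at \<open>\<mu>\<close>.\<close>
  have mu: "\<alpha> (\<mu>,q) \<in> \<int>" if m: "\<mu> \<in> M" "q \<in> Q \<mu>" for \<mu> q
  proof (cases "\<alpha> (\<mu>,q) = 0")
    case False
    have "\<alpha> (\<mu>,p) = 0" if "p \<in> Q \<mu>" "p \<noteq> q" for p
    proof (rule ccontr)
      assume nz: "\<alpha> (\<mu>,p) \<noteq> 0"
      have "p < q \<or> q < p" using that(2) by auto
      then show False
        using layer_full[OF a(2) m(1) that(1) False _ d] layer_full[OF a(2) m(1) m(2) nz _ d] nz False by auto
    qed
    then have "(\<Sum>p\<in>Q \<mu>. \<alpha> (\<mu>,p)) = (\<Sum>p\<in>{q}. \<alpha> (\<mu>,p))"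
      using m finQ by (intro sum.mono_neutral_right) auto
    then show ?thesis using comb_eq(2)[OF m(1), of \<alpha>] cz[of \<mu>] by simp
  qed simp
  have v: "\<alpha> (v,p) \<in> \<int>" if "v \<in> G" "p \<in> P (b v)" for v p
  proof (rule nw_coupling_integral[where f = "\<lambda>v p. \<alpha> (v,p)", OF finGb finP _ _ supp_mono[OF a(2)]])
    show "v \<in> Gb (b v)" "p \<in> P (b v)" using that by (auto simp: Gb_def)
    show "(\<Sum>p\<in>P (b v). \<alpha> (v', p)) \<in> \<int>" if "v' \<in> Gb (b v)" for v'
      using comb_eq(1)[of v' \<alpha>] cz[of v'] that by (simp add: Gb_def)
    show "(\<Sum>v'\<in>Gb (b v). \<alpha> (v', p)) \<in> \<int>" if p: "p \<in> P (b v)" for p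
    proof -
      have "used \<alpha> (b v, p) \<in> \<int>" unfolding used_def using mu by (intro Ints_sum Ints_mult) auto
      then show ?thesis using deg_eq[OF bB[OF \<open>v \<in> G\<close>] p, of \<alpha>] d[of "(b v, p)"]
        by (metis Ints_minus add.commute minus_unique)
    qed
  qed
  have "\<alpha> x \<in> \<int>" for x
  proof (cases "x \<in> G1")
    case True
    then show ?thesis using mu v by (cases x) (auto simp: G1_def R_def split: if_splits)
  next
    case False
    then have "\<alpha> x = 0" using a(1) by (auto simp: kern_def supp_def)
    then show ?thesis by simp
  qed
  then show "\<alpha> \<in> intvec" by (simp add: intvec_def)
qed

lemma slots_filling:
  assumes a: "\<alpha> \<in> slice G1 \<K>' (cdeg cov) t'" and m: "\<mu> \<in> M"
  shows "filling (Q \<mu>) (\<lambda>p. \<epsilon> (pc p)) (\<lambda>p. \<alpha> (\<mu>,p))"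
  unfolding filling_def
proof (intro conjI ballI impI)
  note nn = sliceD(1)[OF a] and C = sliceD(2)[OF a] and d = sliceD(3)[OF a]
  show "0 \<le> \<alpha> (\<mu>,p)" for p by (rule nn)
  show "\<alpha> (\<mu>,p) \<le> \<epsilon> (pc p)" if p: "p \<in> Q \<mu>" for p
  proof -
    obtain s where s: "s \<in> S" "s \<in> cov (\<mu>,p)" using cov_nonempty[OF m p] by blast
    have x: "(\<mu>,p) \<in> G1" using m p by (auto simp: G1_def R_def)
    have "\<alpha> (\<mu>,p) * cdeg cov (\<mu>,p) s \<le> (\<Sum>x\<in>G1. \<alpha> x * cdeg cov x s)"
      by (rule member_le_sum[OF x _ finG1]) (use nn in \<open>auto simp: cdeg_def\<close>)
    then show ?thesis using d[of s] s cov_cls[OF s(2) m] by (simp add: cdeg_def t'_def)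
  qed
  show "\<alpha> (\<mu>,p) = \<epsilon> (pc p)" if "p \<in> Q \<mu>" "p' \<in> Q \<mu>" "p < p'" "\<alpha> (\<mu>,p') \<noteq> 0" for p p'
    using layer_full[OF C m that(1,4,3) d] by (auto simp: t'_def)
qed

lemma slots_unique:
  assumes a: "\<alpha> \<in> slice G1 \<K>' (cdeg cov) t'" and b: "\<beta> \<in> slice G1 \<K>' (cdeg cov) t'"
    and eq: "comb G1 \<rho>1 \<alpha> = comb G1 \<rho>1 \<beta>"
  shows "\<alpha> = \<beta>"
proof
  fix x
  have mu: "\<alpha> (\<mu>,q) = \<beta> (\<mu>,q)" if m: "\<mu> \<in> M" "q \<in> Q \<mu>" for \<mu> q
    by (rule filling_unique[OF finQ slots_filling[OF a m(1)] slots_filling[OF b m(1)] _ m(2)])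
       (use comb_eq(2)[OF m(1), of \<alpha>] comb_eq(2)[OF m(1), of \<beta>] eq in simp)
  then have us: "used \<alpha> s = used \<beta> s" for s unfolding used_def by simp
  have v: "\<alpha> (v,p) = \<beta> (v,p)" if v: "v \<in> G" "p \<in> P (b v)" for v p
  proof (rule nw_coupling_unique[where f = "\<lambda>v p. \<alpha> (v,p)" and f' = "\<lambda>v p. \<beta> (v,p)",
      OF finGb finP _ _ _ _ supp_mono[OF sliceD(2)[OF a]] supp_mono[OF sliceD(2)[OF b]]])
    show "v \<in> Gb (b v)" "p \<in> P (b v)" using that by (auto simp: Gb_def)
    show "(\<Sum>p\<in>P (b v). \<alpha> (v', p)) = (\<Sum>p\<in>P (b v). \<beta> (v', p))" if "v' \<in> Gb (b v)" for v'
      using comb_eq(1)[of v' \<alpha>] comb_eq(1)[of v' \<beta>] eq that by (simp add: Gb_def)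
    show "(\<Sum>v'\<in>Gb (b v). \<alpha> (v', p)) = (\<Sum>v'\<in>Gb (b v). \<beta> (v', p))" if p: "p \<in> P (b v)" for p
      using deg_eq[OF bB[OF v(1)] p, of \<alpha>] deg_eq[OF bB[OF v(1)] p, of \<beta>]
        sliceD(3)[OF a, of "(b v,p)"] sliceD(3)[OF b, of "(b v,p)"] us by simp
  qed (use sliceD(1)[OF a] sliceD(1)[OF b] in auto)
  show "\<alpha> x = \<beta> x"
  proof (cases "x \<in> G1")
    case True
    then show ?thesis using mu v by (cases x) (auto simp: G1_def R_def split: if_splits)
  next
    case False
    then have "\<alpha> x = 0" "\<beta> x = 0"
      using sliceD(2)[OF a] sliceD(2)[OF b] complexD(2)[OF complex'] by (auto simp: supp_def)
    then show ?thesis by simp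
  qed
qed

lemma sum_P: "(\<Sum>p\<in>P i. f p) = (\<Sum>a<k. \<Sum>l<e a i. f (prod_encode (a,l)))"
  and sum_Q: "(\<Sum>p\<in>Q \<mu>. f p) = (\<Sum>a<k. \<Sum>l<W \<mu> a. f (prod_encode (a,l)))" for f :: "nat \<Rightarrow> real"
  unfolding P_def Q_def by (simp_all add: sum.reindex[OF inj_prod_encode] sum.Sigma case_prod_beta)

lemma cov_S: "x \<in> G1 \<Longrightarrow> cov x \<subseteq> S"
  using bB disj by (auto simp: G1_def cov_def R_def S_def split: if_splits)

lemma cov_cls': "x \<in> G1 \<Longrightarrow> s \<in> cov x \<Longrightarrow> cls s = pc (snd x)"
  by (auto simp: cov_def cls_def split: if_splits)

lemma deg1_eq: "(\<Sum>g\<in>G \<union> M. z g * deg1 g i) = (\<Sum>v\<in>Gb i. z v) + (\<Sum>\<mu>\<in>M. real (h \<mu> i) * z \<mu>)"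
proof -
  have "(\<Sum>g\<in>G. z g * deg1 g i) = (\<Sum>v\<in>G. if b v = i then z v else 0)"
    using disj by (intro sum.cong) (auto simp: deg1_def)
  also have "\<dots> = (\<Sum>v\<in>Gb i. z v)" using finG by (simp add: sum.inter_filter[symmetric] Gb_def)
  finally have 1: "(\<Sum>g\<in>G. z g * deg1 g i) = (\<Sum>v\<in>Gb i. z v)" .
  have 2: "(\<Sum>g\<in>M. z g * deg1 g i) = (\<Sum>\<mu>\<in>M. real (h \<mu> i) * z \<mu>)"
    by (intro sum.cong) (auto simp: deg1_def)
  show ?thesis by (simp only: sum.union_disjoint[OF finG finM disj] 1 2)
qed

text \<open>The weight of a ray in \<open>M\<close> is distributed first, as a filling of its
  groups. The remaining capacities \<open>y\<close> of the slots are then coupled with the weights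
  of the rays in \<open>G\<close> by the north-west corner rule, one block at a time.\<close>

lemma slots_exists:
  assumes z: "z \<in> slice (G \<union> M) \<K>1 deg1 t1"
  shows "\<exists>\<alpha>\<in>slice G1 \<K>' (cdeg cov) t'. comb G1 \<rho>1 \<alpha> = z"
proof -
  have znn: "0 \<le> z g" for g using sliceD(1)[OF z] .
  have zK: "supp z \<in> \<K>1" using sliceD(2)[OF z] .
  have zd: "(\<Sum>v\<in>Gb i. z v) + (\<Sum>\<mu>\<in>M. real (h \<mu> i) * z \<mu>) = t1 i" for i
    using sliceD(3)[OF z, of i] by (simp add: deg1_eq)
  have "\<exists>\<kappa>. filling (Q \<mu>) (\<lambda>p. \<epsilon> (pc p)) \<kappa> \<and> sum \<kappa> (Q \<mu>) = z \<mu>" if m: "\<mu> \<in> M" for \<mu>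
  proof (rule filling_exists[OF finQ])
    show "0 \<le> \<epsilon> (pc p)" if "p \<in> Q \<mu>" for p using eps[of "pc p"] that by (simp add: mem_Q)
    show "0 \<le> z \<mu>" by (rule znn)
    \<comment> \<open>The groups of \<open>\<mu>\<close> exhaust the block \<open>i0 \<mu>\<close>,
      so its size gives exactly the total capacity of the groups as a bound for the weight of
      \<open>\<mu>\<close>.\<close>
    let ?i = "i0 \<mu>"
    have "real (h \<mu> ?i) * z \<mu> \<le> (\<Sum>\<nu>\<in>M. real (h \<nu> ?i) * z \<nu>)"
      using znn by (intro member_le_sum[OF m _ finM]) auto
    also have "\<dots> \<le> t1 ?i" using zd[of ?i] sum_nonneg[of "Gb ?i" z] znn by simp
    also have "\<dots> = real (h \<mu> ?i) * (\<Sum>a<k. \<epsilon> a * real (W \<mu> a))"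
      using W0[OF m] i0(1)[OF m] by (simp add: t1_def sum_distrib_left mult_ac)
    finally have "z \<mu> \<le> (\<Sum>a<k. \<epsilon> a * real (W \<mu> a))" using i0(2)[OF m] by simp
    then show "z \<mu> \<le> (\<Sum>p\<in>Q \<mu>. \<epsilon> (pc p))" by (simp add: sum_Q mult.commute)
  qed
  then have "\<forall>\<mu>\<in>M. \<exists>\<kappa>. filling (Q \<mu>) (\<lambda>p. \<epsilon> (pc p)) \<kappa> \<and> sum \<kappa> (Q \<mu>) = z \<mu>" by blast
  from bchoice[OF this] obtain \<kappa> where
    k: "\<And>\<mu>. \<mu> \<in> M \<Longrightarrow> filling (Q \<mu>) (\<lambda>p. \<epsilon> (pc p)) (\<kappa> \<mu>)" "\<And>\<mu>. \<mu> \<in> M \<Longrightarrow> sum (\<kappa> \<mu>) (Q \<mu>) = z \<mu>" by auto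
  have k_le: "0 \<le> \<kappa> \<mu> p" "\<kappa> \<mu> p \<le> \<epsilon> (pc p)" if "\<mu> \<in> M" "p \<in> Q \<mu>" for \<mu> p
    using k(1)[OF that(1)] that(2) by (auto simp: filling_def)
  have k_z: "z \<mu> \<noteq> 0" if "\<mu> \<in> M" "p \<in> Q \<mu>" "\<kappa> \<mu> p \<noteq> 0" for \<mu> p
  proof -
    have "\<kappa> \<mu> p \<le> z \<mu>" unfolding k(2)[OF that(1), symmetric]
      using k_le(1)[OF that(1)] by (intro member_le_sum[OF that(2) _ finQ]) auto
    then show ?thesis using k_le(1)[OF that(1,2)] that(3) by auto
  qed
  have other: "\<kappa> \<nu> p' = 0" if "\<mu> \<in> M" "p \<in> Q \<mu>" "\<kappa> \<mu> p \<noteq> 0" "\<nu> \<in> M" "\<nu> \<noteq> \<mu>" "p' \<in> Q \<nu>" for \<mu> \<nu> p p'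
  proof (rule ccontr)
    assume "\<kappa> \<nu> p' \<noteq> 0"
    then have "\<nu> \<in> supp z \<inter> M" "\<mu> \<in> supp z \<inter> M" using k_z that by (auto simp: supp_def)
    then show False using zK that(5) unfolding \<K>1_def by blast
  qed
  define \<kappa>' where "\<kappa>' x = \<kappa> (fst x) (snd x)" for x
  have used1: "used \<kappa>' s = \<kappa> \<mu> p" if "\<mu> \<in> M" "p \<in> Q \<mu>" "\<kappa> \<mu> p' \<noteq> 0" "p' \<in> Q \<mu>" "s \<in> cov (\<mu>,p)" for s \<mu> p p'
    using used_one[OF that(1,2,5), of \<kappa>'] other[OF that(1,4,3)] by (simp add: \<kappa>'_def)
  have used_le: "0 \<le> used \<kappa>' s \<and> used \<kappa>' s \<le> \<epsilon> (cls s)" if s: "s \<in> S" for s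
  proof (cases "used \<kappa>' s = 0")
    case True
    have "cls s < k" using s by (auto simp: S_def cls_def mem_P)
    then show ?thesis using True eps[of "cls s"] by simp
  next
    case False
    then obtain \<mu> where m: "\<mu> \<in> M" "(\<Sum>q\<in>Q \<mu>. \<kappa>' (\<mu>,q) * of_bool (s \<in> cov (\<mu>,q))) \<noteq> 0"
      unfolding used_def by (rule sum.not_neutral_contains_not_neutral)
    from m(2) obtain q where q: "q \<in> Q \<mu>" "\<kappa>' (\<mu>,q) * of_bool (s \<in> cov (\<mu>,q)) \<noteq> 0"
      by (rule sum.not_neutral_contains_not_neutral)
    have q': "\<kappa> \<mu> q \<noteq> 0" "s \<in> cov (\<mu>,q)" using q(2) by (auto simp: \<kappa>'_def)
    have "used \<kappa>' s = \<kappa> \<mu> q" by (rule used1[OF m(1) q(1) q'(1) q(1) q'(2)])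
    then show ?thesis using k_le[OF m(1) q(1)] cov_cls[OF q'(2) m(1)] by simp
  qed
  have tot: "(\<Sum>p\<in>P i. used \<kappa>' (i,p)) = (\<Sum>\<mu>\<in>M. real (h \<mu> i) * z \<mu>)" if i: "i \<in> B" for i
  proof -
    have "(\<Sum>p\<in>P i. used \<kappa>' (i,p)) = (\<Sum>\<mu>\<in>M. \<Sum>p\<in>P i. \<Sum>q\<in>Q \<mu>. \<kappa> \<mu> q * of_bool ((i,p) \<in> cov (\<mu>,q)))"
      unfolding used_def \<kappa>'_def fst_conv snd_conv by (rule sum.swap)
    also have "\<dots> = (\<Sum>\<mu>\<in>M. real (h \<mu> i) * z \<mu>)"
    proof (intro sum.cong refl)
      fix \<mu> assume m: "\<mu> \<in> M"
      have "(\<Sum>p\<in>P i. \<Sum>q\<in>Q \<mu>. \<kappa> \<mu> q * of_bool ((i,p) \<in> cov (\<mu>,q))) = (\<Sum>q\<in>Q \<mu>. \<Sum>p\<in>P i. \<kappa> \<mu> q * of_bool ((i,p) \<in> cov (\<mu>,q)))"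
        by (rule sum.swap)
      also have "\<dots> = (\<Sum>q\<in>Q \<mu>. \<kappa> \<mu> q * real (h \<mu> i))"
      proof (intro sum.cong refl)
        fix q assume q: "q \<in> Q \<mu>"
        have "card {p\<in>P i. (i,p) \<in> cov (\<mu>,q)} = h \<mu> i"
          unfolding cov_group[OF m q i] by (subst card_image) (auto intro: inj_onI)
        moreover have "(\<Sum>p\<in>P i. of_bool ((i,p) \<in> cov (\<mu>,q)) :: real) = real (card {p\<in>P i. (i,p) \<in> cov (\<mu>,q)})"
          using finP by (simp add: Int_def)
        ultimately show "(\<Sum>p\<in>P i. \<kappa> \<mu> q * of_bool ((i,p) \<in> cov (\<mu>,q))) = \<kappa> \<mu> q * real (h \<mu> i)"
          by (simp only: sum_distrib_left[symmetric])
      qed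
      also have "\<dots> = real (h \<mu> i) * z \<mu>"
        using k(2)[OF m] by (simp add: sum_distrib_right[symmetric])
      finally show "(\<Sum>p\<in>P i. \<Sum>q\<in>Q \<mu>. \<kappa> \<mu> q * of_bool ((i,p) \<in> cov (\<mu>,q))) = real (h \<mu> i) * z \<mu>" .
    qed
    finally show ?thesis .
  qed
  define y where "y i p = \<epsilon> (pc p) - used \<kappa>' (i,p)" for i p
  have "\<exists>f. (\<forall>v p. 0 \<le> f v p) \<and> (\<forall>v p. f v p \<noteq> 0 \<longrightarrow> v \<in> Gb i \<and> p \<in> P i) \<and>
    (\<forall>v\<in>Gb i. (\<Sum>p\<in>P i. f v p) = z v) \<and> (\<forall>p\<in>P i. (\<Sum>v\<in>Gb i. f v p) = y i p) \<and>
    (\<forall>v p v' p'. f v p \<noteq> 0 \<longrightarrow> f v' p' \<noteq> 0 \<longrightarrow> v < v' \<longrightarrow> p \<le> p')" if i: "i \<in> B" for i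
  proof (rule nw_coupling_exists[OF finGb finP])
    show "0 \<le> y i p" if "p \<in> P i" for p
      using used_le[of "(i,p)"] that i by (simp add: y_def S_def cls_def)
    have "(\<Sum>p\<in>P i. \<epsilon> (pc p)) = t1 i" using i by (simp add: sum_P t1_def mult.commute)
    then show "sum z (Gb i) = sum (y i) (P i)"
      using zd[of i] tot[OF i] by (simp add: y_def sum_subtractf)
  qed (rule znn)
  then have "\<forall>i\<in>B. \<exists>f. (\<forall>v p. 0 \<le> f v p) \<and> (\<forall>v p. f v p \<noteq> 0 \<longrightarrow> v \<in> Gb i \<and> p \<in> P i) \<and>
    (\<forall>v\<in>Gb i. (\<Sum>p\<in>P i. f v p) = z v) \<and> (\<forall>p\<in>P i. (\<Sum>v\<in>Gb i. f v p) = y i p) \<and>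
    (\<forall>v p v' p'. f v p \<noteq> 0 \<longrightarrow> f v' p' \<noteq> 0 \<longrightarrow> v < v' \<longrightarrow> p \<le> p')" by blast
  from bchoice[OF this] obtain f where f: "\<forall>i\<in>B. (\<forall>v p. 0 \<le> f i v p) \<and> (\<forall>v p. f i v p \<noteq> 0 \<longrightarrow> v \<in> Gb i \<and> p \<in> P i) \<and>
    (\<forall>v\<in>Gb i. (\<Sum>p\<in>P i. f i v p) = z v) \<and> (\<forall>p\<in>P i. (\<Sum>v\<in>Gb i. f i v p) = y i p) \<and>
    (\<forall>v p v' p'. f i v p \<noteq> 0 \<longrightarrow> f i v' p' \<noteq> 0 \<longrightarrow> v < v' \<longrightarrow> p \<le> p')" ..
  have f1: "0 \<le> f i v p" and f2: "f i v p \<noteq> 0 \<Longrightarrow> v \<in> Gb i \<and> p \<in> P i"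
    and f3: "v \<in> Gb i \<Longrightarrow> (\<Sum>p\<in>P i. f i v p) = z v" and f4: "p \<in> P i \<Longrightarrow> (\<Sum>v\<in>Gb i. f i v p) = y i p"
    and f5: "f i v p \<noteq> 0 \<Longrightarrow> f i v' p' \<noteq> 0 \<Longrightarrow> v < v' \<Longrightarrow> p \<le> p'"
    if "i \<in> B" for i v p v' p' using f that by auto
  define \<alpha> where "\<alpha> x = (if fst x \<in> M then if snd x \<in> Q (fst x) then \<kappa> (fst x) (snd x) else 0
    else if fst x \<in> G then f (b (fst x)) (fst x) (snd x) else 0)" for x
  have aM: "\<alpha> (\<mu>,q) = (if q \<in> Q \<mu> then \<kappa> \<mu> q else 0)" if "\<mu> \<in> M" for \<mu> q using that by (simp add: \<alpha>_def)
  have aG: "\<alpha> (v,p) = f (b v) v p" if "v \<in> G" for v p using that disj by (auto simp: \<alpha>_def)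
  have usedeq: "used \<alpha> s = used \<kappa>' s" for s
    unfolding used_def by (intro sum.cong refl) (simp add: aM \<kappa>'_def)
  have nn: "0 \<le> \<alpha> x" for x using k_le(1) f1 bB by (auto simp: \<alpha>_def)
  have zsupp: "supp z \<subseteq> G \<union> M" using complexD(2)[OF cG zK] .
  have inG1: "x \<in> G1 \<and> fst x \<in> supp z" if x: "\<alpha> x \<noteq> 0" for x
  proof -
    obtain g p where gp: "x = (g,p)" by fastforce
    show ?thesis
    proof (cases "g \<in> M")
      case True
      then have "p \<in> Q g" "\<kappa> g p \<noteq> 0" using x gp aM by (auto split: if_splits)
      then show ?thesis using True k_z[OF True] gp by (auto simp: G1_def R_def supp_def)
    next
      case False
      then have g: "g \<in> G" using x gp by (auto simp: \<alpha>_def split: if_splits)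
      then have nz: "f (b g) g p \<noteq> 0" using x gp aG by simp
      then have p: "g \<in> Gb (b g)" "p \<in> P (b g)" using f2[OF bB[OF g]] by auto
      have "f (b g) g p \<le> (\<Sum>p\<in>P (b g). f (b g) g p)"
        by (rule member_le_sum[OF p(2) _ finP]) (use f1[OF bB[OF g]] in auto)
      then have "z g \<noteq> 0" using f3[OF bB[OF g] p(1)] nz f1[OF bB[OF g], of g p] by auto
      then show ?thesis using p g False gp by (auto simp: G1_def R_def supp_def)
    qed
  qed
  have cz: "comb G1 \<rho>1 \<alpha> = z"
  proof
    fix g
    consider "g \<in> G" | "g \<in> M" | "g \<notin> G \<union> M" by blast
    then show "comb G1 \<rho>1 \<alpha> g = z g"
    proof cases
      case 1
      then show ?thesis using comb_eq(1)[OF 1, of \<alpha>] f3[OF bB[OF 1], of g] aG by (simp add: Gb_def)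
    next
      case 2
      then show ?thesis using comb_eq(2)[OF 2, of \<alpha>] k(2)[OF 2] aM by simp
    next
      case 3
      then have "g \<notin> supp z" using zsupp by blast
      then show ?thesis using comb_eq(3)[OF 3, of \<alpha>] by (simp add: supp_def)
    qed
  qed
  have supp': "supp \<alpha> \<in> \<K>'"
    unfolding \<K>'_def
  proof (intro CollectI conjI ballI impI)
    show "supp \<alpha> \<subseteq> G1" using inG1 by (auto simp: supp_def)
    show "fst ` supp \<alpha> \<in> \<K>1"
      by (rule complexD(3)[OF cG zK]) (use inG1 in \<open>auto simp: supp_def\<close>)
  next
    fix x x' assume x: "x \<in> supp \<alpha>" "x' \<in> supp \<alpha>" "fst x \<notin> M" "fst x' \<notin> M" "b (fst x) = b (fst x')" "fst x < fst x'"
    obtain v p v' p' where vp: "x = (v,p)" "x' = (v',p')" by fastforce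
    have g: "v \<in> G" "v' \<in> G" using inG1[of x] inG1[of x'] x vp zsupp by (auto simp: supp_def)
    have "f (b v) v p \<noteq> 0" "f (b v) v' p' \<noteq> 0" using x g vp aG by (auto simp: supp_def)
    then show "snd x \<le> snd x'" using f5[OF bB[OF g(1)], of v p v' p'] x vp by simp
  next
    fix x x' p assume x: "x \<in> supp \<alpha>" "x' \<in> supp \<alpha>" "fst x \<in> M" "fst x' \<notin> M" "p \<in> Q (fst x)" "p < snd x"
    obtain \<mu> q v r where vp: "x = (\<mu>,q)" "x' = (v,r)" by fastforce
    have m: "\<mu> \<in> M" "q \<in> Q \<mu>" "\<kappa> \<mu> q \<noteq> 0" "p \<in> Q \<mu>" "p < q"
      using x vp aM by (auto simp: supp_def split: if_splits)
    have g: "v \<in> G" using inG1[of x'] x vp zsupp by (auto simp: supp_def)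
    then have nz: "f (b v) v r \<noteq> 0" using x vp aG by (auto simp: supp_def)
    then have r: "v \<in> Gb (b v)" "r \<in> P (b v)" using f2[OF bB[OF g]] by auto
    show "(b (fst x'), snd x') \<notin> cov (fst x, p)"
    proof
      assume "(b (fst x'), snd x') \<in> cov (fst x, p)"
      then have c: "(b v, r) \<in> cov (\<mu>,p)" using vp by simp
      have "used \<kappa>' (b v, r) = \<kappa> \<mu> p" by (rule used1[OF m(1,4,3,2) c])
      also have "\<dots> = \<epsilon> (pc p)" using k(1)[OF m(1)] m unfolding filling_def by blast
      also have "pc p = pc r" using cov_cls[OF c m(1)] by (simp add: cls_def)
      finally have "y (b v) r = 0" by (simp add: y_def)
      then have "(\<Sum>v'\<in>Gb (b v). f (b v) v' r) = 0" using f4[OF bB[OF g] r(2)] by simp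
      moreover have "f (b v) v r \<le> (\<Sum>v'\<in>Gb (b v). f (b v) v' r)"
        by (rule member_le_sum[OF r(1) _ finGb]) (use f1[OF bB[OF g]] in auto)
      ultimately show False using nz f1[OF bB[OF g], of v r] by simp
    qed
  qed
  have "\<alpha> \<in> slice G1 \<K>' (cdeg cov) t'"
    unfolding slice_def
  proof (intro CollectI conjI allI)
    fix s :: "'i \<times> nat"
    show "(\<Sum>x\<in>G1. \<alpha> x * cdeg cov x s) = t' s"
    proof (cases "s \<in> S")
      case True
      then obtain i p where ip: "s = (i,p)" "i \<in> B" "p \<in> P i" by (auto simp: S_def)
      have "(\<Sum>v\<in>Gb i. \<alpha> (v,p)) = (\<Sum>v\<in>Gb i. f i v p)"
        using aG by (intro sum.cong) (auto simp: Gb_def)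
      then show ?thesis using deg_eq[OF ip(2,3), of \<alpha>] f4[OF ip(2,3)] ip True usedeq
        by (simp add: y_def t'_def cls_def)
    next
      case False
      then have "(\<Sum>x\<in>G1. \<alpha> x * cdeg cov x s) = 0"
        using cov_S by (intro sum.neutral) (auto simp: cdeg_def)
      then show ?thesis using False by (simp add: t'_def)
    qed
  qed (use nn supp' in auto)
  then show ?thesis using cz by blast
qed

lemma slots_subdiv: "subdiv (G \<union> M) \<K>1 deg1 t1 G1 \<K>' (cdeg cov) t' \<rho>1"
proof (rule subdivI_deg[where B = S and E = "\<lambda>s i. of_bool (fst s = i)", OF _ complex'])
  show "finite (G \<union> M)" using finG finM by simp
  show "0 \<le> \<rho>1 g x \<and> \<rho>1 g x \<in> \<rat>" for g x by (simp add: \<rho>1_def)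
  have sr: "supp (\<rho>1 x) = {fst x}" for x by (auto simp: supp_def \<rho>1_def)
  show "supp (\<rho>1 g) \<subseteq> G \<union> M" if "g \<in> G1" for g using that by (auto simp: sr G1_def)
  show "(\<Union>g\<in>K. supp (\<rho>1 g)) \<in> \<K>1" if "K \<in> \<K>'" for K
  proof -
    have "(\<Union>g\<in>K. supp (\<rho>1 g)) = fst ` K" by (auto simp: sr)
    then show ?thesis using that by (simp add: \<K>'_def)
  qed
  have sS: "(\<Sum>s\<in>S. f s * of_bool (fst s = i)) = (if i \<in> B then \<Sum>p\<in>P i. f (i,p) else 0)" for f :: "_ \<Rightarrow> real" and i
  proof -
    have "(\<Sum>s\<in>S. f s * of_bool (fst s = i)) = (\<Sum>i'\<in>B. \<Sum>p\<in>P i'. f (i',p) * of_bool (i' = i))"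
      unfolding S_def by (subst sum.Sigma) (use finB finP in \<open>auto simp: case_prod_beta\<close>)
    also have "\<dots> = (\<Sum>i'\<in>B. if i' = i then \<Sum>p\<in>P i. f (i,p) else 0)" by (intro sum.cong refl) auto
    finally show ?thesis using finB by simp
  qed
  show "t1 i = (\<Sum>s\<in>S. t' s * of_bool (fst s = i))" for i
  proof -
    have "(\<Sum>p\<in>P i. t' (i,p)) = (\<Sum>p\<in>P i. \<epsilon> (pc p))" if "i \<in> B"
      using that by (intro sum.cong) (auto simp: t'_def S_def cls_def)
    then show ?thesis unfolding sS by (simp add: t1_def sum_P mult.commute)
  qed
  show "(\<Sum>g\<in>G \<union> M. \<rho>1 x g * deg1 g i) = (\<Sum>s\<in>S. cdeg cov x s * of_bool (fst s = i))" if x: "x \<in> G1" for x i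
  proof -
    obtain g p where gp: "x = (g,p)" by fastforce
    have gGM: "g \<in> G \<union> M" "p \<in> R g" using x gp by (auto simp: G1_def)
    have "(\<Sum>g\<in>G \<union> M. \<rho>1 x g * deg1 g i) = (\<Sum>g'\<in>G \<union> M. if g' = g then deg1 g i else 0)"
      by (intro sum.cong) (auto simp: \<rho>1_def gp)
    also have "\<dots> = deg1 g i" using gGM finG finM by simp
    also have "\<dots> = (if i \<in> B then \<Sum>p'\<in>P i. cdeg cov x (i,p') else 0)"
    proof (cases "g \<in> M")
      case True
      have q: "p \<in> Q g" using gGM True by (simp add: R_def)
      show ?thesis
      proof (cases "i \<in> B")
        case i: True
        have "(\<Sum>p'\<in>P i. cdeg cov x (i,p')) = real (card {p'\<in>P i. (i,p') \<in> cov (g,p)})"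
          using finP by (simp add: cdeg_def gp Int_def)
        also have "\<dots> = real (h g i)"
          unfolding cov_group[OF True q i] by (subst card_image) (auto intro: inj_onI)
        finally show ?thesis using True i by (simp add: deg1_def)
      next
        case False
        then show ?thesis using True hB[OF True, of i] by (auto simp: deg1_def)
      qed
    next
      case False
      then have g: "g \<in> G" "p \<in> P (b g)" using gGM by (auto simp: R_def)
      have "(\<Sum>p'\<in>P i. cdeg cov x (i,p')) = (\<Sum>p'\<in>P i. if p' = p then of_bool (b g = i) else 0)"
        using False by (intro sum.cong) (auto simp: cdeg_def cov_def gp)
      then show ?thesis using False g finP bB[OF g(1)] by (auto simp: deg1_def)
    qed
    also have "\<dots> = (\<Sum>s\<in>S. cdeg cov x s * of_bool (fst s = i))" by (rule sS[symmetric])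
    finally show ?thesis .
  qed
qed (rule slots_exists, assumption, rule slots_unique)

text \<open>Only a ray of \<open>M\<close> can cover two slots, a cell involves at most one of them,
  and it comes after all rays of \<open>G\<close>. This is the hypothesis \<open>top\<close> of
  merging, once the pairs are numbered lexicographically.\<close>

lemma slots_top:
  assumes C: "C \<in> \<K>'" and g: "g \<in> C" and s: "s \<in> cov g" "s' \<in> cov g" "s \<noteq> s'" and x: "x \<in> C" "s \<in> cov x"
  shows "x = g \<or> fst x < fst g"
proof -
  have gM: "fst g \<in> M" using s by (auto simp: cov_def split: if_splits)
  have sub: "C \<subseteq> G1" and f1: "fst ` C \<in> \<K>1" using C by (auto simp: \<K>'_def)
  show ?thesis
  proof (cases "fst x \<in> M")
    case True
    then have "fst x = fst g" using f1 g x gM unfolding \<K>1_def by blast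
    then have "x = g" using cov_unique[OF gM, of s "snd g" "snd x"] s(1) x(2) by (metis prod.collapse)
    then show ?thesis by simp
  next
    case False
    then have "fst x \<in> G" using sub x(1) by (auto simp: G1_def)
    then show ?thesis using GM gM by blast
  qed
qed

end

section \<open>Renumbering of rays; splitting followed by merging\<close>

lemma relabel_comb:
  assumes "inj_on f G'"
  shows "comb (f ` G') (\<lambda>x. \<rho> (inv_into G' f x)) \<beta> = comb G' \<rho> (\<lambda>g. if g \<in> G' then \<beta> (f g) else 0)"
proof
  fix h
  show "comb (f ` G') (\<lambda>x. \<rho> (inv_into G' f x)) \<beta> h = comb G' \<rho> (\<lambda>g. if g \<in> G' then \<beta> (f g) else 0) h"
    unfolding comb_def sum.reindex[OF assms] comp_def
    by (intro sum.cong refl) (simp add: inv_into_f_f[OF assms])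
qed

lemma relabel_deg:
  assumes "inj_on f G'"
  shows "(\<Sum>x\<in>f ` G'. \<beta> x * deg' (inv_into G' f x) s) = (\<Sum>g\<in>G'. (if g \<in> G' then \<beta> (f g) else 0) * (deg' g s :: real))"
  unfolding sum.reindex[OF assms] comp_def
  by (intro sum.cong refl) (simp add: inv_into_f_f[OF assms])

lemma relabel_supp:
  assumes "inj_on f G'" "C \<subseteq> G'" "supp \<beta> = f ` C"
  shows "supp (\<lambda>g. if g \<in> G' then \<beta> (f g) else 0) = C"
proof -
  have "\<beta> (f g) \<noteq> 0 \<longleftrightarrow> g \<in> C" if "g \<in> G'" for g
  proof -
    have "\<beta> (f g) \<noteq> 0 \<longleftrightarrow> f g \<in> f ` C" using assms(3) by (auto simp: supp_def)
    then show ?thesis using inj_on_image_mem_iff[OF assms(1) that assms(2)] by simp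
  qed
  then show ?thesis using assms(2) by (auto simp: supp_def split: if_splits)
qed

lemma relabel_kern:
  assumes "inj_on f G'" "\<beta> \<in> kern (f ` G') (\<lambda>x. deg' (inv_into G' f x))"
  shows "(\<lambda>g. if g \<in> G' then \<beta> (f g) else 0) \<in> kern G' deg'"
  using assms(2) unfolding kern_def relabel_deg[OF assms(1)] by (auto simp: supp_def split: if_splits)

lemma subdiv_relabel:
  assumes s: "subdiv G \<K> deg t G' \<K>' deg' t' \<rho>" and f: "inj_on f G'"
  shows "subdiv G \<K> deg t (f ` G') ((`) f ` \<K>') (\<lambda>x. deg' (inv_into G' f x)) t' (\<lambda>x. \<rho> (inv_into G' f x))"
proof -
  define i where "i = inv_into G' f"
  have c': "complex G' \<K>'" by (rule subdivD(1)[OF s])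
  have i: "i (f g) = g" if "g \<in> G'" for g using inv_into_f_f[OF f that] by (simp add: i_def)
  have iG: "i x \<in> G'" if "x \<in> f ` G'" for x using i that by auto
  define pull where "pull \<beta> = (\<lambda>g. if g \<in> G' then \<beta> (f g) else 0 :: real)" for \<beta>
  note combp = relabel_comb[OF f, of \<rho>, folded i_def pull_def]
  have slp: "pull \<beta> \<in> slice G' \<K>' deg' t'" if b: "\<beta> \<in> slice (f ` G') ((`) f ` \<K>') (\<lambda>x. deg' (i x)) t'" for \<beta>
  proof -
    obtain C where C: "C \<in> \<K>'" "supp \<beta> = f ` C" using sliceD(2)[OF b] by blast
    have "supp (pull \<beta>) = C" unfolding pull_def by (rule relabel_supp[OF f complexD(2)[OF c' C(1)] C(2)])
    moreover have "(\<Sum>g\<in>G'. pull \<beta> g * deg' g s) = t' s" for s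
      using sliceD(3)[OF b, of s] relabel_deg[OF f, of \<beta> deg' s] by (simp add: pull_def i_def)
    ultimately show ?thesis using sliceD(1)[OF b] C(1) by (simp add: slice_def pull_def)
  qed
  show ?thesis
    unfolding subdiv_def i_def[symmetric]
  proof (intro conjI ballI allI)
    show "complex (f ` G') ((`) f ` \<K>')"
      unfolding complex_def
    proof (intro conjI ballI allI impI)
      show "finite (f ` G')" using c' by (simp add: complex_def)
      show "C \<subseteq> f ` G'" if "C \<in> (`) f ` \<K>'" for C using that complexD(2)[OF c'] by blast
      fix C C' assume C: "C \<in> (`) f ` \<K>'" "C' \<subseteq> C"
      then obtain D where D: "D \<in> \<K>'" "C = f ` D" by blast
      then obtain D' where D': "D' \<subseteq> D" "C' = f ` D'" using C(2) by (auto simp: subset_image_iff)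
      have "D' \<in> \<K>'" by (rule complexD(3)[OF c' D(1) D'(1)])
      then show "C' \<in> (`) f ` \<K>'" using D'(2) by blast
    qed
    show "0 \<le> \<rho> (i x) h" "\<rho> (i x) h \<in> \<rat>" "supp (\<rho> (i x)) \<subseteq> G" if "x \<in> f ` G'" for x h
      using subdivD(2-4)[OF s iG[OF that]] by auto
    show "(\<Union>x\<in>C. supp (\<rho> (i x))) \<in> \<K>" if CK: "C \<in> (`) f ` \<K>'" for C
    proof -
      obtain D where D: "D \<in> \<K>'" "C = f ` D" using CK by blast
      have "(\<Union>x\<in>C. supp (\<rho> (i x))) = (\<Union>g\<in>D. supp (\<rho> g))"
        using complexD(2)[OF c' D(1)] i unfolding D(2) by (simp add: subset_iff)
      then show ?thesis using subdivD(5)[OF s D(1)] by simp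
    qed
    show "comb (f ` G') (\<lambda>x. \<rho> (i x)) \<beta> \<in> kern G deg" if "\<beta> \<in> kern (f ` G') (\<lambda>x. deg' (i x))" for \<beta>
      unfolding combp using that relabel_kern[OF f, of \<beta> deg'] by (intro subdivD(6)[OF s]) (simp add: pull_def i_def)
    show "comb (f ` G') (\<lambda>x. \<rho> (i x)) \<beta> \<in> slice G \<K> deg t" if "\<beta> \<in> slice (f ` G') ((`) f ` \<K>') (\<lambda>x. deg' (i x)) t'" for \<beta>
      unfolding combp by (rule subdivD(7)[OF s slp[OF that]])
    fix z assume z: "z \<in> slice G \<K> deg t"
    obtain \<alpha> where a: "\<alpha> \<in> slice G' \<K>' deg' t'" "comb G' \<rho> \<alpha> = z"
      and u: "\<forall>\<beta>. \<beta> \<in> slice G' \<K>' deg' t' \<longrightarrow> comb G' \<rho> \<beta> = z \<longrightarrow> \<beta> = \<alpha>" by (rule subdivE[OF s z])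
    define \<beta> where "\<beta> x = (if x \<in> f ` G' then \<alpha> (i x) else 0)" for x
    have suppa: "supp \<alpha> \<subseteq> G'" by (rule complexD(2)[OF c' sliceD(2)[OF a(1)]])
    have pb: "pull \<beta> = \<alpha>"
      using suppa i by (auto simp: pull_def \<beta>_def supp_def fun_eq_iff)
    have sb: "supp \<beta> = f ` supp \<alpha>"
    proof (intro equalityI subsetI)
      fix x assume "x \<in> supp \<beta>"
      then have x: "x \<in> f ` G'" "\<alpha> (i x) \<noteq> 0" by (auto simp: supp_def \<beta>_def split: if_splits)
      then obtain g where "g \<in> G'" "x = f g" by blast
      then show "x \<in> f ` supp \<alpha>" using x(2) i by (auto simp: supp_def)
    next
      fix x assume "x \<in> f ` supp \<alpha>"
      then obtain g where g: "g \<in> supp \<alpha>" "x = f g" by blast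
      then have "g \<in> G'" using suppa by blast
      then show "x \<in> supp \<beta>" using g i by (auto simp: supp_def \<beta>_def)
    qed
    have "(\<Sum>x\<in>f ` G'. \<beta> x * deg' (i x) s) = (\<Sum>g\<in>G'. pull \<beta> g * deg' g s)" for s
      unfolding pull_def i_def by (rule relabel_deg[OF f])
    then have "(\<Sum>x\<in>f ` G'. \<beta> x * deg' (i x) s) = t' s" for s
      using sliceD(3)[OF a(1), of s] by (simp add: pb)
    then have bs: "\<beta> \<in> slice (f ` G') ((`) f ` \<K>') (\<lambda>x. deg' (i x)) t'"
      using sb sliceD(1,2)[OF a(1)] by (simp add: slice_def \<beta>_def)
    show "\<exists>!\<beta>. \<beta> \<in> slice (f ` G') ((`) f ` \<K>') (\<lambda>x. deg' (i x)) t' \<and> comb (f ` G') (\<lambda>x. \<rho> (i x)) \<beta> = z"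
    proof (rule ex1I[of _ \<beta>])
      show "\<beta> \<in> slice (f ` G') ((`) f ` \<K>') (\<lambda>x. deg' (i x)) t' \<and> comb (f ` G') (\<lambda>x. \<rho> (i x)) \<beta> = z"
        unfolding combp pb using bs a(2) by (intro conjI)
      fix \<gamma> assume g: "\<gamma> \<in> slice (f ` G') ((`) f ` \<K>') (\<lambda>x. deg' (i x)) t' \<and> comb (f ` G') (\<lambda>x. \<rho> (i x)) \<gamma> = z"
      have "pull \<gamma> = \<alpha>"
        by (rule u[rule_format, OF slp[OF conjunct1[OF g]]]) (use g in \<open>simp add: combp\<close>)
      then have on: "\<gamma> (f x) = \<alpha> x" if "x \<in> G'" for x using that by (auto simp: pull_def fun_eq_iff split: if_splits)
      have "supp \<gamma> \<subseteq> f ` G'" using sliceD(2)[OF conjunct1[OF g]] complexD(2)[OF c'] by blast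
      then show "\<gamma> = \<beta>" using on i by (auto simp: \<beta>_def supp_def fun_eq_iff)
    qed
  qed
qed

lemma unimod_relabel:
  assumes u: "unimod G' \<K>' deg' \<rho> L" and c': "complex G' \<K>'" and f: "inj_on f G'"
  shows "unimod (f ` G') ((`) f ` \<K>') (\<lambda>x. deg' (inv_into G' f x)) (\<lambda>x. \<rho> (inv_into G' f x)) L"
  unfolding unimod_def
proof (intro ballI impI)
  fix \<beta> assume b: "\<beta> \<in> kern (f ` G') (\<lambda>x. deg' (inv_into G' f x))" "supp \<beta> \<in> (`) f ` \<K>'"
    "comb (f ` G') (\<lambda>x. \<rho> (inv_into G' f x)) \<beta> \<in> L"
  let ?p = "\<lambda>g. if g \<in> G' then \<beta> (f g) else 0"
  obtain C where C: "C \<in> \<K>'" "supp \<beta> = f ` C" using b(2) by blast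
  have "supp ?p = C" by (rule relabel_supp[OF f complexD(2)[OF c' C(1)] C(2)])
  then have "?p \<in> intvec"
    using u relabel_kern[OF f b(1)] C(1) b(3) unfolding unimod_def relabel_comb[OF f] by blast
  then have "\<beta> x \<in> \<int>" if "x \<in> f ` G'" for x using that by (auto simp: intvec_def split: if_splits)
  moreover have "\<beta> x = 0" if "x \<notin> f ` G'" for x using b(1) that by (auto simp: kern_def supp_def)
  ultimately have "\<beta> x \<in> \<int>" for x by (cases "x \<in> f ` G'") auto
  then show "\<beta> \<in> intvec" by (simp add: intvec_def)
qed

lemma common_denominator:
  assumes "finite X" "X \<subseteq> \<rat>"
  shows "\<exists>N::nat. 0 < N \<and> (\<forall>x\<in>X. real N * x \<in> \<int>)"
  using assms
proof (induction X rule: finite_induct)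
  case (insert x X)
  then obtain N where N: "0 < N" "\<forall>x\<in>X. real N * x \<in> \<int>" by auto
  obtain p q :: int where pq: "q > 0" "x = of_int p / of_int q"
    using insert.prems by (auto elim!: Rats_cases')
  have "real (N * nat q) * y \<in> \<int>" if "y \<in> insert x X" for y
  proof (cases "y = x")
    case True
    have "real (N * nat q) * y = of_int (int N * p)" using pq True by (simp add: field_simps)
    then show ?thesis by (metis Ints_of_int)
  next
    case False
    then have Ny: "real N * y \<in> \<int>" using that N by auto
    have "real (N * nat q) * y = real (nat q) * (real N * y)" by simp
    also have "\<dots> \<in> \<int>" by (rule Ints_mult[OF Ints_of_nat Ny])
    finally show ?thesis .
  qed
  then show ?case using N(1) pq(1) by (intro exI[of _ "N * nat q"]) auto
qed (auto intro: exI[of _ 1])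

lemma (in slots) fold_exists:
  assumes ne: "\<And>i. i \<in> B \<Longrightarrow> \<exists>v\<in>G. b v = i"
  shows "\<exists>(G'::nat set) \<K>'' (b'::nat \<Rightarrow> nat) t'' \<rho>. subdiv (G \<union> M) \<K>1 deg1 t1 G' \<K>'' (udeg b') t'' \<rho> \<and>
    unimod G' \<K>'' (udeg b') \<rho> intvec \<and> (\<forall>g\<in>G'. \<forall>x. \<rho> g x \<in> \<int>) \<and>
    (\<forall>g\<in>G'. b' g < k \<and> t'' (b' g) = \<epsilon> (b' g)) \<and> (\<forall>a. a \<notin> b' ` G' \<longrightarrow> t'' a = 0)"
proof -
  define N where "N = Suc (Max (insert 0 (snd ` G1)))"
  have N: "p < N" if "(g,p) \<in> G1" for g p
    unfolding N_def less_Suc_eq_le using that finG1 by (intro Max_ge) force+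
  \<comment> \<open>Lexicographic numbering: \<open>N\<close> exceeds all slot numbers, so the order
    of the first components is preserved, as \<open>slots_top\<close> requires.\<close>
  define f where "f x = fst x * N + snd x" for x :: "nat \<times> nat"
  have fless: "f x < f y" if "fst x < fst y" "x \<in> G1" for x y
  proof -
    have "fst x * N + snd x < (fst x + 1) * N" using N[of "fst x" "snd x"] that by simp
    also have "\<dots> \<le> fst y * N" using that(1) by (intro mult_le_mono1) simp
    finally show ?thesis by (simp add: f_def)
  qed
  have finj: "inj_on f G1"
  proof (rule inj_onI)
    fix x y assume xy: "x \<in> G1" "y \<in> G1" "f x = f y"
    then have "fst x = fst y" using fless[of x y] fless[of y x] by (metis linorder_neqE_nat nat_less_le)
    then show "x = y" using xy(3) by (simp add: f_def prod_eq_iff)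
  qed
  define i where "i = inv_into G1 f"
  have i: "i (f x) = x" if "x \<in> G1" for x using inv_into_f_f[OF finj that] by (simp add: i_def)
  note s1 = subdiv_relabel[OF slots_subdiv finj, folded i_def]
  note u1 = unimod_relabel[OF slots_unimod complex' finj, folded i_def]
  interpret m: merge "f ` G1" "(`) f ` \<K>'" "\<lambda>x. cov (i x)" cls S "{..<k}" \<epsilon>
  proof
    show "complex (f ` G1) ((`) f ` \<K>')" by (rule subdivD(1)[OF s1])
    show "finite S" by (rule finS)
    show "cov (i g) \<subseteq> S" "cov (i g) \<noteq> {}" if gG: "g \<in> f ` G1" for g
    proof -
      obtain x where x: "x \<in> G1" "g = f x" using gG by blast
      show "cov (i g) \<subseteq> S" using cov_S x i by simp
      show "cov (i g) \<noteq> {}"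
      proof (cases "fst x \<in> M")
        case True
        then have "snd x \<in> Q (fst x)" using x(1) by (auto simp: G1_def R_def)
        then show ?thesis using cov_nonempty[OF True, of "snd x"] x i by auto
      qed (use x i in \<open>simp add: cov_def\<close>)
    qed
    show "cls s = cls s'" if "g \<in> f ` G1" "s \<in> cov (i g)" "s' \<in> cov (i g)" for g s s'
      using that cov_cls' i by (metis (no_types, lifting) imageE)
    show "cls s \<in> {..<k}" if "s \<in> S" for s using that by (auto simp: S_def cls_def mem_P)
    show "h' \<le> g" if C: "C \<in> (`) f ` \<K>'" "g \<in> C" "s \<in> cov (i g)" "s' \<in> cov (i g)" "s \<noteq> s'" "h' \<in> C" "s \<in> cov (i h')"
      for C g s s' h'
    proof -
      obtain D where D: "D \<in> \<K>'" "C = f ` D" using C(1) by blast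
      obtain x y where xy: "g = f x" "h' = f y" "x \<in> D" "y \<in> D" using C(2,6) D by blast
      have G: "x \<in> G1" "y \<in> G1" using xy complexD(2)[OF complex' D(1)] by auto
      have "y = x \<or> fst y < fst x"
        by (rule slots_top[OF D(1) xy(3) _ _ that(5) xy(4)]) (use that xy i G in auto)
      then show ?thesis using fless[of y x] G xy by auto
    qed
    show "0 \<le> \<epsilon> a" if "a \<in> {..<k}" for a using eps that by (simp add: less_imp_le)
  qed simp
  have cd: "(\<lambda>x. cdeg cov (i x)) = cdeg (\<lambda>x. cov (i x))" by (simp add: cdeg_def fun_eq_iff)
  have tt: "m.t1 = t'" by (simp add: m.t1_def t'_def fun_eq_iff)
  note s2 = subdiv_trans[OF s1[unfolded cd] m.merge_subdiv[unfolded tt]]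
  note u2 = unimod_trans[OF m.merge_subdiv[unfolded tt] u1[unfolded cd] m.merge_unimod subdivD(1)[OF s1]]
  define r where "r g = comb (f ` G1) (\<lambda>x. \<rho>1 (i x)) (m.\<rho>2 g)" for g
  obtain F :: "_ \<Rightarrow> nat" where F: "inj_on F m.G2" using finite_imp_inj_to_nat_seg[OF m.finG2] by blast
  define I where "I = inv_into m.G2 F"
  have I: "I x \<in> m.G2" if "x \<in> F ` m.G2" for x using inv_into_into[OF that] by (simp add: I_def)
  have IF: "I (F x) = x" if "x \<in> m.G2" for x using inv_into_f_f[OF F that] by (simp add: I_def)
  note s3 = subdiv_relabel[OF s2 F, folded I_def r_def]
  note u3 = unimod_relabel[OF u2 m.complex2 F, folded I_def r_def]
  have ud: "(\<lambda>x. udeg fst (I x)) = udeg (\<lambda>x. fst (I x))" by (simp add: udeg_def fun_eq_iff)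
  \<comment> \<open>Assigning to each slot a ray with the label of its block gives a cover of class
    \<open>a\<close>. So each class occurs as a label, and the new sizes vanish off the labels in
    use.\<close>
  have cls_ray: "\<exists>x\<in>m.G2. fst x = a" if a: "a < k" for a
  proof -
    define v where "v i = (SOME v. v \<in> G \<and> b v = i)" for i
    have v: "v i \<in> G \<and> b (v i) = i" if "i \<in> B" for i unfolding v_def by (rule someI_ex) (use ne[OF that] in blast)
    define J where "J = restrict (\<lambda>s. f (v (fst s), snd s)) (m.Sl a)"
    have sl: "(v (fst s), snd s) \<in> G1 \<and> cov (v (fst s), snd s) = {s}" if sS: "s \<in> m.Sl a" for s
    proof -
      obtain j p where s: "s = (j,p)" "j \<in> B" "p \<in> P j" using sS unfolding m.Sl_def by (auto simp: S_def)
      have "v j \<notin> M" using v[OF s(2)] disj by auto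
      then show ?thesis using v[OF s(2)] s by (auto simp: G1_def R_def cov_def)
    qed
    have "J \<in> m.Cov a"
      unfolding m.Cov_def
    proof (intro CollectI conjI ballI)
      have J: "J s = f (v (fst s), snd s)" if "s \<in> m.Sl a" for s using that by (simp add: J_def)
      have iJ: "cov (i (J s)) = {s}" if "s \<in> m.Sl a" for s using sl[OF that] i by (simp add: J[OF that])
      show "J \<in> PiE (m.Sl a) (\<lambda>s. {g \<in> f ` G1. s \<in> cov (i g)})"
        unfolding PiE_iff
      proof (intro conjI ballI)
        show "J s \<in> {g \<in> f ` G1. s \<in> cov (i g)}" if "s \<in> m.Sl a" for s
          using sl[OF that] iJ[OF that] J[OF that] by simp
      qed (simp add: J_def)
      show "J s' = J s" if "s \<in> m.Sl a" "s' \<in> cov (i (J s))" for s s'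
        using that(2) iJ[OF that(1)] by simp
    qed
    then show ?thesis using a by (intro bexI[of _ "(a,J)"]) (auto simp: m.G2_def)
  qed
  show ?thesis
  proof (intro exI conjI)
    show "subdiv (G \<union> M) \<K>1 deg1 t1 (F ` m.G2) ((`) F ` m.\<K>2) (udeg (\<lambda>x. fst (I x))) m.t2 (\<lambda>x. r (I x))"
      using s3 unfolding ud .
    show "unimod (F ` m.G2) ((`) F ` m.\<K>2) (udeg (\<lambda>x. fst (I x))) (\<lambda>x. r (I x)) intvec"
      using u3 unfolding ud .
    show "\<forall>g\<in>F ` m.G2. \<forall>x. r (I g) x \<in> \<int>"
      unfolding r_def comb_def by (intro ballI allI Ints_sum Ints_mult) (auto simp: m.\<rho>2_def \<rho>1_def)
    show "\<forall>g\<in>F ` m.G2. fst (I g) < k \<and> m.t2 (fst (I g)) = \<epsilon> (fst (I g))"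
      using I by (force simp: m.G2_def m.t2_def)
    show "\<forall>a. a \<notin> (\<lambda>x. fst (I x)) ` F ` m.G2 \<longrightarrow> m.t2 a = 0"
    proof (intro allI impI)
      fix a assume a: "a \<notin> (\<lambda>x. fst (I x)) ` F ` m.G2"
      have "\<not> a < k"
      proof
        assume "a < k"
        then obtain x where "x \<in> m.G2" "fst x = a" using cls_ray by blast
        then have "a = fst (I (F x))" "F x \<in> F ` m.G2" using IF by simp_all
        then show False using a by blast
      qed
      then show "m.t2 a = 0" by (simp add: m.t2_def)
    qed
  qed
qed

text \<open>The weight of \<open>\<mu>\<close> is limited by the label minimising
  \<open>t i / h \<mu> i\<close>, which is taken as \<open>i0 \<mu>\<close>. The new decomposition
  of \<open>t\<close> is made to keep this minimum on every generator \<open>e a\<close>, through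
  the functionals \<open>g2\<close>, besides nonnegativity, through \<open>g1\<close>. So the same
  label is the bottleneck in all classes.\<close>

lemma weighted_fold:
  fixes G M :: "nat set" and b :: "nat \<Rightarrow> nat" and h :: "nat \<Rightarrow> nat \<Rightarrow> nat" and t :: "nat \<Rightarrow> real"
  assumes V: "rat_subspace V" and finG: "finite G" and finM: "finite M"
    and GM: "\<And>g \<mu>. g \<in> G \<Longrightarrow> \<mu> \<in> M \<Longrightarrow> g < \<mu>"
    and h: "\<And>\<mu> i. \<mu> \<in> M \<Longrightarrow> h \<mu> i \<noteq> 0 \<Longrightarrow> i \<in> b ` G" "\<And>\<mu>. \<mu> \<in> M \<Longrightarrow> \<exists>i. h \<mu> i \<noteq> 0"
    and t: "\<And>i. t i \<in> V" "\<And>i. 0 \<le> t i" "\<And>i. i \<notin> b ` G \<Longrightarrow> t i = 0"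
  shows "\<exists>(G'::nat set) \<K>' (b'::nat \<Rightarrow> nat) t' \<rho>.
    subdiv (G \<union> M) {C. C \<subseteq> G \<union> M \<and> (\<forall>\<mu>\<in>C \<inter> M. \<forall>\<nu>\<in>C \<inter> M. \<mu> = \<nu>)}
      (\<lambda>g i. if g \<in> M then real (h g i) else of_bool (b g = i)) t G' \<K>' (udeg b') t' \<rho> \<and>
    unimod G' \<K>' (udeg b') \<rho> intvec \<and> (\<forall>g\<in>G'. \<forall>x. \<rho> g x \<in> \<int>) \<and>
    (\<forall>g\<in>G'. 0 < t' (b' g) \<and> t' (b' g) \<in> V) \<and> (\<forall>a. a \<notin> b' ` G' \<longrightarrow> t' a = 0)"
proof -
  define B where "B = b ` G"
  have finB: "finite B" using finG by (simp add: B_def)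
  have "\<exists>i. i \<in> B \<and> 0 < h \<mu> i \<and> (\<forall>j\<in>B. 0 < h \<mu> j \<longrightarrow> t i / h \<mu> i \<le> t j / h \<mu> j)" if m: "\<mu> \<in> M" for \<mu>
  proof -
    have "finite {i\<in>B. 0 < h \<mu> i}" "{i\<in>B. 0 < h \<mu> i} \<noteq> {}" using finB h(1)[OF m] h(2)[OF m] by (auto simp: B_def)
    from ex_is_arg_min_if_finite[OF this, of "\<lambda>i. t i / h \<mu> i"]
    show ?thesis by (force simp: is_arg_min_linorder)
  qed
  then have "\<forall>\<mu>\<in>M. \<exists>i. i \<in> B \<and> 0 < h \<mu> i \<and> (\<forall>j\<in>B. 0 < h \<mu> j \<longrightarrow> t i / h \<mu> i \<le> t j / h \<mu> j)" by blast
  from bchoice[OF this] obtain i0 where i0: "\<And>\<mu>. \<mu> \<in> M \<Longrightarrow> i0 \<mu> \<in> B" "\<And>\<mu>. \<mu> \<in> M \<Longrightarrow> 0 < h \<mu> (i0 \<mu>)"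
    "\<And>\<mu> j. \<mu> \<in> M \<Longrightarrow> j \<in> B \<Longrightarrow> 0 < h \<mu> j \<Longrightarrow> t (i0 \<mu>) / h \<mu> (i0 \<mu>) \<le> t j / h \<mu> j" by auto
  define g1 where "g1 i x = (x i :: real)" for i :: nat and x
  define g2 where "g2 p x = real (h (fst p) (i0 (fst p))) * x (snd p) - real (h (fst p) (snd p)) * (x (i0 (fst p)) :: real)" for p :: "nat \<times> nat" and x
  have "\<exists>(k::nat) \<epsilon> e. (\<forall>a<k. 0 < \<epsilon> a \<and> \<epsilon> a \<in> V \<and> (\<forall>i. e a i \<in> \<rat>) \<and> (\<forall>i. i \<notin> B \<longrightarrow> e a i = 0) \<and>
      (\<forall>g\<in>g1 ` B \<union> g2 ` (M \<times> B). 0 \<le> g (e a))) \<and> (\<forall>i. t i = (\<Sum>a<k. \<epsilon> a * e a i))"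
  proof (rule positive_decomposition[OF V finB t(1)])
    show "t i = 0" if "i \<notin> B" for i using t(3) that by (simp add: B_def)
    show "finite (g1 ` B \<union> g2 ` (M \<times> B))" using finB finM by simp
    show "fun_linear g" if "g \<in> g1 ` B \<union> g2 ` (M \<times> B)" for g
      using that by (auto simp: fun_linear_def g1_def[abs_def] g2_def[abs_def] algebra_simps)
    show "g e \<in> \<rat>" if "g \<in> g1 ` B \<union> g2 ` (M \<times> B)" "\<And>i. e i \<in> \<rat>" for g e
      using that by (auto simp: g1_def g2_def)
    show "0 \<le> g t" if g: "g \<in> g1 ` B \<union> g2 ` (M \<times> B)" for g
    proof -
      have "0 \<le> g2 (\<mu>,j) t" if m: "\<mu> \<in> M" "j \<in> B" for \<mu> j
      proof (cases "0 < h \<mu> j")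
        case True
        then show ?thesis using i0(3)[OF m True] i0(2)[OF m(1)] by (simp add: g2_def field_simps)
      qed (use t(2) in \<open>simp add: g2_def\<close>)
      then show ?thesis using g t(2) by (auto simp: g1_def)
    qed
  qed
  then obtain k :: nat and \<epsilon>0 e0 where dec0: "\<forall>a<k. 0 < \<epsilon>0 a \<and> \<epsilon>0 a \<in> V \<and> (\<forall>i. e0 a i \<in> \<rat>) \<and> (\<forall>i. i \<notin> B \<longrightarrow> e0 a i = 0) \<and>
      (\<forall>g\<in>g1 ` B \<union> g2 ` (M \<times> B). 0 \<le> g (e0 a))" "\<forall>i. t i = (\<Sum>a<k. \<epsilon>0 a * e0 a i)" by (elim exE conjE)
  have dec: "\<And>a. a < k \<Longrightarrow> 0 < \<epsilon>0 a" "\<And>a. a < k \<Longrightarrow> \<epsilon>0 a \<in> V"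
    "\<And>a i. a < k \<Longrightarrow> e0 a i \<in> \<rat>" "\<And>a i. a < k \<Longrightarrow> i \<in> B \<Longrightarrow> 0 \<le> g1 i (e0 a)"
    "\<And>a \<mu> i. a < k \<Longrightarrow> \<mu> \<in> M \<Longrightarrow> i \<in> B \<Longrightarrow> 0 \<le> g2 (\<mu>,i) (e0 a)" "\<And>i. t i = (\<Sum>a<k. \<epsilon>0 a * e0 a i)"
    using dec0 by (auto simp: ball_Un)
  obtain N where N: "0 < N" "\<And>a i. a < k \<Longrightarrow> i \<in> B \<Longrightarrow> real N * e0 a i \<in> \<int>"
    using common_denominator[of "(\<lambda>(a,i). e0 a i) ` ({..<k} \<times> B)"] finB dec(3) by (auto simp: image_subset_iff)
  \<comment> \<open>\<open>N\<close> clears denominators, and the factor \<open>H\<close> makes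
    \<open>e a (i0 \<mu>)\<close> divisible by \<open>h \<mu> (i0 \<mu>)\<close>, so that the
    limiting block splits into complete groups. Both factors are compensated in
    \<open>\<epsilon>\<close>.\<close>
  define H where "H = (\<Prod>\<mu>\<in>M. h \<mu> (i0 \<mu>))"
  have Hpos: "0 < H" unfolding H_def using i0(2) by (intro prod_pos) auto
  have Hd: "h \<mu> (i0 \<mu>) dvd H" if "\<mu> \<in> M" for \<mu> unfolding H_def using that finM by (intro dvd_prodI)
  define e where "e a i = H * nat \<lfloor>real N * e0 a i\<rfloor>" for a i
  have e: "real (e a i) = real H * real N * e0 a i" if "a < k" "i \<in> B" for a i
  proof -
    have "0 \<le> real N * e0 a i" using dec(4)[OF that] by (simp add: g1_def)
    moreover have "real_of_int \<lfloor>real N * e0 a i\<rfloor> = real N * e0 a i" using N(2)[OF that] by (simp add: of_int_floor)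
    ultimately show ?thesis by (simp add: e_def)
  qed
  define \<epsilon> where "\<epsilon> a = \<epsilon>0 a / (real H * real N)" for a
  define W where "W \<mu> a = e a (i0 \<mu>) div h \<mu> (i0 \<mu>)" for \<mu> a
  have W0: "e a (i0 \<mu>) = h \<mu> (i0 \<mu>) * W \<mu> a" if "\<mu> \<in> M" for \<mu> a
    unfolding W_def using Hd[OF that] by (simp add: e_def)
  have W: "h \<mu> i * W \<mu> a \<le> e a i" if m: "\<mu> \<in> M" "a < k" "i \<in> B" for \<mu> a i
  proof -
    have "real (h \<mu> i) * e0 a (i0 \<mu>) \<le> real (h \<mu> (i0 \<mu>)) * e0 a i"
      using dec(5)[OF m(2,1,3)] by (simp add: g2_def)
    then have "real H * real N * (real (h \<mu> i) * e0 a (i0 \<mu>)) \<le> real H * real N * (real (h \<mu> (i0 \<mu>)) * e0 a i)"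
      by (rule mult_left_mono) simp
    then have "real (h \<mu> i) * real (e a (i0 \<mu>)) \<le> real (h \<mu> (i0 \<mu>)) * real (e a i)"
      using e[OF m(2,3)] e[OF m(2) i0(1)[OF m(1)]] by (simp add: mult_ac)
    then have "h \<mu> i * e a (i0 \<mu>) \<le> h \<mu> (i0 \<mu>) * e a i" by (metis of_nat_le_iff of_nat_mult)
    then have "h \<mu> (i0 \<mu>) * (h \<mu> i * W \<mu> a) \<le> h \<mu> (i0 \<mu>) * e a i" using W0[OF m(1), of a] by (simp add: mult_ac)
    then show ?thesis using i0(2)[OF m(1)] by simp
  qed
  interpret slots G M b h B k \<epsilon> e W i0
    by unfold_locales (use finG finM GM finB h i0 W0 W dec(1) Hpos N(1) in \<open>auto simp: B_def \<epsilon>_def\<close>)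
  have t1: "t1 = t"
  proof
    fix i
    have "(\<Sum>a<k. \<epsilon> a * real (e a i)) = (\<Sum>a<k. \<epsilon>0 a * e0 a i)" if "i \<in> B"
      using e[OF _ that] Hpos N(1) by (intro sum.cong) (auto simp: \<epsilon>_def)
    then show "t1 i = t i" using dec(6)[of i] t(3)[folded B_def, of i] by (simp add: t1_def)
  qed
  have d1: "deg1 = (\<lambda>g i. if g \<in> M then real (h g i) else of_bool (b g = i))" by (simp add: deg1_def fun_eq_iff)
  have eV: "\<epsilon> a \<in> V" if "a < k" for a
    using rat_subspace_scale[OF V, of "1 / (real H * real N)" "\<epsilon>0 a"] dec(2)[OF that] by (simp add: \<epsilon>_def)
  have "\<exists>v\<in>G. b v = i" if "i \<in> B" for i using that by (auto simp: B_def)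
  from fold_exists[OF this]
  obtain G' :: "nat set" and \<K>'' and b' :: "nat \<Rightarrow> nat" and t'' \<rho> where
    s: "subdiv (G \<union> M) \<K>1 deg1 t1 G' \<K>'' (udeg b') t'' \<rho>" and u: "unimod G' \<K>'' (udeg b') \<rho> intvec" "\<forall>g\<in>G'. \<forall>x. \<rho> g x \<in> \<int>"
    and bt: "\<forall>g\<in>G'. b' g < k \<and> t'' (b' g) = \<epsilon> (b' g)" "\<forall>a. a \<notin> b' ` G' \<longrightarrow> t'' a = 0" by blast
  have "\<forall>g\<in>G'. 0 < t'' (b' g) \<and> t'' (b' g) \<in> V" using bt(1) eV eps by auto
  then show ?thesis using s[unfolded t1 d1 \<K>1_def] u bt(2) by blast
qed

section \<open>Star subdivision\<close>

definition zmod :: "('r \<Rightarrow> real) set \<Rightarrow> bool" where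
  "zmod L \<longleftrightarrow> (\<lambda>_. 0) \<in> L \<and> (\<forall>x\<in>L. \<forall>y\<in>L. \<forall>c::int. (\<lambda>g. x g + of_int c * y g) \<in> L)"

lemma zmod_add_mult: "zmod L \<Longrightarrow> x \<in> L \<Longrightarrow> y \<in> L \<Longrightarrow> (\<lambda>g. x g + of_int c * y g) \<in> L"
  by (simp add: zmod_def)

lemma zmod_zero: "zmod L \<Longrightarrow> (\<lambda>_. 0) \<in> L"
  by (simp add: zmod_def)

lemma zmod_lin:
  assumes "zmod L" "x \<in> L" "y \<in> L"
  shows "(\<lambda>g. of_int a * x g + of_int c * y g) \<in> L"
proof -
  have "(\<lambda>g. 0 + of_int a * x g) \<in> L" using zmod_add_mult[OF assms(1) zmod_zero[OF assms(1)] assms(2)] .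
  then have "(\<lambda>g. of_int a * x g) \<in> L" by simp
  from zmod_add_mult[OF assms(1) this assms(3)] show ?thesis .
qed

lemma zmod_sum:
  assumes "zmod L" "\<And>i. i \<in> I \<Longrightarrow> a i \<in> \<int>" "\<And>i. i \<in> I \<Longrightarrow> x i \<in> L"
  shows "(\<lambda>g. \<Sum>i\<in>I. a i * x i g) \<in> L"
  using assms(2,3)
proof (induction I rule: infinite_finite_induct)
  case (insert i I)
  obtain c :: int where "a i = of_int c" using insert.prems(1)[of i] by (auto elim: Ints_cases)
  then show ?case using zmod_add_mult[OF assms(1) insert.IH, of "x i" c] insert by (simp add: add.commute)
qed (use zmod_zero[OF assms(1)] in auto)

definition adjoin :: "('r \<Rightarrow> real) set \<Rightarrow> ('r \<Rightarrow> real) \<Rightarrow> ('r \<Rightarrow> real) set" where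
  "adjoin L m = {\<lambda>g. of_int z * m g + x g | x z. x \<in> L}"

lemma adjoinI: "x \<in> L \<Longrightarrow> (\<lambda>g. of_int z * m g + x g) \<in> adjoin L m"
  by (auto simp: adjoin_def)

lemma adjoinE:
  assumes "u \<in> adjoin L m"
  obtains z x where "x \<in> L" "u = (\<lambda>g. of_int z * m g + x g)"
  using assms by (auto simp: adjoin_def)

lemma zmod_adjoin:
  assumes "zmod L" shows "zmod (adjoin L m)"
  unfolding zmod_def
proof (intro conjI ballI allI)
  show "(\<lambda>_. 0) \<in> adjoin L m" using adjoinI[OF zmod_zero[OF assms], of 0 m] by simp
  fix u v and c :: int assume uv: "u \<in> adjoin L m" "v \<in> adjoin L m"
  obtain z x where u1: "x \<in> L" "u = (\<lambda>g. of_int z * m g + x g)" by (rule adjoinE[OF uv(1)])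
  obtain z' x' where u2: "x' \<in> L" "v = (\<lambda>g. of_int z' * m g + x' g)" by (rule adjoinE[OF uv(2)])
  note u = u1 u2
  have "(\<lambda>g. u g + of_int c * v g) = (\<lambda>g. of_int (z + c * z') * m g + (x g + of_int c * x' g))"
    by (simp add: u fun_eq_iff algebra_simps)
  then show "(\<lambda>g. u g + of_int c * v g) \<in> adjoin L m"
    using adjoinI[OF zmod_add_mult[OF assms u(1,3), of c], of "z + c * z'" m] by simp
qed

lemma adjoin_mono: "L \<subseteq> adjoin L m"
  using adjoinI[of _ L 0 m] by auto

lemma intvec_lin:
  assumes "x \<in> intvec" "y \<in> intvec" "a \<in> \<int>" "c \<in> \<int>" shows "(\<lambda>g. a * x g + c * y g) \<in> intvec"
  using assms by (auto simp: intvec_def)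

lemma comb_sum: "comb G \<rho> (\<lambda>g. \<Sum>i\<in>I. a i * x i g) h = (\<Sum>i\<in>I. a i * comb G \<rho> (x i) h)"
proof -
  have "comb G \<rho> (\<lambda>g. \<Sum>i\<in>I. a i * x i g) h = (\<Sum>g\<in>G. \<Sum>i\<in>I. a i * (x i g * \<rho> g h))"
    by (simp add: comb_def sum_distrib_right mult.assoc)
  also have "\<dots> = (\<Sum>i\<in>I. \<Sum>g\<in>G. a i * (x i g * \<rho> g h))" by (rule sum.swap)
  finally show ?thesis by (simp add: comb_def sum_distrib_left)
qed

definition bdegree :: "nat set \<Rightarrow> (nat \<Rightarrow> nat) \<Rightarrow> (nat \<Rightarrow> real) \<Rightarrow> nat \<Rightarrow> real" where
  "bdegree G b x a = (\<Sum>g\<in>G. x g * udeg b g a)"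

lemma bdegree_add: "bdegree G b (\<lambda>g. \<alpha> g + \<beta> g) a = bdegree G b \<alpha> a + bdegree G b \<beta> a"
  and bdegree_diff: "bdegree G b (\<lambda>g. \<alpha> g - \<beta> g) a = bdegree G b \<alpha> a - bdegree G b \<beta> a"
  by (simp_all add: bdegree_def algebra_simps sum.distrib sum_subtractf)

lemma kern_udeg_iff: "x \<in> kern G (udeg b) \<longleftrightarrow> supp x \<subseteq> G \<and> (\<forall>a. bdegree G b x a = 0)"
  by (simp add: kern_def bdegree_def)

lemma bdegree_int: "x \<in> intvec \<Longrightarrow> bdegree G b x a \<in> \<int>"
  unfolding bdegree_def by (intro Ints_sum Ints_mult) (auto simp: intvec_def udeg_def)

lemma bdegree_nonneg: "(\<And>g. 0 \<le> x g) \<Longrightarrow> 0 \<le> bdegree G b x a"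
  unfolding bdegree_def by (intro sum_nonneg) (auto simp: udeg_def)

lemma bdegree_nonzero:
  assumes "bdegree G b x a \<noteq> 0" shows "\<exists>g\<in>supp x. b g = a"
proof -
  obtain g where "g \<in> G" "x g * udeg b g a \<noteq> 0"
    using assms unfolding bdegree_def by (rule sum.not_neutral_contains_not_neutral)
  then show ?thesis by (auto simp: supp_def udeg_def)
qed

text \<open>The whole degree \<open>D a\<close> is put on one chosen ray with label
  \<open>a\<close>; this gives integrality and the bound at once.\<close>

lemma integral_representative:
  assumes finG: "finite G" and D: "\<And>a. D a \<in> \<int>" "\<And>a. D a \<noteq> 0 \<Longrightarrow> \<exists>g\<in>K. b g = a" and K: "K \<subseteq> G"
  shows "\<exists>y\<in>intvec. supp y \<subseteq> K \<and> (\<forall>a. bdegree G b y a = D a) \<and> (\<forall>g. \<bar>y g\<bar> \<le> \<bar>D (b g)\<bar>)"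
proof -
  define rep where "rep a = (SOME g. g \<in> K \<and> b g = a)" for a
  have rep: "rep a \<in> K \<and> b (rep a) = a" if "D a \<noteq> 0" for a
    unfolding rep_def by (rule someI_ex) (use D(2)[OF that] in blast)
  define y where "y g = (if g = rep (b g) then D (b g) else 0)" for g
  have "bdegree G b y a = D a" for a
  proof -
    have "bdegree G b y a = (\<Sum>g\<in>G. if g = rep a then (if b g = a then D a else 0) else 0)"
      unfolding bdegree_def by (intro sum.cong) (auto simp: y_def udeg_def)
    also have "\<dots> = (if rep a \<in> G \<and> b (rep a) = a then D a else 0)" using finG by auto
    also have "\<dots> = D a" using rep[of a] K by auto
    finally show ?thesis .
  qed
  moreover have "supp y \<subseteq> K" using rep by (force simp: supp_def y_def split: if_splits)
  ultimately show ?thesis using D(1) by (intro bexI[of _ y]) (auto simp: intvec_def y_def)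
qed

text \<open>Star subdivision of an \<open>L\<close>-unimodular complex at the points of the coset \<open>m + L\<close>: every cell has at
  most one face that contains such a point \<open>c\<close> (given by its coordinates on the cell, reduced modulo 1)
  in its relative interior.\<close>

locale star =
  fixes G :: "nat set" and \<K> :: "nat set set" and b :: "nat \<Rightarrow> nat" and \<rho> :: "nat \<Rightarrow> 'r \<Rightarrow> real"
    and L :: "('r \<Rightarrow> real) set" and m :: "'r \<Rightarrow> real" and d :: nat
  assumes cG: "complex G \<K>" and unim: "unimod G \<K> (udeg b) \<rho> L" and integ: "integral_on G (udeg b) \<rho> L"
    and L: "zmod L" and d: "2 \<le> d" and dm: "(\<lambda>g. real d * m g) \<in> L"
begin

lemma finG: "finite G" using cG by (simp add: complex_def)

abbreviation degree :: "(nat \<Rightarrow> real) \<Rightarrow> nat \<Rightarrow> real" where "degree \<equiv> bdegree G b"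

lemmas degree_diff = bdegree_diff[of G b] and kern_iff = kern_udeg_iff[of _ G b] and degree_int = bdegree_int[of _ G b]
  and degree_nonneg = bdegree_nonneg[of _ G b] and degree_nonzero = bdegree_nonzero[of G b] and degree_def = bdegree_def[of G b]

text \<open>The analogue of a Waterman point in semistable reduction. The vector \<open>c\<close> is
  not itself a relation, as its degrees are only integers; \<open>y\<close> is an integral vector on
  the same face with the same degrees, which corrects this.\<close>

definition wp :: "(nat \<Rightarrow> real) \<Rightarrow> (nat \<Rightarrow> real) \<Rightarrow> bool" where
  "wp c y \<longleftrightarrow> supp c \<in> \<K> \<and> supp c \<noteq> {} \<and> (\<forall>g. 0 \<le> c g \<and> c g < 1) \<and> y \<in> intvec \<and> supp y \<subseteq> supp c \<and>
     (\<lambda>g. c g - y g) \<in> kern G (udeg b) \<and> (\<lambda>h. comb G \<rho> (\<lambda>g. c g - y g) h - m h) \<in> L"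

lemma unimD: "x \<in> kern G (udeg b) \<Longrightarrow> supp x \<in> \<K> \<Longrightarrow> comb G \<rho> x \<in> L \<Longrightarrow> x \<in> intvec"
  using unim by (simp add: unimod_def)

lemma integD: "x \<in> kern G (udeg b) \<Longrightarrow> x \<in> intvec \<Longrightarrow> comb G \<rho> x \<in> L"
  using integ by (simp add: integral_on_def)

lemma kern_diff: "x \<in> kern G (udeg b) \<Longrightarrow> y \<in> kern G (udeg b) \<Longrightarrow> (\<lambda>g. x g - y g) \<in> kern G (udeg b)"
  using kern_lin[of x G "udeg b" y 1 "-1"] by simp

lemma comb_diff: "comb G \<rho> (\<lambda>g. x g - y g) h = comb G \<rho> x h - comb G \<rho> y h"
  using comb_lin[of G \<rho> 1 x "-1" y] by simp

lemma comb_scale: "comb G \<rho> (\<lambda>g. c * x g) h = c * comb G \<rho> x h"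
  using comb_lin[of G \<rho> c x 0 x] by simp

lemma wpD:
  assumes "wp c y"
  shows "supp c \<in> \<K>" "supp c \<noteq> {}" "0 \<le> c g" "c g < 1" "y \<in> intvec" "supp y \<subseteq> supp c"
    "(\<lambda>g. c g - y g) \<in> kern G (udeg b)" "(\<lambda>h. comb G \<rho> (\<lambda>g. c g - y g) h - m h) \<in> L"
  using assms by (simp_all add: wp_def)

text \<open>The difference of the two corrected vectors is a relation on the cell with image in
  \<open>L\<close>, hence integral by unimodularity. So \<open>c - c'\<close> is integral, with all
  coordinates of absolute value below \<open>1\<close>.\<close>

lemma wp_unique:
  assumes c: "wp c y" and c': "wp c' y'" and K: "supp c \<subseteq> K" "supp c' \<subseteq> K" "K \<in> \<K>"
  shows "c = c'"
proof -
  let ?x = "\<lambda>g. (c g - y g) - (c' g - y' g)"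
  have 1: "?x \<in> kern G (udeg b)" by (rule kern_diff[OF wpD(7)[OF c] wpD(7)[OF c']])
  have "supp ?x \<subseteq> K"
  proof
    fix g assume "g \<in> supp ?x"
    then have "g \<in> supp c \<or> g \<in> supp y \<or> g \<in> supp c' \<or> g \<in> supp y'" by (auto simp: supp_def)
    then show "g \<in> K" using c c' K by (auto simp: wp_def)
  qed
  then have 2: "supp ?x \<in> \<K>" using complexD(3)[OF cG K(3)] by blast
  have "comb G \<rho> ?x = (\<lambda>h. (comb G \<rho> (\<lambda>g. c g - y g) h - m h) + of_int (-1) * (comb G \<rho> (\<lambda>g. c' g - y' g) h - m h))"
    by (simp add: comb_diff fun_eq_iff)
  also have "\<dots> \<in> L" by (rule zmod_add_mult[OF L wpD(8)[OF c] wpD(8)[OF c']])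
  finally have "?x \<in> intvec" using unimD[OF 1 2] by blast
  then have "c g - c' g \<in> \<int>" for g
  proof -
    have "?x g \<in> \<int>" "y g \<in> \<int>" "y' g \<in> \<int>" using \<open>?x \<in> intvec\<close> wpD(5)[OF c] wpD(5)[OF c'] by (simp_all add: intvec_def)
    from Ints_add[OF this(1) Ints_diff[OF this(2,3)]] show ?thesis by simp
  qed
  moreover have "\<bar>c g - c' g\<bar> < 1" for g
  proof -
    have "0 \<le> c g" "c g < 1" "0 \<le> c' g" "c' g < 1" using c c' by (auto simp: wp_def)
    then show ?thesis by linarith
  qed
  ultimately have "c g - c' g = 0" for g using Ints_nonzero_abs_less1 by blast
  then show ?thesis by (simp add: fun_eq_iff)
qed

text \<open>Take the fractional parts of \<open>\<alpha>\<close>. After correction of the degrees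
  they differ from \<open>\<alpha>\<close> by an integral relation, whose image is in
  \<open>L\<close> by \<open>integ\<close>; they do not all vanish because \<open>\<alpha>\<close>
  is not integral.\<close>

lemma wp_exists:
  assumes a: "\<alpha> \<in> kern G (udeg b)" "supp \<alpha> \<in> \<K>" "(\<lambda>h. comb G \<rho> \<alpha> h - m h) \<in> L" "\<alpha> \<notin> intvec"
  shows "\<exists>c y. wp c y \<and> supp c \<subseteq> supp \<alpha>"
proof -
  define c where "c g = frac (\<alpha> g)" for g
  define n where "n g = real_of_int \<lfloor>\<alpha> g\<rfloor>" for g
  have cn: "c g = \<alpha> g - n g" for g by (simp add: c_def n_def frac_def)
  have sc: "supp c \<subseteq> supp \<alpha>" by (auto simp: supp_def c_def)
  have cK: "supp c \<in> \<K>" by (rule complexD(3)[OF cG a(2) sc])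
  have cG': "supp c \<subseteq> G" by (rule complexD(2)[OF cG cK])
  have ni: "n \<in> intvec" by (simp add: intvec_def n_def)
  have dc: "degree c a = - degree n a" for a
    using a(1) degree_diff[of \<alpha> n a] by (simp add: kern_iff cn[abs_def])
  have "\<exists>y\<in>intvec. supp y \<subseteq> supp c \<and> (\<forall>a. degree y a = degree c a) \<and> (\<forall>g. \<bar>y g\<bar> \<le> \<bar>degree c (b g)\<bar>)"
    by (rule integral_representative[OF finG _ degree_nonzero cG']) (use dc degree_int[OF ni] in auto)
  then obtain y where y: "y \<in> intvec" "supp y \<subseteq> supp c" "\<And>a. degree y a = degree c a" by blast
  have k: "(\<lambda>g. c g - y g) \<in> kern G (udeg b)"
  proof -
    have "supp (\<lambda>g. c g - y g) \<subseteq> supp c \<union> supp y" by (auto simp: supp_def)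
    then show ?thesis using y cG' by (auto simp: kern_iff degree_diff)
  qed
  let ?e = "\<lambda>g. \<alpha> g - (c g - y g)"
  have e: "?e = (\<lambda>g. 1 * n g + 1 * y g)" by (simp add: cn fun_eq_iff)
  have "?e \<in> intvec" unfolding e by (rule intvec_lin[OF ni y(1)]) auto
  then have "comb G \<rho> ?e \<in> L" by (intro integD kern_diff a(1) k)
  then have "(\<lambda>h. (comb G \<rho> \<alpha> h - m h) + of_int (-1) * comb G \<rho> ?e h) \<in> L"
    by (intro zmod_add_mult[OF L a(3)])
  then have "(\<lambda>h. comb G \<rho> (\<lambda>g. c g - y g) h - m h) \<in> L" by (simp add: comb_diff)
  moreover have "supp c \<noteq> {}" using a(4) by (auto simp: supp_def c_def intvec_def)
  moreover have "0 \<le> c g \<and> c g < 1" for g by (simp add: c_def frac_lt_1)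
  ultimately have "wp c y" unfolding wp_def using cK y k by blast
  then show ?thesis using sc by blast
qed

text \<open>As \<open>d * m\<close> lies in \<open>L\<close>, the \<open>d\<close>-fold of
  \<open>c - y\<close> is a relation on the cell with image in \<open>L\<close>, so unimodularity
  applies.\<close>

lemma wp_denominator:
  assumes c: "wp c y" shows "real d * c g \<in> \<int>"
proof -
  let ?x = "\<lambda>g. real d * (c g - y g)"
  have k: "(\<lambda>g. c g - y g) \<in> kern G (udeg b)" using c by (simp add: wp_def)
  have 1: "?x \<in> kern G (udeg b)" using kern_lin[OF k k, of "real d" 0] by simp
  have "supp ?x \<subseteq> supp c" using c by (auto simp: wp_def supp_def)
  then have 2: "supp ?x \<in> \<K>" using complexD(3)[OF cG] c by (auto simp: wp_def)
  have "comb G \<rho> ?x = (\<lambda>h. real d * m h + of_int (int d) * (comb G \<rho> (\<lambda>g. c g - y g) h - m h))"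
    unfolding fun_eq_iff comb_scale by (simp add: right_diff_distrib)
  also have "\<dots> \<in> L" by (rule zmod_add_mult[OF L dm wpD(8)[OF c]])
  finally have "?x \<in> intvec" by (rule unimD[OF 1 2])
  then have "?x g \<in> \<int>" "y g \<in> \<int>" using wpD(5)[OF c] by (simp_all add: intvec_def)
  from Ints_add[OF this(1) Ints_mult[OF Ints_of_nat this(2), of d]] show ?thesis by (simp add: right_diff_distrib)
qed

definition centres :: "(nat \<Rightarrow> real) set" where "centres = {c. \<exists>y. wp c y}"

lemma finite_centres: "finite centres"
proof (rule finite_imageD)
  have "supp ` centres \<subseteq> Pow G" using complexD(2)[OF cG] by (auto simp: centres_def wp_def)
  then show "finite (supp ` centres)" using finG finite_subset by blast
  show "inj_on supp centres"
  proof (rule inj_onI)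
    fix c c' assume "c \<in> centres" "c' \<in> centres" "supp c = supp c'"
    then show "c = c'" using wp_unique[of c _ c' _ "supp c"] by (auto simp: centres_def wp_def)
  qed
qed

text \<open>Centres are numbered beyond all rays in \<open>G\<close>, since the splitting into slots
  wants them to come last.\<close>

definition off :: nat where "off = Suc (Max (insert 0 G))"

definition idx :: "(nat \<Rightarrow> real) \<Rightarrow> nat" where
  "idx = (SOME \<phi>. inj_on \<phi> centres \<and> (\<forall>c. off \<le> \<phi> c))"

lemma idx: "inj_on idx centres" "off \<le> idx c"
proof -
  obtain \<phi> :: "_ \<Rightarrow> nat" where "inj_on \<phi> centres" using finite_imp_inj_to_nat_seg[OF finite_centres] by blast
  then have "inj_on (\<lambda>c. off + \<phi> c) centres \<and> (\<forall>c. off \<le> off + \<phi> c)" by (auto simp: inj_on_def)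
  then have "\<exists>\<phi>. inj_on \<phi> centres \<and> (\<forall>c. off \<le> \<phi> c)" by (rule exI[of _ "\<lambda>c. off + \<phi> c"])
  then have "inj_on idx centres \<and> (\<forall>c. off \<le> idx c)" unfolding idx_def by (rule someI_ex)
  then show "inj_on idx centres" "off \<le> idx c" by auto
qed

definition M :: "nat set" where "M = idx ` centres"

definition cv :: "nat \<Rightarrow> nat \<Rightarrow> real" where "cv = inv_into centres idx"

definition yv :: "nat \<Rightarrow> nat \<Rightarrow> real" where "yv \<mu> = (SOME y. wp (cv \<mu>) y)"

lemma cv: "\<mu> \<in> M \<Longrightarrow> cv \<mu> \<in> centres" unfolding M_def cv_def by (rule inv_into_into)

lemma cv_idx: "c \<in> centres \<Longrightarrow> cv (idx c) = c" unfolding cv_def by (rule inv_into_f_f[OF idx(1)])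

lemma cv_inj: "\<mu> \<in> M \<Longrightarrow> \<nu> \<in> M \<Longrightarrow> cv \<mu> = cv \<nu> \<Longrightarrow> \<mu> = \<nu>"
  unfolding M_def using cv_idx by auto

lemma wp_cv: "\<mu> \<in> M \<Longrightarrow> wp (cv \<mu>) (yv \<mu>)"
  unfolding yv_def using someI_ex[of "wp (cv \<mu>)"] cv[of \<mu>] by (simp add: centres_def)

lemma finM: "finite M" using finite_centres by (simp add: M_def)

lemma GM: "g \<in> G \<Longrightarrow> \<mu> \<in> M \<Longrightarrow> g < \<mu>"
proof -
  assume g: "g \<in> G" and m: "\<mu> \<in> M"
  have "g < off" unfolding off_def less_Suc_eq_le using g finG by (intro Max_ge) auto
  then show ?thesis using m idx(2) by (auto simp: M_def intro: less_le_trans)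
qed

lemma disj: "G \<inter> M = {}" using GM by fastforce

lemma cv_facts:
  assumes "\<mu> \<in> M"
  shows "supp (cv \<mu>) \<in> \<K>" "supp (cv \<mu>) \<noteq> {}" "supp (cv \<mu>) \<subseteq> G" "0 \<le> cv \<mu> g" "cv \<mu> g < 1" "cv \<mu> g \<in> \<rat>"
proof -
  have w: "wp (cv \<mu>) (yv \<mu>)" by (rule wp_cv[OF assms])
  then show "supp (cv \<mu>) \<in> \<K>" "supp (cv \<mu>) \<noteq> {}" "0 \<le> cv \<mu> g" "cv \<mu> g < 1" by (auto simp: wp_def)
  then show "supp (cv \<mu>) \<subseteq> G" using complexD(2)[OF cG] by blast
  obtain z where "real d * cv \<mu> g = of_int z" by (rule Ints_cases[OF wp_denominator[OF w]])
  then have "real d * cv \<mu> g \<in> \<rat>" by simp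
  then have "real d * cv \<mu> g / real d \<in> \<rat>" by (intro Rats_divide) auto
  then show "cv \<mu> g \<in> \<rat>" using d by simp
qed

lemma cv_same: "\<mu> \<in> M \<Longrightarrow> \<nu> \<in> M \<Longrightarrow> supp (cv \<mu>) \<subseteq> K \<Longrightarrow> supp (cv \<nu>) \<subseteq> K \<Longrightarrow> K \<in> \<K> \<Longrightarrow> \<mu> = \<nu>"
  using wp_unique[OF wp_cv wp_cv] cv_inj by blast

definition ht :: "nat \<Rightarrow> nat \<Rightarrow> nat" where "ht \<mu> i = nat \<lfloor>degree (cv \<mu>) i\<rfloor>"

lemma ht: "\<mu> \<in> M \<Longrightarrow> real (ht \<mu> i) = degree (cv \<mu>) i"
proof -
  assume m: "\<mu> \<in> M"
  have w: "wp (cv \<mu>) (yv \<mu>)" by (rule wp_cv[OF m])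
  have "degree (cv \<mu>) i = degree (yv \<mu>) i"
    using w degree_diff[of "cv \<mu>" "yv \<mu>" i] by (simp add: wp_def kern_iff)
  then have "degree (cv \<mu>) i \<in> \<int>" using degree_int w by (simp add: wp_def)
  moreover have "0 \<le> degree (cv \<mu>) i" by (rule degree_nonneg) (rule cv_facts(4)[OF m])
  ultimately show ?thesis by (simp add: ht_def of_int_floor)
qed

definition degs :: "nat \<Rightarrow> nat \<Rightarrow> real" where
  "degs g i = (if g \<in> M then real (ht g i) else of_bool (b g = i))"

definition \<rho>s :: "nat \<Rightarrow> nat \<Rightarrow> real" where
  "\<rho>s g = (if g \<in> M then cv g else (\<lambda>x. of_bool (x = g)))"

text \<open>A cell of \<open>\<K>\<close> contains the support of at most one centre, so all star
  subdivisions can be made simultaneously. The last condition discards the faces that are replaced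
  by the star of a centre.\<close>

definition \<K>s :: "nat set set" where
  "\<K>s = {C. C \<subseteq> G \<union> M \<and> (\<forall>\<mu>\<in>C \<inter> M. \<forall>\<nu>\<in>C \<inter> M. \<mu> = \<nu>) \<and> C - M \<in> \<K> \<and>
     (\<forall>\<mu>\<in>C \<inter> M. (C - M) \<union> supp (cv \<mu>) \<in> \<K>) \<and> (\<forall>\<nu>\<in>M. \<not> supp (cv \<nu>) \<subseteq> C)}"

lemma \<K>sD:
  assumes "C \<in> \<K>s"
  shows "C \<subseteq> G \<union> M" "\<mu> \<in> C \<inter> M \<Longrightarrow> \<nu> \<in> C \<inter> M \<Longrightarrow> \<mu> = \<nu>" "C - M \<in> \<K>"
    "\<mu> \<in> C \<inter> M \<Longrightarrow> (C - M) \<union> supp (cv \<mu>) \<in> \<K>" "\<nu> \<in> M \<Longrightarrow> \<not> supp (cv \<nu>) \<subseteq> C"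
  using assms by (simp_all add: \<K>s_def)

lemma complexs: "complex (G \<union> M) \<K>s"
  unfolding complex_def
proof (intro conjI ballI allI impI)
  show "finite (G \<union> M)" using finG finM by simp
  show "C \<subseteq> G \<union> M" if "C \<in> \<K>s" for C using that by (simp add: \<K>s_def)
  show "C' \<in> \<K>s" if C: "C \<in> \<K>s" "C' \<subseteq> C" for C C'
  proof -
    note C1 = \<K>sD[OF C(1)]
    show ?thesis
      unfolding \<K>s_def
    proof (intro CollectI conjI ballI)
      show "C' \<subseteq> G \<union> M" using C1(1) C(2) by blast
      show "\<mu> = \<nu>" if "\<mu> \<in> C' \<inter> M" "\<nu> \<in> C' \<inter> M" for \<mu> \<nu> by (rule C1(2)) (use that C(2) in auto)
      show "C' - M \<in> \<K>" by (rule complexD(3)[OF cG C1(3)]) (use C(2) in auto)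
      show "C' - M \<union> supp (cv \<mu>) \<in> \<K>" if "\<mu> \<in> C' \<inter> M" for \<mu>
        by (rule complexD(3)[OF cG C1(4)[of \<mu>]]) (use C(2) that in auto)
      show "\<not> supp (cv \<nu>) \<subseteq> C'" if "\<nu> \<in> M" for \<nu> using C1(5)[OF that] C(2) by blast
    qed
  qed
qed

lemma combs: "comb (G \<union> M) \<rho>s \<alpha> x = (if x \<in> G then \<alpha> x else 0) + (\<Sum>\<mu>\<in>M. \<alpha> \<mu> * cv \<mu> x)"
proof -
  have "(\<Sum>g\<in>G. \<alpha> g * \<rho>s g x) = (\<Sum>g\<in>G. if g = x then \<alpha> x else 0)"
    using disj by (intro sum.cong) (auto simp: \<rho>s_def)
  also have "\<dots> = (if x \<in> G then \<alpha> x else 0)" using finG by simp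
  finally have 1: "(\<Sum>g\<in>G. \<alpha> g * \<rho>s g x) = (if x \<in> G then \<alpha> x else 0)" .
  have 2: "(\<Sum>g\<in>M. \<alpha> g * \<rho>s g x) = (\<Sum>\<mu>\<in>M. \<alpha> \<mu> * cv \<mu> x)"
    by (intro sum.cong) (auto simp: \<rho>s_def)
  show ?thesis by (simp only: comb_def sum.union_disjoint[OF finG finM disj] 1 2)
qed

lemma combs_single:
  assumes "supp \<alpha> \<in> \<K>s" "\<mu> \<in> M" "\<alpha> \<mu> \<noteq> 0"
  shows "comb (G \<union> M) \<rho>s \<alpha> x = (if x \<in> G then \<alpha> x else 0) + \<alpha> \<mu> * cv \<mu> x"
proof -
  have "\<alpha> \<nu> = 0" if "\<nu> \<in> M" "\<nu> \<noteq> \<mu>" for \<nu>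
    using \<K>sD(2)[OF assms(1), of \<nu> \<mu>] assms(2,3) that by (auto simp: supp_def)
  then have "(\<Sum>\<nu>\<in>M. \<alpha> \<nu> * cv \<nu> x) = (\<Sum>\<nu>\<in>M. if \<nu> = \<mu> then \<alpha> \<mu> * cv \<mu> x else 0)"
    by (intro sum.cong) auto
  then show ?thesis using combs[of \<alpha> x] assms(2) finM by simp
qed

lemma combs_none:
  assumes "supp \<alpha> \<subseteq> G \<union> M" "supp \<alpha> \<inter> M = {}"
  shows "comb (G \<union> M) \<rho>s \<alpha> = \<alpha>"
proof
  fix x
  have "(\<Sum>\<nu>\<in>M. \<alpha> \<nu> * cv \<nu> x) = 0" using assms by (intro sum.neutral) (auto simp: supp_def)
  then show "comb (G \<union> M) \<rho>s \<alpha> x = \<alpha> x" using combs[of \<alpha> x] assms by (auto simp: supp_def)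
qed

lemma supp_\<rho>s: "supp (\<rho>s g) = (if g \<in> M then supp (cv g) else {g})"
  by (auto simp: \<rho>s_def supp_def)

lemma degs_eq:
  assumes "g \<in> G \<union> M"
  shows "(\<Sum>h\<in>G. \<rho>s g h * udeg b h s) = degs g s"
proof (cases "g \<in> M")
  case True
  then show ?thesis using ht[OF True, of s] by (simp add: \<rho>s_def degs_def degree_def)
next
  case False
  have "(\<Sum>h\<in>G. \<rho>s g h * udeg b h s) = (\<Sum>h\<in>G. if h = g then udeg b g s else 0)"
    using False by (intro sum.cong) (auto simp: \<rho>s_def)
  then show ?thesis using False assms finG by (simp add: degs_def udeg_def)
qed

lemma star_exists:
  assumes z: "z \<in> slice G \<K> (udeg b) t"
  shows "\<exists>\<alpha>\<in>slice (G \<union> M) \<K>s degs t. comb (G \<union> M) \<rho>s \<alpha> = z"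
proof -
  have zK: "supp z \<in> \<K>" by (rule sliceD(2)[OF z])
  have zG: "supp z \<subseteq> G" by (rule complexD(2)[OF cG zK])
  have znn: "0 \<le> z g" for g by (rule sliceD(1)[OF z])
  have main: ?thesis
    if a: "\<And>g. 0 \<le> \<alpha> g" "supp \<alpha> \<in> \<K>s" "comb (G \<union> M) \<rho>s \<alpha> = z" for \<alpha>
  proof -
    have "(\<Sum>g\<in>G \<union> M. \<alpha> g * degs g s) = t s" for s
    proof -
      have "(\<Sum>g\<in>G \<union> M. \<alpha> g * degs g s) = (\<Sum>g\<in>G \<union> M. \<Sum>h\<in>G. \<alpha> g * \<rho>s g h * udeg b h s)"
      proof (rule sum.cong[OF refl])
        fix g assume g: "g \<in> G \<union> M"
        show "\<alpha> g * degs g s = (\<Sum>h\<in>G. \<alpha> g * \<rho>s g h * udeg b h s)"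
          unfolding degs_eq[OF g, symmetric] by (simp add: sum_distrib_left mult.assoc)
      qed
      also have "\<dots> = (\<Sum>h\<in>G. \<Sum>g\<in>G \<union> M. \<alpha> g * \<rho>s g h * udeg b h s)" by (rule sum.swap)
      also have "\<dots> = (\<Sum>h\<in>G. comb (G \<union> M) \<rho>s \<alpha> h * udeg b h s)" by (simp add: comb_def sum_distrib_right)
      finally show ?thesis using a(3) sliceD(3)[OF z, of s] by simp
    qed
    then have "\<alpha> \<in> slice (G \<union> M) \<K>s degs t" using a by (simp add: slice_def)
    then show ?thesis using a(3) by blast
  qed
  show ?thesis
  proof (cases "\<exists>\<mu>\<in>M. supp (cv \<mu>) \<subseteq> supp z")
    case False
    have sM: "supp z \<inter> M = {}" using zG disj by blast
    then have "supp z - M = supp z" by blast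
    then have "supp z \<in> \<K>s" using False zK zG sM by (auto simp: \<K>s_def)
    moreover have "comb (G \<union> M) \<rho>s z = z" using zG sM by (intro combs_none) auto
    ultimately show ?thesis using main[of z] znn by blast
  next
    case True
    then obtain \<mu> where m: "\<mu> \<in> M" "supp (cv \<mu>) \<subseteq> supp z" by blast
    \<comment> \<open>The centre takes the largest weight that leaves all other weights nonnegative.
      The minimum is attained at some \<open>k\<close> in its support, which disappears, so that the
      remaining support no longer contains that of the centre.\<close>
    define w where "w = Min ((\<lambda>g. z g / cv \<mu> g) ` supp (cv \<mu>))"
    have fin: "finite (supp (cv \<mu>))" using cv_facts(3)[OF m(1)] finG finite_subset by blast
    have wle: "w * cv \<mu> g \<le> z g" for g
    proof (cases "g \<in> supp (cv \<mu>)")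
      case True
      then have "w \<le> z g / cv \<mu> g" unfolding w_def using fin by (intro Min_le) auto
      moreover have "0 < cv \<mu> g" using True cv_facts(4)[OF m(1), of g] by (simp add: supp_def)
      ultimately show ?thesis by (simp add: field_simps)
    qed (use znn in \<open>simp add: supp_def\<close>)
    have "w \<in> (\<lambda>g. z g / cv \<mu> g) ` supp (cv \<mu>)" unfolding w_def using fin cv_facts(2)[OF m(1)] by (intro Min_in) auto
    then obtain k where k: "k \<in> supp (cv \<mu>)" "w = z k / cv \<mu> k" by blast
    have kz: "k \<in> supp z" using k m by blast
    have kp: "0 < cv \<mu> k" "0 < z k" using k(1) kz cv_facts(4)[OF m(1), of k] znn[of k] by (auto simp: supp_def order_less_le)
    have wpos: "0 < w" using k kp by simp
    define \<alpha> where "\<alpha> x = (if x = \<mu> then w else if x \<in> G then z x - w * cv \<mu> x else 0)" for x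
    have muG: "\<mu> \<notin> G" using m disj by blast
    have am: "\<alpha> \<mu> = w" by (simp add: \<alpha>_def)
    have aG: "\<alpha> x = z x - w * cv \<mu> x" if "x \<in> G" for x using that muG by (auto simp: \<alpha>_def)
    have s1: "supp \<alpha> - M \<subseteq> supp z"
    proof
      fix x assume "x \<in> supp \<alpha> - M"
      then have x: "x \<in> G" "z x - w * cv \<mu> x \<noteq> 0" using m(1) by (auto simp: supp_def \<alpha>_def split: if_splits)
      then show "x \<in> supp z" using m(2) by (auto simp: supp_def)
    qed
    have s2: "supp \<alpha> \<inter> M \<subseteq> {\<mu>}" using disj by (auto simp: supp_def \<alpha>_def split: if_splits)
    have ak: "\<alpha> k = 0" using aG[of k] kz zG kp k(2) by (auto simp: field_simps)
    have "supp \<alpha> \<in> \<K>s"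
      unfolding \<K>s_def
    proof (intro CollectI conjI ballI)
      show "supp \<alpha> \<subseteq> G \<union> M" using m(1) by (auto simp: supp_def \<alpha>_def split: if_splits)
      show "x = y" if "x \<in> supp \<alpha> \<inter> M" "y \<in> supp \<alpha> \<inter> M" for x y using that s2 by blast
      show "supp \<alpha> - M \<in> \<K>" by (rule complexD(3)[OF cG zK s1])
      show "supp \<alpha> - M \<union> supp (cv x) \<in> \<K>" if "x \<in> supp \<alpha> \<inter> M" for x
        by (rule complexD(3)[OF cG zK]) (use that s1 s2 m(2) in auto)
      show "\<not> supp (cv \<nu>) \<subseteq> supp \<alpha>" if n: "\<nu> \<in> M" for \<nu>
      proof
        assume s: "supp (cv \<nu>) \<subseteq> supp \<alpha>"
        then have "supp (cv \<nu>) \<subseteq> supp z" using s1 cv_facts(3)[OF n] disj by blast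
        then have "\<nu> = \<mu>" using cv_same[OF n m(1) _ m(2) zK] by blast
        then show False using s k(1) ak by (auto simp: supp_def)
      qed
    qed
    moreover have "comb (G \<union> M) \<rho>s \<alpha> = z"
    proof
      fix x
      have "comb (G \<union> M) \<rho>s \<alpha> x = (if x \<in> G then \<alpha> x else 0) + w * cv \<mu> x"
        using combs_single[OF \<open>supp \<alpha> \<in> \<K>s\<close> m(1), of x] am wpos by simp
      then show "comb (G \<union> M) \<rho>s \<alpha> x = z x"
      proof (cases "x \<in> G")
        case False
        then have "x \<notin> supp z" "x \<notin> supp (cv \<mu>)" using zG cv_facts(3)[OF m(1)] by auto
        then show ?thesis using \<open>comb (G \<union> M) \<rho>s \<alpha> x = _\<close> False by (simp add: supp_def)
      qed (use \<open>comb (G \<union> M) \<rho>s \<alpha> x = _\<close> aG[of x] in simp)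
    qed
    moreover have "0 \<le> \<alpha> x" for x using wle[of x] wpos by (simp add: \<alpha>_def)
    ultimately show ?thesis using main[of \<alpha>] by blast
  qed
qed

lemma star_supp:
  assumes a: "\<alpha> \<in> slice (G \<union> M) \<K>s degs t"
  shows "supp (comb (G \<union> M) \<rho>s \<alpha>) = (\<Union>g\<in>supp \<alpha>. supp (\<rho>s g))"
proof (rule supp_comb_nonneg)
  show "finite (G \<union> M)" using finG finM by simp
  show "supp \<alpha> \<subseteq> G \<union> M" by (rule complexD(2)[OF complexs sliceD(2)[OF a]])
  show "0 \<le> \<alpha> g" for g by (rule sliceD(1)[OF a])
  show "0 \<le> \<rho>s g h" for g h using cv_facts(4) by (simp add: \<rho>s_def)
qed

lemma star_cell:
  assumes "C \<in> \<K>s"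
  shows "(\<Union>g\<in>C. supp (\<rho>s g)) \<in> \<K>"
proof (cases "C \<inter> M = {}")
  case True
  then have "(\<Union>g\<in>C. supp (\<rho>s g)) = C - M" by (auto simp: supp_\<rho>s)
  then show ?thesis using assms by (simp add: \<K>s_def)
next
  case False
  then obtain \<mu> where m: "\<mu> \<in> C \<inter> M" by blast
  have C: "C = insert \<mu> (C - M)" using \<K>sD(2)[OF assms _ m] m by blast
  have 1: "(\<Union>g\<in>C - M. supp (\<rho>s g)) = C - M" by (auto simp: supp_\<rho>s)
  have 2: "supp (\<rho>s \<mu>) = supp (cv \<mu>)" using m by (simp add: supp_\<rho>s)
  have "(\<Union>g\<in>C. supp (\<rho>s g)) = supp (\<rho>s \<mu>) \<union> (\<Union>g\<in>C - M. supp (\<rho>s g))" by (subst C) simp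
  then have "(\<Union>g\<in>C. supp (\<rho>s g)) = (C - M) \<union> supp (cv \<mu>)" unfolding 1 2 by (simp add: Un_commute)
  then show ?thesis using assms m by (simp add: \<K>s_def)
qed

lemma star_unique:
  assumes a: "\<alpha> \<in> slice (G \<union> M) \<K>s degs t" and b: "\<beta> \<in> slice (G \<union> M) \<K>s degs t"
    and eq: "comb (G \<union> M) \<rho>s \<alpha> = comb (G \<union> M) \<rho>s \<beta>"
  shows "\<alpha> = \<beta>"
proof -
  have K: "supp \<alpha> \<in> \<K>s" "supp \<beta> \<in> \<K>s" by (rule sliceD(2)[OF a], rule sliceD(2)[OF b])
  have GMs: "supp \<alpha> \<subseteq> G \<union> M" "supp \<beta> \<subseteq> G \<union> M" using complexD(2)[OF complexs] K by auto
  define Z where "Z = supp (comb (G \<union> M) \<rho>s \<alpha>)"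
  have Z: "Z = (\<Union>g\<in>supp \<alpha>. supp (\<rho>s g))" "Z = (\<Union>g\<in>supp \<beta>. supp (\<rho>s g))"
    using star_supp[OF a] star_supp[OF b] eq by (auto simp: Z_def)
  have ZK: "Z \<in> \<K>" using star_cell[OF K(1)] Z(1) by simp
  have contains: "supp (cv \<mu>) \<subseteq> Z" if h: "\<mu> \<in> supp \<alpha> \<inter> M \<or> \<mu> \<in> supp \<beta> \<inter> M" for \<mu>
  proof -
    have r: "supp (\<rho>s \<mu>) = supp (cv \<mu>)" using h supp_\<rho>s[of \<mu>] by auto
    show ?thesis using h
    proof
      assume "\<mu> \<in> supp \<alpha> \<inter> M"
      then show ?thesis unfolding Z(1) r[symmetric] by (intro UN_upper) simp
    next
      assume "\<mu> \<in> supp \<beta> \<inter> M"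
      then show ?thesis unfolding Z(2) r[symmetric] by (intro UN_upper) simp
    qed
  qed
  have none: "\<not> supp (cv \<mu>) \<subseteq> Z" if "\<gamma> \<in> {\<alpha>, \<beta>}" "supp \<gamma> \<inter> M = {}" "\<mu> \<in> M" for \<gamma> \<mu>
  proof -
    have "(\<Union>g\<in>supp \<gamma>. supp (\<rho>s g)) = supp \<gamma>" using that(2) by (auto simp: supp_\<rho>s)
    then have "Z = supp \<gamma>" using that(1) Z by auto
    then show ?thesis using \<K>sD(5)[OF K(1) that(3)] \<K>sD(5)[OF K(2) that(3)] that(1) by auto
  qed
  show ?thesis
  proof (cases "supp \<alpha> \<inter> M = {}")
    case True
    have T2: "supp \<beta> \<inter> M = {}"
    proof (rule ccontr)
      assume "supp \<beta> \<inter> M \<noteq> {}"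
      then obtain \<nu> where n: "\<nu> \<in> supp \<beta> \<inter> M" by blast
      have "\<not> supp (cv \<nu>) \<subseteq> Z" by (rule none[of \<alpha>]) (use True n in simp_all)
      then show False using contains[OF disjI2[OF n]] by simp
    qed
    show ?thesis using eq unfolding combs_none[OF GMs(1) True] combs_none[OF GMs(2) T2] .
  next
    case False
    then obtain \<mu> where m: "\<mu> \<in> supp \<alpha> \<inter> M" by blast
    have "supp \<beta> \<inter> M \<noteq> {}"
    proof
      assume e: "supp \<beta> \<inter> M = {}"
      have "\<not> supp (cv \<mu>) \<subseteq> Z" by (rule none[of \<beta>]) (use e m in simp_all)
      then show False using contains[OF disjI1[OF m]] by simp
    qed
    then obtain \<nu> where n: "\<nu> \<in> supp \<beta> \<inter> M" by blast
    have mn: "\<nu> = \<mu>" by (rule cv_same[OF _ _ contains contains ZK]) (use m n in auto)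
    have mM: "\<mu> \<in> M" "\<alpha> \<mu> \<noteq> 0" "\<beta> \<mu> \<noteq> 0" using m n mn by (auto simp: supp_def)
    have e: "\<alpha> x + \<alpha> \<mu> * cv \<mu> x = \<beta> x + \<beta> \<mu> * cv \<mu> x" if "x \<in> G" for x
      using combs_single[OF K(1) mM(1,2), of x] combs_single[OF K(2) mM(1,3), of x] eq that by simp
    \<comment> \<open>By the last condition on \<open>\<K>s\<close> there is a \<open>k\<close> in
      the support of the centre at which \<open>\<gamma>\<close> vanishes. There the image of
      \<open>\<gamma>\<close> consists of the contribution of the centre alone, and comparison with
      the image of \<open>\<delta>\<close> bounds \<open>\<delta> \<mu>\<close>.\<close>
    have le: "\<delta> \<mu> \<le> \<gamma> \<mu>" if "{\<gamma>,\<delta>} = {\<alpha>,\<beta>}" for \<gamma> \<delta>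
    proof -
      have g: "supp \<gamma> \<in> \<K>s" "\<And>x. 0 \<le> \<delta> x" using that K sliceD(1)[OF a] sliceD(1)[OF b] by (auto simp: doubleton_eq_iff)
      then obtain k where k: "k \<in> supp (cv \<mu>)" "k \<notin> supp \<gamma>" using \<K>sD(5)[OF g(1) mM(1)] by blast
      have kG: "k \<in> G" using cv_facts(3)[OF mM(1)] k(1) by blast
      have "\<gamma> k + \<gamma> \<mu> * cv \<mu> k = \<delta> k + \<delta> \<mu> * cv \<mu> k" using e[OF kG] that by (auto simp: doubleton_eq_iff)
      then have "\<delta> \<mu> * cv \<mu> k \<le> \<gamma> \<mu> * cv \<mu> k" using k(2) g(2)[of k] by (simp add: supp_def)
      moreover have "0 < cv \<mu> k" using k(1) cv_facts(4)[OF mM(1), of k] by (simp add: supp_def)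
      ultimately show ?thesis by simp
    qed
    have w: "\<alpha> \<mu> = \<beta> \<mu>" using le[of \<alpha> \<beta>] le[of \<beta> \<alpha>] by (simp add: insert_commute)
    show ?thesis
    proof
      fix x
      show "\<alpha> x = \<beta> x"
      proof (cases "x \<in> G")
        case True then show ?thesis using e[OF True] w by simp
      next
        case False
        have z: "\<gamma> x = 0" if "x \<noteq> \<mu>" "supp \<gamma> \<in> \<K>s" "supp \<gamma> \<subseteq> G \<union> M" "\<mu> \<in> supp \<gamma>" for \<gamma>
          using \<K>sD(2)[OF that(2), of x \<mu>] that False mM(1) by (auto simp: supp_def)
        show ?thesis
        proof (cases "x = \<mu>")
          case ne: False
          have "\<mu> \<in> supp \<alpha>" "\<mu> \<in> supp \<beta>" using m n mn by auto
          then show ?thesis using z[OF ne K(1) GMs(1)] z[OF ne K(2) GMs(2)] by simp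
        qed (use w in simp)
      qed
    qed
  qed
qed

lemma star_subdiv:
  assumes t: "\<And>i. i \<notin> b ` G \<Longrightarrow> t i = 0"
  shows "subdiv G \<K> (udeg b) t (G \<union> M) \<K>s degs t \<rho>s"
proof (rule subdivI_deg[where B = "b ` G" and E = "\<lambda>u s. of_bool (u = s)", OF finG complexs])
  show "0 \<le> \<rho>s g h \<and> \<rho>s g h \<in> \<rat>" for g h using cv_facts(4,6) by (simp add: \<rho>s_def)
  show "supp (\<rho>s g) \<subseteq> G" if "g \<in> G \<union> M" for g using that cv_facts(3) by (auto simp: supp_\<rho>s)
  have B: "(\<Sum>u\<in>b ` G. f u * of_bool (u = s)) = f s" if "s \<notin> b ` G \<Longrightarrow> f s = 0" for f :: "nat \<Rightarrow> real" and s
  proof -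
    have "(\<Sum>u\<in>b ` G. f u * of_bool (u = s)) = (\<Sum>u\<in>b ` G. if u = s then f s else 0)" by (intro sum.cong) auto
    also have "\<dots> = (if s \<in> b ` G then f s else 0)" by (rule sum.delta) (simp add: finG)
    finally show ?thesis using that by simp
  qed
  have dz: "degs g s = 0" if "g \<in> G \<union> M" "s \<notin> b ` G" for g s
    unfolding degs_eq[OF that(1), symmetric] using that(2) by (intro sum.neutral) (auto simp: udeg_def)
  show "(\<Sum>h\<in>G. \<rho>s g h * udeg b h s) = (\<Sum>u\<in>b ` G. degs g u * of_bool (u = s))" if "g \<in> G \<union> M" for g s
    unfolding degs_eq[OF that] by (rule B[symmetric]) (rule dz[OF that])
  show "t s = (\<Sum>u\<in>b ` G. t u * of_bool (u = s))" for s by (rule B[symmetric]) (rule t)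
qed (rule star_cell, assumption, rule star_exists, assumption, rule star_unique)

end

section \<open>Orders of relations after a star subdivision\<close>

context star begin

lemma adjoin_diff:
  assumes k: "x \<in> kern G (udeg b)" and K: "supp x \<subseteq> K" "supp c \<subseteq> K" "K \<in> \<K>" and c: "wp c y"
    and u: "comb G \<rho> x = (\<lambda>h. of_int z * m h + l h)" "l \<in> L"
  shows "x g - of_int z * c g \<in> \<int>"
proof -
  let ?x = "\<lambda>g. 1 * x g + (- of_int z) * (c g - y g)"
  have 1: "?x \<in> kern G (udeg b)" by (rule kern_lin[OF k wpD(7)[OF c]])
  have "supp ?x \<subseteq> supp x \<union> supp c \<union> supp y" by (auto simp: supp_def)
  then have 2: "supp ?x \<in> \<K>" using complexD(3)[OF cG K(3)] K(1,2) wpD(6)[OF c] by blast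
  have "comb G \<rho> ?x = (\<lambda>h. l h + of_int (- z) * (comb G \<rho> (\<lambda>g. c g - y g) h - m h))"
    unfolding comb_lin u(1) by (simp add: algebra_simps)
  also have "\<dots> \<in> L" by (rule zmod_add_mult[OF L u(2) wpD(8)[OF c]])
  finally have "?x g \<in> \<int>" using unimD[OF 1 2] by (simp add: intvec_def)
  moreover have "of_int z * y g \<in> \<int>" using wpD(5)[OF c] by (intro Ints_mult) (auto simp: intvec_def)
  ultimately have "?x g - of_int z * y g \<in> \<int>" by (rule Ints_diff)
  then show ?thesis by (simp add: algebra_simps)
qed

text \<open>The order is \<open>e = d * c g0\<close>, where \<open>g0\<close> lies in the support
  \<open>c\<close> of the centre but not in the cell; it is an integer between \<open>0\<close> and
  \<open>d\<close> because \<open>0 < c g0 < 1\<close>. Modulo integers the image of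
  \<open>\<alpha>\<close> on the old rays is \<open>z * c\<close>. At \<open>g0\<close> this says
  that \<open>w * c g0\<close> is an integer, so \<open>e * w\<close> is one, and the other
  coordinates follow.\<close>

lemma exponent_mu:
  assumes K: "supp \<alpha> \<in> \<K>s" and mu: "\<mu> \<in> M" "\<alpha> \<mu> \<noteq> 0"
    and k: "comb (G \<union> M) \<rho>s \<alpha> \<in> kern G (udeg b)"
    and u: "comb G \<rho> (comb (G \<union> M) \<rho>s \<alpha>) = (\<lambda>h. of_int z * m h + l h)" "l \<in> L"
  shows "\<exists>e::nat. 1 \<le> e \<and> e < d \<and> (\<lambda>g. real e * \<alpha> g) \<in> intvec"
proof -
  define c where "c = cv \<mu>"
  have c: "wp c (yv \<mu>)" unfolding c_def by (rule wp_cv[OF mu(1)])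
  let ?\<beta> = "comb (G \<union> M) \<rho>s \<alpha>"
  have mS: "\<mu> \<in> supp \<alpha> \<inter> M" using mu by (simp add: supp_def)
  define K' where "K' = (supp \<alpha> - M) \<union> supp c"
  have K': "K' \<in> \<K>" unfolding K'_def c_def by (rule \<K>sD(4)[OF K mS])
  have \<beta>: "?\<beta> x = (if x \<in> G then \<alpha> x else 0) + \<alpha> \<mu> * c x" for x
    unfolding c_def by (rule combs_single[OF K mu])
  have s\<beta>: "supp ?\<beta> \<subseteq> K'"
  proof
    fix x assume "x \<in> supp ?\<beta>"
    then have "(x \<in> G \<and> \<alpha> x \<noteq> 0) \<or> c x \<noteq> 0" by (auto simp: supp_def \<beta> split: if_splits)
    then show "x \<in> K'" using disj by (auto simp: K'_def supp_def)
  qed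
  have int: "?\<beta> g - of_int z * c g \<in> \<int>" for g
    by (rule adjoin_diff[OF k s\<beta> _ K' c u]) (simp add: K'_def)
  obtain g0 where g0: "g0 \<in> supp c" "g0 \<notin> supp \<alpha>" using \<K>sD(5)[OF K mu(1)] by (auto simp: c_def)
  define w where "w = \<alpha> \<mu> - of_int z"
  have "w * c g0 = ?\<beta> g0 - of_int z * c g0" using g0(2) by (simp add: \<beta> w_def supp_def algebra_simps)
  then have j: "w * c g0 \<in> \<int>" using int by simp
  have dc: "real d * c g \<in> \<int>" for g by (rule wp_denominator[OF c])
  have c0: "0 < c g0" "c g0 < 1" using wpD(3,4)[OF c, of g0] g0(1) by (auto simp: supp_def order_less_le)
  obtain e' where e': "real d * c g0 = of_int e'" by (rule Ints_cases[OF dc])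
  have dpos: "0 < real d" using d by simp
  have "0 < real d * c g0" "real d * c g0 < real d" using c0 dpos by simp_all
  then have e'b: "0 < e'" "e' < int d" unfolding e' by simp_all
  define e where "e = nat e'"
  have e: "real e = real d * c g0" "1 \<le> e" "e < d" using e'b e' by (auto simp: e_def)
  have ew: "real e * w = real d * (w * c g0)" by (simp add: e(1))
  have "real e * \<alpha> x \<in> \<int>" for x
  proof -
    consider "x = \<mu>" | "x \<in> G" | "x \<notin> G" "x \<noteq> \<mu>" by blast
    then show ?thesis
    proof cases
      case 1
      have "real e * \<alpha> x = real d * (w * c g0) + real e * of_int z"
        unfolding 1 ew[symmetric] by (simp add: w_def algebra_simps)
      then show ?thesis using j by (simp add: Ints_add Ints_mult)
    next
      case 2
      have n: "\<alpha> x + w * c x \<in> \<int>" using int[of x] 2 by (simp add: \<beta> w_def algebra_simps)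
      have "real e * \<alpha> x = real e * (\<alpha> x + w * c x) - (w * c g0) * (real d * c x)"
        by (simp add: e(1) algebra_simps)
      also have "\<dots> \<in> \<int>" by (intro Ints_diff Ints_mult n j dc Ints_of_nat)
      finally show ?thesis .
    next
      case 3
      have "\<alpha> x = 0"
      proof (rule ccontr)
        assume "\<alpha> x \<noteq> 0"
        then have "x \<in> supp \<alpha> \<inter> M" using \<K>sD(1)[OF K] 3(1) by (auto simp: supp_def)
        then show False using \<K>sD(2)[OF K _ mS] 3(2) by blast
      qed
      then show ?thesis by simp
    qed
  qed
  then show ?thesis using e(2,3) by (intro exI[of _ e]) (simp add: intvec_def)
qed

text \<open>Let \<open>q\<close> be the gcd of \<open>z\<close> and \<open>d\<close>. If
  \<open>q = 1\<close>, some multiple of \<open>x\<close> has image in the coset of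
  \<open>m\<close>. As the cell contains no centre, this multiple is integral, hence
  \<open>m \<in> L\<close>, and \<open>x\<close> itself is integral. If \<open>q > 1\<close>,
  multiplying by \<open>d div q\<close> makes the coefficient of \<open>m\<close> a multiple of
  \<open>d\<close>, and the image falls into \<open>L\<close>.\<close>

lemma exponent_none:
  assumes T: "supp x \<in> \<K>" "\<And>\<nu>. \<nu> \<in> M \<Longrightarrow> \<not> supp (cv \<nu>) \<subseteq> supp x"
    and k: "x \<in> kern G (udeg b)"
    and u: "comb G \<rho> x = (\<lambda>h. of_int z * m h + l h)" "l \<in> L"
  shows "\<exists>e::nat. 1 \<le> e \<and> e < d \<and> (\<lambda>g. real e * x g) \<in> intvec"
proof -
  define q where "q = gcd z (int d)"
  have dpos: "0 < int d" using d by simp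
  have qpos: "0 < q" unfolding q_def using d by simp
  have sm: "supp (\<lambda>g. c * x g) \<in> \<K>" for c
    by (rule complexD(3)[OF cG T(1)]) (auto simp: supp_def)
  have km: "(\<lambda>g. c * x g) \<in> kern G (udeg b)" for c using kern_lin[OF k k, of c 0] by simp
  show ?thesis
  proof (cases "q = 1")
    case True
    obtain s t where st: "s * z + t * int d = 1" using bezout_int[of z "int d"] True by (auto simp: q_def)
    let ?y = "\<lambda>g. of_int s * x g"
    have e: "comb G \<rho> ?y h - m h = of_int s * l h + of_int (- t) * (real d * m h)" for h
    proof -
      have "comb G \<rho> ?y h - m h = (of_int (s * z) - 1) * m h + of_int s * l h"
        unfolding comb_scale u(1) by (simp add: algebra_simps)
      also have "s * z = 1 - t * int d" using st by simp
      finally show ?thesis by (simp add: algebra_simps)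
    qed
    have 1: "(\<lambda>h. comb G \<rho> ?y h - m h) \<in> L" unfolding e by (rule zmod_lin[OF L u(2) dm])
    have yi: "?y \<in> intvec"
    proof (rule ccontr)
      assume "?y \<notin> intvec"
      from wp_exists[OF km sm 1 this] obtain c y where c: "wp c y" "supp c \<subseteq> supp ?y" by blast
      have "c \<in> centres" using c(1) by (auto simp: centres_def)
      then have "idx c \<in> M" "cv (idx c) = c" using cv_idx by (auto simp: M_def)
      moreover have "supp ?y \<subseteq> supp x" by (auto simp: supp_def)
      ultimately show False using T(2)[of "idx c"] c(2) by auto
    qed
    have cy: "comb G \<rho> ?y \<in> L" by (rule integD[OF km yi])
    have "(\<lambda>h. comb G \<rho> ?y h + of_int (-1) * (comb G \<rho> ?y h - m h)) \<in> L" by (rule zmod_add_mult[OF L cy 1])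
    then have mL: "m \<in> L" by simp
    have "comb G \<rho> x \<in> L" unfolding u(1) using zmod_add_mult[OF L u(2) mL, of z] by (simp add: add.commute)
    then have "x \<in> intvec" by (rule unimD[OF k T(1)])
    then show ?thesis using d by (intro exI[of _ 1]) simp
  next
    case False
    define e where "e = nat (int d div q)"
    have qd: "q dvd int d" "q dvd z" by (simp_all add: q_def)
    have q2: "2 \<le> q" using qpos False by simp
    have dq: "int d = q * (int d div q)" using qd by simp
    have epos: "0 < int d div q" using dq qpos dpos by (metis zero_less_mult_pos)
    have "int d div q < int d"
    proof -
      have "2 * (int d div q) \<le> q * (int d div q)" using q2 epos by (intro mult_right_mono) auto
      then show ?thesis using dq epos by linarith
    qed
    then have e: "1 \<le> e" "e < d" "int e = int d div q" using epos by (auto simp: e_def)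
    have ez: "int e * z = (z div q) * int d"
    proof -
      have "int e * z = int e * (q * (z div q))" using qd by simp
      also have "\<dots> = (int e * q) * (z div q)" by simp
      also have "int e * q = int d" using e(3) dq by (simp add: mult.commute)
      finally show ?thesis by simp
    qed
    have "comb G \<rho> (\<lambda>g. real e * x g) = (\<lambda>h. of_int (int e) * l h + of_int (z div q) * (real d * m h))"
    proof
      fix h
      have "comb G \<rho> (\<lambda>g. real e * x g) h = of_int (int e * z) * m h + real e * l h"
        unfolding comb_scale u(1) by (simp add: algebra_simps)
      then show "comb G \<rho> (\<lambda>g. real e * x g) h = of_int (int e) * l h + of_int (z div q) * (real d * m h)"
        unfolding ez by simp
    qed
    also have "\<dots> \<in> L" by (rule zmod_lin[OF L u(2) dm])
    finally have "(\<lambda>g. real e * x g) \<in> intvec" by (rule unimD[OF km sm])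
    then show ?thesis using e by blast
  qed
qed

lemma kerns:
  assumes a: "\<alpha> \<in> kern (G \<union> M) degs"
  shows "comb (G \<union> M) \<rho>s \<alpha> \<in> kern G (udeg b)"
  by (rule subdivD(6)[OF star_subdiv[of "\<lambda>_. 0"] a]) simp

lemma star_exponent:
  assumes a: "\<alpha> \<in> kern (G \<union> M) degs" "supp \<alpha> \<in> \<K>s" "comb G \<rho> (comb (G \<union> M) \<rho>s \<alpha>) \<in> adjoin L m"
  shows "\<exists>e::nat. 1 \<le> e \<and> e < d \<and> (\<lambda>g. real e * \<alpha> g) \<in> intvec"
proof -
  obtain z l where u: "l \<in> L" "comb G \<rho> (comb (G \<union> M) \<rho>s \<alpha>) = (\<lambda>h. of_int z * m h + l h)"
    by (rule adjoinE[OF a(3)])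
  note k = kerns[OF a(1)]
  show ?thesis
  proof (cases "supp \<alpha> \<inter> M = {}")
    case True
    have c: "comb (G \<union> M) \<rho>s \<alpha> = \<alpha>" by (rule combs_none[OF \<K>sD(1)[OF a(2)] True])
    have "supp \<alpha> - M = supp \<alpha>" using True by blast
    then have "supp \<alpha> \<in> \<K>" using \<K>sD(3)[OF a(2)] by simp
    from exponent_none[OF this \<K>sD(5)[OF a(2)] k[unfolded c] u(2)[unfolded c] u(1)] show ?thesis .
  next
    case False
    then obtain \<mu> where "\<mu> \<in> M" "\<alpha> \<mu> \<noteq> 0" by (auto simp: supp_def)
    from exponent_mu[OF a(2) this k u(2,1)] show ?thesis .
  qed
qed

text \<open>A centre is written as \<open>(c - y) + y\<close>. The first part is a relation whose
  image is in the coset of \<open>m\<close>; the second parts, together with the weights on old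
  rays, form an integral relation with image in \<open>L\<close>.\<close>

lemma star_integral: "integral_on (G \<union> M) degs (\<lambda>g. comb G \<rho> (\<rho>s g)) (adjoin L m)"
  unfolding integral_on_def comb_comb[symmetric]
proof (intro ballI impI)
  fix \<alpha> assume a: "\<alpha> \<in> kern (G \<union> M) degs" "\<alpha> \<in> intvec"
  let ?\<beta> = "comb (G \<union> M) \<rho>s \<alpha>"
  let ?c = "\<lambda>\<mu> g. cv \<mu> g - yv \<mu> g"
  let ?s = "\<lambda>g. \<Sum>\<mu>\<in>M. \<alpha> \<mu> * ?c \<mu> g"
  have ai: "\<alpha> g \<in> \<int>" for g using a(2) by (simp add: intvec_def)
  have cA: "comb G \<rho> (?c \<mu>) \<in> adjoin L m" if "\<mu> \<in> M" for \<mu>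
    using adjoinI[OF wpD(8)[OF wp_cv[OF that]], of 1 m] by simp
  have 1: "comb G \<rho> ?s \<in> adjoin L m"
    unfolding comb_sum[abs_def] by (rule zmod_sum[OF zmod_adjoin[OF L] ai cA])
  have sk: "?s \<in> kern G (udeg b)"
    unfolding kern_iff
  proof (intro conjI allI)
    have "supp (?c \<mu>) \<subseteq> G" if "\<mu> \<in> M" for \<mu> using wpD(7)[OF wp_cv[OF that]] by (simp add: kern_iff)
    then have "?s g = 0" if "g \<notin> G" for g using that by (intro sum.neutral) (auto simp: supp_def)
    then show "supp ?s \<subseteq> G" by (auto simp: supp_def)
    fix i
    have "degree ?s i = (\<Sum>g\<in>G. \<Sum>\<mu>\<in>M. \<alpha> \<mu> * (?c \<mu> g * udeg b g i))"
      by (simp add: degree_def sum_distrib_right mult.assoc)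
    also have "\<dots> = (\<Sum>\<mu>\<in>M. \<Sum>g\<in>G. \<alpha> \<mu> * (?c \<mu> g * udeg b g i))" by (rule sum.swap)
    also have "\<dots> = (\<Sum>\<mu>\<in>M. \<alpha> \<mu> * degree (?c \<mu>) i)" by (simp add: degree_def sum_distrib_left)
    also have "\<dots> = 0" using wpD(7)[OF wp_cv] by (intro sum.neutral) (simp add: kern_iff)
    finally show "degree ?s i = 0" .
  qed
  let ?n = "\<lambda>g. ?\<beta> g - ?s g"
  have nk: "?n \<in> kern G (udeg b)" by (rule kern_diff[OF kerns[OF a(1)] sk])
  have "?n g = (if g \<in> G then \<alpha> g else 0) + (\<Sum>\<mu>\<in>M. \<alpha> \<mu> * yv \<mu> g)" for g
    unfolding combs by (simp add: right_diff_distrib sum_subtractf)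
  moreover have "(\<Sum>\<mu>\<in>M. \<alpha> \<mu> * yv \<mu> g) \<in> \<int>" for g
    using wpD(5)[OF wp_cv] by (intro Ints_sum Ints_mult ai) (auto simp: intvec_def)
  ultimately have "?n \<in> intvec" using ai by (simp add: intvec_def Ints_add)
  then have "comb G \<rho> ?n \<in> adjoin L m" using integD[OF nk] adjoin_mono by blast
  from zmod_add_mult[OF zmod_adjoin[OF L] this 1, of 1]
  have "(\<lambda>h. comb G \<rho> ?n h + comb G \<rho> ?s h) \<in> adjoin L m" by simp
  moreover have "(\<lambda>h. comb G \<rho> ?n h + comb G \<rho> ?s h) = comb G \<rho> ?\<beta>"
    unfolding comb_diff by simp
  ultimately show "comb G \<rho> ?\<beta> \<in> adjoin L m" by (rule subst[rotated])
qed

end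

text \<open>The degree at a label carried by no ray is always \<open>0\<close>, so \<open>t\<close>
  has to vanish there.\<close>

definition sizes :: "real set \<Rightarrow> nat set \<Rightarrow> (nat \<Rightarrow> nat) \<Rightarrow> (nat \<Rightarrow> real) \<Rightarrow> bool" where
  "sizes V G b t \<longleftrightarrow> (\<forall>g\<in>G. 0 < t (b g) \<and> t (b g) \<in> V) \<and> (\<forall>a. a \<notin> b ` G \<longrightarrow> t a = 0)"

lemma integral_trans:
  assumes "integral_on G' deg' (\<lambda>g. comb G \<rho> (\<rho>' g)) L"
    and s: "subdiv G' \<K>' deg' t' G'' \<K>'' deg'' t'' \<rho>''" and i: "\<forall>g\<in>G''. \<forall>x. \<rho>'' g x \<in> \<int>"
  shows "integral_on G'' deg'' (\<lambda>g. comb G \<rho> (comb G' \<rho>' (\<rho>'' g))) L"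
  unfolding integral_on_def
proof (intro ballI impI)
  fix \<alpha> assume a: "\<alpha> \<in> kern G'' deg''" "\<alpha> \<in> intvec"
  have "comb G'' \<rho>'' \<alpha> \<in> intvec"
    using a(2) i by (auto simp: intvec_def comb_def intro!: Ints_sum Ints_mult)
  then show "comb G'' (\<lambda>g. comb G \<rho> (comb G' \<rho>' (\<rho>'' g))) \<alpha> \<in> L"
    using assms(1) subdivD(6)[OF s a(1)] unfolding integral_on_def comb_comb[symmetric] by simp
qed

text \<open>The multidegrees of the centres are folded back to single labels on the complex of all
  sets with at most one centre, and the result is restricted to the star subdivision. Folding is
  unimodular for integral vectors, so it does not raise the order of a relation.\<close>

lemma star_step:
  fixes G1 :: "nat set"
  assumes V: "rat_subspace V"
    and s: "subdiv G \<K> deg t G1 \<K>1 (udeg b1) t1 \<rho>1"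
    and u: "unimod G1 \<K>1 (udeg b1) \<rho>1 L" and i: "integral_on G1 (udeg b1) \<rho>1 L"
    and sz: "sizes V G1 b1 t1" and L: "zmod L" and d: "2 \<le> d" and dm: "(\<lambda>g. real d * m g) \<in> L"
  shows "\<exists>(G2::nat set) \<K>2 b2 t2 \<rho>2. subdiv G \<K> deg t G2 \<K>2 (udeg b2) t2 \<rho>2 \<and>
    integral_on G2 (udeg b2) \<rho>2 (adjoin L m) \<and> sizes V G2 b2 t2 \<and>
    (\<forall>\<alpha>\<in>kern G2 (udeg b2). supp \<alpha> \<in> \<K>2 \<longrightarrow> comb G2 \<rho>2 \<alpha> \<in> adjoin L m \<longrightarrow>
      (\<exists>e::nat. 1 \<le> e \<and> e < d \<and> (\<lambda>g. real e * \<alpha> g) \<in> intvec))"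
proof -
  interpret star G1 \<K>1 b1 \<rho>1 L m d by unfold_locales (use subdivD(1)[OF s] u i L d dm in auto)
  have tz: "t1 a = 0" if "a \<notin> b1 ` G1" for a using sz that by (simp add: sizes_def)
  have tV: "t1 a \<in> V \<and> 0 \<le> t1 a" for a
    using sz rat_subspace_0[OF V] by (cases "a \<in> b1 ` G1") (auto simp: sizes_def less_imp_le)
  have hB: "a \<in> b1 ` G1" if "\<mu> \<in> M" "ht \<mu> a \<noteq> 0" for \<mu> a
  proof -
    have "degree (cv \<mu>) a \<noteq> 0" using ht[OF that(1), of a] that(2) by simp
    from degree_nonzero[OF this] show ?thesis using cv_facts(3)[OF that(1)] by blast
  qed
  have hn: "\<exists>a. ht \<mu> a \<noteq> 0" if m: "\<mu> \<in> M" for \<mu>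
  proof -
    obtain g where g: "g \<in> supp (cv \<mu>)" using cv_facts(2)[OF m] by blast
    then have gG: "g \<in> G1" using cv_facts(3)[OF m] by blast
    have "cv \<mu> g * udeg b1 g (b1 g) \<le> degree (cv \<mu>) (b1 g)"
      unfolding degree_def by (rule member_le_sum[OF gG _ finG]) (use cv_facts(4)[OF m] in \<open>auto simp: udeg_def\<close>)
    moreover have "0 < cv \<mu> g" using g cv_facts(4)[OF m, of g] by (simp add: supp_def)
    ultimately have "0 < real (ht \<mu> (b1 g))" using ht[OF m, of "b1 g"] by (simp add: udeg_def)
    then show ?thesis by auto
  qed
  let ?K = "{C. C \<subseteq> G1 \<union> M \<and> (\<forall>\<mu>\<in>C \<inter> M. \<forall>\<nu>\<in>C \<inter> M. \<mu> = \<nu>)}"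
  have "\<exists>(G'::nat set) \<K>' (b'::nat \<Rightarrow> nat) t' \<rho>.
    subdiv (G1 \<union> M) ?K (\<lambda>g i. if g \<in> M then real (ht g i) else of_bool (b1 g = i)) t1 G' \<K>' (udeg b') t' \<rho> \<and>
    unimod G' \<K>' (udeg b') \<rho> intvec \<and> (\<forall>g\<in>G'. \<forall>x. \<rho> g x \<in> \<int>) \<and>
    (\<forall>g\<in>G'. 0 < t' (b' g) \<and> t' (b' g) \<in> V) \<and> (\<forall>a. a \<notin> b' ` G' \<longrightarrow> t' a = 0)"
    by (rule weighted_fold[OF V finG finM GM hB hn]) (use tz tV in auto)
  then obtain G2 :: "nat set" and \<K>' and b2 :: "nat \<Rightarrow> nat" and t2 \<rho>' where
    F: "subdiv (G1 \<union> M) ?K (\<lambda>g i. if g \<in> M then real (ht g i) else of_bool (b1 g = i)) t1 G2 \<K>' (udeg b2) t2 \<rho>' \<and>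
      unimod G2 \<K>' (udeg b2) \<rho>' intvec \<and> (\<forall>g\<in>G2. \<forall>x. \<rho>' g x \<in> \<int>) \<and>
      (\<forall>g\<in>G2. 0 < t2 (b2 g) \<and> t2 (b2 g) \<in> V) \<and> (\<forall>a. a \<notin> b2 ` G2 \<longrightarrow> t2 a = 0)" by (elim exE) (rule that)
  note f0 = conjunct1[OF F] and fu = conjunct1[OF conjunct2[OF F]] and fi = conjunct1[OF conjunct2[OF conjunct2[OF F]]]
    and fz = conjunct2[OF conjunct2[OF conjunct2[OF F]]]
  have dg: "(\<lambda>g i. if g \<in> M then real (ht g i) else of_bool (b1 g = i)) = degs" by (simp add: degs_def fun_eq_iff)
  have KK: "\<K>s \<subseteq> ?K"
  proof (rule subsetI, intro CollectI conjI ballI)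
    fix C assume C: "C \<in> \<K>s"
    show "C \<subseteq> G1 \<union> M" by (rule \<K>sD(1)[OF C])
    show "\<mu> = \<nu>" if "\<mu> \<in> C \<inter> M" "\<nu> \<in> C \<inter> M" for \<mu> \<nu> by (rule \<K>sD(2)[OF C that])
  qed
  define \<K>2 where "\<K>2 = {K\<in>\<K>'. (\<Union>g\<in>K. supp (\<rho>' g)) \<in> \<K>s}"
  have f: "subdiv (G1 \<union> M) \<K>s degs t1 G2 \<K>2 (udeg b2) t2 \<rho>'"
    unfolding \<K>2_def by (rule subdiv_restrict[OF f0[unfolded dg] KK complexs])
  define \<rho>2 where "\<rho>2 g = comb G1 \<rho>1 (comb (G1 \<union> M) \<rho>s (\<rho>' g))" for g
  have s2: "subdiv G \<K> deg t G2 \<K>2 (udeg b2) t2 \<rho>2"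
    unfolding \<rho>2_def by (rule subdiv_trans[OF s subdiv_trans[OF star_subdiv[OF tz] f]])
  have i2: "integral_on G2 (udeg b2) \<rho>2 (adjoin L m)"
    unfolding \<rho>2_def by (rule integral_trans[OF star_integral f fi])
  have "\<exists>e::nat. 1 \<le> e \<and> e < d \<and> (\<lambda>g. real e * \<alpha> g) \<in> intvec"
    if a: "\<alpha> \<in> kern G2 (udeg b2)" "supp \<alpha> \<in> \<K>2" "comb G2 \<rho>2 \<alpha> \<in> adjoin L m" for \<alpha>
  proof -
    let ?\<beta> = "comb G2 \<rho>' \<alpha>"
    have k: "?\<beta> \<in> kern (G1 \<union> M) degs" by (rule subdivD(6)[OF f a(1)])
    have K: "supp ?\<beta> \<in> \<K>s"
      by (rule complexD(3)[OF complexs subdivD(5)[OF f a(2)] supp_comb_subset'])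
    have "comb G1 \<rho>1 (comb (G1 \<union> M) \<rho>s ?\<beta>) \<in> adjoin L m"
      using a(3) unfolding \<rho>2_def comb_comb[symmetric] .
    from star_exponent[OF k K this] obtain e :: nat where e: "1 \<le> e" "e < d" "(\<lambda>g. real e * ?\<beta> g) \<in> intvec" by blast
    have "(\<lambda>g. real e * \<alpha> g) \<in> kern G2 (udeg b2)" using kern_lin[OF a(1) a(1), of "real e" 0] by simp
    moreover have "supp (\<lambda>g. real e * \<alpha> g) = supp \<alpha>" using e(1) by (auto simp: supp_def)
    then have "supp (\<lambda>g. real e * \<alpha> g) \<in> \<K>'" using a(2) by (simp add: \<K>2_def)
    moreover have "comb G2 \<rho>' (\<lambda>g. real e * \<alpha> g) \<in> intvec"
      using e(3) comb_lin[of G2 \<rho>' "real e" \<alpha> 0 \<alpha>] by simp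
    ultimately have "(\<lambda>g. real e * \<alpha> g) \<in> intvec" using fu by (simp add: unimod_def)
    then show ?thesis using e(1,2) by blast
  qed
  then show ?thesis using s2 i2 fz unfolding sizes_def by blast
qed

section \<open>Reduction of the exponent\<close>

fun lat :: "('r \<Rightarrow> real) set \<Rightarrow> ('r \<Rightarrow> real) list \<Rightarrow> ('r \<Rightarrow> real) set" where
  "lat L [] = L"
| "lat L (m # ms) = adjoin (lat L ms) m"

lemma zmod_lat: "zmod L \<Longrightarrow> zmod (lat L ms)"
  by (induction ms) (auto intro: zmod_adjoin)

lemma lat_base: "L \<subseteq> lat L ms"
proof (induction ms)
  case (Cons m ms)
  then show ?case using adjoin_mono[of "lat L ms" m] by simp
qed simp

lemma adjoin_self: "zmod L \<Longrightarrow> m \<in> adjoin L m"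
  using adjoinI[OF zmod_zero, of L 1 m] by simp

lemma lat_member: "zmod L \<Longrightarrow> m \<in> set ms \<Longrightarrow> m \<in> lat L ms"
proof (induction ms)
  case (Cons a ms)
  then show ?case using adjoin_self[OF zmod_lat, of L a ms] adjoin_mono[of "lat L ms" a] by auto
qed simp

lemma lat_least:
  assumes "zmod H" "L \<subseteq> H" "set ms \<subseteq> H" shows "lat L ms \<subseteq> H"
  using assms(3)
proof (induction ms)
  case (Cons m ms)
  then have "lat L ms \<subseteq> H" "m \<in> H" by auto
  then show ?case using zmod_lin[OF assms(1), of m _ _ 1] by (auto simp: adjoin_def)
qed (use assms in simp)

lemma zmod_kern_int: "zmod (kern G deg \<inter> intvec)"
  unfolding zmod_def
proof (intro conjI ballI allI)
  show "(\<lambda>_. 0) \<in> kern G deg \<inter> intvec" by (simp add: kern_def intvec_def supp_def)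
  fix x y and c :: int assume "x \<in> kern G deg \<inter> intvec" "y \<in> kern G deg \<inter> intvec"
  then show "(\<lambda>g. x g + of_int c * y g) \<in> kern G deg \<inter> intvec"
    using kern_lin[of x G deg y 1 "of_int c"] intvec_lin[of x y 1 "of_int c"] by simp
qed

text \<open>Stated for the full simplex on \<open>G\<close>, so that one subdivision can be
  restricted to any complex on these rays.\<close>

definition resolvable :: "real set \<Rightarrow> nat set \<Rightarrow> (nat \<Rightarrow> nat) \<Rightarrow> (nat \<Rightarrow> real) \<Rightarrow> (nat \<Rightarrow> real) set \<Rightarrow> bool" where
  "resolvable V G b t L \<longleftrightarrow> (\<exists>(G'::nat set) \<K>' (b' :: nat \<Rightarrow> nat) t' \<rho>. subdiv G (Pow G) (udeg b) t G' \<K>' (udeg b') t' \<rho> \<and>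
     unimod G' \<K>' (udeg b') \<rho> L \<and> integral_on G' (udeg b') \<rho> L \<and> sizes V G' b' t')"

lemma comb_unit:
  assumes "finite G" "supp \<alpha> \<subseteq> G"
  shows "comb G (\<lambda>g x. of_bool (x = g)) \<alpha> = \<alpha>"
proof
  fix x
  have "comb G (\<lambda>g x. of_bool (x = g)) \<alpha> x = (\<Sum>g\<in>G. if g = x then \<alpha> x else 0)"
    unfolding comb_def by (intro sum.cong) auto
  also have "\<dots> = \<alpha> x" using assms by (auto simp: supp_def)
  finally show "comb G (\<lambda>g x. of_bool (x = g)) \<alpha> x = \<alpha> x" .
qed

lemma resolvable_trivial:
  assumes finG: "finite G" and sz: "sizes V G b t"
  shows "resolvable V G b t (kern G (udeg b) \<inter> intvec)"
proof -
  let ?r = "\<lambda>g x. of_bool (x = g) :: real"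
  have c: "complex G (Pow G)" using finG by (auto simp: complex_def)
  have sr: "supp (?r g) = {g}" for g by (auto simp: supp_def)
  have cu: "comb G ?r \<alpha> = \<alpha>" if "\<alpha> \<in> kern G (udeg b) \<or> \<alpha> \<in> slice G (Pow G) (udeg b) t" for \<alpha>
    using that by (intro comb_unit[OF finG]) (auto simp: kern_def slice_def)
  have "subdiv G (Pow G) (udeg b) t G (Pow G) (udeg b) t ?r"
    unfolding subdiv_def sr using c cu by auto
  moreover have "unimod G (Pow G) (udeg b) ?r (kern G (udeg b) \<inter> intvec)" "integral_on G (udeg b) ?r (kern G (udeg b) \<inter> intvec)"
    unfolding unimod_def integral_on_def using cu by auto
  ultimately show ?thesis unfolding resolvable_def using sz by blast
qed

text \<open>Subtract the integral parts and correct the degrees of the fractional parts on one ray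
  per label; such a degree is at most \<open>card G\<close>. So each relation has a bounded
  representative modulo integral relations, on the same face.\<close>

lemma kern_reduce:
  fixes G :: "nat set" and b :: "nat \<Rightarrow> nat"
  assumes finG: "finite G" and x: "x \<in> kern G (udeg b)"
  shows "\<exists>y\<in>kern G (udeg b) \<inter> intvec. supp y \<subseteq> supp x \<and> (\<forall>g. \<bar>x g - y g\<bar> \<le> real (card G) + 1)"
proof -
  define c where "c g = frac (x g)" for g
  define n where "n g = real_of_int \<lfloor>x g\<rfloor>" for g
  have cn: "c g = x g - n g" for g by (simp add: c_def n_def frac_def)
  have sc: "supp c \<subseteq> supp x" and sn: "supp n \<subseteq> supp x" by (auto simp: supp_def c_def n_def)
  have xG: "supp x \<subseteq> G" using x by (simp add: kern_def)
  have ni: "n \<in> intvec" by (simp add: intvec_def n_def)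
  have dc: "bdegree G b c a = - bdegree G b n a" for a
    using x bdegree_diff[of G b x n a] by (simp add: kern_udeg_iff cn[abs_def])
  have "\<exists>y\<in>intvec. supp y \<subseteq> supp x \<and> (\<forall>a. bdegree G b y a = bdegree G b c a) \<and> (\<forall>g. \<bar>y g\<bar> \<le> \<bar>bdegree G b c (b g)\<bar>)"
  proof (rule integral_representative[OF finG _ _ xG])
    show "bdegree G b c a \<in> \<int>" for a using dc bdegree_int[OF ni, of G b a] by simp
    show "\<exists>g\<in>supp x. b g = a" if "bdegree G b c a \<noteq> 0" for a using bdegree_nonzero[OF that] sc by blast
  qed
  then obtain y where y: "y \<in> intvec" "supp y \<subseteq> supp x" "\<And>a. bdegree G b y a = bdegree G b c a"
    "\<And>g. \<bar>y g\<bar> \<le> \<bar>bdegree G b c (b g)\<bar>" by blast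
  have cb: "0 \<le> c g" "c g \<le> 1" for g using frac_lt_1[of "x g"] by (auto simp: c_def)
  have bd: "\<bar>bdegree G b c a\<bar> \<le> real (card G)" for a
  proof -
    have "bdegree G b c a \<le> (\<Sum>g\<in>G. 1)" unfolding bdegree_def using cb by (intro sum_mono) (auto simp: udeg_def)
    then show ?thesis using bdegree_nonneg[of c G b a] cb(1) by simp
  qed
  let ?y = "\<lambda>g. n g + y g"
  have "supp ?y \<subseteq> supp n \<union> supp y" by (auto simp: supp_def)
  then have s: "supp ?y \<subseteq> supp x" using sn y(2) by blast
  have "?y \<in> kern G (udeg b)" using s xG y(3) dc by (simp add: kern_udeg_iff bdegree_add)
  moreover have "?y \<in> intvec" using ni y(1) by (simp add: intvec_def)
  moreover have "\<bar>x g - ?y g\<bar> \<le> real (card G) + 1" for g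
  proof -
    have "x g - ?y g = c g - y g" by (simp add: cn)
    then show ?thesis using cb[of g] y(4)[of g] bd[of "b g"] by linarith
  qed
  ultimately show ?thesis using s by blast
qed

lemma finite_bounded_fractions:
  assumes finG: "finite G"
  shows "finite {x :: nat \<Rightarrow> real. supp x \<subseteq> G \<and> (\<forall>g. \<bar>x g\<bar> \<le> N) \<and> (\<exists>e::nat. 1 \<le> e \<and> e \<le> d \<and> (\<lambda>g. real e * x g) \<in> intvec)}"
proof -
  define Y where "Y = (\<lambda>(e,z). real_of_int z / real e) ` ({1..d} \<times> {- \<lceil>real d * N\<rceil>..\<lceil>real d * N\<rceil>})"
  have "x g \<in> Y" if x: "\<forall>g. \<bar>x g\<bar> \<le> N" "1 \<le> e" "e \<le> d" "(\<lambda>g. real e * x g) \<in> intvec" for x g and e :: nat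
  proof -
    have "real e * x g \<in> \<int>" using x(4) by (simp add: intvec_def)
    then obtain z where z: "real e * x g = of_int z" by (rule Ints_cases)
    have "\<bar>real_of_int z\<bar> = real e * \<bar>x g\<bar>" unfolding z[symmetric] by (simp add: abs_mult)
    also have "\<dots> \<le> real d * N" using x by (intro mult_mono) auto
    finally have "z \<in> {- \<lceil>real d * N\<rceil>..\<lceil>real d * N\<rceil>}" by (simp add: abs_le_iff) linarith
    moreover have "x g = real_of_int z / real e" using z x(2) by (simp add: field_simps)
    ultimately show ?thesis unfolding Y_def using x(2,3) by (intro image_eqI[of _ _ "(e,z)"]) auto
  qed
  then have "{x. supp x \<subseteq> G \<and> (\<forall>g. \<bar>x g\<bar> \<le> N) \<and> (\<exists>e::nat. 1 \<le> e \<and> e \<le> d \<and> (\<lambda>g. real e * x g) \<in> intvec)}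
     \<subseteq> {x. \<forall>g. (g \<in> G \<longrightarrow> x g \<in> Y) \<and> (g \<notin> G \<longrightarrow> x g = 0)}"
    by (auto simp: supp_def)
  moreover have "finite {x :: nat \<Rightarrow> real. \<forall>g. (g \<in> G \<longrightarrow> x g \<in> Y) \<and> (g \<notin> G \<longrightarrow> x g = 0)}"
    by (rule finite_set_of_finite_funs[OF finG]) (simp add: Y_def)
  ultimately show ?thesis by (rule finite_subset)
qed

lemma zmod_preimage: "zmod L \<Longrightarrow> zmod {\<beta>. comb G \<rho> \<beta> \<in> L}"
  unfolding zmod_def
proof (elim conjE, intro conjI ballI allI)
  assume L: "(\<lambda>_. 0) \<in> L" "\<forall>x\<in>L. \<forall>y\<in>L. \<forall>c::int. (\<lambda>g. x g + of_int c * y g) \<in> L"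
  have "comb G \<rho> (\<lambda>_. 0) = (\<lambda>_. 0)" by (simp add: comb_def fun_eq_iff)
  then show "(\<lambda>_. 0) \<in> {\<beta>. comb G \<rho> \<beta> \<in> L}" using L(1) by simp
  fix x y and c :: int assume "x \<in> {\<beta>. comb G \<rho> \<beta> \<in> L}" "y \<in> {\<beta>. comb G \<rho> \<beta> \<in> L}"
  then show "(\<lambda>g. x g + of_int c * y g) \<in> {\<beta>. comb G \<rho> \<beta> \<in> L}"
    using L(2) comb_lin[of G \<rho> 1 x "of_int c" y] by simp
qed

text \<open>The groups \<open>{x \<in> kern (K) | comb x \<in> L}\<close> of the cells \<open>K\<close> generate a single lattice on the free
  vector space on the rays. So a subdivision of the full simplex, unimodular for this lattice, resolves
  all cells at once.\<close>

lemma resolve_cells: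
  fixes \<K>2 :: "nat set set"
  assumes finG: "finite G2" and c2: "complex G2 \<K>2" and i2: "integral_on G2 (udeg b2) \<rho>2 L" and L: "zmod L"
    and ex: "\<And>\<alpha>. \<alpha> \<in> kern G2 (udeg b2) \<Longrightarrow> supp \<alpha> \<in> \<K>2 \<Longrightarrow> comb G2 \<rho>2 \<alpha> \<in> L \<Longrightarrow>
      \<exists>e::nat. 1 \<le> e \<and> e \<le> q \<and> (\<lambda>g. real e * \<alpha> g) \<in> intvec"
    and Q: "\<And>ms. (\<And>m. m \<in> set ms \<Longrightarrow> m \<in> kern G2 (udeg b2) \<and> (\<exists>e::nat. 1 \<le> e \<and> e \<le> q \<and> (\<lambda>g. real e * m g) \<in> intvec)) \<Longrightarrow>
      resolvable V G2 b2 t2 (lat (kern G2 (udeg b2) \<inter> intvec) ms)"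
  shows "\<exists>(G3::nat set) \<K>3 (b3::nat \<Rightarrow> nat) t3 \<rho>3. subdiv G2 \<K>2 (udeg b2) t2 G3 \<K>3 (udeg b3) t3 \<rho>3 \<and>
    unimod G3 \<K>3 (udeg b3) (\<lambda>g. comb G2 \<rho>2 (\<rho>3 g)) L \<and> integral_on G3 (udeg b3) (\<lambda>g. comb G2 \<rho>2 (\<rho>3 g)) L \<and> sizes V G3 b3 t3"
proof -
  \<comment> \<open>Bounded representatives, taken over all cells. Their orders are at most
    \<open>q\<close>, so there are finitely many of them, and they can serve as generators of one
    lattice.\<close>
  define X where "X = {x. x \<in> kern G2 (udeg b2) \<and> supp x \<in> \<K>2 \<and> comb G2 \<rho>2 x \<in> L \<and> (\<forall>g. \<bar>x g\<bar> \<le> real (card G2) + 1)}"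
  have "X \<subseteq> {x. supp x \<subseteq> G2 \<and> (\<forall>g. \<bar>x g\<bar> \<le> real (card G2) + 1) \<and> (\<exists>e::nat. 1 \<le> e \<and> e \<le> q \<and> (\<lambda>g. real e * x g) \<in> intvec)}"
    using ex complexD(2)[OF c2] by (auto simp: X_def)
  then have "finite X" using finite_bounded_fractions[OF finG] finite_subset by blast
  then obtain xs where xs: "set xs = X" using finite_list by blast
  define L0 where "L0 = kern G2 (udeg b2) \<inter> intvec"
  have L0: "zmod L0" unfolding L0_def by (rule zmod_kern_int)
  have "resolvable V G2 b2 t2 (lat L0 xs)"
    unfolding L0_def by (rule Q) (use xs ex in \<open>auto simp: X_def\<close>)
  then obtain G3 :: "nat set" and \<K>3 and b3 :: "nat \<Rightarrow> nat" and t3 \<rho>3 where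
    R: "subdiv G2 (Pow G2) (udeg b2) t2 G3 \<K>3 (udeg b3) t3 \<rho>3 \<and> unimod G3 \<K>3 (udeg b3) \<rho>3 (lat L0 xs) \<and>
      integral_on G3 (udeg b3) \<rho>3 (lat L0 xs) \<and> sizes V G3 b3 t3"
    unfolding resolvable_def by (elim exE) (rule that)
  note s0 = conjunct1[OF R] and u3 = conjunct1[OF conjunct2[OF R]] and i3 = conjunct1[OF conjunct2[OF conjunct2[OF R]]]
    and sz3 = conjunct2[OF conjunct2[OF conjunct2[OF R]]]
  define \<K>3' where "\<K>3' = {K\<in>\<K>3. (\<Union>g\<in>K. supp (\<rho>3 g)) \<in> \<K>2}"
  have "\<K>2 \<subseteq> Pow G2" using complexD(2)[OF c2] by blast
  then have s3: "subdiv G2 \<K>2 (udeg b2) t2 G3 \<K>3' (udeg b3) t3 \<rho>3"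
    unfolding \<K>3'_def by (rule subdiv_restrict[OF s0 _ c2])
  have "unimod G3 \<K>3' (udeg b3) (\<lambda>g. comb G2 \<rho>2 (\<rho>3 g)) L"
    unfolding unimod_def comb_comb[symmetric]
  proof (intro ballI impI)
    fix \<alpha> assume a: "\<alpha> \<in> kern G3 (udeg b3)" "supp \<alpha> \<in> \<K>3'" "comb G2 \<rho>2 (comb G3 \<rho>3 \<alpha>) \<in> L"
    let ?\<beta> = "comb G3 \<rho>3 \<alpha>"
    have k: "?\<beta> \<in> kern G2 (udeg b2)" by (rule subdivD(6)[OF s3 a(1)])
    have K: "supp ?\<beta> \<in> \<K>2" by (rule complexD(3)[OF c2 subdivD(5)[OF s3 a(2)] supp_comb_subset'])
    obtain y where y: "y \<in> L0" "supp y \<subseteq> supp ?\<beta>" "\<And>g. \<bar>?\<beta> g - y g\<bar> \<le> real (card G2) + 1"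
      using kern_reduce[OF finG k] unfolding L0_def by blast
    have yk: "y \<in> kern G2 (udeg b2)" "y \<in> intvec" using y(1) by (auto simp: L0_def)
    let ?x = "\<lambda>g. 1 * ?\<beta> g + (-1) * y g"
    have "?x \<in> kern G2 (udeg b2)" by (rule kern_lin[OF k yk(1)])
    moreover have "supp ?x \<subseteq> supp ?\<beta>" using y(2) by (auto simp: supp_def)
    then have "supp ?x \<in> \<K>2" by (rule complexD(3)[OF c2 K])
    moreover have "comb G2 \<rho>2 y \<in> L" using i2 yk by (simp add: integral_on_def)
    then have "comb G2 \<rho>2 ?x \<in> L" unfolding comb_lin using zmod_add_mult[OF L a(3), of "comb G2 \<rho>2 y" "-1"] by simp
    ultimately have "?x \<in> X" using y(3) by (simp add: X_def)
    then have "?x \<in> lat L0 xs" by (intro lat_member[OF L0]) (simp add: xs)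
    moreover have "y \<in> lat L0 xs" using y(1) lat_base by blast
    ultimately have "(\<lambda>g. ?x g + of_int 1 * y g) \<in> lat L0 xs" by (rule zmod_add_mult[OF zmod_lat[OF L0]])
    then have "?\<beta> \<in> lat L0 xs" by simp
    moreover have "supp \<alpha> \<in> \<K>3" using a(2) by (simp add: \<K>3'_def)
    ultimately show "\<alpha> \<in> intvec" using u3 a(1) by (simp add: unimod_def)
  qed
  moreover have "integral_on G3 (udeg b3) (\<lambda>g. comb G2 \<rho>2 (\<rho>3 g)) L"
    unfolding integral_on_def comb_comb[symmetric]
  proof (intro ballI impI)
    fix \<alpha> assume a: "\<alpha> \<in> kern G3 (udeg b3)" "\<alpha> \<in> intvec"
    have "lat L0 xs \<subseteq> {\<beta>. comb G2 \<rho>2 \<beta> \<in> L}"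
      by (rule lat_least[OF zmod_preimage[OF L]]) (use i2 xs in \<open>auto simp: L0_def integral_on_def X_def\<close>)
    then show "comb G2 \<rho>2 (comb G3 \<rho>3 \<alpha>) \<in> L" using i3 a by (auto simp: integral_on_def)
  qed
  ultimately show ?thesis using s3 sz3 by blast
qed

text \<open>The outer induction is on the bound \<open>q\<close> for the orders, the inner one on
  the generators. After the star subdivision for a generator of order \<open>d \<le> q\<close>,
  cells carry relations of order at most \<open>d - 1\<close> only. Possibly there are many more
  generators now, but the outer hypothesis resolves them all, applied to the full simplex on the new
  rays.\<close>

theorem resolve:
  assumes V: "rat_subspace V" and finG: "finite G" and sz: "sizes V G b t"
    and ms: "\<And>m. m \<in> set ms \<Longrightarrow> m \<in> kern G (udeg b) \<and> (\<exists>e::nat. 1 \<le> e \<and> e \<le> q \<and> (\<lambda>g. real e * m g) \<in> intvec)"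
  shows "resolvable V G b t (lat (kern G (udeg b) \<inter> intvec) ms)"
  using finG sz ms
proof (induction q arbitrary: G b t ms rule: less_induct)
  case (less q)
  show ?case
    using less.prems(3)
  proof (induction ms)
    case Nil
    then show ?case using resolvable_trivial[OF less.prems(1,2)] by simp
  next
    case (Cons m ms)
    define L0 where "L0 = kern G (udeg b) \<inter> intvec"
    define L where "L = lat L0 ms"
    have L0: "zmod L0" unfolding L0_def by (rule zmod_kern_int)
    have L: "zmod L" unfolding L_def by (rule zmod_lat[OF L0])
    have r: "resolvable V G b t L" unfolding L_def L0_def by (rule Cons.IH) (use Cons.prems in auto)
    obtain d :: nat where d: "1 \<le> d" "d \<le> q" "(\<lambda>g. real d * m g) \<in> intvec" and mk: "m \<in> kern G (udeg b)"
      using Cons.prems[of m] by auto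
    have "(\<lambda>g. real d * m g) \<in> kern G (udeg b)" using kern_lin[OF mk mk, of "real d" 0] by simp
    then have "(\<lambda>g. real d * m g) \<in> L0" using d(3) by (simp add: L0_def)
    then have dm: "(\<lambda>g. real d * m g) \<in> L" using lat_base[of L0 ms] by (auto simp: L_def)
    show ?case
    proof (cases "d = 1")
      case True
      then have "m \<in> L" using dm by simp
      then have "adjoin L m \<subseteq> L" using zmod_lin[OF L, of m _ _ 1] by (auto simp: adjoin_def)
      then have "adjoin L m = L" using adjoin_mono by blast
      then show ?thesis using r by (simp add: L_def L0_def)
    next
      case False
      then have d2: "2 \<le> d" using d(1) by simp
      obtain G1 :: "nat set" and \<K>1 and b1 :: "nat \<Rightarrow> nat" and t1 \<rho>1 where
        R: "subdiv G (Pow G) (udeg b) t G1 \<K>1 (udeg b1) t1 \<rho>1 \<and> unimod G1 \<K>1 (udeg b1) \<rho>1 L \<and>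
          integral_on G1 (udeg b1) \<rho>1 L \<and> sizes V G1 b1 t1"
        using r unfolding resolvable_def by (elim exE) (rule that)
      note s1 = conjunct1[OF R] and u1 = conjunct1[OF conjunct2[OF R]] and i1 = conjunct1[OF conjunct2[OF conjunct2[OF R]]]
        and sz1 = conjunct2[OF conjunct2[OF conjunct2[OF R]]]
      obtain G2 :: "nat set" and \<K>2 and b2 :: "nat \<Rightarrow> nat" and t2 \<rho>2 where
        R2: "subdiv G (Pow G) (udeg b) t G2 \<K>2 (udeg b2) t2 \<rho>2 \<and>
          integral_on G2 (udeg b2) \<rho>2 (adjoin L m) \<and> sizes V G2 b2 t2 \<and>
          (\<forall>\<alpha>\<in>kern G2 (udeg b2). supp \<alpha> \<in> \<K>2 \<longrightarrow> comb G2 \<rho>2 \<alpha> \<in> adjoin L m \<longrightarrow>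
            (\<exists>e::nat. 1 \<le> e \<and> e < d \<and> (\<lambda>g. real e * \<alpha> g) \<in> intvec))"
        using star_step[OF V s1 u1 i1 sz1 L d2 dm] by (elim exE) (rule that)
      note s2 = conjunct1[OF R2] and i2 = conjunct1[OF conjunct2[OF R2]] and sz2 = conjunct1[OF conjunct2[OF conjunct2[OF R2]]]
        and ex2 = conjunct2[OF conjunct2[OF conjunct2[OF R2]]]
      have c2: "complex G2 \<K>2" by (rule subdivD(1)[OF s2])
      have fin2: "finite G2" by (rule complexD(1)[OF c2])
      have "\<exists>(G3::nat set) \<K>3 (b3::nat \<Rightarrow> nat) t3 \<rho>3. subdiv G2 \<K>2 (udeg b2) t2 G3 \<K>3 (udeg b3) t3 \<rho>3 \<and>
        unimod G3 \<K>3 (udeg b3) (\<lambda>g. comb G2 \<rho>2 (\<rho>3 g)) (adjoin L m) \<and>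
        integral_on G3 (udeg b3) (\<lambda>g. comb G2 \<rho>2 (\<rho>3 g)) (adjoin L m) \<and> sizes V G3 b3 t3"
      proof (rule resolve_cells[OF fin2 c2 i2 zmod_adjoin[OF L], where q = "d - 1"])
        show "\<exists>e::nat. 1 \<le> e \<and> e \<le> d - 1 \<and> (\<lambda>g. real e * \<alpha> g) \<in> intvec"
          if a: "\<alpha> \<in> kern G2 (udeg b2)" "supp \<alpha> \<in> \<K>2" "comb G2 \<rho>2 \<alpha> \<in> adjoin L m" for \<alpha>
        proof -
          obtain e :: nat where "1 \<le> e" "e < d" "(\<lambda>g. real e * \<alpha> g) \<in> intvec"
            using bspec[OF ex2 a(1)] a(2,3) by auto
          then show ?thesis by (intro exI[of _ e]) auto
        qed
        have dq: "d - 1 < q" using d d2 by simp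
        show "resolvable V G2 b2 t2 (lat (kern G2 (udeg b2) \<inter> intvec) ms)"
          if "\<And>m. m \<in> set ms \<Longrightarrow> m \<in> kern G2 (udeg b2) \<and> (\<exists>e::nat. 1 \<le> e \<and> e \<le> d - 1 \<and> (\<lambda>g. real e * m g) \<in> intvec)" for ms
          by (rule less.IH[OF dq fin2 sz2 that])
      qed
      then obtain G3 :: "nat set" and \<K>3 and b3 :: "nat \<Rightarrow> nat" and t3 \<rho>3 where
        R3: "subdiv G2 \<K>2 (udeg b2) t2 G3 \<K>3 (udeg b3) t3 \<rho>3 \<and>
        unimod G3 \<K>3 (udeg b3) (\<lambda>g. comb G2 \<rho>2 (\<rho>3 g)) (adjoin L m) \<and>
        integral_on G3 (udeg b3) (\<lambda>g. comb G2 \<rho>2 (\<rho>3 g)) (adjoin L m) \<and> sizes V G3 b3 t3"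
        by (elim exE) (rule that)
      have "subdiv G (Pow G) (udeg b) t G3 \<K>3 (udeg b3) t3 (\<lambda>g. comb G2 \<rho>2 (\<rho>3 g))"
        by (rule subdiv_trans[OF s2 conjunct1[OF R3]])
      then have "resolvable V G b t (adjoin L m)" unfolding resolvable_def using conjunct2[OF R3] by blast
      then show ?thesis by (simp add: L_def L0_def)
    qed
  qed
qed

section \<open>Pulling\<close>

text \<open>The coordinates are the values of the forms of a hyperplane arrangement:
  \<open>r\<close> lies in the closed cell having \<open>z\<close> in its relative interior.\<close>

definition incell :: "('f \<Rightarrow> real) \<Rightarrow> ('f \<Rightarrow> real) \<Rightarrow> bool" where
  "incell z r \<longleftrightarrow> (\<forall>f. (z f = 0 \<longrightarrow> r f = 0) \<and> 0 \<le> z f * r f)"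

definition conformal :: "('g \<Rightarrow> 'f \<Rightarrow> real) \<Rightarrow> 'g set \<Rightarrow> bool" where
  "conformal \<rho> K \<longleftrightarrow> (\<forall>g\<in>K. \<forall>h\<in>K. \<forall>f. 0 \<le> \<rho> g f * \<rho> h f)"

text \<open>For conformal \<open>K\<close> this is membership in the smallest cell containing the
  rays of \<open>K\<close>, the cell of any combination of them with positive weights.\<close>

definition cell_contains :: "('g \<Rightarrow> 'f \<Rightarrow> real) \<Rightarrow> 'g set \<Rightarrow> ('f \<Rightarrow> real) \<Rightarrow> bool" where
  "cell_contains \<rho> K r \<longleftrightarrow> (\<forall>f. (r f \<noteq> 0 \<longrightarrow> (\<exists>g\<in>K. \<rho> g f \<noteq> 0)) \<and> (\<forall>g\<in>K. 0 \<le> \<rho> g f * r f))"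

lemma same_sign_trans:
  fixes x y z :: real
  assumes "y \<noteq> 0" "0 \<le> x * y" "0 \<le> y * z" shows "0 \<le> x * z"
  using assms by (auto simp: zero_le_mult_iff)

lemma incell_trans: "incell x y \<Longrightarrow> incell y z \<Longrightarrow> incell x z"
  unfolding incell_def using same_sign_trans by (metis mult_zero_right order_refl)

lemma conformal_comb:
  assumes G: "finite G" "supp \<alpha> \<subseteq> G" and pos: "\<And>g. 0 \<le> \<alpha> g" and c: "conformal \<rho> (supp \<alpha>)"
  shows "comb G \<rho> \<alpha> f = 0 \<longleftrightarrow> (\<forall>g\<in>supp \<alpha>. \<rho> g f = 0)" "g \<in> supp \<alpha> \<Longrightarrow> 0 \<le> comb G \<rho> \<alpha> f * \<rho> g f"
proof -
  have ge: "0 \<le> \<alpha> h * \<rho> h f * \<rho> g f" if "g \<in> supp \<alpha>" for g h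
  proof (cases "h \<in> supp \<alpha>")
    case True
    then have "0 \<le> \<rho> h f * \<rho> g f" using c that by (auto simp: conformal_def)
    then show ?thesis using pos[of h] by (simp add: mult.assoc)
  qed (simp add: supp_def)
  have e: "comb G \<rho> \<alpha> f * \<rho> g f = (\<Sum>h\<in>G. \<alpha> h * \<rho> h f * \<rho> g f)" for g
    by (simp add: comb_def sum_distrib_right)
  show p: "0 \<le> comb G \<rho> \<alpha> f * \<rho> g f" if "g \<in> supp \<alpha>" for g
    unfolding e by (rule sum_nonneg) (use ge that in auto)
  have "\<rho> g f = 0" if "g \<in> supp \<alpha>" "comb G \<rho> \<alpha> f = 0" for g
  proof -
    have "(\<Sum>h\<in>G. \<alpha> h * \<rho> h f * \<rho> g f) = 0" using e[of g] that(2) by simp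
    then have "\<alpha> g * \<rho> g f * \<rho> g f = 0"
      using sum_nonneg_eq_0_iff[OF G(1), of "\<lambda>h. \<alpha> h * \<rho> h f * \<rho> g f"] ge that(1) G(2) by auto
    then show ?thesis using that(1) by (simp add: supp_def)
  qed
  moreover have "comb G \<rho> \<alpha> f = 0" if "\<forall>g\<in>supp \<alpha>. \<rho> g f = 0"
    unfolding comb_def by (rule sum.neutral) (use that in \<open>auto simp: supp_def\<close>)
  ultimately show "comb G \<rho> \<alpha> f = 0 \<longleftrightarrow> (\<forall>g\<in>supp \<alpha>. \<rho> g f = 0)" by blast
qed

lemma incell_comb:
  assumes "finite G" "supp \<alpha> \<subseteq> G" "\<And>g. 0 \<le> \<alpha> g" "conformal \<rho> (supp \<alpha>)"
  shows "incell (comb G \<rho> \<alpha>) r \<longleftrightarrow> cell_contains \<rho> (supp \<alpha>) r"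
proof -
  note cc = conformal_comb[OF assms]
  have "((comb G \<rho> \<alpha> f = 0 \<longrightarrow> r f = 0) \<and> 0 \<le> comb G \<rho> \<alpha> f * r f) \<longleftrightarrow>
    ((r f \<noteq> 0 \<longrightarrow> (\<exists>g\<in>supp \<alpha>. \<rho> g f \<noteq> 0)) \<and> (\<forall>g\<in>supp \<alpha>. 0 \<le> \<rho> g f * r f))" (is "?A \<longleftrightarrow> ?B") for f
  proof
    assume A: ?A
    show ?B
    proof (intro conjI ballI impI)
      show "\<exists>g\<in>supp \<alpha>. \<rho> g f \<noteq> 0" if "r f \<noteq> 0" using cc(1)[of f] A that by blast
      show "0 \<le> \<rho> g f * r f" if "g \<in> supp \<alpha>" for g
      proof (cases "comb G \<rho> \<alpha> f = 0")
        case False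
        have "0 \<le> \<rho> g f * comb G \<rho> \<alpha> f" using cc(2)[OF that, of f] by (simp add: mult.commute)
        then show ?thesis using same_sign_trans[OF False] A by blast
      qed (use A in simp)
    qed
  next
    assume B: ?B
    show ?A
    proof
      show r: "comb G \<rho> \<alpha> f = 0 \<longrightarrow> r f = 0" using B cc(1)[of f] by blast
      show "0 \<le> comb G \<rho> \<alpha> f * r f"
      proof (cases "r f = 0")
        case False
        then obtain g where g: "g \<in> supp \<alpha>" "\<rho> g f \<noteq> 0" using B by blast
        show ?thesis by (rule same_sign_trans[OF g(2) cc(2)[OF g(1)]]) (use B g in blast)
      qed simp
    qed
  qed
  then show ?thesis unfolding incell_def cell_contains_def by blast
qed

lemma cell_contains_mono:
  assumes c: "conformal \<rho> K" and sub: "K' \<subseteq> K" and r: "cell_contains \<rho> K' r"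
  shows "cell_contains \<rho> K r"
  unfolding cell_contains_def
proof (intro allI conjI ballI impI)
  show ex: "\<exists>g\<in>K. \<rho> g f \<noteq> 0" if "r f \<noteq> 0" for f using r sub that unfolding cell_contains_def by blast
  show "0 \<le> \<rho> g f * r f" if "g \<in> K" for f g
  proof (cases "r f = 0")
    case False
    then obtain h where h: "h \<in> K'" "\<rho> h f \<noteq> 0" using r by (auto simp: cell_contains_def)
    have "0 \<le> \<rho> g f * \<rho> h f" using c that h(1) sub by (auto simp: conformal_def)
    moreover have "0 \<le> \<rho> h f * r f" using r h(1) by (auto simp: cell_contains_def)
    ultimately show ?thesis by (rule same_sign_trans[OF h(2)])
  qed simp
qed

text \<open>The pulling triangulation: every point is moved away from the first ray lying in its cell until
  the cell changes. \<open>pulled\<close> describes the supports of the representations which arise.\<close>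

locale pulling =
  fixes N :: nat and \<rho> :: "nat \<Rightarrow> 'f \<Rightarrow> real" and I :: "'f set" and Z :: "('f \<Rightarrow> real) set"
  assumes finI: "finite I" and outside: "z \<in> Z \<Longrightarrow> f \<notin> I \<Longrightarrow> z f = 0"
    and ray_nonzero: "g < N \<Longrightarrow> \<exists>f. \<rho> g f \<noteq> 0"
    and step: "z \<in> Z \<Longrightarrow> g < N \<Longrightarrow> 0 \<le> c \<Longrightarrow> incell z (\<lambda>f. z f - c * \<rho> g f) \<Longrightarrow> (\<lambda>f. z f - c * \<rho> g f) \<in> Z"
    and ray: "z \<in> Z \<Longrightarrow> z f \<noteq> 0 \<Longrightarrow> \<exists>g<N. incell z (\<rho> g)"
begin

text \<open>In increasing order, each \<open>g\<close> is the first ray in the cell of what is still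
  to be represented, and this cell has been left for one without \<open>g\<close> once
  \<open>g\<close> is subtracted. The conditions speak about tails of \<open>K\<close> only and are
  inherited by subsets, since a smaller tail spans a smaller cell.\<close>

definition pulled :: "nat set set" where
  "pulled = {K. K \<subseteq> {..<N} \<and> conformal \<rho> K \<and> (\<forall>g\<in>K. (\<forall>h<N. cell_contains \<rho> {x\<in>K. g \<le> x} (\<rho> h) \<longrightarrow> g \<le> h) \<and>
     \<not> cell_contains \<rho> {x\<in>K. g < x} (\<rho> g))}"

lemma conformal_subset: "conformal \<rho> K \<Longrightarrow> K' \<subseteq> K \<Longrightarrow> conformal \<rho> K'"
  by (auto simp: conformal_def)

lemma complex_pulled: "complex {..<N} pulled"
  unfolding complex_def
proof (intro conjI ballI allI impI)
  show "K \<subseteq> {..<N}" if "K \<in> pulled" for K using that by (simp add: pulled_def)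
  show "K' \<in> pulled" if K: "K \<in> pulled" "K' \<subseteq> K" for K K'
  proof -
    have c: "conformal \<rho> K" using K(1) by (simp add: pulled_def)
    have m: "cell_contains \<rho> {x\<in>K. P x} r" if "cell_contains \<rho> {x\<in>K'. P x} r" for P r
      by (rule cell_contains_mono[OF conformal_subset[OF c] _ that]) (use K in auto)
    have "\<forall>g\<in>K. (\<forall>h<N. cell_contains \<rho> {x\<in>K. g \<le> x} (\<rho> h) \<longrightarrow> g \<le> h) \<and> \<not> cell_contains \<rho> {x\<in>K. g < x} (\<rho> g)"
      "K \<subseteq> {..<N}" using K(1) by (simp_all add: pulled_def)
    then show ?thesis unfolding pulled_def using m conformal_subset[OF c K(2)] K(2) by blast
  qed
qed simp

lemma pulled_exists:
  "z \<in> Z \<Longrightarrow> \<exists>\<alpha>. (\<forall>g. 0 \<le> \<alpha> g) \<and> supp \<alpha> \<in> pulled \<and> comb {..<N} \<rho> \<alpha> = z"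
proof (induction "card (supp z)" arbitrary: z rule: less_induct)
  case less
  have sI: "supp z \<subseteq> I" using outside[OF less.prems] by (auto simp: supp_def)
  have fins: "finite (supp z)" by (rule finite_subset[OF sI finI])
  show ?case
  proof (cases "supp z = {}")
    case True
    then have "comb {..<N} \<rho> (\<lambda>_. 0) = z" by (auto simp: comb_def supp_def)
    moreover have "supp (\<lambda>_. 0 :: real) \<in> pulled" by (simp add: supp_def pulled_def conformal_def)
    ultimately show ?thesis by (intro exI[of _ "\<lambda>_. 0"]) simp
  next
    case False
    then have "\<exists>g. g < N \<and> incell z (\<rho> g)" using ray[OF less.prems] by (auto simp: supp_def)
    define g where "g = (LEAST g. g < N \<and> incell z (\<rho> g))"
    have g: "g < N" "incell z (\<rho> g)" unfolding g_def using LeastI_ex[OF \<open>\<exists>g. g < N \<and> incell z (\<rho> g)\<close>] by auto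
    have least: "g \<le> h" if "h < N" "incell z (\<rho> h)" for h unfolding g_def by (rule Least_le) (use that in simp)
    have sg: "supp (\<rho> g) \<subseteq> supp z" using g(2) by (auto simp: incell_def supp_def)
    have ne: "supp (\<rho> g) \<noteq> {}" using ray_nonzero[OF g(1)] by (auto simp: supp_def)
    have fg: "finite (supp (\<rho> g))" by (rule finite_subset[OF sg fins])
    \<comment> \<open>The longest step that keeps all signs. It ends where a coordinate in the
      support of \<open>\<rho> g\<close> becomes \<open>0\<close>; the new cell is a proper face not
      containing \<open>g\<close>.\<close>
    define c where "c = Min ((\<lambda>f. z f / \<rho> g f) ` supp (\<rho> g))"
    have cle: "c \<le> z f / \<rho> g f" if "f \<in> supp (\<rho> g)" for f unfolding c_def using fg that by (intro Min_le) auto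
    have "c \<in> (\<lambda>f. z f / \<rho> g f) ` supp (\<rho> g)" unfolding c_def using fg ne by (intro Min_in) auto
    then obtain f0 where f0: "f0 \<in> supp (\<rho> g)" "c = z f0 / \<rho> g f0" by blast
    have c0: "0 \<le> c" using g(2) f0(2) unfolding incell_def by (auto simp: zero_le_divide_iff zero_le_mult_iff)
    define z' where "z' = (\<lambda>f. z f - c * \<rho> g f)"
    have cell: "incell z z'"
      unfolding incell_def
    proof (intro allI conjI impI)
      fix f
      show "z' f = 0" if "z f = 0" using g(2) that by (simp add: incell_def z'_def)
      show "0 \<le> z f * z' f"
      proof (cases "\<rho> g f = 0")
        case False
        have "z' f = \<rho> g f * (z f / \<rho> g f - c)" using False by (simp add: z'_def field_simps)
        then have "z f * z' f = (z f * \<rho> g f) * (z f / \<rho> g f - c)" by (simp only: mult.assoc)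
        moreover have "0 \<le> z f * \<rho> g f" using g(2) by (simp add: incell_def)
        moreover have "0 \<le> z f / \<rho> g f - c" using cle[of f] False by (simp add: supp_def)
        ultimately show ?thesis by (simp only: mult_nonneg_nonneg)
      qed (simp add: z'_def)
    qed
    have z'Z: "z' \<in> Z" unfolding z'_def by (rule step[OF less.prems g(1) c0]) (use cell in \<open>simp add: z'_def\<close>)
    have zf0: "z' f0 = 0" "\<rho> g f0 \<noteq> 0" using f0 by (auto simp: z'_def supp_def)
    have "supp z' \<subseteq> supp z" using cell by (auto simp: incell_def supp_def)
    moreover have "f0 \<in> supp z" "f0 \<notin> supp z'" using f0(1) sg zf0 by (auto simp: supp_def)
    ultimately have "card (supp z') < card (supp z)" by (intro psubset_card_mono fins) blast
    then obtain \<beta> where b: "\<And>g. 0 \<le> \<beta> g" "supp \<beta> \<in> pulled" "comb {..<N} \<rho> \<beta> = z'"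
      using less.hyps[OF _ z'Z] by blast
    have bN: "supp \<beta> \<subseteq> {..<N}" and bc: "conformal \<rho> (supp \<beta>)"
      and bp: "\<And>x. x \<in> supp \<beta> \<Longrightarrow> (\<forall>h<N. cell_contains \<rho> {y\<in>supp \<beta>. x \<le> y} (\<rho> h) \<longrightarrow> x \<le> h) \<and>
         \<not> cell_contains \<rho> {y\<in>supp \<beta>. x < y} (\<rho> x)" using b(2) by (simp_all add: pulled_def)
    have inb: "incell z' r \<longleftrightarrow> cell_contains \<rho> (supp \<beta>) r" for r
      using incell_comb[OF finite_lessThan bN b(1) bc] b(3) by simp
    have in_z: "incell z (\<rho> h)" if "h \<in> supp \<beta>" for h
    proof (rule incell_trans[OF cell])
      show "incell z' (\<rho> h)" unfolding inb cell_contains_def using bc that by (auto simp: conformal_def)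
    qed
    have ng: "\<not> incell z' (\<rho> g)" using zf0 by (auto simp: incell_def)
    have gb: "g < h" if h: "h \<in> supp \<beta>" for h
    proof -
      have "g \<le> h" using least in_z[OF h] h bN by auto
      moreover have "h \<noteq> g"
      proof
        assume "h = g"
        then have "incell z' (\<rho> g)" unfolding inb cell_contains_def using bc h by (auto simp: conformal_def)
        then show False using ng by blast
      qed
      ultimately show ?thesis by simp
    qed
    then have bg: "\<beta> g = 0" by (auto simp: supp_def)
    define \<alpha> where "\<alpha> = \<beta>(g := c)"
    have cpos: "0 < c"
    proof -
      have "z f0 \<noteq> 0" using f0(1) sg by (auto simp: supp_def)
      then show ?thesis using c0 f0(2) zf0(2) by (simp add: order_less_le)
    qed
    have sa: "supp \<alpha> = insert g (supp \<beta>)" using cpos by (auto simp: \<alpha>_def supp_def)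
    have ap: "0 \<le> \<alpha> h" for h using b(1) c0 by (simp add: \<alpha>_def)
    have ca: "conformal \<rho> (supp \<alpha>)"
      unfolding conformal_def
    proof (intro ballI allI)
      fix x y f assume "x \<in> supp \<alpha>" "y \<in> supp \<alpha>"
      then have xy: "incell z (\<rho> x)" "incell z (\<rho> y)" using in_z g(2) sa by auto
      show "0 \<le> \<rho> x f * \<rho> y f"
      proof (cases "z f = 0")
        case False
        have "0 \<le> \<rho> x f * z f" "0 \<le> z f * \<rho> y f" using xy by (simp_all add: incell_def mult.commute)
        then show ?thesis by (rule same_sign_trans[OF False])
      qed (use xy in \<open>simp add: incell_def\<close>)
    qed
    have aN: "supp \<alpha> \<subseteq> {..<N}" using bN g(1) sa by auto
    have az: "comb {..<N} \<rho> \<alpha> = z"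
    proof
      fix f
      have "comb {..<N} \<rho> \<alpha> f = (\<Sum>h<N. \<beta> h * \<rho> h f + (if h = g then c * \<rho> g f else 0))"
        unfolding comb_def using bg by (intro sum.cong) (auto simp: \<alpha>_def)
      also have "\<dots> = z' f + c * \<rho> g f" using g(1) b(3)[symmetric] by (simp add: sum.distrib comb_def)
      finally show "comb {..<N} \<rho> \<alpha> f = z f" by (simp add: z'_def)
    qed
    have ina: "incell z r \<longleftrightarrow> cell_contains \<rho> (supp \<alpha>) r" for r
      using incell_comb[OF finite_lessThan aN ap ca] az by simp
    have "supp \<alpha> \<in> pulled"
      unfolding pulled_def
    proof (intro CollectI conjI ballI)
      show "supp \<alpha> \<subseteq> {..<N}" "conformal \<rho> (supp \<alpha>)" by fact+
      fix x assume x: "x \<in> supp \<alpha>"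
      have e1: "{y\<in>supp \<alpha>. g \<le> y} = supp \<alpha>" "{y\<in>supp \<alpha>. g < y} = supp \<beta>" using gb sa by (auto intro: order_less_imp_le)
      have e2: "{y\<in>supp \<alpha>. x \<le> y} = {y\<in>supp \<beta>. x \<le> y}" "{y\<in>supp \<alpha>. x < y} = {y\<in>supp \<beta>. x < y}" if "x \<noteq> g"
        using gb sa x that by (auto dest: gb)
      show "\<forall>h<N. cell_contains \<rho> {y\<in>supp \<alpha>. x \<le> y} (\<rho> h) \<longrightarrow> x \<le> h"
      proof (cases "x = g")
        case True
        then show ?thesis using e1 least ina by simp
      next
        case F: False
        then show ?thesis using e2[OF F] bp x sa by simp
      qed
      show "\<not> cell_contains \<rho> {y\<in>supp \<alpha>. x < y} (\<rho> x)"
      proof (cases "x = g")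
        case True
        then show ?thesis using e1 ng inb by simp
      next
        case F: False
        then show ?thesis using e2[OF F] bp x sa by simp
      qed
    qed
    then show ?thesis using ap az by blast
  qed
qed

text \<open>The smallest element of a support is the first ray in the cell of the point, so both
  supports start with the same \<open>g\<close>. If the weights at \<open>g\<close> differed,
  subtracting the smaller one on both sides would give a point whose cell contains \<open>g\<close>
  by one representation and not by the other.\<close>

lemma pulled_unique:
  assumes "\<And>g. 0 \<le> \<alpha> g" "supp \<alpha> \<in> pulled" "\<And>g. 0 \<le> \<beta> g" "supp \<beta> \<in> pulled"
    and "comb {..<N} \<rho> \<alpha> = comb {..<N} \<rho> \<beta>"
  shows "\<alpha> = \<beta>"
  using assms
proof (induction "card (supp \<alpha>)" arbitrary: \<alpha> \<beta> rule: less_induct)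
  case less
  have D: "supp \<gamma> \<subseteq> {..<N}" "conformal \<rho> (supp \<gamma>)" "finite (supp \<gamma>)"
    "\<And>g h. g \<in> supp \<gamma> \<Longrightarrow> h < N \<Longrightarrow> cell_contains \<rho> {x\<in>supp \<gamma>. g \<le> x} (\<rho> h) \<Longrightarrow> g \<le> h"
    "\<And>g. g \<in> supp \<gamma> \<Longrightarrow> \<not> cell_contains \<rho> {x\<in>supp \<gamma>. g < x} (\<rho> g)" if "supp \<gamma> \<in> pulled" for \<gamma> :: "nat \<Rightarrow> real"
    using that finite_subset by (auto simp: pulled_def)
  define z where "z = comb {..<N} \<rho> \<alpha>"
  have ina: "incell z r \<longleftrightarrow> cell_contains \<rho> (supp \<alpha>) r" for r
    unfolding z_def by (rule incell_comb[OF finite_lessThan D(1) less.prems(1) D(2)]) (rule less.prems)+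
  have inb: "incell z r \<longleftrightarrow> cell_contains \<rho> (supp \<beta>) r" for r
    unfolding z_def less.prems(5) by (rule incell_comb[OF finite_lessThan D(1) less.prems(3) D(2)]) (rule less.prems)+
  have self: "cell_contains \<rho> (supp \<gamma>) (\<rho> g)" if "g \<in> supp \<gamma>" "supp \<gamma> \<in> pulled" for g \<gamma>
    using D(2)[OF that(2)] that(1) by (auto simp: cell_contains_def conformal_def)
  have nz: "supp \<gamma> \<noteq> {}" if "g \<in> supp \<gamma>'" "supp \<gamma>' \<in> pulled" "\<And>r. cell_contains \<rho> (supp \<gamma>') r = cell_contains \<rho> (supp \<gamma>) r" for \<gamma> \<gamma>' :: "nat \<Rightarrow> real" and g
  proof
    assume "supp \<gamma> = {}"
    then have "cell_contains \<rho> {} (\<rho> g)" using self[OF that(1,2)] that(3) by simp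
    then show False using ray_nonzero[of g] D(1)[OF that(2)] that(1) by (auto simp: cell_contains_def)
  qed
  show ?case
  proof (cases "supp \<alpha> = {}")
    case True
    then have "supp \<beta> = {}" using nz[of _ \<beta> \<alpha>] less.prems(4) ina inb by blast
    then show ?thesis using True by (auto simp: supp_def fun_eq_iff)
  next
    case False
    then have nb: "supp \<beta> \<noteq> {}" using nz[of _ \<alpha> \<beta>] less.prems(2) ina inb by blast
    define g where "g = Min (supp \<alpha>)"
    have first: "Min (supp \<gamma>) \<in> supp \<gamma>" "{x\<in>supp \<gamma>. Min (supp \<gamma>) \<le> x} = supp \<gamma>"
      "{x\<in>supp \<gamma>. Min (supp \<gamma>) < x} = supp \<gamma> - {Min (supp \<gamma>)}" if "supp \<gamma> \<noteq> {}" "finite (supp \<gamma>)" for \<gamma> :: "nat \<Rightarrow> real"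
    proof -
      show 1: "Min (supp \<gamma>) \<in> supp \<gamma>" by (rule Min_in[OF that(2,1)])
      show 2: "{x\<in>supp \<gamma>. Min (supp \<gamma>) \<le> x} = supp \<gamma>" using Min_le[OF that(2)] by blast
      show "{x\<in>supp \<gamma>. Min (supp \<gamma>) < x} = supp \<gamma> - {Min (supp \<gamma>)}"
        using Min_le[OF that(2)] by (auto simp only: order_less_le)
    qed
    note fa = first[OF False D(3)[OF less.prems(2)]] and fb = first[OF nb D(3)[OF less.prems(4)]]
    have "Min (supp \<alpha>) \<le> Min (supp \<beta>)"
      by (rule D(4)[OF less.prems(2) fa(1)]) (use fb D(1)[OF less.prems(4)] fa self[OF fb(1) less.prems(4)] ina inb in auto)
    moreover have "Min (supp \<beta>) \<le> Min (supp \<alpha>)"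
      by (rule D(4)[OF less.prems(4) fb(1)]) (use fa D(1)[OF less.prems(2)] fb self[OF fa(1) less.prems(2)] ina inb in auto)
    ultimately have gg: "Min (supp \<alpha>) = g" "Min (supp \<beta>) = g" by (simp_all add: g_def)
    have gN: "g < N" using fa(1) D(1)[OF less.prems(2)] gg by auto
    have upd: "comb {..<N} \<rho> (\<gamma>(g := x)) = (\<lambda>f. comb {..<N} \<rho> \<gamma> f - (\<gamma> g - x) * \<rho> g f)" for \<gamma> x
    proof
      fix f
      have "comb {..<N} \<rho> (\<gamma>(g := x)) f = (\<Sum>h<N. \<gamma> h * \<rho> h f - (if h = g then (\<gamma> g - x) * \<rho> g f else 0))"
        unfolding comb_def by (intro sum.cong) (auto simp: algebra_simps)
      then show "comb {..<N} \<rho> (\<gamma>(g := x)) f = comb {..<N} \<rho> \<gamma> f - (\<gamma> g - x) * \<rho> g f"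
        using gN by (simp add: sum_subtractf comb_def)
    qed
    have le: "\<gamma>' g \<le> \<gamma> g" if c: "\<And>g. 0 \<le> \<gamma> g" "supp \<gamma> \<in> pulled" "\<And>g. 0 \<le> \<gamma>' g" "supp \<gamma>' \<in> pulled"
      "comb {..<N} \<rho> \<gamma> = comb {..<N} \<rho> \<gamma>'" "supp \<gamma> \<noteq> {}" "Min (supp \<gamma>) = g" for \<gamma> \<gamma>'
    proof (rule ccontr)
      assume "\<not> \<gamma>' g \<le> \<gamma> g"
      then have lt: "\<gamma> g < \<gamma>' g" by simp
      have g1: "g \<in> supp \<gamma>" "{x\<in>supp \<gamma>. g < x} = supp \<gamma> - {g}" using first[OF c(6) D(3)[OF c(2)]] c(7) by auto
      let ?a = "\<gamma>(g := 0)" and ?b = "\<gamma>'(g := \<gamma>' g - \<gamma> g)"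
      have sa: "supp ?a = supp \<gamma> - {g}" and sb: "supp ?b = supp \<gamma>'"
        using lt c(1)[of g] by (auto simp: supp_def)
      have eq: "comb {..<N} \<rho> ?a = comb {..<N} \<rho> ?b" unfolding upd using c(5) by simp
      have "incell (comb {..<N} \<rho> ?b) (\<rho> g)"
      proof (subst incell_comb)
        show "cell_contains \<rho> (supp ?b) (\<rho> g)" unfolding sb using lt c(1)[of g] by (intro self c) (simp add: supp_def)
        show "supp ?b \<subseteq> {..<N}" "conformal \<rho> (supp ?b)" unfolding sb by (rule D[OF c(4)])+
        show "0 \<le> ?b h" for h using lt c(3) by simp
      qed simp
      then have "cell_contains \<rho> (supp ?a) (\<rho> g)"
      proof (subst incell_comb[symmetric])
        show "supp ?a \<subseteq> {..<N}" using D(1)[OF c(2)] sa by blast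
        show "conformal \<rho> (supp ?a)" unfolding sa by (rule conformal_subset[OF D(2)[OF c(2)]]) blast
        show "0 \<le> ?a h" for h using c(1) by simp
      qed (use eq in simp_all)
      then show False using D(5)[OF c(2) g1(1)] unfolding g1(2) sa by blast
    qed
    have ag: "\<alpha> g = \<beta> g"
      using le[OF less.prems False gg(1)] le[OF less.prems(3,4,1,2) less.prems(5)[symmetric] nb gg(2)] by simp
    have s0: "supp (\<gamma>(g := 0)) = supp \<gamma> - {g}" for \<gamma> :: "nat \<Rightarrow> real" by (auto simp: supp_def)
    have "\<alpha>(g := 0) = \<beta>(g := 0)"
    proof (rule less.hyps)
      show "card (supp (\<alpha>(g := 0))) < card (supp \<alpha>)"
        unfolding s0 using fa(1) gg D(3)[OF less.prems(2)] by (intro psubset_card_mono) auto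
      show "supp (\<alpha>(g := 0)) \<in> pulled" "supp (\<beta>(g := 0)) \<in> pulled" unfolding s0
        by (rule complexD(3)[OF complex_pulled less.prems(2)], blast, rule complexD(3)[OF complex_pulled less.prems(4)], blast)
      show "comb {..<N} \<rho> (\<alpha>(g := 0)) = comb {..<N} \<rho> (\<beta>(g := 0))" unfolding upd using less.prems(5) ag by simp
    qed (use less.prems(1,3) in simp_all)
    then have "(\<alpha>(g := 0))(g := \<alpha> g) = (\<beta>(g := 0))(g := \<beta> g)" using ag by (rule arg_cong2[where f = "\<lambda>\<gamma>. fun_upd \<gamma> g"])
    then show ?thesis by simp
  qed
qed

end

section \<open>The initial subdivision\<close>

type_synonym 'n form = "real \<times> (real^'n)"

definition normals :: "('n::finite \<Rightarrow> 'n form) \<Rightarrow> real^'n^'n" where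
  "normals \<phi> = (\<chi> i. snd (\<phi> i))"

text \<open>Cramer's rule for the common zero of the forms \<open>\<phi> i\<close>, with the
  constant terms treated as a parameter \<open>y\<close>. The explicit formula yields
  rationality.\<close>

definition vertex :: "('n::finite \<Rightarrow> 'n form) \<Rightarrow> ('n form \<Rightarrow> real) \<Rightarrow> real^'n" where
  "vertex \<phi> y = (\<chi> k. det (\<chi> i j. if j = k then - y (\<phi> i) else normals \<phi> $ i $ j) / det (normals \<phi>))"

lemma vertex_iff:
  assumes "det (normals \<phi>) \<noteq> 0"
  shows "x = vertex \<phi> y \<longleftrightarrow> (\<forall>i. y (\<phi> i) + snd (\<phi> i) \<bullet> x = 0)"
proof -
  have "x = vertex \<phi> y \<longleftrightarrow> normals \<phi> *v x = (\<chi> i. - y (\<phi> i))"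
    unfolding cramer[OF assms] vertex_def by (simp cong: if_cong)
  also have "\<dots> \<longleftrightarrow> (\<forall>i. y (\<phi> i) + snd (\<phi> i) \<bullet> x = 0)"
    by (simp add: vec_eq_iff matrix_vector_mul_component normals_def eq_neg_iff_add_eq_0 add.commute)
  finally show ?thesis .
qed

lemma vertex_linear:
  assumes "det (normals \<phi>) \<noteq> 0"
  shows "vertex \<phi> (\<lambda>f. a * y f + b * y' f) = a *\<^sub>R vertex \<phi> y + b *\<^sub>R vertex \<phi> y'"
proof (rule sym, subst vertex_iff[OF assms], intro allI)
  fix i
  have "y (\<phi> i) + snd (\<phi> i) \<bullet> vertex \<phi> y = 0" "y' (\<phi> i) + snd (\<phi> i) \<bullet> vertex \<phi> y' = 0"
    using vertex_iff[OF assms] by blast+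
  then have "a * (y (\<phi> i) + snd (\<phi> i) \<bullet> vertex \<phi> y) + b * (y' (\<phi> i) + snd (\<phi> i) \<bullet> vertex \<phi> y') = 0" by simp
  then show "a * y (\<phi> i) + b * y' (\<phi> i) + snd (\<phi> i) \<bullet> (a *\<^sub>R vertex \<phi> y + b *\<^sub>R vertex \<phi> y') = 0"
    by (simp add: inner_add_right algebra_simps)
qed

lemma vertex_sum:
  assumes "det (normals \<phi>) \<noteq> 0"
  shows "vertex \<phi> (\<lambda>f. \<Sum>a\<in>A. s a * e a f) = (\<Sum>a\<in>A. s a *\<^sub>R vertex \<phi> (e a))"
proof (induction A rule: infinite_finite_induct)
  case (insert x A)
  then show ?case using vertex_linear[OF assms, of "s x" "e x" 1 "\<lambda>f. \<Sum>a\<in>A. s a * e a f"] by simp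
qed (use vertex_linear[OF assms, of 0 y 0 y for y] in simp_all)

lemma Rats_det:
  fixes A :: "real^'n^'n"
  assumes "\<And>i j. A $ i $ j \<in> \<rat>" shows "det A \<in> \<rat>"
  unfolding det_def using assms by (intro Rats_sum Rats_mult Rats_prod) auto

lemma vertex_rational:
  assumes "\<And>i. y (\<phi> i) \<in> \<rat>" "\<And>i j. snd (\<phi> i) $ j \<in> \<rat>"
  shows "vertex \<phi> y $ k \<in> \<rat>"
  unfolding vertex_def using assms by (auto intro!: Rats_det Rats_divide simp: normals_def)

lemma spanning_forms:
  fixes Z :: "('n::finite form) set"
  assumes "span (snd ` Z) = UNIV"
  shows "\<exists>\<phi>. range \<phi> \<subseteq> Z \<and> det (normals \<phi>) \<noteq> 0"
proof -
  obtain B where B: "B \<subseteq> snd ` Z" "independent B" "snd ` Z \<subseteq> span B" "card B = dim (snd ` Z)"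
    by (rule basis_exists)
  have sB: "span B = UNIV" using assms span_mono[OF B(3)] by (auto simp: span_span)
  have "dim (snd ` Z) = dim (UNIV :: (real^'n) set)" unfolding assms[symmetric] by simp
  then have "card B = CARD('n)" using B(4) by simp
  moreover have "finite B" by (rule independent_imp_finite[OF B(2)])
  ultimately obtain h where h: "bij_betw h (UNIV :: 'n set) B"
    using finite_same_card_bij[of "UNIV :: 'n set" B] by auto
  have "\<forall>i. \<exists>f\<in>Z. snd f = h i" using bij_betwE[OF h] B(1) by force
  then obtain \<phi> where phi: "\<And>i. \<phi> i \<in> Z" "\<And>i. snd (\<phi> i) = h i" by metis
  have "rows (normals \<phi>) = B"
    using bij_betw_imp_surj_on[OF h] by (auto simp: rows_def row_def normals_def phi vec_nth_inverse)
  then have "invertible (normals \<phi>)" unfolding invertible_left_inverse matrix_left_invertible_span_rows using sB by simp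
  then show ?thesis using phi(1) by (intro exI[of _ \<phi>]) (auto simp: invertible_det_nz)
qed

definition form_values :: "('n::finite form) set \<Rightarrow> ('n form \<Rightarrow> real) \<Rightarrow> real^'n \<Rightarrow> 'n form \<Rightarrow> real" where
  "form_values F y x f = (if f \<in> F then y f + snd f \<bullet> x else 0)"

lemma incell_nonneg: "incell z z' \<Longrightarrow> 0 \<le> z f \<Longrightarrow> 0 \<le> z' f"
  unfolding incell_def by (cases "z f = 0") (auto simp: zero_le_mult_iff)

text \<open>Move from \<open>x\<close> orthogonally to the normals of all forms vanishing there
  until a further form vanishes; no sign is lost on the way. By \<open>bd\<close> some nonnegative
  form decreases in each direction, so the motion ends. It can be repeated until the normals of the
  vanishing forms span.\<close>

lemma fibre_vertex:
  fixes F :: "('n::finite form) set"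
  assumes F: "finite F" and bd: "\<And>u. u \<noteq> 0 \<Longrightarrow> \<exists>f\<in>F. snd f \<bullet> u < 0 \<and> 0 \<le> form_values F y x f"
  shows "\<exists>x'. incell (form_values F y x) (form_values F y x') \<and> span (snd ` {f\<in>F. form_values F y x' f = 0}) = UNIV"
  using bd
proof (induction "card {f\<in>F. form_values F y x f \<noteq> 0}" arbitrary: x rule: less_induct)
  case less
  let ?v = "form_values F y"
  show ?case
  proof (cases "span (snd ` {f\<in>F. ?v x f = 0}) = UNIV")
    case True
    then show ?thesis by (intro exI[of _ x]) (auto simp: incell_def)
  next
    case False
    obtain u where u: "u \<noteq> 0" "\<And>w. w \<in> span (snd ` {f\<in>F. ?v x f = 0}) \<Longrightarrow> u \<bullet> w = 0"
      using span_not_UNIV_orthogonal[OF False] by blast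
    have uz: "snd f \<bullet> u = 0" if "f \<in> F" "?v x f = 0" for f
      using u(2)[OF span_base[of "snd f"]] that by (simp add: inner_commute)
    define B where "B = {f\<in>F. ?v x f * (snd f \<bullet> u) < 0}"
    obtain f1 where f1: "f1 \<in> F" "snd f1 \<bullet> u < 0" "0 \<le> ?v x f1" using less.prems[OF u(1)] by blast
    have "?v x f1 \<noteq> 0" using uz[OF f1(1)] f1(2) by auto
    then have "0 < ?v x f1" using f1(3) by simp
    then have "f1 \<in> B" using f1 by (simp add: B_def mult_pos_neg)
    have finB: "finite B" using F by (simp add: B_def)
    define c where "c = Min ((\<lambda>f. - ?v x f / (snd f \<bullet> u)) ` B)"
    have cle: "c \<le> - ?v x f / (snd f \<bullet> u)" if "f \<in> B" for f unfolding c_def using finB that by (intro Min_le) auto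
    have "c \<in> (\<lambda>f. - ?v x f / (snd f \<bullet> u)) ` B" unfolding c_def using finB \<open>f1 \<in> B\<close> by (intro Min_in) auto
    then obtain f0 where f0: "f0 \<in> B" "c = - ?v x f0 / (snd f0 \<bullet> u)" by blast
    have c0: "0 \<le> c" using f0 by (auto simp: B_def mult_less_0_iff divide_le_0_iff)
    define x1 where "x1 = x + c *\<^sub>R u"
    have v1: "?v x1 f = ?v x f + c * (snd f \<bullet> u)" if "f \<in> F" for f
      using that by (simp add: form_values_def x1_def inner_add_right)
    have cell: "incell (?v x) (?v x1)"
      unfolding incell_def
    proof (intro allI conjI impI)
      fix f
      show "?v x1 f = 0" if "?v x f = 0"
        using uz[of f] v1[of f] that by (cases "f \<in> F") (auto simp: form_values_def)
      show "0 \<le> ?v x f * ?v x1 f"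
      proof (cases "f \<in> F")
        case fF: True
        have e: "?v x f * ?v x1 f = ?v x f * ?v x f + c * (?v x f * (snd f \<bullet> u))"
          unfolding v1[OF fF] by (simp add: algebra_simps)
        show ?thesis
        proof (cases "f \<in> B")
          case True
          then have neg: "?v x f * (snd f \<bullet> u) < 0" by (simp add: B_def)
          have "(- ?v x f / (snd f \<bullet> u)) * (?v x f * (snd f \<bullet> u)) \<le> c * (?v x f * (snd f \<bullet> u))"
            using mult_right_mono_neg[OF cle[OF True], of "?v x f * (snd f \<bullet> u)"] neg by simp
          moreover have "(- ?v x f / (snd f \<bullet> u)) * (?v x f * (snd f \<bullet> u)) = - (?v x f * ?v x f)"
            using neg by (cases "snd f \<bullet> u = 0") (simp_all add: field_simps)
          ultimately show ?thesis unfolding e by linarith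
        next
          case False
          then show ?thesis unfolding e using c0 fF by (simp add: B_def)
        qed
      qed (simp add: form_values_def)
    qed
    have z0: "?v x1 f0 = 0" "?v x f0 \<noteq> 0" "f0 \<in> F"
    proof -
      show F0: "f0 \<in> F" and "?v x f0 \<noteq> 0" using f0(1) by (auto simp: B_def)
      have "snd f0 \<bullet> u \<noteq> 0" using f0(1) by (auto simp: B_def)
      then show "?v x1 f0 = 0" unfolding v1[OF F0] f0(2) by simp
    qed
    have "{f\<in>F. ?v x1 f \<noteq> 0} \<subset> {f\<in>F. ?v x f \<noteq> 0}" using cell z0 by (auto simp: incell_def)
    then have lt: "card {f\<in>F. ?v x1 f \<noteq> 0} < card {f\<in>F. ?v x f \<noteq> 0}" using F by (intro psubset_card_mono) auto
    have "\<exists>f\<in>F. snd f \<bullet> w < 0 \<and> 0 \<le> ?v x1 f" if w: "w \<noteq> 0" for w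
    proof -
      obtain f where f: "f \<in> F" "snd f \<bullet> w < 0" "0 \<le> ?v x f" using less.prems[OF w] by blast
      have "0 \<le> ?v x1 f" by (rule incell_nonneg[OF cell f(3)])
      then show ?thesis using f by blast
    qed
    then obtain x' where "incell (?v x1) (?v x')" "span (snd ` {f\<in>F. ?v x' f = 0}) = UNIV"
      using less.hyps[OF lt] by blast
    then show ?thesis using incell_trans[OF cell] by blast
  qed
qed

definition bases :: "('n::finite form) set \<Rightarrow> ('n \<Rightarrow> 'n form) set" where
  "bases F = {\<phi>. range \<phi> \<subseteq> F \<and> det (normals \<phi>) \<noteq> 0}"

lemma finite_bases: "finite F \<Longrightarrow> finite (bases F)"
  using finite_set_of_finite_funs[of "UNIV :: 'n set" F undefined]
  by (rule finite_subset[rotated]) (auto simp: bases_def)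

text \<open>At each vertex of the arrangement, each form is required to keep its sign weakly when
  the constant terms are replaced by a generator \<open>e a\<close>. The arrangement of the actual
  forms then degenerates to that of \<open>e a\<close> without any crossing. A common factor,
  compensated in \<open>\<epsilon>\<close>, makes the vertices integral.\<close>

lemma form_decomposition:
  fixes F :: "('n::finite form) set"
  assumes V: "rat_subspace V" and F: "finite F" and fV: "\<And>f. f \<in> F \<Longrightarrow> fst f \<in> V"
    and rat: "\<And>f i. f \<in> F \<Longrightarrow> snd f $ i \<in> \<rat>"
  defines "g \<equiv> \<lambda>\<phi> f y. y f + snd f \<bullet> vertex \<phi> y"
  shows "\<exists>(k::nat) \<epsilon> e. (\<forall>a<k. 0 < \<epsilon> a \<and> \<epsilon> a \<in> V \<and> (\<forall>\<phi>\<in>bases F. (\<forall>i. vertex \<phi> (e a) $ i \<in> \<int>) \<and>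
      (\<forall>f\<in>F. (0 \<le> g \<phi> f fst \<longrightarrow> 0 \<le> g \<phi> f (e a)) \<and> (g \<phi> f fst \<le> 0 \<longrightarrow> g \<phi> f (e a) \<le> 0)))) \<and>
    (\<forall>f\<in>F. fst f = (\<Sum>a<k. \<epsilon> a * e a f))"
proof -
  define t where "t f = (if f \<in> F then fst f else 0)" for f :: "'n form"
  have gt: "g \<phi> f t = g \<phi> f fst" if "\<phi> \<in> bases F" "f \<in> F" for \<phi> f
  proof -
    have "t (\<phi> i) = fst (\<phi> i)" for i using that by (auto simp: t_def bases_def)
    then have "vertex \<phi> t = vertex \<phi> fst" by (simp add: vertex_def cong: if_cong)
    then show ?thesis using that by (simp add: g_def t_def)
  qed
  have glin: "g \<phi> f (\<lambda>i. x * e i + y * e' i) = x * g \<phi> f e + y * g \<phi> f e'" if "\<phi> \<in> bases F" for \<phi> f e e' x y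
    using vertex_linear[of \<phi> x e y e'] that by (simp add: g_def bases_def inner_add_right algebra_simps)
  have ratP: "snd (\<phi> i) $ j \<in> \<rat>" if "\<phi> \<in> bases F" for \<phi> i j
    by (rule rat) (use that in \<open>auto simp: bases_def\<close>)
  define \<G> where "\<G> = (\<lambda>(\<phi>,f,\<sigma>) y. \<sigma> * g \<phi> f y) ` {(\<phi>,f,\<sigma>). \<phi> \<in> bases F \<and> f \<in> F \<and> \<sigma> \<in> {1,-1} \<and> 0 \<le> \<sigma> * g \<phi> f t}"
  have \<G>E: "\<exists>\<phi>\<in>bases F. \<exists>f\<in>F. \<exists>\<sigma>\<in>{1,-1}. 0 \<le> \<sigma> * g \<phi> f t \<and> h = (\<lambda>y. \<sigma> * g \<phi> f y)" if h: "h \<in> \<G>" for h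
  proof -
    obtain p where p: "h = (case p of (\<phi>,f,\<sigma>) \<Rightarrow> \<lambda>y. \<sigma> * g \<phi> f y)"
      "p \<in> {(\<phi>,f,\<sigma>). \<phi> \<in> bases F \<and> f \<in> F \<and> \<sigma> \<in> {1,-1} \<and> 0 \<le> \<sigma> * g \<phi> f t}"
      using h unfolding \<G>_def by (rule imageE)
    obtain \<phi> f \<sigma> where e: "p = (\<phi>,f,\<sigma>)" by (cases p)
    show ?thesis using p unfolding e by (intro bexI[of _ \<phi>] bexI[of _ f] bexI[of _ \<sigma>]) simp_all
  qed
  have "\<exists>(k::nat) \<epsilon> e. (\<forall>a<k. 0 < \<epsilon> a \<and> \<epsilon> a \<in> V \<and> (\<forall>i. e a i \<in> \<rat>) \<and> (\<forall>i. i \<notin> F \<longrightarrow> e a i = 0) \<and> (\<forall>h\<in>\<G>. 0 \<le> h (e a))) \<and>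
    (\<forall>i. t i = (\<Sum>a<k. \<epsilon> a * e a i))"
  proof (rule positive_decomposition[OF V F])
    show "t i \<in> V" "i \<notin> F \<Longrightarrow> t i = 0" for i using fV rat_subspace_0[OF V] by (auto simp: t_def)
    have "finite (bases F \<times> F \<times> {1,-1::real})" using finite_bases[OF F] F by simp
    then show "finite \<G>" unfolding \<G>_def by (intro finite_imageI) (rule finite_subset, auto)
    show "fun_linear h" if "h \<in> \<G>" for h
      using \<G>E[OF that] glin by (auto simp: fun_linear_def algebra_simps)
    show "h e \<in> \<rat>" if h: "h \<in> \<G>" and e: "\<And>i. e i \<in> \<rat>" for h e
    proof -
      obtain \<phi> f \<sigma> where p: "\<phi> \<in> bases F" "f \<in> F" "\<sigma> \<in> {1,-1}" "h = (\<lambda>y. \<sigma> * g \<phi> f y)" using \<G>E[OF h] by blast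
      have "g \<phi> f e \<in> \<rat>" unfolding g_def inner_vec_def
        using e rat[OF p(2)] vertex_rational[of e \<phi>] ratP[OF p(1)] by (intro Rats_add Rats_sum) auto
      then show ?thesis using p(3,4) by auto
    qed
    show "0 \<le> h t" if "h \<in> \<G>" for h using \<G>E[OF that] by auto
  qed
  then obtain k :: nat and \<epsilon> e where
    R: "(\<forall>a<k. 0 < \<epsilon> a \<and> \<epsilon> a \<in> V \<and> (\<forall>i. e a i \<in> \<rat>) \<and> (\<forall>i. i \<notin> F \<longrightarrow> e a i = 0) \<and> (\<forall>h\<in>\<G>. 0 \<le> h (e a))) \<and>
    (\<forall>i. t i = (\<Sum>a<k. \<epsilon> a * e a i))" by (elim exE) (rule that)
  have R1: "0 < \<epsilon> a" "\<epsilon> a \<in> V" "e a i \<in> \<rat>" "h \<in> \<G> \<Longrightarrow> 0 \<le> h (e a)" if "a < k" for a i h using conjunct1[OF R] that by blast+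
  have vr: "vertex \<phi> (e a) $ i \<in> \<rat>" if "a < k" "\<phi> \<in> bases F" for a \<phi> i
    by (rule vertex_rational) (use R1(3)[OF that(1)] ratP[OF that(2)] in auto)
  have "finite ((\<lambda>(a,\<phi>,i). vertex \<phi> (e a) $ i) ` ({..<k} \<times> bases F \<times> UNIV))" using finite_bases[OF F] by simp
  then obtain M :: nat where M: "0 < M" "\<And>a \<phi> i. a < k \<Longrightarrow> \<phi> \<in> bases F \<Longrightarrow> real M * vertex \<phi> (e a) $ i \<in> \<int>"
    using common_denominator[of "(\<lambda>(a,\<phi>,i). vertex \<phi> (e a) $ i) ` ({..<k} \<times> bases F \<times> UNIV)"] vr by (auto simp: image_subset_iff)
  define e' where "e' a f = real M * e a f" for a f
  have ve: "vertex \<phi> (e' a) = real M *\<^sub>R vertex \<phi> (e a)" if "\<phi> \<in> bases F" for \<phi> a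
    using vertex_linear[of \<phi> "real M" "e a" 0 "e a"] that by (simp add: e'_def[abs_def] bases_def)
  have ge: "g \<phi> f (e' a) = real M * g \<phi> f (e a)" if "\<phi> \<in> bases F" for \<phi> f a
    using ve[OF that] by (simp add: g_def e'_def algebra_simps)
  have "(0 \<le> g \<phi> f fst \<longrightarrow> 0 \<le> g \<phi> f (e' a)) \<and> (g \<phi> f fst \<le> 0 \<longrightarrow> g \<phi> f (e' a) \<le> 0)"
    if a: "a < k" and p: "\<phi> \<in> bases F" and f: "f \<in> F" for a \<phi> f
  proof -
    have s: "0 \<le> \<sigma> * g \<phi> f (e a)" if "\<sigma> \<in> {1,-1}" "0 \<le> \<sigma> * g \<phi> f t" for \<sigma>
    proof -
      have "(\<lambda>y. \<sigma> * g \<phi> f y) \<in> \<G>" unfolding \<G>_def using that p f by (intro image_eqI[of _ _ "(\<phi>,f,\<sigma>)"]) auto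
      then show ?thesis using R1(4)[OF a] by fastforce
    qed
    show ?thesis unfolding ge[OF p] gt[OF p f, symmetric] using s[of 1] s[of "-1"] M(1)
      by (auto simp: mult_nonneg_nonpos)
  qed
  moreover have "0 < \<epsilon> a / real M" "\<epsilon> a / real M \<in> V" if "a < k" for a
  proof -
    show "0 < \<epsilon> a / real M" using R1(1)[OF that] M(1) by simp
    have "(1 / real M) * \<epsilon> a \<in> V" by (rule rat_subspace_scale[OF V _ R1(2)[OF that]]) simp
    then show "\<epsilon> a / real M \<in> V" by simp
  qed
  moreover have "\<forall>i. vertex \<phi> (e' a) $ i \<in> \<int>" if "a < k" "\<phi> \<in> bases F" for a \<phi>
    using M(2)[OF that] ve[OF that(2)] by simp
  moreover have "fst f = (\<Sum>a<k. (\<epsilon> a / real M) * e' a f)" if "f \<in> F" for f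
    using spec[OF conjunct2[OF R], of f] M(1) that by (simp add: e'_def t_def)
  ultimately show ?thesis
    by (intro exI[of _ k] exI[of _ "\<lambda>a. \<epsilon> a / real M"] exI[of _ e']) blast
qed

section \<open>The cone over the box and its triangulation\<close>

definition point :: "'r set \<Rightarrow> ('r \<Rightarrow> real^'n) \<Rightarrow> ('r \<Rightarrow> real) \<Rightarrow> real^'n" where
  "point G r \<alpha> = (\<Sum>g\<in>G. \<alpha> g *\<^sub>R r g)"

lemma point_nth: "point G r \<alpha> $ i = comb G (\<lambda>g. ($) (r g)) \<alpha> i"
  by (simp add: point_def comb_def)

text \<open>Points of the cone over the box: parameters \<open>s\<close>, standing for the constant terms
  \<open>\<Sum> s a * e a f\<close> of the forms, and a point \<open>x\<close>, recorded by the values of all forms.\<close>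

definition cone_point :: "('n::finite form) set \<Rightarrow> nat \<Rightarrow> (nat \<Rightarrow> 'n form \<Rightarrow> real) \<Rightarrow> (nat \<Rightarrow> real) \<Rightarrow> real^'n \<Rightarrow>
    'n form + nat \<Rightarrow> real" where
  "cone_point F k e s x = case_sum (form_values F (\<lambda>f. \<Sum>a<k. s a * e a f) x) (\<lambda>a. if a < k then s a else 0)"

lemma cone_point_simps:
  "cone_point F k e s x (Inl f) = form_values F (\<lambda>f. \<Sum>a<k. s a * e a f) x f"
  "cone_point F k e s x (Inr a) = (if a < k then s a else 0)"
  by (simp_all add: cone_point_def)

lemma cone_point_lin:
  "cone_point F k e (\<lambda>a. p * s a + q * s' a) (p *\<^sub>R x + q *\<^sub>R x') j = p * cone_point F k e s x j + q * cone_point F k e s' x' j"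
  by (cases j) (simp_all add: cone_point_simps form_values_def algebra_simps inner_add_right sum.distrib sum_distrib_left)

lemma cone_point_sum:
  "cone_point F k e (\<lambda>a. \<Sum>g\<in>G. \<alpha> g * s g a) (\<Sum>g\<in>G. \<alpha> g *\<^sub>R r g) j = (\<Sum>g\<in>G. \<alpha> g * cone_point F k e (s g) (r g) j)"
proof (induction G rule: infinite_finite_induct)
  case (insert g G)
  then show ?case
    using cone_point_lin[of F k e "\<alpha> g" "s g" 1 "\<lambda>a. \<Sum>g\<in>G. \<alpha> g * s g a" "r g" "\<Sum>g\<in>G. \<alpha> g *\<^sub>R r g" j] by simp
qed (use cone_point_lin[of F k e 0 _ 0 _ 0 0 j] in simp_all)

text \<open>Move \<open>x\<close> inside its fibre to a vertex \<open>x'\<close>. It is the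
  combination with coefficients \<open>s\<close> of the vertices for the generators
  \<open>e a\<close>, and by \<open>sign\<close> a form takes values of one sign on all of these. So
  nothing cancels, and any summand with \<open>s a > 0\<close> lies in the cell of
  \<open>x'\<close>.\<close>

lemma form_ray:
  fixes F :: "('n::finite form) set"
  assumes F: "finite F" and box: "\<And>i. (c, axis i 1) \<in> F" "\<And>i. (c, - axis i 1) \<in> F"
    and s: "\<And>a. a < k \<Longrightarrow> 0 \<le> s a" and e: "\<And>f. f \<in> F \<Longrightarrow> fst f = (\<Sum>a<k. \<epsilon> a * e a f)"
    and sign: "\<And>a \<phi> f. a < k \<Longrightarrow> \<phi> \<in> bases F \<Longrightarrow> f \<in> F \<Longrightarrow>
      (0 \<le> fst f + snd f \<bullet> vertex \<phi> fst \<longrightarrow> 0 \<le> e a f + snd f \<bullet> vertex \<phi> (e a)) \<and>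
      (fst f + snd f \<bullet> vertex \<phi> fst \<le> 0 \<longrightarrow> e a f + snd f \<bullet> vertex \<phi> (e a) \<le> 0)"
    and inbox: "\<And>i. 0 \<le> cone_point F k e s x (Inl (c, axis i 1))" "\<And>i. 0 \<le> cone_point F k e s x (Inl (c, - axis i 1))"
    and nz: "cone_point F k e s x j \<noteq> 0"
  shows "\<exists>a<k. \<exists>\<phi>\<in>bases F. incell (cone_point F k e s x) (cone_point F k e (\<lambda>b. of_bool (a = b)) (vertex \<phi> (e a)))"
proof -
  define y where "y f = (\<Sum>a<k. s a * e a f)" for f
  have "\<exists>a<k. s a \<noteq> 0"
  \<comment> \<open>For \<open>s = 0\<close> the box inequalities read \<open>0 \<le> x $ i\<close>
    and \<open>0 \<le> - x $ i\<close>, so the point is the apex of the cone, which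
    \<open>nz\<close> excludes.\<close>
  proof (rule ccontr)
    assume "\<not> ?thesis"
    then have s0: "s a = 0" if "a < k" for a using that by auto
    have "0 \<le> x $ i" "0 \<le> - x $ i" for i
      using inbox[of i] box s0 by (simp_all add: cone_point_simps form_values_def inner_axis')
    then have "x $ i = 0" for i by (simp add: order.antisym)
    then have "x = 0" by (simp add: vec_eq_iff)
    then have "cone_point F k e s x j = 0" using s0 by (cases j) (simp_all add: cone_point_simps form_values_def)
    then show False using nz by simp
  qed
  then obtain a where a: "a < k" "s a \<noteq> 0" by blast
  have sa: "0 < s a" using s[OF a(1)] a(2) by simp
  have "\<exists>x'. incell (form_values F y x) (form_values F y x') \<and> span (snd ` {f\<in>F. form_values F y x' f = 0}) = UNIV"
  proof (rule fibre_vertex[OF F])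
    fix u :: "real^'n" assume "u \<noteq> 0"
    then obtain i where i: "u $ i \<noteq> 0" by (auto simp: vec_eq_iff)
    have b: "0 \<le> form_values F y x (c, axis i 1)" "0 \<le> form_values F y x (c, - axis i 1)"
      using inbox[of i] by (simp_all add: cone_point_simps y_def[abs_def])
    show "\<exists>f\<in>F. snd f \<bullet> u < 0 \<and> 0 \<le> form_values F y x f"
    proof (cases "u $ i < 0")
      case True
      then show ?thesis by (intro bexI[OF _ box(1)[of i]]) (use b in \<open>simp add: inner_axis'\<close>)
    next
      case False
      then show ?thesis by (intro bexI[OF _ box(2)[of i]]) (use b i in \<open>simp add: inner_axis'\<close>)
    qed
  qed
  then obtain x' where x': "incell (form_values F y x) (form_values F y x')" "span (snd ` {f\<in>F. form_values F y x' f = 0}) = UNIV"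
    by blast
  obtain \<phi> where phi: "range \<phi> \<subseteq> {f\<in>F. form_values F y x' f = 0}" "det (normals \<phi>) \<noteq> 0" using spanning_forms[OF x'(2)] by blast
  have pb: "\<phi> \<in> bases F" using phi by (auto simp: bases_def)
  have "y (\<phi> i) + snd (\<phi> i) \<bullet> x' = 0" for i
  proof -
    have "\<phi> i \<in> {f\<in>F. form_values F y x' f = 0}" using phi(1) by (rule subsetD) simp
    then show ?thesis by (auto simp: form_values_def)
  qed
  then have xv: "x' = vertex \<phi> y" unfolding vertex_iff[OF phi(2)] by simp
  have xs: "x' = (\<Sum>a<k. s a *\<^sub>R vertex \<phi> (e a))" unfolding xv y_def[abs_def] by (rule vertex_sum[OF phi(2)])
  define g where "g b f = e b f + snd f \<bullet> vertex \<phi> (e b)" for b f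
  have val: "form_values F y x' f = (\<Sum>b<k. s b * g b f)" if "f \<in> F" for f
    using that by (simp add: form_values_def y_def xs g_def inner_sum_right algebra_simps sum.distrib)
  have mem: "s a * g a f \<le> (\<Sum>b<k. s b * g b f)" if "\<And>b. b < k \<Longrightarrow> 0 \<le> g b f" for f
    by (rule member_le_sum) (use a(1) s that in auto)
  have mem': "(\<Sum>b<k. s b * g b f) \<le> s a * g a f" if "\<And>b. b < k \<Longrightarrow> g b f \<le> 0" for f
  proof -
    have "s a * - g a f \<le> (\<Sum>b<k. s b * - g b f)"
      by (rule member_le_sum) (use a(1) s that in \<open>auto simp: mult_nonneg_nonpos\<close>)
    then show ?thesis by (simp add: sum_negf)
  qed
  have sg: "(\<forall>b<k. 0 \<le> g b f) \<or> (\<forall>b<k. g b f \<le> 0)" if "f \<in> F" for f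
    using sign[OF _ pb that] unfolding g_def by (meson linear)
  have key: "((\<Sum>b<k. s b * g b f) = 0 \<longrightarrow> g a f = 0) \<and> 0 \<le> (\<Sum>b<k. s b * g b f) * g a f" if f: "f \<in> F" for f
    using sg[OF f]
  proof
    assume p: "\<forall>b<k. 0 \<le> g b f"
    then have "0 \<le> g a f" "s a * g a f \<le> (\<Sum>b<k. s b * g b f)" "0 \<le> s a * g a f"
      using a sa mem by auto
    moreover have "s a * g a f = 0 \<longleftrightarrow> g a f = 0" using sa by simp
    ultimately show ?thesis by (smt (verit) mult_nonneg_nonneg)
  next
    assume p: "\<forall>b<k. g b f \<le> 0"
    then have "g a f \<le> 0" "(\<Sum>b<k. s b * g b f) \<le> s a * g a f" "s a * g a f \<le> 0"
      using a sa mem' by (auto simp: mult_nonneg_nonpos)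
    moreover have "s a * g a f = 0 \<longleftrightarrow> g a f = 0" using sa by simp
    ultimately show ?thesis by (smt (verit) mult_nonpos_nonpos)
  qed
  have d: "(\<Sum>b<k. of_bool (a = b) * e b f) = e a f" for f
  proof -
    have "(\<Sum>b<k. of_bool (a = b) * e b f) = (\<Sum>b<k. if b = a then e a f else 0)" by (intro sum.cong) auto
    then show ?thesis using a(1) by simp
  qed
  have v: "form_values F (\<lambda>f. \<Sum>b<k. of_bool (a = b) * e b f) (vertex \<phi> (e a)) f = (if f \<in> F then g a f else 0)" for f
    unfolding d by (simp add: form_values_def g_def)
  have "incell (form_values F y x') (form_values F (\<lambda>f. \<Sum>b<k. of_bool (a = b) * e b f) (vertex \<phi> (e a)))"
    unfolding incell_def
  proof (intro allI)
    fix f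
    show "(form_values F y x' f = 0 \<longrightarrow> form_values F (\<lambda>f. \<Sum>b<k. of_bool (a = b) * e b f) (vertex \<phi> (e a)) f = 0) \<and>
       0 \<le> form_values F y x' f * form_values F (\<lambda>f. \<Sum>b<k. of_bool (a = b) * e b f) (vertex \<phi> (e a)) f"
    proof (cases "f \<in> F")
      case True
      show ?thesis unfolding v val[OF True] using key[OF True] True by simp
    qed (simp add: form_values_def)
  qed
  from incell_trans[OF x'(1) this]
  have c1: "incell (form_values F y x) (form_values F (\<lambda>f. \<Sum>b<k. of_bool (a = b) * e b f) (vertex \<phi> (e a)))" .
  have "incell (cone_point F k e s x) (cone_point F k e (\<lambda>b. of_bool (a = b)) (vertex \<phi> (e a)))"
    unfolding incell_def
  proof
    fix j
    show "(cone_point F k e s x j = 0 \<longrightarrow> cone_point F k e (\<lambda>b. of_bool (a = b)) (vertex \<phi> (e a)) j = 0) \<and>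
       0 \<le> cone_point F k e s x j * cone_point F k e (\<lambda>b. of_bool (a = b)) (vertex \<phi> (e a)) j"
    proof (cases j)
      case (Inl f)
      show ?thesis using c1 unfolding Inl cone_point_simps incell_def y_def[abs_def] by blast
    next
      case (Inr b)
      show ?thesis using a s[of b] unfolding Inr by (auto simp: cone_point_simps)
    qed
  qed
  then show ?thesis using a(1) pb by blast
qed

text \<open>The slice is a bijective parametrisation of the cube [-c, c]^n. By \<open>signs\<close>
  an inequality from \<open>F\<close> that holds at one point holds on the whole smallest cell of
  this point, so cells do not cross the cells of \<open>X\<close>.\<close>

locale box_complex =
  fixes V :: "real set" and c :: real and F :: "('n::finite form) set" and G :: "nat set" and \<K> :: "nat set set"
    and b :: "nat \<Rightarrow> nat" and t :: "nat \<Rightarrow> real" and r :: "nat \<Rightarrow> real^'n"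
  assumes V: "rat_subspace V" and cx: "complex G \<K>" and sz: "sizes V G b t"
    and inbox: "\<alpha> \<in> slice G \<K> (udeg b) t \<Longrightarrow> \<bar>point G r \<alpha> $ i\<bar> \<le> c"
    and cover: "(\<And>i. \<bar>x $ i\<bar> \<le> c) \<Longrightarrow> \<exists>\<alpha>\<in>slice G \<K> (udeg b) t. point G r \<alpha> = x"
    and inj: "\<alpha> \<in> slice G \<K> (udeg b) t \<Longrightarrow> \<beta> \<in> slice G \<K> (udeg b) t \<Longrightarrow> point G r \<alpha> = point G r \<beta> \<Longrightarrow> \<alpha> = \<beta>"
    and signs: "f \<in> F \<Longrightarrow> \<alpha> \<in> slice G \<K> (udeg b) t \<Longrightarrow> \<beta> \<in> slice G \<K> (udeg b) t \<Longrightarrow> supp \<beta> \<subseteq> supp \<alpha> \<Longrightarrow>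
      0 \<le> fst f + snd f \<bullet> point G r \<alpha> \<Longrightarrow> 0 \<le> fst f + snd f \<bullet> point G r \<beta>"

theorem initial_complex:
  fixes F :: "('n::finite form) set"
  assumes V: "rat_subspace V" and F: "finite F" and fV: "\<And>f. f \<in> F \<Longrightarrow> fst f \<in> V"
    and rat: "\<And>f i. f \<in> F \<Longrightarrow> snd f $ i \<in> \<rat>" and c0: "0 \<le> c"
    and box: "\<And>i. (c, axis i 1) \<in> F" "\<And>i. (c, - axis i 1) \<in> F"
  shows "\<exists>G \<K> b t r. box_complex V c F G \<K> b t r \<and> (\<forall>g\<in>G. \<forall>i. r g $ i \<in> \<int>) \<and>
    (\<forall>K\<in>\<K>. \<exists>\<alpha>\<in>slice G \<K> (udeg b) t. K \<subseteq> supp \<alpha>)"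
proof -
  have "\<exists>(k::nat) \<epsilon> e. (\<forall>a<k. 0 < \<epsilon> a \<and> \<epsilon> a \<in> V \<and> (\<forall>\<phi>\<in>bases F. (\<forall>i. vertex \<phi> (e a) $ i \<in> \<int>) \<and>
      (\<forall>f\<in>F. (0 \<le> fst f + snd f \<bullet> vertex \<phi> fst \<longrightarrow> 0 \<le> e a f + snd f \<bullet> vertex \<phi> (e a)) \<and>
         (fst f + snd f \<bullet> vertex \<phi> fst \<le> 0 \<longrightarrow> e a f + snd f \<bullet> vertex \<phi> (e a) \<le> 0)))) \<and>
    (\<forall>f\<in>F. fst f = (\<Sum>a<k. \<epsilon> a * e a f))"
    by (rule form_decomposition[OF V F fV rat])
  then obtain k :: nat and \<epsilon> e where R: "(\<forall>a<k. 0 < \<epsilon> a \<and> \<epsilon> a \<in> V \<and> (\<forall>\<phi>\<in>bases F. (\<forall>i. vertex \<phi> (e a) $ i \<in> \<int>) \<and>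
      (\<forall>f\<in>F. (0 \<le> fst f + snd f \<bullet> vertex \<phi> fst \<longrightarrow> 0 \<le> e a f + snd f \<bullet> vertex \<phi> (e a)) \<and>
         (fst f + snd f \<bullet> vertex \<phi> fst \<le> 0 \<longrightarrow> e a f + snd f \<bullet> vertex \<phi> (e a) \<le> 0)))) \<and>
    (\<forall>f\<in>F. fst f = (\<Sum>a<k. \<epsilon> a * e a f))"
    by (elim exE) (rule that)
  have eps: "0 < \<epsilon> a" "\<epsilon> a \<in> V" if "a < k" for a using conjunct1[OF R] that by blast+
  have vint: "vertex \<phi> (e a) $ i \<in> \<int>" if "a < k" "\<phi> \<in> bases F" for a \<phi> i using conjunct1[OF R] that by blast
  have sign: "(0 \<le> fst f + snd f \<bullet> vertex \<phi> fst \<longrightarrow> 0 \<le> e a f + snd f \<bullet> vertex \<phi> (e a)) \<and>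
      (fst f + snd f \<bullet> vertex \<phi> fst \<le> 0 \<longrightarrow> e a f + snd f \<bullet> vertex \<phi> (e a) \<le> 0)"
    if "a < k" "\<phi> \<in> bases F" "f \<in> F" for a \<phi> f using conjunct1[OF R] that by blast
  have dec: "fst f = (\<Sum>a<k. \<epsilon> a * e a f)" if "f \<in> F" for f using conjunct2[OF R] that by blast
  let ?cp = "cone_point F k e" and ?\<delta> = "\<lambda>a b. of_bool (a = b) :: real"
  define B where "B = range (\<lambda>i. (c, axis i 1 :: real^'n)) \<union> range (\<lambda>i. (c, - axis i 1))"
  have BF: "f \<in> F" if "f \<in> B" for f using that box by (auto simp: B_def)
  have Bm: "(c, axis i 1) \<in> B" "(c, - axis i 1) \<in> B" for i by (auto simp: B_def)
  \<comment> \<open>A ray is a vertex over the \<open>a\<close>-th unit parameter vector, which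
    gives it the single label \<open>a\<close>. It belongs to the cone if the box inequalities hold
    for the constant terms \<open>e a\<close>.\<close>
  define R where "R = {p \<in> (\<lambda>(a,\<phi>). (a, vertex \<phi> (e a))) ` ({..<k} \<times> bases F). \<forall>f\<in>B. 0 \<le> ?cp (?\<delta> (fst p)) (snd p) (Inl f)}"
  have "finite R" unfolding R_def using finite_bases[OF F] by simp
  then obtain h where h: "bij_betw h {0..<card R} R" using ex_bij_betw_nat_finite by blast
  define N where "N = card R"
  define b where "b g = fst (h g)" for g
  define r where "r g = snd (h g)" for g
  define \<rho> where "\<rho> g = ?cp (?\<delta> (b g)) (r g)" for g
  have hR: "h ` {..<N} = R" using bij_betw_imp_surj_on[OF h] by (simp add: N_def atLeast0LessThan)
  have hm: "h g \<in> R" if "g < N" for g using hR that by blast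
  have bk: "b g < k" and rint: "r g $ i \<in> \<int>" and rB: "f \<in> B \<Longrightarrow> 0 \<le> \<rho> g (Inl f)" if "g < N" for g f i
    using hm[OF that] vint by (auto simp: R_def b_def r_def \<rho>_def)
  define Z where "Z = {z. \<exists>s x. z = ?cp s x \<and> (\<forall>a<k. 0 \<le> s a) \<and> (\<forall>f\<in>B. 0 \<le> ?cp s x (Inl f))}"
  interpret pulling N \<rho> "Inl ` F \<union> Inr ` {..<k}" Z
  proof
    show "finite (Inl ` F \<union> Inr ` {..<k})" using F by simp
    show "z f = 0" if z: "z \<in> Z" "f \<notin> Inl ` F \<union> Inr ` {..<k}" for z f
    proof -
      obtain s x where "z = ?cp s x" using z(1) by (auto simp: Z_def)
      then show ?thesis using z(2) by (cases f) (auto simp: cone_point_simps form_values_def)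
    qed
    show "\<exists>f. \<rho> g f \<noteq> 0" if "g < N" for g
      by (rule exI[of _ "Inr (b g)"]) (use bk[OF that] in \<open>simp add: \<rho>_def cone_point_simps\<close>)
    show "(\<lambda>f. z f - p * \<rho> g f) \<in> Z" if z: "z \<in> Z" "g < N" "0 \<le> p" "incell z (\<lambda>f. z f - p * \<rho> g f)" for z g p
    proof -
      obtain s x where s: "z = ?cp s x" "\<And>a. a < k \<Longrightarrow> 0 \<le> s a" "\<And>f. f \<in> B \<Longrightarrow> 0 \<le> ?cp s x (Inl f)" using z(1) by (auto simp: Z_def)
      let ?s = "\<lambda>a. 1 * s a + (-p) * ?\<delta> (b g) a" and ?x = "1 *\<^sub>R x + (-p) *\<^sub>R r g"
      have eq: "(\<lambda>f. z f - p * \<rho> g f) = ?cp ?s ?x"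
        unfolding s(1) \<rho>_def by (rule ext, subst cone_point_lin) simp
      have nn: "0 \<le> ?cp ?s ?x j" if "0 \<le> z j" for j using incell_nonneg[OF z(4) that] eq by metis
      have "0 \<le> ?s a" if "a < k" for a using nn[of "Inr a"] s(1,2) that by (simp add: cone_point_simps)
      moreover have "0 \<le> ?cp ?s ?x (Inl f)" if "f \<in> B" for f by (rule nn) (use s(1,3) that in simp)
      ultimately show ?thesis unfolding eq Z_def by blast
    qed
    show "\<exists>g<N. incell z (\<rho> g)" if z: "z \<in> Z" "z j \<noteq> 0" for z j
    proof -
      obtain s x where s: "z = ?cp s x" "\<And>a. a < k \<Longrightarrow> 0 \<le> s a" "\<And>f. f \<in> B \<Longrightarrow> 0 \<le> ?cp s x (Inl f)" using z(1) by (auto simp: Z_def)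
      obtain a \<phi> where ap: "a < k" "\<phi> \<in> bases F" "incell z (?cp (?\<delta> a) (vertex \<phi> (e a)))"
        using form_ray[OF F box s(2) dec sign s(3)[OF Bm(1)] s(3)[OF Bm(2)], of j] z(2) s(1) by blast
      have "0 \<le> ?cp (?\<delta> a) (vertex \<phi> (e a)) (Inl f)" if "f \<in> B" for f
        by (rule incell_nonneg[OF ap(3)]) (use s(1,3) that in simp)
      then have "(a, vertex \<phi> (e a)) \<in> R" using ap(1,2) by (auto simp: R_def)
      then obtain g where g: "g < N" "h g = (a, vertex \<phi> (e a))" using hR by (metis imageE lessThan_iff)
      show ?thesis by (rule exI[of _ g]) (use g ap(3) in \<open>simp add: \<rho>_def b_def r_def\<close>)
    qed
  qed
  define t where "t a = (if a < k then \<epsilon> a else 0)" for a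
  let ?S = "slice {..<N} pulled (udeg b) t" and ?p = "point {..<N} r"
  have deg: "(\<Sum>g<N. \<alpha> g * udeg b g a) = 0" if "\<not> a < k" for \<alpha> a
    by (rule sum.neutral) (use bk that in \<open>auto simp: udeg_def\<close>)
  have comb: "comb {..<N} \<rho> \<alpha> = ?cp (\<lambda>a. \<Sum>g<N. \<alpha> g * udeg b g a) (?p \<alpha>)" for \<alpha>
    using cone_point_sum[of F k e \<alpha> "\<lambda>g. ?\<delta> (b g)" "{..<N}" r]
    by (intro ext) (simp add: comb_def \<rho>_def point_def udeg_def)
  have slice_comb: "comb {..<N} \<rho> \<alpha> = ?cp t (?p \<alpha>)" if "\<alpha> \<in> ?S" for \<alpha>
    unfolding comb using sliceD(3)[OF that] by simp
  have cpt: "?cp t x (Inl f) = fst f + snd f \<bullet> x" if "f \<in> F" for f x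
    using that dec[OF that] by (simp add: cone_point_simps form_values_def t_def)
  have inj: "x = x'" if eq: "?cp t x = ?cp t x'" for x x'
  proof (rule vec_eq_iff[THEN iffD2], rule allI)
    fix i show "x $ i = x' $ i" using fun_cong[OF eq, of "Inl (c, axis i 1)"] cpt[OF box(1)] by (simp add: inner_axis')
  qed
  have slice_box: "\<bar>?p \<alpha> $ i\<bar> \<le> c" if a: "\<alpha> \<in> ?S" for \<alpha> i
  proof -
    have "0 \<le> comb {..<N} \<rho> \<alpha> (Inl f)" if "f \<in> B" for f
      unfolding comb_def by (intro sum_nonneg mult_nonneg_nonneg) (use sliceD(1)[OF a] rB that in auto)
    then have "0 \<le> fst f + snd f \<bullet> ?p \<alpha>" if "f \<in> B" for f
      unfolding slice_comb[OF a] using cpt BF that by metis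
    from this[OF Bm(1)[of i]] this[OF Bm(2)[of i]] show ?thesis by (simp add: inner_axis' abs_le_iff)
  qed
  have cover: "\<exists>\<alpha>\<in>?S. ?p \<alpha> = x" if x: "\<And>i. \<bar>x $ i\<bar> \<le> c" for x
  proof -
    have "0 \<le> ?cp t x (Inl f)" if f: "f \<in> B" for f
      unfolding cpt[OF BF[OF f]] using f unfolding B_def
    proof (elim UnE rangeE)
      fix i
      have "0 \<le> c + x $ i" "0 \<le> c - x $ i" using x[of i] by linarith+
      then show "f = (c, axis i 1) \<Longrightarrow> 0 \<le> fst f + snd f \<bullet> x" "f = (c, - axis i 1) \<Longrightarrow> 0 \<le> fst f + snd f \<bullet> x"
        by (simp_all add: inner_axis')
    qed
    then have "?cp t x \<in> Z" unfolding Z_def using eps(1) by (auto simp: t_def less_imp_le intro!: exI[of _ t] exI[of _ x])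
    then obtain \<alpha> where a: "\<And>g. 0 \<le> \<alpha> g" "supp \<alpha> \<in> pulled" "comb {..<N} \<rho> \<alpha> = ?cp t x" using pulled_exists by blast
    have d: "(\<Sum>g<N. \<alpha> g * udeg b g a) = t a" for a
    proof (cases "a < k")
      case True
      then show ?thesis using fun_cong[OF a(3), of "Inr a"] unfolding comb by (simp add: cone_point_simps)
    qed (use deg in \<open>simp add: t_def\<close>)
    then have S: "\<alpha> \<in> ?S" using a by (simp add: slice_def)
    show ?thesis by (rule bexI[OF inj S]) (use slice_comb[OF S] a(3) in simp)
  qed
  have uniq: "\<alpha> = \<beta>" if "\<alpha> \<in> ?S" "\<beta> \<in> ?S" "?p \<alpha> = ?p \<beta>" for \<alpha> \<beta>
    by (rule pulled_unique) (use that slice_comb sliceD(1,2)[OF that(1)] sliceD(1,2)[OF that(2)] in simp_all)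
  have signs: "0 \<le> fst f + snd f \<bullet> ?p \<beta>"
    if f: "f \<in> F" and ab: "\<alpha> \<in> ?S" "\<beta> \<in> ?S" "supp \<beta> \<subseteq> supp \<alpha>" "0 \<le> fst f + snd f \<bullet> ?p \<alpha>" for f \<alpha> \<beta>
  proof -
    have sa: "supp \<alpha> \<subseteq> {..<N}" "conformal \<rho> (supp \<alpha>)" using sliceD(2)[OF ab(1)] by (simp_all add: pulled_def)
    note cc = conformal_comb[OF finite_lessThan sa(1) sliceD(1)[OF ab(1)] sa(2), where f = "Inl f"]
    have v: "comb {..<N} \<rho> \<alpha> (Inl f) = fst f + snd f \<bullet> ?p \<alpha>" "comb {..<N} \<rho> \<beta> (Inl f) = fst f + snd f \<bullet> ?p \<beta>"
      using slice_comb ab(1,2) cpt[OF f] by simp_all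
    have "0 \<le> \<rho> g (Inl f)" if "g \<in> supp \<alpha>" for g
      using cc(1) cc(2)[OF that] v(1) ab(4) that by (cases "comb {..<N} \<rho> \<alpha> (Inl f) = 0") (auto simp: zero_le_mult_iff)
    then have p: "0 \<le> \<rho> g (Inl f)" if "\<beta> g \<noteq> 0" for g using ab(3) that by (auto simp: supp_def)
    have "0 \<le> \<beta> g * \<rho> g (Inl f)" for g using p[of g] sliceD(1)[OF ab(2), of g] by (cases "\<beta> g = 0") simp_all
    then have "0 \<le> comb {..<N} \<rho> \<beta> (Inl f)" unfolding comb_def by (intro sum_nonneg)
    then show ?thesis using v(2) by simp
  qed
  \<comment> \<open>Only faces of supports of actual points are kept. Relations on such a face can
    be used to perturb a point of the slice, on which injectivity is known.\<close>
  define \<K> where "\<K> = {K. \<exists>\<alpha>\<in>?S. K \<subseteq> supp \<alpha>}"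
  have sub: "\<K> \<subseteq> pulled" unfolding \<K>_def using complexD(3)[OF complex_pulled] sliceD(2) by blast
  have eqS: "slice {..<N} \<K> (udeg b) t = ?S"
    using sub by (auto simp: slice_def \<K>_def)
  have cK: "complex {..<N} \<K>"
    unfolding complex_def
  proof (intro conjI ballI allI impI)
    show "K \<subseteq> {..<N}" if "K \<in> \<K>" for K using complexD(2)[OF complex_pulled] sub that by blast
    show "K' \<in> \<K>" if "K \<in> \<K>" "K' \<subseteq> K" for K K' using that unfolding \<K>_def by blast
  qed simp
  have sz: "sizes V {..<N} b t"
    unfolding sizes_def
  proof (intro conjI ballI allI impI)
    fix g assume "g \<in> {..<N}"
    then show "0 < t (b g)" "t (b g) \<in> V" using bk eps by (simp_all add: t_def)
  next
    fix a assume a: "a \<notin> b ` {..<N}"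
    \<comment> \<open>The slice is nonempty because the box contains \<open>0\<close>; a label
      without rays therefore has size \<open>0\<close>.\<close>
    obtain \<alpha> where "\<alpha> \<in> ?S" using cover[of 0] c0 by auto
    then have "t a = (\<Sum>g<N. \<alpha> g * udeg b g a)" by (simp add: sliceD(3))
    also have "\<dots> = 0" by (rule sum.neutral) (use a in \<open>auto simp: udeg_def\<close>)
    finally show "t a = 0" .
  qed
  have full: "\<forall>K\<in>\<K>. \<exists>\<alpha>\<in>?S. K \<subseteq> supp \<alpha>" unfolding \<K>_def by blast
  have "box_complex V c F {..<N} \<K> b t r"
    by (unfold_locales, unfold eqS) (fact V cK sz | (rule slice_box uniq signs; assumption) | (rule cover, blast))+
  moreover have "\<forall>g\<in>{..<N}. \<forall>i. r g $ i \<in> \<int>" using rint by simp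
  ultimately show ?thesis using full unfolding eqS[symmetric] by blast
qed

section \<open>Unimodular subdivisions of the box\<close>

text \<open>A small multiple of the relation can be added to \<open>\<sigma>\<close> without leaving
  its cell. If the image of the relation is \<open>0\<close>, this does not move the point, and
  injectivity on points forces the relation to vanish.\<close>

lemma kern_point_injective:
  assumes fin: "finite G" and cx: "complex G \<K>"
    and inj: "\<And>\<alpha> \<beta>. \<alpha> \<in> slice G \<K> deg t \<Longrightarrow> \<beta> \<in> slice G \<K> deg t \<Longrightarrow> point G r \<alpha> = point G r \<beta> \<Longrightarrow> \<alpha> = \<beta>"
    and \<sigma>: "\<sigma> \<in> slice G \<K> deg t" and \<alpha>: "\<alpha> \<in> kern G deg" "supp \<alpha> \<subseteq> supp \<sigma>" and z: "point G r \<alpha> = 0"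
  shows "\<alpha> = (\<lambda>_. 0)"
proof (rule ccontr)
  assume "\<alpha> \<noteq> (\<lambda>_. 0)"
  then have ne: "supp \<alpha> \<noteq> {}" by (auto simp: supp_def)
  have fs: "finite (supp \<alpha>)" using \<alpha>(1) fin by (auto simp: kern_def intro: finite_subset)
  define c where "c = Min ((\<lambda>g. \<sigma> g / \<bar>\<alpha> g\<bar>) ` supp \<alpha>)"
  have cle: "c \<le> \<sigma> g / \<bar>\<alpha> g\<bar>" if "g \<in> supp \<alpha>" for g unfolding c_def using fs that by (intro Min_le) auto
  have "c \<in> (\<lambda>g. \<sigma> g / \<bar>\<alpha> g\<bar>) ` supp \<alpha>" unfolding c_def using fs ne by (intro Min_in) auto
  then obtain g where g: "g \<in> supp \<alpha>" "c = \<sigma> g / \<bar>\<alpha> g\<bar>" by blast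
  have "\<sigma> g \<noteq> 0" using g(1) \<alpha>(2) by (auto simp: supp_def)
  then have cpos: "0 < c" using g sliceD(1)[OF \<sigma>, of g] by (simp add: supp_def)
  let ?\<beta> = "\<lambda>g. \<sigma> g + c * \<alpha> g"
  have nn: "0 \<le> ?\<beta> h" for h
  proof (cases "h \<in> supp \<alpha>")
    case True
    then have "c * \<bar>\<alpha> h\<bar> \<le> \<sigma> h" using cle[OF True] by (simp add: supp_def pos_le_divide_eq)
    moreover have "c * - \<bar>\<alpha> h\<bar> \<le> c * \<alpha> h" using cpos by (intro mult_left_mono) auto
    ultimately show ?thesis by simp
  qed (use sliceD(1)[OF \<sigma>] in \<open>simp add: supp_def\<close>)
  have "supp ?\<beta> \<subseteq> supp \<sigma>" using \<alpha>(2) by (auto simp: supp_def)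
  then have "supp ?\<beta> \<in> \<K>" by (rule complexD(3)[OF cx sliceD(2)[OF \<sigma>]])
  moreover have "(\<Sum>g\<in>G. ?\<beta> g * deg g s) = t s" for s
  proof -
    have "(\<Sum>g\<in>G. ?\<beta> g * deg g s) = (\<Sum>g\<in>G. \<sigma> g * deg g s) + c * (\<Sum>g\<in>G. \<alpha> g * deg g s)"
      by (simp add: algebra_simps sum.distrib sum_distrib_left)
    then show ?thesis using sliceD(3)[OF \<sigma>, of s] \<alpha>(1) by (simp add: kern_def)
  qed
  ultimately have b: "?\<beta> \<in> slice G \<K> deg t" using nn by (simp add: slice_def)
  have "point G r ?\<beta> = point G r \<sigma> + c *\<^sub>R point G r \<alpha>"
    by (simp add: point_def algebra_simps sum.distrib scaleR_sum_right)
  then have "?\<beta> = \<sigma>" by (intro inj[OF b \<sigma>]) (simp add: z)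
  then have "\<sigma> g + c * \<alpha> g = \<sigma> g" by (rule fun_cong)
  then show False using g(1) cpos by (simp add: supp_def)
qed

text \<open>A cell carries only finitely many bounded relations with integral image, so the multiples of
  such a relation repeat modulo integral relations.\<close>

lemma exponent_bound:
  fixes G :: "nat set" and b :: "nat \<Rightarrow> nat" and r :: "nat \<Rightarrow> real^'n::finite"
  assumes fin: "finite G" and cx: "complex G \<K>" and rint: "\<And>g i. g \<in> G \<Longrightarrow> r g $ i \<in> \<int>"
    and inj: "\<And>\<alpha>. \<alpha> \<in> kern G (udeg b) \<Longrightarrow> supp \<alpha> \<in> \<K> \<Longrightarrow> point G r \<alpha> = 0 \<Longrightarrow> \<alpha> = (\<lambda>_. 0)"
  shows "\<exists>q. \<forall>\<alpha>\<in>kern G (udeg b). supp \<alpha> \<in> \<K> \<longrightarrow> (\<forall>i. point G r \<alpha> $ i \<in> \<int>) \<longrightarrow>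
    (\<exists>e::nat. 1 \<le> e \<and> e \<le> q \<and> (\<lambda>g. real e * \<alpha> g) \<in> intvec)"
proof -
  let ?C = "real (card G) + 1"
  define X where "X = {x. x \<in> kern G (udeg b) \<and> supp x \<in> \<K> \<and> (\<forall>i. point G r x $ i \<in> \<int>) \<and> (\<forall>g. \<bar>x g\<bar> \<le> ?C)}"
  define B where "B = (\<Sum>g\<in>G. ?C * (\<Sum>i\<in>UNIV. \<bar>r g $ i\<bar>))"
  have bound: "\<bar>point G r x $ i\<bar> \<le> B" if "x \<in> X" for x i
  proof -
    have "\<bar>point G r x $ i\<bar> \<le> (\<Sum>g\<in>G. \<bar>x g\<bar> * \<bar>r g $ i\<bar>)"
      using sum_abs[of "\<lambda>g. x g * r g $ i" G] by (simp add: point_def abs_mult)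
    also have "\<dots> \<le> B" unfolding B_def
      using that by (intro sum_mono mult_mono) (auto simp: X_def intro: member_le_sum)
    finally show ?thesis .
  qed
  \<comment> \<open>Finiteness of \<open>X\<close>: a relation is determined by its support and its
    image, and the images are integral and bounded.\<close>
  have rel: "inj_on (\<lambda>x. (supp x, \<lambda>i. point G r x $ i)) X"
  proof (rule inj_onI)
    fix x y assume xy: "x \<in> X" "y \<in> X" "(supp x, \<lambda>i. point G r x $ i) = (supp y, \<lambda>i. point G r y $ i)"
    have p: "point G r x = point G r y" using xy(3) by (simp add: vec_eq_iff fun_eq_iff)
    have "(\<lambda>g. 1 * x g + (-1) * y g) = (\<lambda>_. 0)"
    proof (rule inj)
      show "(\<lambda>g. 1 * x g + (-1) * y g) \<in> kern G (udeg b)" using xy(1,2) by (intro kern_lin) (auto simp: X_def)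
      have "supp x = supp y" using xy(3) by simp
      then have "supp (\<lambda>g. 1 * x g + (-1) * y g) \<subseteq> supp x" unfolding supp_def by fastforce
      then show "supp (\<lambda>g. 1 * x g + (-1) * y g) \<in> \<K>" using complexD(3)[OF cx] xy(1) by (auto simp: X_def)
      show "point G r (\<lambda>g. 1 * x g + (-1) * y g) = 0" using p by (simp add: point_def algebra_simps sum_subtractf)
    qed
    then show "x = y" by (simp add: fun_eq_iff)
  qed
  have "x \<in> X \<Longrightarrow> point G r x $ i \<in> of_int ` {- \<lceil>B\<rceil>..\<lceil>B\<rceil>}" for x i
  proof -
    assume x: "x \<in> X"
    then have "point G r x $ i \<in> \<int>" by (simp add: X_def)
    then obtain z where z: "point G r x $ i = of_int z" by (rule Ints_cases)
    have "z \<in> {- \<lceil>B\<rceil>..\<lceil>B\<rceil>}" using bound[OF x, of i] unfolding z by (simp add: abs_le_iff) linarith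
    then show ?thesis using z by simp
  qed
  then have "(\<lambda>x. (supp x, \<lambda>i. point G r x $ i)) ` X \<subseteq>
      Pow G \<times> {f. \<forall>i. (i \<in> UNIV \<longrightarrow> f i \<in> of_int ` {- \<lceil>B\<rceil>..\<lceil>B\<rceil>}) \<and> (i \<notin> UNIV \<longrightarrow> f i = 0)}"
    using complexD(2)[OF cx] by (auto simp: X_def)
  moreover have "finite (Pow G \<times> {f :: 'n \<Rightarrow> real. \<forall>i. (i \<in> UNIV \<longrightarrow> f i \<in> of_int ` {- \<lceil>B\<rceil>..\<lceil>B\<rceil>}) \<and> (i \<notin> UNIV \<longrightarrow> f i = 0)})"
    using fin by (intro finite_cartesian_product finite_set_of_finite_funs) auto
  ultimately have finX: "finite X" using finite_subset finite_image_iff[OF rel] by blast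
  have "\<exists>e::nat. 1 \<le> e \<and> e \<le> card X \<and> (\<lambda>g. real e * \<alpha> g) \<in> intvec"
    if a: "\<alpha> \<in> kern G (udeg b)" "supp \<alpha> \<in> \<K>" "\<And>i. point G r \<alpha> $ i \<in> \<int>" for \<alpha>
  proof -
    have k: "(\<lambda>g. real j * \<alpha> g) \<in> kern G (udeg b)" for j using kern_lin[OF a(1) a(1), of "real j" 0] by simp
    have "\<forall>j. \<exists>y. y \<in> kern G (udeg b) \<inter> intvec \<and> supp y \<subseteq> supp \<alpha> \<and> (\<forall>g. \<bar>real j * \<alpha> g - y g\<bar> \<le> ?C)"
    proof
      fix j :: nat
      have "supp (\<lambda>g. real j * \<alpha> g) \<subseteq> supp \<alpha>" by (auto simp: supp_def)
      then show "\<exists>y. y \<in> kern G (udeg b) \<inter> intvec \<and> supp y \<subseteq> supp \<alpha> \<and> (\<forall>g. \<bar>real j * \<alpha> g - y g\<bar> \<le> ?C)"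
        using kern_reduce[OF fin k[of j]] by blast
    qed
    then obtain y where y: "\<And>j. y j \<in> kern G (udeg b) \<inter> intvec \<and> supp (y j) \<subseteq> supp \<alpha> \<and> (\<forall>g. \<bar>real j * \<alpha> g - y j g\<bar> \<le> ?C)"
      by (rule choice[THEN exE]) blast
    define x where "x j g = real j * \<alpha> g + (-1) * y j g" for j :: nat and g
    have xX: "x j \<in> X" for j
    proof -
      have "x j \<in> kern G (udeg b)" unfolding x_def[abs_def] using y[of j] by (intro kern_lin a(1)) auto
      moreover have "supp (x j) \<subseteq> supp \<alpha>" using y[of j] by (auto simp: supp_def x_def)
      then have "supp (x j) \<in> \<K>" by (rule complexD(3)[OF cx a(2)])
      moreover have "point G r (x j) $ i \<in> \<int>" for i
      proof -
        have "point G r (x j) $ i = real j * point G r \<alpha> $ i - (\<Sum>g\<in>G. y j g * r g $ i)"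
          by (simp add: point_def x_def algebra_simps sum_subtractf sum_distrib_left)
        moreover have "(\<Sum>g\<in>G. y j g * r g $ i) \<in> \<int>"
          using y[of j] rint by (intro Ints_sum Ints_mult) (auto simp: intvec_def)
        ultimately show ?thesis using a(3)[of i] by simp
      qed
      moreover have "\<bar>x j g\<bar> \<le> ?C" for g using y[of j] by (simp add: x_def)
      ultimately show ?thesis by (simp add: X_def)
    qed
    \<comment> \<open>Pigeonhole: two of the multiples \<open>0, ..., card X\<close> agree modulo
      integral relations, and their difference is the exponent.\<close>
    have "\<not> inj_on x {..card X}"
    proof
      assume "inj_on x {..card X}"
      then have "card (x ` {..card X}) = Suc (card X)" by (simp add: card_image)
      moreover have "card (x ` {..card X}) \<le> card X" using xX by (intro card_mono finX) auto
      ultimately show False by simp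
    qed
    then obtain i j where ij: "i \<le> card X" "j \<le> card X" "x i = x j" "i < j"
      by (auto simp: inj_on_def) (metis nat_neq_iff)
    have "real (j - i) * \<alpha> g = y j g - y i g" for g
      using fun_cong[OF ij(3), of g] ij(4) by (simp add: x_def of_nat_diff algebra_simps)
    then have "(\<lambda>g. real (j - i) * \<alpha> g) \<in> intvec" using y[of i] y[of j] by (simp add: intvec_def)
    then show ?thesis using ij by (intro exI[of _ "j - i"]) auto
  qed
  then show ?thesis by blast
qed

text \<open>Rays are merely rational, as those introduced by the subdivision are rational
  combinations of old ones. Integral relations still have integral image by \<open>int\<close>, in
  particular the difference of two rays with the same label.\<close>

locale polystable_complex = box_complex V c F G \<K> b t r
  for V c and F :: "('n::finite form) set" and G \<K> b t r +
  assumes rat: "g \<in> G \<Longrightarrow> r g $ i \<in> \<rat>"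
    and uni: "\<alpha> \<in> kern G (udeg b) \<Longrightarrow> supp \<alpha> \<in> \<K> \<Longrightarrow> (\<And>i. point G r \<alpha> $ i \<in> \<int>) \<Longrightarrow> \<alpha> \<in> intvec"
    and int: "\<alpha> \<in> kern G (udeg b) \<Longrightarrow> \<alpha> \<in> intvec \<Longrightarrow> point G r \<alpha> $ i \<in> \<int>"

text \<open>Resolution is applied with all integral vectors as the lattice in the target. The
  initial rays are integral, which gives \<open>integral_on\<close>, and
  \<open>exponent_bound\<close> provides the bound on orders from which the induction
  starts.\<close>

theorem polystable_complex_exists:
  fixes F :: "('n::finite form) set"
  assumes V: "rat_subspace V" and F: "finite F" and fV: "\<And>f. f \<in> F \<Longrightarrow> fst f \<in> V"
    and rat: "\<And>f i. f \<in> F \<Longrightarrow> snd f $ i \<in> \<rat>" and c0: "0 \<le> c"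
    and box: "\<And>i. (c, axis i 1) \<in> F" "\<And>i. (c, - axis i 1) \<in> F"
  shows "\<exists>G \<K> b t r. polystable_complex V c F G \<K> b t r"
proof -
  have "\<exists>G0 \<K>0 b0 t0 r0. box_complex V c F G0 \<K>0 b0 t0 r0 \<and> (\<forall>g\<in>G0. \<forall>i. r0 g $ i \<in> \<int>) \<and>
      (\<forall>K\<in>\<K>0. \<exists>\<alpha>\<in>slice G0 \<K>0 (udeg b0) t0. K \<subseteq> supp \<alpha>)"
    by (rule initial_complex[OF V F fV rat c0 box])
  then obtain G0 \<K>0 b0 t0 r0 where R: "box_complex V c F G0 \<K>0 b0 t0 r0 \<and> (\<forall>g\<in>G0. \<forall>i. r0 g $ i \<in> \<int>) \<and>
      (\<forall>K\<in>\<K>0. \<exists>\<alpha>\<in>slice G0 \<K>0 (udeg b0) t0. K \<subseteq> supp \<alpha>)"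
    by (elim exE) (rule that)
  interpret B: box_complex V c F G0 \<K>0 b0 t0 r0 using R by blast
  let ?T = "slice G0 \<K>0 (udeg b0) t0"
  note c0 = B.cx and sz0 = B.sz
  have rint: "r0 g $ i \<in> \<int>" if "g \<in> G0" for g i using R that by blast
  have full0: "\<exists>\<alpha>\<in>?T. K \<subseteq> supp \<alpha>" if "K \<in> \<K>0" for K using R that by blast
  have fin0: "finite G0" by (rule complexD(1)[OF c0])
  have "\<exists>q. \<forall>\<alpha>\<in>kern G0 (udeg b0). supp \<alpha> \<in> \<K>0 \<longrightarrow> (\<forall>i. point G0 r0 \<alpha> $ i \<in> \<int>) \<longrightarrow>
    (\<exists>e::nat. 1 \<le> e \<and> e \<le> q \<and> (\<lambda>g. real e * \<alpha> g) \<in> intvec)"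
  proof (rule exponent_bound[OF fin0 c0 rint])
    fix \<alpha> assume a: "\<alpha> \<in> kern G0 (udeg b0)" "supp \<alpha> \<in> \<K>0" "point G0 r0 \<alpha> = 0"
    obtain \<sigma> where s: "\<sigma> \<in> ?T" "supp \<alpha> \<subseteq> supp \<sigma>" using full0 a(2) by blast
    show "\<alpha> = (\<lambda>_. 0)" by (rule kern_point_injective[OF fin0 c0 _ s(1) a(1) s(2) a(3)]) (rule B.inj)
  qed
  then obtain q where q: "\<exists>e::nat. 1 \<le> e \<and> e \<le> q \<and> (\<lambda>g. real e * \<alpha> g) \<in> intvec"
    if "\<alpha> \<in> kern G0 (udeg b0)" "supp \<alpha> \<in> \<K>0" "\<And>i. point G0 r0 \<alpha> $ i \<in> \<int>" for \<alpha> by (elim exE) (rule that, blast)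
  define \<rho>0 where "\<rho>0 g = ($) (r0 g)" for g
  have comb0: "comb G0 \<rho>0 \<alpha> i = point G0 r0 \<alpha> $ i" for \<alpha> i by (simp add: point_nth \<rho>0_def[abs_def])
  have L: "zmod (intvec :: ('n \<Rightarrow> real) set)" by (auto simp: zmod_def intvec_def)
  have i0: "integral_on G0 (udeg b0) \<rho>0 intvec"
    unfolding integral_on_def intvec_def comb_def \<rho>0_def using rint by (auto intro!: Ints_sum Ints_mult)
  have "\<exists>(G3::nat set) \<K>3 (b3::nat \<Rightarrow> nat) t3 \<rho>3. subdiv G0 \<K>0 (udeg b0) t0 G3 \<K>3 (udeg b3) t3 \<rho>3 \<and>
    unimod G3 \<K>3 (udeg b3) (\<lambda>g. comb G0 \<rho>0 (\<rho>3 g)) intvec \<and> integral_on G3 (udeg b3) (\<lambda>g. comb G0 \<rho>0 (\<rho>3 g)) intvec \<and> sizes V G3 b3 t3"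
  proof (rule resolve_cells[OF fin0 c0 i0 L, where q = q])
    fix \<alpha> assume "\<alpha> \<in> kern G0 (udeg b0)" "supp \<alpha> \<in> \<K>0" "comb G0 \<rho>0 \<alpha> \<in> intvec"
    then show "\<exists>e::nat. 1 \<le> e \<and> e \<le> q \<and> (\<lambda>g. real e * \<alpha> g) \<in> intvec" by (intro q) (auto simp: intvec_def comb0)
  next
    fix ms assume "\<And>m. m \<in> set ms \<Longrightarrow> m \<in> kern G0 (udeg b0) \<and> (\<exists>e::nat. 1 \<le> e \<and> e \<le> q \<and> (\<lambda>g. real e * m g) \<in> intvec)"
    then show "resolvable V G0 b0 t0 (lat (kern G0 (udeg b0) \<inter> intvec) ms)" by (rule resolve[OF V fin0 sz0])
  qed
  then obtain G3 :: "nat set" and \<K>3 and b3 :: "nat \<Rightarrow> nat" and t3 \<rho>3 where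
    R3: "subdiv G0 \<K>0 (udeg b0) t0 G3 \<K>3 (udeg b3) t3 \<rho>3 \<and>
    unimod G3 \<K>3 (udeg b3) (\<lambda>g. comb G0 \<rho>0 (\<rho>3 g)) intvec \<and> integral_on G3 (udeg b3) (\<lambda>g. comb G0 \<rho>0 (\<rho>3 g)) intvec \<and> sizes V G3 b3 t3"
    by (elim exE) (rule that)
  note s3 = conjunct1[OF R3] and u3 = conjunct1[OF conjunct2[OF R3]] and i3 = conjunct1[OF conjunct2[OF conjunct2[OF R3]]]
    and sz3 = conjunct2[OF conjunct2[OF conjunct2[OF R3]]]
  note c3 = subdivD(1)[OF s3]
  define r where "r g = point G0 r0 (\<rho>3 g)" for g
  have r3: "(\<lambda>g. comb G0 \<rho>0 (\<rho>3 g)) = (\<lambda>g. ($) (r g))" by (simp add: fun_eq_iff comb0 r_def)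
  have pt: "point G3 r \<alpha> = point G0 r0 (comb G3 \<rho>3 \<alpha>)" for \<alpha>
  proof -
    have "comb G0 \<rho>0 (comb G3 \<rho>3 \<alpha>) = comb G3 (\<lambda>g. ($) (r g)) \<alpha>" unfolding comb_comb r3 ..
    then show ?thesis by (simp add: vec_eq_iff point_nth[of G3] flip: comb0)
  qed
  let ?S = "slice G3 \<K>3 (udeg b3) t3"
  have sc: "supp (comb G3 \<rho>3 \<alpha>) = (\<Union>g\<in>supp \<alpha>. supp (\<rho>3 g))" if "\<alpha> \<in> ?S" for \<alpha>
    by (rule supp_comb_nonneg[OF complexD(1)[OF c3] complexD(2)[OF c3 sliceD(2)[OF that]] sliceD(1)[OF that]])
      (rule subdivD(2)[OF s3])
  have "polystable_complex V c F G3 \<K>3 b3 t3 r"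
  proof
    show "rat_subspace V" "complex G3 \<K>3" "sizes V G3 b3 t3" by fact+
    show "r g $ i \<in> \<rat>" if "g \<in> G3" for g i
      unfolding r_def point_nth comb_def
      using subdivD(3)[OF s3 that] rint Ints_subset_Rats by (intro Rats_sum Rats_mult) auto
    show "\<bar>point G3 r \<alpha> $ i\<bar> \<le> c" if "\<alpha> \<in> ?S" for \<alpha> i
      unfolding pt by (rule B.inbox[OF subdivD(7)[OF s3 that]])
    show "\<exists>\<alpha>\<in>?S. point G3 r \<alpha> = x" if x: "\<And>i. \<bar>x $ i\<bar> \<le> c" for x
    proof -
      obtain \<beta> where b: "\<beta> \<in> ?T" "point G0 r0 \<beta> = x" using B.cover[OF x] by blast
      obtain \<alpha> where a: "\<alpha> \<in> ?S" "comb G3 \<rho>3 \<alpha> = \<beta>" by (rule subdivE[OF s3 b(1)])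
      show ?thesis by (rule bexI[OF _ a(1)]) (simp add: pt a(2) b(2))
    qed
    show "\<alpha> = \<beta>" if ab: "\<alpha> \<in> ?S" "\<beta> \<in> ?S" "point G3 r \<alpha> = point G3 r \<beta>" for \<alpha> \<beta>
    proof (rule subdiv_unique[OF s3 ab(1,2)])
      show "comb G3 \<rho>3 \<alpha> = comb G3 \<rho>3 \<beta>"
        using B.inj[OF subdivD(7)[OF s3 ab(1)] subdivD(7)[OF s3 ab(2)]] ab(3) unfolding pt by blast
    qed
    show "\<alpha> \<in> intvec" if a: "\<alpha> \<in> kern G3 (udeg b3)" "supp \<alpha> \<in> \<K>3" "\<And>i. point G3 r \<alpha> $ i \<in> \<int>" for \<alpha>
      using u3 a unfolding r3 unimod_def by (auto simp: point_nth intvec_def)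
    show "point G3 r \<alpha> $ i \<in> \<int>" if a: "\<alpha> \<in> kern G3 (udeg b3)" "\<alpha> \<in> intvec" for \<alpha> i
    proof -
      have "comb G3 (\<lambda>g. ($) (r g)) \<alpha> \<in> intvec" using i3 a unfolding r3 integral_on_def by blast
      then show ?thesis by (simp add: point_nth intvec_def)
    qed
    show "0 \<le> fst f + snd f \<bullet> point G3 r \<beta>"
      if f: "f \<in> F" and ab: "\<alpha> \<in> ?S" "\<beta> \<in> ?S" "supp \<beta> \<subseteq> supp \<alpha>" "0 \<le> fst f + snd f \<bullet> point G3 r \<alpha>" for f \<alpha> \<beta>
    proof -
      have "supp (comb G3 \<rho>3 \<beta>) \<subseteq> supp (comb G3 \<rho>3 \<alpha>)" unfolding sc[OF ab(1)] sc[OF ab(2)] using ab(3) by blast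
      then show ?thesis
        using B.signs[OF f subdivD(7)[OF s3 ab(1)] subdivD(7)[OF s3 ab(2)]] ab(4) unfolding pt by blast
    qed
  qed
  then show ?thesis by blast
qed

section \<open>Cells\<close>

lemma finite_line_affine:
  fixes A :: "'a::real_vector set"
  assumes A: "affine A" and y: "y \<notin> A"
  shows "finite {u. x + u *\<^sub>R (y - x) \<in> A}"
proof -
  have "u = u'" if uu: "x + u *\<^sub>R (y - x) \<in> A" "x + u' *\<^sub>R (y - x) \<in> A" for u u'
  proof (rule ccontr)
    assume ne: "u \<noteq> u'"
    define s where "s = (1 - u) / (u' - u)"
    have s: "s * u' = 1 - u + s * u" using ne by (simp add: s_def field_simps)
    have "(1 - s) *\<^sub>R (x + u *\<^sub>R (y - x)) + s *\<^sub>R (x + u' *\<^sub>R (y - x)) = x + ((1 - s) * u + s * u') *\<^sub>R (y - x)"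
      by (simp add: algebra_simps)
    also have "(1 - s) * u + s * u' = 1" using s by (simp add: algebra_simps)
    finally have "(1 - s) *\<^sub>R (x + u *\<^sub>R (y - x)) + s *\<^sub>R (x + u' *\<^sub>R (y - x)) = y" by simp
    then show False using mem_affine[OF A uu, of "1 - s" s] y by simp
  qed
  note eq = this
  show ?thesis
  proof (cases "{u. x + u *\<^sub>R (y - x) \<in> A} = {}")
    case False
    then obtain u where u: "x + u *\<^sub>R (y - x) \<in> A" by auto
    have "{u. x + u *\<^sub>R (y - x) \<in> A} \<subseteq> {u}"
    proof
      fix u' assume "u' \<in> {u. x + u *\<^sub>R (y - x) \<in> A}"
      then show "u' \<in> {u}" using eq[OF _ u] by simp
    qed
    then show ?thesis by (rule finite_subset) simp
  qed simp
qed

text \<open>On the segment between a point avoiding the earlier sets and a point outside the new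
  one, each of the affine sets meets only finitely many parameters.\<close>

lemma convex_not_covered_by_affine:
  assumes "convex P" "finite \<A>" "\<And>A. A \<in> \<A> \<Longrightarrow> affine A \<and> \<not> P \<subseteq> A" "P \<noteq> {}"
  shows "\<exists>y\<in>P. \<forall>A\<in>\<A>. y \<notin> A"
  using assms(2,3)
proof (induction \<A> rule: finite_induct)
  case empty
  then show ?case using assms(4) by blast
next
  case (insert A \<A>)
  then obtain y where y: "y \<in> P" "\<And>B. B \<in> \<A> \<Longrightarrow> y \<notin> B" by blast
  obtain z where z: "z \<in> P" "z \<notin> A" using insert.prems[of A] by blast
  let ?l = "\<lambda>u. z + u *\<^sub>R (y - z)"
  have fin: "finite {u. ?l u \<in> B}" if "B \<in> \<A>" for B by (rule finite_line_affine) (use insert.prems y that in auto)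
  have "{u. ?l u \<in> A} = {u. y + (1 - u) *\<^sub>R (z - y) \<in> A}" by (simp add: algebra_simps)
  also have "\<dots> = (\<lambda>u. 1 - u) -` {u. y + u *\<^sub>R (z - y) \<in> A}" by auto
  finally have e: "{u. ?l u \<in> A} = (\<lambda>u. 1 - u) -` {u. y + u *\<^sub>R (z - y) \<in> A}" .
  have "finite {u. ?l u \<in> A}"
    unfolding e using finite_line_affine[of A z y] z(2) insert.prems[of A] by (intro finite_vimageI) (auto simp: inj_on_def)
  then have "finite (\<Union>B\<in>insert A \<A>. {u. ?l u \<in> B})" using fin insert.hyps(1) by auto
  moreover have "infinite {0<..<1::real}" by simp
  ultimately obtain u where u: "u \<in> {0<..<1}" "u \<notin> (\<Union>B\<in>insert A \<A>. {u. ?l u \<in> B})"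
    by (meson finite_subset subsetI)
  have "?l u = (1 - u) *\<^sub>R z + u *\<^sub>R y" by (simp add: algebra_simps)
  then have "?l u \<in> P" using convexD_alt[OF assms(1) z(1) y(1), of u] u(1) by simp
  then show ?case using u(2) by blast
qed

text \<open>Near \<open>x\<close>, a segment to a general point of \<open>P\<close> avoids the affine hulls not containing \<open>P\<close>.\<close>

lemma cover_by_full:
  fixes P :: "'a::real_normed_vector set"
  assumes P: "convex P" and fin: "finite \<Q>" and cl: "\<And>Q. Q \<in> \<Q> \<Longrightarrow> closed Q" and cov: "P \<subseteq> \<Union>\<Q>" and x: "x \<in> P"
  shows "\<exists>Q\<in>\<Q>. x \<in> Q \<and> P \<subseteq> affine hull Q"
proof (rule ccontr)
  assume no: "\<not> ?thesis"
  define B where "B = {Q\<in>\<Q>. \<not> P \<subseteq> affine hull Q}"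
  have "\<exists>y\<in>P. \<forall>A\<in>(\<lambda>Q. affine hull Q) ` B. y \<notin> A"
    by (rule convex_not_covered_by_affine[OF P]) (use fin x in \<open>auto simp: B_def\<close>)
  then obtain y where y: "y \<in> P" "\<And>Q. Q \<in> B \<Longrightarrow> y \<notin> affine hull Q" by blast
  let ?l = "\<lambda>u. x + u *\<^sub>R (y - x)"
  have "finite {u. ?l u \<in> affine hull Q}" if "Q \<in> B" for Q by (rule finite_line_affine) (use y that in auto)
  moreover have "finite B" using fin by (simp add: B_def)
  ultimately have fl: "finite (\<Union>Q\<in>B. {u. ?l u \<in> affine hull Q})" by blast
  have "closed (\<Union>(\<Q> - B))" by (rule closed_Union) (use fin cl in auto)
  moreover have "x \<notin> \<Union>(\<Q> - B)" using no by (auto simp: B_def)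
  ultimately have op: "open (- \<Union>(\<Q> - B))" "x \<in> - \<Union>(\<Q> - B)" by auto
  have "(?l \<longlongrightarrow> x + 0 *\<^sub>R (y - x)) (at 0)" by (intro tendsto_intros)
  then have "(?l \<longlongrightarrow> x) (at 0)" by simp
  then have "eventually (\<lambda>u. ?l u \<in> - \<Union>(\<Q> - B)) (at 0)" using op by (rule topological_tendstoD)
  then obtain d where d: "0 < d" "\<And>u. u \<noteq> 0 \<Longrightarrow> dist u 0 < d \<Longrightarrow> ?l u \<in> - \<Union>(\<Q> - B)"
    unfolding eventually_at by blast
  have "{0<..<min d 1} \<subseteq> (\<Union>Q\<in>B. {u. ?l u \<in> affine hull Q})"
  proof
    fix u assume u: "u \<in> {0<..<min d 1}"
    have "?l u = (1 - u) *\<^sub>R x + u *\<^sub>R y" by (simp add: algebra_simps)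
    then have "?l u \<in> P" using convexD_alt[OF P x y(1), of u] u by simp
    then obtain Q where Q: "Q \<in> \<Q>" "?l u \<in> Q" using cov by blast
    have "?l u \<in> - \<Union>(\<Q> - B)" by (rule d(2)) (use u in auto)
    then have "Q \<in> B" using Q by blast
    then show "u \<in> (\<Union>Q\<in>B. {u. ?l u \<in> affine hull Q})" using hull_inc[OF Q(2)] by blast
  qed
  then have "finite {0<..<min d 1}" using fl finite_subset by blast
  moreover have "infinite {0<..<min d 1}" using d(1) by (simp add: infinite_Ioo)
  ultimately show False by blast
qed

context polystable_complex
begin

abbreviation "S \<equiv> slice G \<K> (udeg b) t"

definition cell :: "nat set \<Rightarrow> (real^'n) set" where
  "cell K = point G r ` {\<alpha>\<in>S. supp \<alpha> \<subseteq> K}"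

lemma finG: "finite G" by (rule complexD(1)[OF cx])

lemma point_convex: "point G r (\<lambda>g. (1 - u) * \<alpha> g + u * \<beta> g) = (1 - u) *\<^sub>R point G r \<alpha> + u *\<^sub>R point G r \<beta>"
  by (simp add: point_def algebra_simps sum.distrib sum_subtractf scaleR_sum_right)

lemma slice_convex:
  assumes K: "K \<in> \<K>" and \<alpha>: "\<alpha> \<in> S" "supp \<alpha> \<subseteq> K" and \<beta>: "\<beta> \<in> S" "supp \<beta> \<subseteq> K" and u: "0 \<le> u" "u \<le> 1"
  shows "(\<lambda>g. (1 - u) * \<alpha> g + u * \<beta> g) \<in> S"
proof -
  have "supp (\<lambda>g. (1 - u) * \<alpha> g + u * \<beta> g) \<subseteq> supp \<alpha> \<union> supp \<beta>" by (auto simp: supp_def)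
  then have "supp (\<lambda>g. (1 - u) * \<alpha> g + u * \<beta> g) \<subseteq> K" using \<alpha>(2) \<beta>(2) by blast
  then have "supp (\<lambda>g. (1 - u) * \<alpha> g + u * \<beta> g) \<in> \<K>" by (rule complexD(3)[OF cx K])
  moreover have "(\<Sum>g\<in>G. ((1 - u) * \<alpha> g + u * \<beta> g) * udeg b g a) = t a" for a
  proof -
    have "(\<Sum>g\<in>G. ((1 - u) * \<alpha> g + u * \<beta> g) * udeg b g a) =
      (1 - u) * (\<Sum>g\<in>G. \<alpha> g * udeg b g a) + u * (\<Sum>g\<in>G. \<beta> g * udeg b g a)"
      by (simp add: algebra_simps sum.distrib sum_subtractf sum_distrib_left)
    then show ?thesis using sliceD(3)[OF \<alpha>(1), of a] sliceD(3)[OF \<beta>(1), of a] by (simp add: algebra_simps)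
  qed
  ultimately show ?thesis using sliceD(1)[OF \<alpha>(1)] sliceD(1)[OF \<beta>(1)] u by (simp add: slice_def)
qed

lemma cell_mono: "K' \<subseteq> K \<Longrightarrow> cell K' \<subseteq> cell K"
  by (auto simp: cell_def)

text \<open>A common point has only one weight vector, whose support lies in both sets.\<close>

lemma cell_Int: "cell K \<inter> cell K' = cell (K \<inter> K')"
proof
  show "cell K \<inter> cell K' \<subseteq> cell (K \<inter> K')"
  proof
    fix x assume "x \<in> cell K \<inter> cell K'"
    then obtain \<alpha> \<beta> where a: "\<alpha> \<in> S" "supp \<alpha> \<subseteq> K" "x = point G r \<alpha>" and b: "\<beta> \<in> S" "supp \<beta> \<subseteq> K'" "x = point G r \<beta>"
      unfolding cell_def by blast
    have "\<alpha> = \<beta>" by (rule inj[OF a(1) b(1)]) (use a b in simp)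
    then show "x \<in> cell (K \<inter> K')" unfolding cell_def using a b by blast
  qed
qed (simp add: cell_mono)

lemma convex_cell:
  assumes K: "K \<in> \<K>" shows "convex (cell K)"
proof -
  have "(1 - u) *\<^sub>R x + u *\<^sub>R y \<in> cell K" if xy: "x \<in> cell K" "y \<in> cell K" and u: "0 \<le> u" "u \<le> 1" for x y u
  proof -
    obtain \<alpha> \<beta> where a: "\<alpha> \<in> S" "supp \<alpha> \<subseteq> K" "x = point G r \<alpha>" and b: "\<beta> \<in> S" "supp \<beta> \<subseteq> K" "y = point G r \<beta>"
      using xy unfolding cell_def by blast
    have "supp (\<lambda>g. (1 - u) * \<alpha> g + u * \<beta> g) \<subseteq> supp \<alpha> \<union> supp \<beta>" by (auto simp: supp_def)
    then have "supp (\<lambda>g. (1 - u) * \<alpha> g + u * \<beta> g) \<subseteq> K" using a(2) b(2) by blast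
    then show ?thesis unfolding cell_def a(3) b(3) point_convex[symmetric]
      by (intro imageI CollectI conjI slice_convex[OF K a(1,2) b(1,2) u])
  qed
  then show ?thesis unfolding convex_alt by blast
qed

text \<open>By uniqueness of weights, those of \<open>z\<close> are the convex combination of the
  weights of \<open>x\<close> and \<open>y\<close>. All are nonnegative, so if the combination
  vanishes off \<open>K'\<close>, both ends do.\<close>

lemma cell_face:
  assumes K: "K \<in> \<K>" and sub: "K' \<subseteq> K" shows "cell K' face_of cell K"
  unfolding face_of_def
proof (intro conjI ballI impI)
  show "cell K' \<subseteq> cell K" by (rule cell_mono[OF sub])
  show "convex (cell K')" by (rule convex_cell[OF complexD(3)[OF cx K sub]])
  fix x y z assume xy: "x \<in> cell K" "y \<in> cell K" and z: "z \<in> cell K'" "z \<in> open_segment x y"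
  obtain \<alpha> \<beta> where a: "\<alpha> \<in> S" "supp \<alpha> \<subseteq> K" "x = point G r \<alpha>" and b: "\<beta> \<in> S" "supp \<beta> \<subseteq> K" "y = point G r \<beta>"
    using xy unfolding cell_def by blast
  obtain \<gamma> where c: "\<gamma> \<in> S" "supp \<gamma> \<subseteq> K'" "z = point G r \<gamma>" using z(1) unfolding cell_def by blast
  obtain u where u: "0 < u" "u < 1" "z = (1 - u) *\<^sub>R x + u *\<^sub>R y" using z(2) unfolding in_segment by blast
  let ?\<delta> = "\<lambda>g. (1 - u) * \<alpha> g + u * \<beta> g"
  have d: "?\<delta> \<in> S" by (rule slice_convex[OF K a(1,2) b(1,2)]) (use u in auto)
  have eq: "?\<delta> = \<gamma>" by (rule inj[OF d c(1)]) (use u(3) a(3) b(3) c(3) in \<open>simp add: point_convex\<close>)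
  have z0: "\<alpha> g = 0 \<and> \<beta> g = 0" if g: "g \<notin> K'" for g
  proof -
    have "(1 - u) * \<alpha> g + u * \<beta> g = 0" using fun_cong[OF eq, of g] g c(2) by (auto simp: supp_def)
    moreover have "0 \<le> (1 - u) * \<alpha> g" "0 \<le> u * \<beta> g" using sliceD(1)[OF a(1)] sliceD(1)[OF b(1)] u by simp_all
    ultimately have "(1 - u) * \<alpha> g = 0" "u * \<beta> g = 0" by linarith+
    then show ?thesis using u by simp
  qed
  then have "supp \<alpha> \<subseteq> K'" "supp \<beta> \<subseteq> K'" by (auto simp: supp_def)
  then show "x \<in> cell K'" "y \<in> cell K'" unfolding cell_def using a b by blast+
qed

text \<open>The cell is the image of a compact set of weights. A weight is at most the size of its
  label, so these weights form a product of intervals, cut by the degree conditions.\<close>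

lemma closed_cell:
  assumes K: "K \<in> \<K>" shows "closed (cell K)"
proof -
  define C where "C = (PiE UNIV (\<lambda>g. if g \<in> K then {0..t (b g)} else {0}) :: (nat \<Rightarrow> real) set)"
  have cC: "compact C"
    unfolding C_def compactin_euclidean_iff[symmetric] euclidean_product_topology[symmetric] compactin_PiE by auto
  have cd: "closed {\<alpha> :: nat \<Rightarrow> real. \<forall>a. (\<Sum>g\<in>G. \<alpha> g * udeg b g a) = t a}"
  proof -
    have "{\<alpha> :: nat \<Rightarrow> real. \<forall>a. (\<Sum>g\<in>G. \<alpha> g * udeg b g a) = t a} = (\<Inter>a. {\<alpha>. (\<Sum>g\<in>G. \<alpha> g * udeg b g a) = t a})" by auto
    then show ?thesis by (simp only:) (intro closed_INT ballI closed_Collect_eq continuous_intros continuous_on_product_coordinates)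
  qed
  have KG: "K \<subseteq> G" by (rule complexD(2)[OF cx K])
  have "{\<alpha>\<in>S. supp \<alpha> \<subseteq> K} = C \<inter> {\<alpha>. \<forall>a. (\<Sum>g\<in>G. \<alpha> g * udeg b g a) = t a}"
  proof (intro equalityI subsetI)
    fix \<alpha> assume "\<alpha> \<in> {\<alpha>\<in>S. supp \<alpha> \<subseteq> K}"
    then have a: "\<alpha> \<in> S" "supp \<alpha> \<subseteq> K" by auto
    have "\<alpha> g \<le> t (b g)" if "g \<in> K" for g
    proof -
      have "\<alpha> g * udeg b g (b g) \<le> (\<Sum>h\<in>G. \<alpha> h * udeg b h (b g))"
        by (rule member_le_sum) (use that KG sliceD(1)[OF a(1)] finG in \<open>auto simp: udeg_def\<close>)
      then show ?thesis using sliceD(3)[OF a(1), of "b g"] by (simp add: udeg_def)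
    qed
    then have "\<alpha> \<in> C" using sliceD(1)[OF a(1)] a(2) by (auto simp: C_def supp_def)
    then show "\<alpha> \<in> C \<inter> {\<alpha>. \<forall>a. (\<Sum>g\<in>G. \<alpha> g * udeg b g a) = t a}" using sliceD(3)[OF a(1)] by simp
  next
    fix \<alpha> assume a: "\<alpha> \<in> C \<inter> {\<alpha>. \<forall>a. (\<Sum>g\<in>G. \<alpha> g * udeg b g a) = t a}"
    have m: "\<alpha> g \<in> (if g \<in> K then {0..t (b g)} else {0})" for g using a by (auto simp: C_def PiE_def Pi_def)
    have "0 \<le> \<alpha> g" for g using m[of g] by (auto split: if_splits)
    moreover have "g \<in> K" if "\<alpha> g \<noteq> 0" for g using m[of g] that by (auto split: if_splits)
    then have s: "supp \<alpha> \<subseteq> K" by (auto simp: supp_def)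
    ultimately show "\<alpha> \<in> {\<alpha>\<in>S. supp \<alpha> \<subseteq> K}" using a complexD(3)[OF cx K s] by (simp add: slice_def)
  qed
  then have "compact {\<alpha>\<in>S. supp \<alpha> \<subseteq> K}" using compact_Int_closed[OF cC cd] by simp
  moreover have "continuous_on {\<alpha>\<in>S. supp \<alpha> \<subseteq> K} (point G r)"
    unfolding point_def[abs_def] by (intro continuous_intros continuous_on_subset[OF continuous_on_product_coordinates]) simp
  ultimately show ?thesis unfolding cell_def by (intro compact_imp_closed compact_continuous_image)
qed

end

section \<open>Edge vectors and lattice bases\<close>

context polystable_complex
begin

text \<open>The ray \<open>g0 a\<close> is the base vertex of the simplex factor with label \<open>a\<close>.\<close>

definition base :: "(nat \<Rightarrow> nat) \<Rightarrow> nat set \<Rightarrow> bool" where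
  "base g0 K \<longleftrightarrow> (\<forall>a\<in>b ` G. g0 a \<in> K \<and> b (g0 a) = a)"

definition apexes :: "(nat \<Rightarrow> nat) \<Rightarrow> nat set" where
  "apexes g0 = g0 ` b ` G"

definition edge :: "(nat \<Rightarrow> nat) \<Rightarrow> nat \<Rightarrow> real^'n" where
  "edge g0 g = r g - r (g0 (b g))"

definition origin :: "(nat \<Rightarrow> nat) \<Rightarrow> real^'n" where
  "origin g0 = (\<Sum>a\<in>b ` G. t a *\<^sub>R r (g0 a))"

text \<open>For \<open>x\<close> vanishing at the apexes this enforces the degrees \<open>d\<close>
  by changing the apex weights alone. With \<open>d = 0\<close> it produces relations, with
  \<open>d = t\<close> points of the slice.\<close>

definition lift :: "(nat \<Rightarrow> nat) \<Rightarrow> (nat \<Rightarrow> real) \<Rightarrow> (nat \<Rightarrow> real) \<Rightarrow> nat \<Rightarrow> real" where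
  "lift g0 d x g = x g + of_bool (g \<in> apexes g0) * (d (b g) - bdegree G b x (b g))"

lemma base_exists:
  assumes \<sigma>: "\<sigma> \<in> S" shows "\<exists>g0. base g0 (supp \<sigma>)"
proof -
  have "\<forall>a\<in>b ` G. \<exists>g. g \<in> supp \<sigma> \<and> b g = a"
  proof
    fix a assume "a \<in> b ` G"
    then have "0 < t a" using sz by (auto simp: sizes_def)
    then have "bdegree G b \<sigma> a \<noteq> 0" using sliceD(3)[OF \<sigma>, of a] by (simp add: bdegree_def)
    then show "\<exists>g. g \<in> supp \<sigma> \<and> b g = a" using bdegree_nonzero by blast
  qed
  then obtain g0 where "\<forall>a\<in>b ` G. g0 a \<in> supp \<sigma> \<and> b (g0 a) = a" using bchoice by metis
  then show ?thesis unfolding base_def by blast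
qed

lemma baseD:
  assumes "base g0 K" "K \<in> \<K>"
  shows "apexes g0 \<subseteq> K" "apexes g0 \<subseteq> G" "g \<in> apexes g0 \<Longrightarrow> g0 (b g) = g"
  using assms complexD(2)[OF cx assms(2)] by (auto simp: base_def apexes_def)

lemma lift_degree:
  assumes g0: "base g0 K" "K \<in> \<K>" and x: "\<forall>g\<in>apexes g0. x g = 0"
  shows "bdegree G b (lift g0 d x) a = (if a \<in> b ` G then d a else 0)"
proof -
  have "bdegree G b (lift g0 d x) a =
    bdegree G b x a + (\<Sum>g\<in>G. of_bool (g \<in> apexes g0) * (d (b g) - bdegree G b x (b g)) * udeg b g a)"
    unfolding bdegree_def[of G b "lift g0 d x"] lift_def by (simp add: distrib_right sum.distrib bdegree_def)
  also have "(\<Sum>g\<in>G. of_bool (g \<in> apexes g0) * (d (b g) - bdegree G b x (b g)) * udeg b g a) =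
      (\<Sum>g\<in>G. if g = g0 a then of_bool (a \<in> b ` G) * (d a - bdegree G b x a) else 0)"
  proof (rule sum.cong[OF refl])
    fix g assume "g \<in> G"
    have "g \<in> apexes g0 \<and> b g = a \<longleftrightarrow> g = g0 a \<and> a \<in> b ` G"
      using g0(1) by (auto simp: base_def apexes_def)
    then show "of_bool (g \<in> apexes g0) * (d (b g) - bdegree G b x (b g)) * udeg b g a =
        (if g = g0 a then of_bool (a \<in> b ` G) * (d a - bdegree G b x a) else 0)"
      by (auto simp: udeg_def)
  qed
  also have "\<dots> = (if a \<in> b ` G then d a - bdegree G b x a else 0)"
    using finG baseD(2)[OF g0] by (auto simp: apexes_def)
  finally have "bdegree G b (lift g0 d x) a = bdegree G b x a + (if a \<in> b ` G then d a - bdegree G b x a else 0)" .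
  moreover have "bdegree G b x a = 0" if "a \<notin> b ` G"
    unfolding bdegree_def using that by (intro sum.neutral) (auto simp: udeg_def)
  ultimately show ?thesis by simp
qed

lemma point_edges:
  assumes g0: "base g0 K"
  shows "point G r \<alpha> = (\<Sum>g\<in>G. \<alpha> g *\<^sub>R edge g0 g) + (\<Sum>a\<in>b ` G. bdegree G b \<alpha> a *\<^sub>R r (g0 a))"
proof -
  have "(\<Sum>a\<in>b ` G. bdegree G b \<alpha> a *\<^sub>R r (g0 a)) = (\<Sum>a\<in>b ` G. \<Sum>g\<in>G. (\<alpha> g * udeg b g a) *\<^sub>R r (g0 a))"
    by (simp add: bdegree_def scaleR_sum_left)
  also have "\<dots> = (\<Sum>g\<in>G. \<Sum>a\<in>b ` G. (\<alpha> g * udeg b g a) *\<^sub>R r (g0 a))" by (rule sum.swap)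
  also have "\<dots> = (\<Sum>g\<in>G. \<alpha> g *\<^sub>R r (g0 (b g)))"
  proof (rule sum.cong[OF refl])
    fix g assume g: "g \<in> G"
    have "(\<Sum>a\<in>b ` G. (\<alpha> g * udeg b g a) *\<^sub>R r (g0 a)) = (\<Sum>a\<in>b ` G. if a = b g then \<alpha> g *\<^sub>R r (g0 (b g)) else 0)"
      by (intro sum.cong) (auto simp: udeg_def)
    then show "(\<Sum>a\<in>b ` G. (\<alpha> g * udeg b g a) *\<^sub>R r (g0 a)) = \<alpha> g *\<^sub>R r (g0 (b g))" using g finG by simp
  qed
  finally show ?thesis by (simp add: point_def edge_def algebra_simps sum_subtractf)
qed

lemma slice_point_edges:
  assumes g0: "base g0 K" and \<alpha>: "\<alpha> \<in> S"
  shows "point G r \<alpha> = origin g0 + (\<Sum>g\<in>G. \<alpha> g *\<^sub>R edge g0 g)"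
  unfolding point_edges[OF g0] origin_def bdegree_def sliceD(3)[OF \<alpha>] by simp

lemma lift_point:
  assumes g0: "base g0 K" "K \<in> \<K>" and x: "\<forall>g\<in>apexes g0. x g = 0"
  shows "point G r (lift g0 (\<lambda>_. 0) x) = (\<Sum>g\<in>G. x g *\<^sub>R edge g0 g)"
proof -
  have "point G r (lift g0 (\<lambda>_. 0) x) = (\<Sum>g\<in>G. lift g0 (\<lambda>_. 0) x g *\<^sub>R edge g0 g)"
    unfolding point_edges[OF g0(1)] lift_degree[OF g0 x] by simp
  also have "\<dots> = (\<Sum>g\<in>G. x g *\<^sub>R edge g0 g)"
    using baseD(3)[OF g0] by (intro sum.cong) (auto simp: lift_def edge_def)
  finally show ?thesis .
qed

lemma supp_lift: "supp (lift g0 d x) \<subseteq> supp x \<union> apexes g0"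
  by (auto simp: supp_def lift_def)

lemma lift_kern:
  assumes g0: "base g0 K" "K \<in> \<K>" and x: "\<forall>g\<in>apexes g0. x g = 0" "supp x \<subseteq> G"
  shows "lift g0 (\<lambda>_. 0) x \<in> kern G (udeg b)"
proof -
  have "supp (lift g0 (\<lambda>_. 0) x) \<subseteq> G" using supp_lift[of g0 "\<lambda>_. 0" x] x(2) baseD(2)[OF g0] by blast
  then show ?thesis using lift_degree[OF g0 x(1), of "\<lambda>_. 0"] by (simp add: kern_udeg_iff)
qed

lemma lift_off: "g \<notin> apexes g0 \<Longrightarrow> lift g0 d x g = x g"
  by (simp add: lift_def)

text \<open>The lift of a unit vector is an integral relation with this edge as its image.\<close>

lemma edge_int:
  assumes g0: "base g0 K" "K \<in> \<K>" and g: "g \<in> G"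
  shows "edge g0 g $ i \<in> \<int>"
proof (cases "g \<in> apexes g0")
  case True
  then show ?thesis using baseD(3)[OF g0 True] by (simp add: edge_def)
next
  case False
  define x where "x h = (of_bool (h = g) :: real)" for h
  have x: "\<forall>h\<in>apexes g0. x h = 0" "supp x \<subseteq> G" using False g by (auto simp: x_def supp_def)
  have "x \<in> intvec" by (simp add: intvec_def x_def)
  then have "lift g0 (\<lambda>_. 0) x \<in> intvec" unfolding lift_def intvec_def
    using bdegree_int[of x G b] by (auto simp: intvec_def)
  from int[OF lift_kern[OF g0 x] this, of i]
  have "(\<Sum>h\<in>G. x h *\<^sub>R edge g0 h) $ i \<in> \<int>" unfolding lift_point[OF g0 x(1)] .
  moreover have "(\<Sum>h\<in>G. x h *\<^sub>R edge g0 h) = (\<Sum>h\<in>G. if h = g then edge g0 g else 0)"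
    by (intro sum.cong) (auto simp: x_def)
  ultimately show ?thesis using g finG by simp
qed

text \<open>A linear dependence lifts to a relation on the cell with image \<open>0\<close>.\<close>

lemma edges_independent:
  assumes \<sigma>: "\<sigma> \<in> S" and g0: "base g0 (supp \<sigma>)" and x: "supp x \<subseteq> supp \<sigma> - apexes g0"
    and z: "(\<Sum>g\<in>G. x g *\<^sub>R edge g0 g) = 0"
  shows "x g = 0"
proof -
  note K = sliceD(2)[OF \<sigma>]
  have x': "\<forall>h\<in>apexes g0. x h = 0" using x by (auto simp: supp_def)
  have sG: "supp x \<subseteq> G" using x complexD(2)[OF cx K] by blast
  have "lift g0 (\<lambda>_. 0) x = (\<lambda>_. 0)"
  proof (rule kern_point_injective[OF finG cx inj \<sigma> lift_kern[OF g0 K x' sG]])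
    show "supp (lift g0 (\<lambda>_. 0) x) \<subseteq> supp \<sigma>" using supp_lift[of g0 "\<lambda>_. 0" x] x baseD(1)[OF g0 K] by blast
    show "point G r (lift g0 (\<lambda>_. 0) x) = 0" unfolding lift_point[OF g0 K x'] by (rule z)
  qed
  then show ?thesis using x' lift_off[of g g0 "\<lambda>_. 0" x] by (cases "g \<in> apexes g0") simp_all
qed

text \<open>An integral combination lifts to a relation on the cell with integral image. This is
  where unimodularity turns into saturation of the lattice spanned by the edges.\<close>

lemma edges_saturated:
  assumes \<sigma>: "\<sigma> \<in> S" and g0: "base g0 (supp \<sigma>)" and x: "supp x \<subseteq> supp \<sigma> - apexes g0"
    and z: "\<And>i. (\<Sum>g\<in>G. x g *\<^sub>R edge g0 g) $ i \<in> \<int>"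
  shows "x g \<in> \<int>"
proof -
  note K = sliceD(2)[OF \<sigma>]
  have x': "\<forall>h\<in>apexes g0. x h = 0" using x by (auto simp: supp_def)
  have sG: "supp x \<subseteq> G" using x complexD(2)[OF cx K] by blast
  have "lift g0 (\<lambda>_. 0) x \<in> intvec"
  proof (rule uni[OF lift_kern[OF g0 K x' sG]])
    have "supp (lift g0 (\<lambda>_. 0) x) \<subseteq> supp \<sigma>" using supp_lift[of g0 "\<lambda>_. 0" x] x baseD(1)[OF g0 K] by blast
    then show "supp (lift g0 (\<lambda>_. 0) x) \<in> \<K>" by (rule complexD(3)[OF cx K])
    show "point G r (lift g0 (\<lambda>_. 0) x) $ i \<in> \<int>" for i unfolding lift_point[OF g0 K x'] by (rule z)
  qed
  then have "lift g0 (\<lambda>_. 0) x g \<in> \<int>" by (simp add: intvec_def)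
  then show ?thesis using x' lift_off[of g g0 "\<lambda>_. 0" x] by (cases "g \<in> apexes g0") simp_all
qed

text \<open>The cells cover the cube, so the point of \<open>\<sigma>\<close> lies in one whose
  affine hull contains the cube. Uniqueness of weights puts the support of \<open>\<sigma>\<close>
  into that of the cell.\<close>

lemma full_dimensional:
  assumes c: "0 < c" and \<sigma>: "\<sigma> \<in> S"
  shows "\<exists>\<tau>\<in>S. supp \<sigma> \<subseteq> supp \<tau> \<and> affine hull (cell (supp \<tau>)) = UNIV"
proof -
  define P where "P = (cbox (\<chi> i. - c) (\<chi> i. c) :: (real^'n) set)"
  have memP: "x \<in> P \<longleftrightarrow> (\<forall>i. \<bar>x $ i\<bar> \<le> c)" for x by (auto simp: P_def mem_box_cart abs_le_iff minus_le_iff)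
  define \<Q> where "\<Q> = (\<lambda>\<tau>. cell (supp \<tau>)) ` S"
  have "\<Q> \<subseteq> cell ` Pow G" unfolding \<Q>_def
    by (intro image_subsetI imageI PowI complexD(2)[OF cx sliceD(2)])
  then have fin: "finite \<Q>" using finG finite_subset by blast
  have cl: "closed Q" if "Q \<in> \<Q>" for Q
    using that closed_cell[OF sliceD(2)] by (auto simp: \<Q>_def)
  have self: "point G r \<tau> \<in> cell (supp \<tau>)" if "\<tau> \<in> S" for \<tau> using that by (auto simp: cell_def)
  have "P \<subseteq> \<Union>\<Q>"
  proof
    fix x assume "x \<in> P"
    then obtain \<alpha> where "\<alpha> \<in> S" "point G r \<alpha> = x" using cover[of x] memP by blast
    then show "x \<in> \<Union>\<Q>" using self by (auto simp: \<Q>_def)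
  qed
  moreover have "convex P" by (simp add: P_def convex_box)
  moreover have "point G r \<sigma> \<in> P" unfolding memP using inbox[OF \<sigma>] by blast
  ultimately obtain Q where Q: "Q \<in> \<Q>" "point G r \<sigma> \<in> Q" "P \<subseteq> affine hull Q"
    using cover_by_full[OF _ fin cl] by blast
  obtain \<tau> where \<tau>: "\<tau> \<in> S" "Q = cell (supp \<tau>)" using Q(1) by (auto simp: \<Q>_def)
  obtain \<beta> where \<beta>: "\<beta> \<in> S" "supp \<beta> \<subseteq> supp \<tau>" "point G r \<sigma> = point G r \<beta>"
    using Q(2) unfolding \<tau>(2) cell_def by blast
  have sub: "supp \<sigma> \<subseteq> supp \<tau>" using inj[OF \<sigma> \<beta>(1) \<beta>(3)] \<beta>(2) by simp
  have "interior P \<noteq> {}"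
  proof -
    have "(0::real^'n) \<in> box (\<chi> i. - c) (\<chi> i. c)" using c by (simp add: mem_box_cart)
    then show ?thesis unfolding P_def interior_cbox by blast
  qed
  then have "affine hull P = UNIV" by (rule affine_hull_nonempty_interior)
  moreover have "affine hull P \<subseteq> affine hull Q" by (rule hull_minimal[where S = affine, OF Q(3) affine_affine_hull])
  ultimately have "affine hull Q = UNIV" by auto
  then show ?thesis using \<tau> sub by blast
qed

lemma edges_span:
  assumes \<tau>: "\<tau> \<in> S" and g0: "base g0 (supp \<tau>)" and full: "affine hull (cell (supp \<tau>)) = UNIV"
  shows "span (edge g0 ` (supp \<tau> - apexes g0)) = UNIV"
proof -
  let ?W = "span (edge g0 ` (supp \<tau> - apexes g0))"
  note K = sliceD(2)[OF \<tau>]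
  have "cell (supp \<tau>) \<subseteq> (+) (origin g0) ` ?W"
  proof
    fix x assume "x \<in> cell (supp \<tau>)"
    then obtain \<alpha> where \<alpha>: "\<alpha> \<in> S" "supp \<alpha> \<subseteq> supp \<tau>" "x = point G r \<alpha>" unfolding cell_def by blast
    have "\<alpha> g *\<^sub>R edge g0 g \<in> ?W" for g
    proof (cases "g \<in> supp \<tau> - apexes g0")
      case False
      then have "\<alpha> g = 0 \<or> edge g0 g = 0" using \<alpha>(2) baseD(3)[OF g0 K, of g] by (auto simp: supp_def edge_def)
      then have "\<alpha> g *\<^sub>R edge g0 g = 0" by auto
      then show ?thesis by (simp only: span_zero)
    qed (intro span_scale span_base imageI)
    then have "(\<Sum>g\<in>G. \<alpha> g *\<^sub>R edge g0 g) \<in> ?W" by (intro span_sum)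
    then show "x \<in> (+) (origin g0) ` ?W" unfolding \<alpha>(3) slice_point_edges[OF g0 \<alpha>(1)] by (rule imageI)
  qed
  moreover have "affine ((+) (origin g0) ` ?W)" using affine_translation[THEN iffD1, OF subspace_imp_affine[OF subspace_span]] .
  ultimately have "affine hull (cell (supp \<tau>)) \<subseteq> (+) (origin g0) ` ?W" by (rule hull_minimal)
  then have "origin g0 + y \<in> (+) (origin g0) ` ?W" for y using full by blast
  then have "y \<in> ?W" for y by (metis (no_types) imageE add_left_cancel)
  then show ?thesis by blast
qed

lemma edges_card:
  assumes \<tau>: "\<tau> \<in> S" and g0: "base g0 (supp \<tau>)" and full: "affine hull (cell (supp \<tau>)) = UNIV"
  shows "card (supp \<tau> - apexes g0) = CARD('n)"
proof -
  define J where "J = supp \<tau> - apexes g0"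
  have JG: "J \<subseteq> G" using complexD(2)[OF cx sliceD(2)[OF \<tau>]] by (auto simp: J_def)
  have finJ: "finite J" by (rule finite_subset[OF JG finG])
  have z: "x g = 0" if "supp x \<subseteq> J" "(\<Sum>g\<in>J. x g *\<^sub>R edge g0 g) = 0" for x :: "nat \<Rightarrow> real" and g
  proof (rule edges_independent[OF \<tau> g0])
    show "supp x \<subseteq> supp \<tau> - apexes g0" using that(1) by (simp add: J_def)
    show "(\<Sum>g\<in>G. x g *\<^sub>R edge g0 g) = 0"
      using sum.mono_neutral_left[OF finG JG, of "\<lambda>g. x g *\<^sub>R edge g0 g"] that by (auto simp: supp_def)
  qed
  have inj: "inj_on (edge g0) J"
  proof (rule inj_onI, rule ccontr)
    fix g h assume gh: "g \<in> J" "h \<in> J" "edge g0 g = edge g0 h" "g \<noteq> h"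
    define x where "x k = (if k = g then 1 else 0) - (if k = h then 1 else 0 :: real)" for k
    have "(\<Sum>k\<in>J. x k *\<^sub>R edge g0 k) = (\<Sum>k\<in>J. (if k = g then edge g0 g else 0) - (if k = h then edge g0 h else 0))"
      by (intro sum.cong) (auto simp: x_def)
    also have "\<dots> = 0" using gh finJ by (simp add: sum_subtractf)
    finally have "x g = 0" by (intro z) (use gh in \<open>auto simp: x_def supp_def split: if_splits\<close>)
    then show False using gh(4) by (simp add: x_def)
  qed
  have "independent (edge g0 ` J)"
    unfolding dependent_finite[OF finite_imageI[OF finJ]]
  proof (intro notI, elim exE conjE bexE imageE)
    fix u v g assume u: "(\<Sum>v\<in>edge g0 ` J. u v *\<^sub>R v) = 0" "g \<in> J" "u v \<noteq> 0" "v = edge g0 g"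
    define x where "x g = (if g \<in> J then u (edge g0 g) else 0)" for g
    have "(\<Sum>g\<in>J. x g *\<^sub>R edge g0 g) = (\<Sum>g\<in>J. u (edge g0 g) *\<^sub>R edge g0 g)"
      by (intro sum.cong) (auto simp: x_def)
    also have "\<dots> = 0" using u(1) by (simp add: sum.reindex[OF inj])
    finally have "x g = 0" by (intro z) (auto simp: x_def supp_def)
    then show False using u(2-4) by (simp add: x_def)
  qed
  then have "card (edge g0 ` J) = dim (UNIV :: (real^'n) set)"
    using edges_span[OF assms] by (intro basis_card_eq_dim) (auto simp: J_def)
  then show ?thesis using card_image[OF inj] by (simp add: J_def)
qed

end

lemma integer_inverse:
  fixes U W :: "real^'n^'n"
  assumes "U ** W = mat 1" "W ** U = mat 1" "\<And>i j. U $ i $ j \<in> \<int>" "\<And>i j. W $ i $ j \<in> \<int>"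
  shows "\<exists>A::int^'n^'n. invertible A \<and> map_matrix real_of_int A = W"
proof -
  define fl where "fl M = (\<chi> i j. \<lfloor>M $ i $ j\<rfloor>)" for M :: "real^'n^'n"
  have fl: "map_matrix real_of_int (fl M) = M" if "\<And>i j. M $ i $ j \<in> \<int>" for M
    using that by (simp add: vec_eq_iff fl_def)
  have mult: "fl M ** fl M' = mat 1" if "M ** M' = mat 1" "\<And>i j. M $ i $ j \<in> \<int>" "\<And>i j. M' $ i $ j \<in> \<int>" for M M'
  proof -
    have "real_of_int ((fl M ** fl M') $ i $ j) = (M ** M') $ i $ j" for i j
      using that(2,3) by (simp add: matrix_matrix_mult_def fl_def)
    then have "real_of_int ((fl M ** fl M') $ i $ j) = real_of_int (mat 1 $ i $ j)" for i j
      unfolding that(1) by (simp add: mat_def)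
    then show ?thesis by (simp add: vec_eq_iff)
  qed
  have "invertible (fl W)" unfolding invertible_def using mult assms by blast
  then show ?thesis using fl[OF assms(4)] by blast
qed

context polystable_complex
begin

lemma sum_reindexed:
  assumes \<pi>: "bij_betw \<pi> (UNIV :: 'i::finite set) J" and J: "J \<subseteq> G" and x: "\<And>g. g \<notin> J \<Longrightarrow> f g = 0"
  shows "(\<Sum>g\<in>G. f g) = (\<Sum>i\<in>UNIV. f (\<pi> i) :: 'm::comm_monoid_add)"
proof -
  have "(\<Sum>g\<in>G. f g) = (\<Sum>g\<in>J. f g)" by (rule sum.mono_neutral_right[OF finG J]) (use x in auto)
  also have "\<dots> = (\<Sum>i\<in>UNIV. f (\<pi> i))" by (rule sum.reindex_bij_betw[OF \<pi>, symmetric])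
  finally show ?thesis .
qed

text \<open>The edges of a full-dimensional cell \<open>\<tau>\<close> around
  \<open>\<sigma>\<close>, with apexes chosen in \<open>\<sigma>\<close>, form a basis of Z^n. The
  inverse \<open>W\<close> of the matrix of edges sends a point, up to translation, to its weights
  off the apexes. The edges of \<open>\<tau>\<close> outside \<open>\<sigma>\<close> provide the
  coordinates that are \<open>0\<close>.\<close>

lemma semistable_cell:
  assumes c: "0 < c" and \<sigma>: "\<sigma> \<in> S"
  shows "product_of_semistable_simplices V (cell (supp \<sigma>))"
proof -
  obtain \<tau> where \<tau>: "\<tau> \<in> S" "supp \<sigma> \<subseteq> supp \<tau>" "affine hull (cell (supp \<tau>)) = UNIV"
    using full_dimensional[OF c \<sigma>] by blast
  obtain g0 where g0: "base g0 (supp \<sigma>)" using base_exists[OF \<sigma>] by blast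
  have g0': "base g0 (supp \<tau>)" using g0 \<tau>(2) unfolding base_def by blast
  note K = sliceD(2)[OF \<sigma>] and K' = sliceD(2)[OF \<tau>(1)]
  define J where "J = supp \<tau> - apexes g0"
  have JG: "J \<subseteq> G" using complexD(2)[OF cx K'] by (auto simp: J_def)
  have finJ: "finite J" by (rule finite_subset[OF JG finG])
  have "card (UNIV :: 'n set) = card J" unfolding J_def by (rule edges_card[OF \<tau>(1) g0' \<tau>(3), symmetric])
  then obtain \<pi> where \<pi>: "bij_betw \<pi> (UNIV :: 'n set) J" using finite_same_card_bij[OF finite_class.finite_UNIV finJ] by blast
  have \<pi>J: "\<pi> j \<in> J" for j using bij_betwE[OF \<pi>] by simp
  have \<pi>inj: "inj \<pi>" using \<pi> by (simp add: bij_betw_def)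
  have inv\<pi>: "\<pi> (inv \<pi> g) = g" if "g \<in> J" for g using bij_betw_inv_into_right[OF \<pi> that] by simp
  have J0: "edge g0 g = 0" if "g \<in> apexes g0" for g using baseD(3)[OF g0 K that] by (simp add: edge_def)
  define ext where "ext y g = (if g \<in> J then y $ inv \<pi> g else 0)" for y :: "real^'n" and g
  have ext\<pi>: "ext y (\<pi> j) = y $ j" for y j using \<pi>J inv_f_f[OF \<pi>inj] by (simp add: ext_def)
  have extJ: "supp (ext y) \<subseteq> supp \<tau> - apexes g0" for y by (auto simp: supp_def ext_def J_def)
  have ext0: "\<forall>g\<in>apexes g0. ext y g = 0" for y by (simp add: ext_def J_def)
  define U :: "real^'n^'n" where "U = (\<chi> i j. edge g0 (\<pi> j) $ i)"
  have U: "U *v (\<chi> j. x (\<pi> j)) = (\<Sum>g\<in>G. x g *\<^sub>R edge g0 g)" if "\<And>g. g \<in> G \<Longrightarrow> g \<notin> J \<Longrightarrow> x g *\<^sub>R edge g0 g = 0" for x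
  proof -
    have "(\<Sum>g\<in>G. x g *\<^sub>R edge g0 g) = (\<Sum>g\<in>G. if g \<in> J then x g *\<^sub>R edge g0 g else 0)"
      using that by (intro sum.cong) auto
    also have "\<dots> = (\<Sum>j\<in>UNIV. x (\<pi> j) *\<^sub>R edge g0 (\<pi> j))"
      using \<pi>J by (subst sum_reindexed[OF \<pi> JG]) auto
    finally show ?thesis by (simp add: vec_eq_iff matrix_vector_mult_def U_def mult.commute)
  qed
  have Uext: "U *v y = (\<Sum>g\<in>G. ext y g *\<^sub>R edge g0 g)" for y
  proof -
    have "U *v (\<chi> j. ext y (\<pi> j)) = (\<Sum>g\<in>G. ext y g *\<^sub>R edge g0 g)" by (rule U) (simp add: ext_def)
    then show ?thesis by (simp add: ext\<pi>)
  qed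
  have "inj ((*v) U)"
    unfolding vec.inj_iff_eq_0
  proof (intro allI impI)
    fix y assume "U *v y = 0"
    then have "ext y (\<pi> j) = 0" for j
      unfolding Uext by (intro edges_independent[OF \<tau>(1) g0' extJ])
    then show "y = 0" by (simp add: ext\<pi> vec_eq_iff)
  qed
  then obtain W where W: "W ** U = mat 1" using matrix_left_invertible_injective by blast
  then have W': "U ** W = mat 1" using matrix_left_right_inverse by blast
  have WU: "W *v (U *v y) = y" for y by (simp add: matrix_vector_mul_assoc W)
  have Wint: "W $ i $ j \<in> \<int>" for i j
  proof -
    let ?y = "W *v axis j 1"
    have Uy: "U *v ?y = axis j 1" by (simp add: matrix_vector_mul_assoc W')
    have "ext ?y (\<pi> i) \<in> \<int>"
    proof (rule edges_saturated[OF \<tau>(1) g0' extJ])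
      show "(\<Sum>g\<in>G. ext ?y g *\<^sub>R edge g0 g) $ k \<in> \<int>" for k
        unfolding Uext[symmetric] Uy by (simp add: axis_def)
    qed
    then show ?thesis by (simp add: ext\<pi> matrix_vector_mul_component inner_axis)
  qed
  have "U $ i $ j \<in> \<int>" for i j unfolding U_def using edge_int[OF g0 K] \<pi>J JG by auto
  then obtain A :: "int^'n^'n" where A: "invertible A" "map_matrix real_of_int A = W"
    using integer_inverse[OF W' W _ Wint] by blast
  define v where "v = - (W *v origin g0)"
  have tV: "t a \<in> V" if "a \<in> b ` G" for a using sz that by (auto simp: sizes_def)
  have vV: "v $ i \<in> V" for i
  proof -
    have o: "origin g0 $ k \<in> V" for k
    proof -
      have "r (g0 a) $ k * t a \<in> V" if "a \<in> b ` G" for a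
        by (rule rat_subspace_scale[OF V rat tV[OF that]]) (use that baseD(2)[OF g0 K] in \<open>auto simp: apexes_def\<close>)
      then have "(\<Sum>a\<in>b ` G. r (g0 a) $ k * t a) \<in> V" by (rule rat_subspace_sum[OF V])
      then show ?thesis by (simp add: origin_def mult.commute)
    qed
    have "(\<Sum>k\<in>UNIV. W $ i $ k * origin g0 $ k) \<in> V"
      by (intro rat_subspace_sum[OF V] rat_subspace_scale[OF V _ o]) (use Wint Ints_subset_Rats in auto)
    then show ?thesis unfolding v_def by (simp add: matrix_vector_mult_def rat_subspace_minus[OF V])
  qed
  have pt: "W *v point G r \<alpha> + v = (\<chi> j. \<alpha> (\<pi> j))" if \<alpha>: "\<alpha> \<in> S" "supp \<alpha> \<subseteq> supp \<sigma>" for \<alpha>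
  proof -
    have "(\<Sum>g\<in>G. \<alpha> g *\<^sub>R edge g0 g) = U *v (\<chi> j. \<alpha> (\<pi> j))"
      by (rule U[symmetric]) (use \<alpha>(2) \<tau>(2) J0 in \<open>auto simp: J_def supp_def\<close>)
    then show ?thesis unfolding slice_point_edges[OF g0 \<alpha>(1)]
      by (simp add: v_def matrix_vector_right_distrib WU)
  qed
  obtain \<theta> where \<theta>: "bij_betw \<theta> {0..<card (b ` G)} (b ` G)" using ex_bij_betw_nat_finite[of "b ` G"] finG by blast
  define l where "l = card (b ` G)"
  have \<theta>im: "\<theta> ` {..<l} = b ` G" and \<theta>inj: "inj_on \<theta> {..<l}"
    using \<theta> by (auto simp: l_def bij_betw_def atLeast0LessThan)
  \<comment> \<open>\<open>\<pi>\<close> does not take apexes as values. So a label whose only ray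
    in \<open>\<sigma>\<close> is its apex has an empty block, which is a simplex of dimension
    \<open>0\<close>.\<close>
  define B where "B i = {j. \<pi> j \<in> supp \<sigma> \<and> b (\<pi> j) = \<theta> i}" for i
  have disj: "disjoint_family_on B {..<l}" using \<theta>inj by (auto simp: disjoint_family_on_def B_def inj_on_def)
  have BU: "(\<Union>i<l. B i) = {j. \<pi> j \<in> supp \<sigma>}"
  proof
    show "{j. \<pi> j \<in> supp \<sigma>} \<subseteq> (\<Union>i<l. B i)"
    proof
      fix j assume j: "j \<in> {j. \<pi> j \<in> supp \<sigma>}"
      have "b (\<pi> j) \<in> \<theta> ` {..<l}" unfolding \<theta>im using \<pi>J JG by blast
      then obtain i where "i < l" "b (\<pi> j) = \<theta> i" by auto
      then show "j \<in> (\<Union>i<l. B i)" using j by (auto simp: B_def)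
    qed
  qed (auto simp: B_def)
  have block: "(\<Sum>j\<in>B i. \<alpha> (\<pi> j)) = bdegree G b (\<lambda>g. if g \<in> J \<inter> supp \<sigma> then \<alpha> g else 0) (\<theta> i)" for \<alpha> i
  proof -
    have "bdegree G b (\<lambda>g. if g \<in> J \<inter> supp \<sigma> then \<alpha> g else 0) (\<theta> i)
      = (\<Sum>j\<in>UNIV. (if \<pi> j \<in> J \<inter> supp \<sigma> then \<alpha> (\<pi> j) else 0) * udeg b (\<pi> j) (\<theta> i))"
      unfolding bdegree_def by (rule sum_reindexed[OF \<pi> JG]) auto
    also have "\<dots> = (\<Sum>j\<in>UNIV. if j \<in> B i then \<alpha> (\<pi> j) else 0)"
      using \<pi>J by (intro sum.cong) (auto simp: B_def udeg_def)
    also have "\<dots> = (\<Sum>j\<in>B i. \<alpha> (\<pi> j))" by (simp add: sum.If_cases)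
    finally show ?thesis by simp
  qed
  have "(\<lambda>x. W *v x + v) ` cell (supp \<sigma>) = std_polystable l B (\<lambda>i. t (\<theta> i))"
  proof (intro equalityI subsetI)
    fix y assume "y \<in> (\<lambda>x. W *v x + v) ` cell (supp \<sigma>)"
    then obtain \<alpha> where \<alpha>: "\<alpha> \<in> S" "supp \<alpha> \<subseteq> supp \<sigma>" "y = W *v point G r \<alpha> + v" unfolding cell_def by blast
    have y: "y $ j = \<alpha> (\<pi> j)" for j unfolding \<alpha>(3) pt[OF \<alpha>(1,2)] by simp
    have "(\<Sum>j\<in>B i. y $ j) \<le> t (\<theta> i)" for i
    proof -
      have "(\<Sum>j\<in>B i. y $ j) \<le> bdegree G b \<alpha> (\<theta> i)"
        unfolding y block unfolding bdegree_def
        using sliceD(1)[OF \<alpha>(1)] by (intro sum_mono mult_right_mono) (auto simp: udeg_def)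
      then show ?thesis using sliceD(3)[OF \<alpha>(1)] by (simp add: bdegree_def)
    qed
    moreover have "y $ j = 0" if "j \<notin> (\<Union>i<l. B i)" for j using that \<alpha>(2) unfolding BU y by (auto simp: supp_def)
    ultimately show "y \<in> std_polystable l B (\<lambda>i. t (\<theta> i))"
      unfolding std_polystable_def using sliceD(1)[OF \<alpha>(1)] by (simp add: y)
  next
    fix y assume y: "y \<in> std_polystable l B (\<lambda>i. t (\<theta> i))"
    have y1: "0 \<le> y $ j" if "i < l" "j \<in> B i" for i j using y that by (auto simp: std_polystable_def)
    have y2: "(\<Sum>j\<in>B i. y $ j) \<le> t (\<theta> i)" if "i < l" for i using y that by (auto simp: std_polystable_def)
    have y3: "y $ j = 0" if "\<pi> j \<notin> supp \<sigma>" for j using y that unfolding std_polystable_def BU by simp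
    have ynn: "0 \<le> y $ j" for j
    proof (cases "\<pi> j \<in> supp \<sigma>")
      case True
      then have "j \<in> (\<Union>i<l. B i)" unfolding BU by simp
      then show ?thesis using y1 by blast
    qed (simp add: y3)
    have es: "ext y g = 0" if "g \<notin> supp \<sigma>" for g using y3[of "inv \<pi> g"] inv\<pi>[of g] that by (simp add: ext_def)
    \<comment> \<open>The coordinates are the weights off the apexes, and each apex takes the slack
      in the inequality of its block.\<close>
    let ?\<alpha> = "lift g0 t (ext y)"
    have deg: "bdegree G b (ext y) (\<theta> i) = (\<Sum>j\<in>B i. y $ j)" for i
    proof -
      have "ext y g = (if g \<in> J \<inter> supp \<sigma> then ext y g else 0)" for g
        using es[of g] by (cases "g \<in> J") (simp_all add: ext_def)
      then have "ext y = (\<lambda>g. if g \<in> J \<inter> supp \<sigma> then ext y g else 0)" by (rule ext)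
      then show ?thesis using block[of "ext y" i] by (simp add: ext\<pi>)
    qed
    have "0 \<le> ?\<alpha> g" for g
    proof (cases "g \<in> apexes g0")
      case True
      then have "b g \<in> \<theta> ` {..<l}" unfolding \<theta>im using baseD(2)[OF g0 K] by blast
      then obtain i where "i < l" "b g = \<theta> i" by auto
      then have "0 \<le> t (b g) - bdegree G b (ext y) (b g)" using deg y2 by simp
      then show ?thesis using ext0 True by (simp add: lift_def)
    qed (use ynn in \<open>simp add: lift_off ext_def\<close>)
    moreover have "supp (ext y) \<subseteq> supp \<sigma>" using es by (auto simp: supp_def)
    then have s: "supp ?\<alpha> \<subseteq> supp \<sigma>" using supp_lift[of g0 t "ext y"] baseD(1)[OF g0 K] by blast
    moreover have "bdegree G b ?\<alpha> a = t a" for a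
      unfolding lift_degree[OF g0 K ext0] using sz by (simp add: sizes_def)
    ultimately have \<alpha>: "?\<alpha> \<in> S" using complexD(3)[OF cx K s] by (simp add: slice_def bdegree_def)
    have "y = W *v point G r ?\<alpha> + v"
      unfolding pt[OF \<alpha> s] using \<pi>J by (simp add: vec_eq_iff lift_off J_def ext\<pi>)
    moreover have "point G r ?\<alpha> \<in> cell (supp \<sigma>)" using \<alpha> s by (auto simp: cell_def)
    ultimately show "y \<in> (\<lambda>x. W *v x + v) ` cell (supp \<sigma>)" by blast
  qed
  moreover have "\<forall>i<l. t (\<theta> i) \<in> V \<and> 0 < t (\<theta> i)"
  proof (intro allI impI)
    fix i assume "i < l"
    then have "\<theta> i \<in> b ` G" using \<theta>im by blast
    then show "t (\<theta> i) \<in> V \<and> 0 < t (\<theta> i)" using sz by (auto simp: sizes_def)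
  qed
  ultimately show ?thesis
    unfolding product_of_semistable_simplices_def
    by (intro exI[of _ A] exI[of _ v] exI[of _ l] exI[of _ B] exI[of _ "\<lambda>i. t (\<theta> i)"]) (simp add: A vV disj)
qed

end

section \<open>Standard polytopes as polytopes over V, and the refinement of X\<close>

lemma V_affineI:
  assumes "v \<in> V" "\<And>i. a $ i \<in> \<int>"
  shows "V_affine V (\<lambda>x. v + a \<bullet> x)"
proof -
  have "(\<lambda>x. v + a \<bullet> x) = (\<lambda>x. v + (\<Sum>i\<in>UNIV. of_int ((\<chi> i. \<lfloor>a $ i\<rfloor>) $ i) * x $ i))"
    using assms(2) by (simp add: inner_vec_def)
  then show ?thesis unfolding V_affine_def using assms(1) by blast
qed

text \<open>The inequalities of the standard polytope are pulled back along the integral affine map,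
  each equation giving two of them. Boundedness is transported by the inverse matrix.\<close>

lemma product_of_semistable_imp_polytope:
  fixes P :: "(real^'n::finite) set"
  assumes V: "rat_subspace V" and P: "product_of_semistable_simplices V P"
  shows "ZV_polytope V P"
proof -
  obtain A :: "int^'n^'n" and v :: "real^'n" and l :: nat and J \<pi> where
    R: "invertible A \<and> (\<forall>i. v $ i \<in> V) \<and> disjoint_family_on J {..<l} \<and> (\<forall>i<l. \<pi> i \<in> V \<and> 0 < \<pi> i) \<and>
        (\<lambda>x. map_matrix real_of_int A *v x + v) ` P = std_polystable l J \<pi>"
    using P unfolding product_of_semistable_simplices_def by (elim exE) (rule that)
  define M where "M = map_matrix real_of_int A"
  let ?h = "\<lambda>x. M *v x + v"
  have im: "?h ` P = std_polystable l J \<pi>" using R by (simp add: M_def)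
  have vV: "v $ i \<in> V" for i using R by blast
  have pV: "\<pi> i \<in> V" and p0: "0 < \<pi> i" if "i < l" for i using R that by blast+
  have vV': "sum (($) v) X \<in> V" for X using vV by (intro rat_subspace_sum[OF V])
  obtain B :: "int^'n^'n" where B: "B ** A = mat 1" using R unfolding invertible_def by blast
  define W where "W = map_matrix real_of_int B"
  have WM: "W ** M = mat 1"
  proof -
    have "(W ** M) $ i $ j = real_of_int ((B ** A) $ i $ j)" for i j by (simp add: W_def M_def matrix_matrix_mult_def)
    then show ?thesis unfolding B by (simp add: vec_eq_iff mat_def)
  qed
  have W: "W *v (?h x - v) = x" for x by (simp add: matrix_vector_mul_assoc WM)
  have mem: "x \<in> P \<longleftrightarrow> ?h x \<in> std_polystable l J \<pi>" for x
    unfolding im[symmetric] using W by (metis (no_types, lifting) imageE imageI)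
  let ?N = "- (\<Union>i<l. J i)"
  define F where "F = (\<lambda>j x. v $ j + M $ j \<bullet> x) ` (\<Union>i<l. J i) \<union> (\<lambda>i x. (\<pi> i - (\<Sum>j\<in>J i. v $ j)) + (- (\<Sum>j\<in>J i. M $ j)) \<bullet> x) ` {..<l} \<union>
    (\<lambda>j x. v $ j + M $ j \<bullet> x) ` ?N \<union> (\<lambda>j x. - v $ j + (- M $ j) \<bullet> x) ` ?N"
  have hc: "?h x $ j = v $ j + M $ j \<bullet> x" for x j by (simp add: matrix_vector_mul_component)
  have hs: "\<pi> i - (\<Sum>j\<in>J i. ?h x $ j) = (\<pi> i - (\<Sum>j\<in>J i. v $ j)) + (- (\<Sum>j\<in>J i. M $ j)) \<bullet> x" for x i
    unfolding hc by (simp add: sum.distrib inner_sum_left)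
  have Mint: "M $ i $ j \<in> \<int>" for i j by (simp add: M_def)
  have "V_affine V f" if "f \<in> F" for f
    using that unfolding F_def
  proof (elim UnE imageE)
    show "V_affine V f" if "f = (\<lambda>x. v $ j + M $ j \<bullet> x)" for j unfolding that by (rule V_affineI) (use vV Mint in auto)
    show "V_affine V f" if "f = (\<lambda>x. v $ j + M $ j \<bullet> x)" for j unfolding that by (rule V_affineI) (use vV Mint in auto)
    show "V_affine V f" if "f = (\<lambda>x. - v $ j + (- M $ j) \<bullet> x)" for j unfolding that
      by (rule V_affineI) (use vV Mint rat_subspace_minus[OF V] in auto)
    show "V_affine V f" if "f = (\<lambda>x. (\<pi> i - (\<Sum>j\<in>J i. v $ j)) + (- (\<Sum>j\<in>J i. M $ j)) \<bullet> x)" "i \<in> {..<l}" for i unfolding that(1)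
      by (rule V_affineI) (use that(2) pV vV' Mint rat_subspace_diff[OF V] in \<open>auto simp: sum_component\<close>)
  qed
  moreover have "finite F" unfolding F_def by (intro finite_UnI finite_imageI) auto
  moreover have "P = {x. \<forall>f\<in>F. 0 \<le> f x}"
  proof (intro set_eqI)
    fix x
    have "(\<forall>f\<in>F. 0 \<le> f x) \<longleftrightarrow> (\<forall>j\<in>(\<Union>i<l. J i). 0 \<le> ?h x $ j) \<and> (\<forall>i\<in>{..<l}. 0 \<le> \<pi> i - (\<Sum>j\<in>J i. ?h x $ j)) \<and>
        (\<forall>j\<in>?N. 0 \<le> ?h x $ j) \<and> (\<forall>j\<in>?N. 0 \<le> - ?h x $ j)"
      unfolding F_def hs unfolding hc ball_Un ball_simps(9) by (simp add: conj_assoc)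
    also have "\<dots> \<longleftrightarrow> ?h x \<in> std_polystable l J \<pi>"
    proof -
      have "(\<forall>j\<in>?N. 0 \<le> ?h x $ j) \<and> (\<forall>j\<in>?N. 0 \<le> - ?h x $ j) \<longleftrightarrow> (\<forall>j. j \<notin> (\<Union>i<l. J i) \<longrightarrow> ?h x $ j = 0)"
        by (metis Compl_iff neg_0_le_iff_le order.antisym order.refl)
      then show ?thesis unfolding std_polystable_def by auto
    qed
    finally show "x \<in> P \<longleftrightarrow> x \<in> {x. \<forall>f\<in>F. 0 \<le> f x}" unfolding mem by simp
  qed
  moreover have "P \<noteq> {}"
  proof -
    have "0 \<in> std_polystable l J \<pi>" using p0 by (auto simp: std_polystable_def less_imp_le)
    then show ?thesis using im by auto
  qed
  moreover have "bounded P"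
  proof -
    have "std_polystable l J \<pi> \<subseteq> cbox 0 (\<chi> j. \<Sum>i<l. \<pi> i)"
    proof
      fix y assume y: "y \<in> std_polystable l J \<pi>"
      have s: "0 \<le> (\<Sum>i<l. \<pi> i)" using p0 by (intro sum_nonneg) (auto simp: less_imp_le)
      have "0 \<le> y $ j \<and> y $ j \<le> (\<Sum>i<l. \<pi> i)" for j
      proof (cases "j \<in> (\<Union>i<l. J i)")
        case True
        then obtain i where i: "i < l" "j \<in> J i" by auto
        have nn: "0 \<le> y $ k" if "k \<in> J i" for k using y i(1) that by (auto simp: std_polystable_def)
        have "y $ j \<le> (\<Sum>k\<in>J i. y $ k)" by (rule member_le_sum) (use i(2) nn in auto)
        also have "\<dots> \<le> \<pi> i" using y i(1) by (auto simp: std_polystable_def)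
        also have "\<dots> \<le> (\<Sum>i<l. \<pi> i)" by (rule member_le_sum) (use i(1) p0 in \<open>auto simp: less_imp_le\<close>)
        finally show ?thesis using nn[OF i(2)] by simp
      qed (use y s in \<open>auto simp: std_polystable_def\<close>)
      then show "y \<in> cbox 0 (\<chi> j. \<Sum>i<l. \<pi> i)" by (simp add: mem_box_cart)
    qed
    then have bs: "bounded (std_polystable l J \<pi>)" using bounded_subset bounded_cbox by blast
    have "P = (\<lambda>y. W *v y) ` ((\<lambda>y. y - v) ` std_polystable l J \<pi>)"
      unfolding im[symmetric] image_image W by simp
    moreover have "bounded ((\<lambda>y. y - v) ` std_polystable l J \<pi>)"
      by (rule bounded_translation_minus[OF bs])
    ultimately show ?thesis using bounded_linear_image matrix_vector_mul_bounded_linear by blast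
  qed
  ultimately show ?thesis unfolding ZV_polytope_def by blast
qed

lemma polytope_forms:
  fixes P :: "(real^'n::finite) set"
  assumes "ZV_polytope V P"
  shows "\<exists>F. finite F \<and> (\<forall>f\<in>F. fst f \<in> V \<and> (\<forall>i. snd f $ i \<in> \<int>)) \<and> P = {x. \<forall>f\<in>F. 0 \<le> fst f + snd f \<bullet> x}"
proof -
  obtain \<Phi> where \<Phi>: "finite \<Phi>" "\<And>h. h \<in> \<Phi> \<Longrightarrow> V_affine V h" "P = {x. \<forall>h\<in>\<Phi>. 0 \<le> h x}"
    using assms unfolding ZV_polytope_def by blast
  have "\<forall>h\<in>\<Phi>. \<exists>f :: 'n form. fst f \<in> V \<and> (\<forall>i. snd f $ i \<in> \<int>) \<and> h = (\<lambda>x. fst f + snd f \<bullet> x)"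
  proof
    fix h assume "h \<in> \<Phi>"
    then obtain v and a :: "int^'n" where h: "v \<in> V" "h = (\<lambda>x. v + (\<Sum>i\<in>UNIV. of_int (a $ i) * x $ i))"
      using \<Phi>(2) unfolding V_affine_def by blast
    show "\<exists>f :: 'n form. fst f \<in> V \<and> (\<forall>i. snd f $ i \<in> \<int>) \<and> h = (\<lambda>x. fst f + snd f \<bullet> x)"
      by (rule exI[of _ "(v, \<chi> i. of_int (a $ i))"]) (simp add: h inner_vec_def)
  qed
  then obtain \<phi> where \<phi>: "\<And>h. h \<in> \<Phi> \<Longrightarrow> fst (\<phi> h) \<in> V \<and> (\<forall>i. snd (\<phi> h) $ i \<in> \<int>) \<and> h = (\<lambda>x. fst (\<phi> h) + snd (\<phi> h) \<bullet> x)"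
    using bchoice by metis
  have "0 \<le> h x \<longleftrightarrow> 0 \<le> fst (\<phi> h) + snd (\<phi> h) \<bullet> x" if "h \<in> \<Phi>" for h x
    using \<phi>[OF that] by metis
  then have "P = {x. \<forall>f\<in>\<phi> ` \<Phi>. 0 \<le> fst f + snd f \<bullet> x}" unfolding \<Phi>(3) by auto
  then show ?thesis using \<phi> \<Phi>(1) by (intro exI[of _ "\<phi> ` \<Phi>"]) blast
qed

lemma ZV_polytope_imp_polytope:
  assumes "ZV_polytope V P" shows "polytope P"
proof -
  obtain F where F: "finite F" "P = {x. \<forall>f\<in>F. 0 \<le> fst f + snd f \<bullet> x}" using polytope_forms[OF assms] by blast
  have "P = (\<Inter>f\<in>F. {x. - fst f \<le> snd f \<bullet> x})"
  proof -
    have "0 \<le> fst f + snd f \<bullet> x \<longleftrightarrow> - fst f \<le> snd f \<bullet> x" for f x by linarith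
    then show ?thesis unfolding F(2) by auto
  qed
  then have "polyhedron P" using F(1)
    by (simp only:) (intro polyhedron_Inter finite_imageI, auto intro: polyhedron_halfspace_ge)
  then show ?thesis using assms by (simp add: ZV_polytope_def polytope_eq_bounded_polyhedron)
qed

text \<open>All constant terms vanish, so the polytope is a cone, and a bounded cone is the origin.
  This is the standard polytope with \<open>l = 0\<close>.\<close>

lemma trivial_polytope:
  fixes P :: "(real^'n::finite) set"
  assumes V: "V = {0}" and P: "ZV_polytope V P"
  shows "product_of_semistable_simplices V P"
proof -
  obtain F where F: "\<And>f. f \<in> F \<Longrightarrow> fst f \<in> V" "P = {x. \<forall>f\<in>F. 0 \<le> fst f + snd f \<bullet> x}" using polytope_forms[OF P] by blast
  have P0: "P = {x. \<forall>f\<in>F. 0 \<le> snd f \<bullet> x}" unfolding F(2) using F(1) V by auto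
  obtain C where C: "\<And>x. x \<in> P \<Longrightarrow> norm x \<le> C" using P by (auto simp: ZV_polytope_def bounded_iff)
  have "x = 0" if x: "x \<in> P" for x
  proof (rule ccontr)
    assume "x \<noteq> 0"
    then have n: "0 < norm x" by simp
    define u where "u = (\<bar>C\<bar> + 1) / norm x"
    have "0 \<le> u" by (simp add: u_def)
    then have "u *\<^sub>R x \<in> P" using x unfolding P0 by simp
    then have "norm (u *\<^sub>R x) \<le> C" by (rule C)
    then show False using n by (simp add: u_def)
  qed
  then have "P = {0}" using P by (auto simp: ZV_polytope_def)
  moreover have "map_matrix real_of_int (mat 1 :: int^'n^'n) = mat 1" by (simp add: vec_eq_iff mat_def)
  moreover have "std_polystable 0 J \<pi> = {0 :: real^'n}" for J \<pi> by (auto simp: std_polystable_def vec_eq_iff)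
  moreover have "invertible (mat 1 :: int^'n^'n)" unfolding invertible_def by (rule exI[of _ "mat 1"]) simp
  ultimately show ?thesis
    unfolding product_of_semistable_simplices_def using V
    by (intro exI[of _ "mat 1"] exI[of _ 0]) (simp add: disjoint_family_on_def)
qed

text \<open>Complexes are pure, so only the cells of dimension \<open>k\<close> contained in some
  cell of \<open>X\<close> are kept. They still cover: \<open>P\<close> is the union of the cells
  contained in it, and each of its points lies in one whose affine hull contains
  \<open>P\<close>.\<close>

lemma (in polystable_complex) refinement:
  fixes X :: "(real^'n) set set"
  assumes X: "polyhedral_complex X" and c: "0 < c"
    and box: "\<And>P x i. P \<in> X \<Longrightarrow> x \<in> P \<Longrightarrow> \<bar>x $ i\<bar> \<le> c"
    and forms: "\<And>P. P \<in> X \<Longrightarrow> \<exists>E\<subseteq>F. P = {x. \<forall>f\<in>E. 0 \<le> fst f + snd f \<bullet> x}"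
  shows "\<exists>X'. polyhedral_complex X' \<and> refines_complex X' X \<and>
    (\<forall>P\<in>X'. ZV_polytope V P \<and> product_of_semistable_simplices V P)"
proof -
  obtain k :: nat where k: "\<And>P. P \<in> X \<Longrightarrow> polytope P \<and> aff_dim P = int k" using X unfolding polyhedral_complex_def by blast
  define X' where "X' = {cell (supp \<sigma>) |\<sigma>. \<sigma> \<in> S \<and> aff_dim (cell (supp \<sigma>)) = int k \<and> (\<exists>P\<in>X. cell (supp \<sigma>) \<subseteq> P)}"
  have X'E: "\<exists>\<sigma>\<in>S. C = cell (supp \<sigma>) \<and> aff_dim C = int k \<and> (\<exists>P\<in>X. C \<subseteq> P)" if "C \<in> X'" for C
    using that unfolding X'_def by blast
  have semi: "product_of_semistable_simplices V C" if "C \<in> X'" for C using X'E[OF that] semistable_cell[OF c] by blast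
  have ZV: "ZV_polytope V C" if "C \<in> X'" for C by (rule product_of_semistable_imp_polytope[OF V semi[OF that]])
  have "X' \<subseteq> cell ` Pow G"
  proof
    fix C assume "C \<in> X'"
    then obtain \<sigma> where "\<sigma> \<in> S" "C = cell (supp \<sigma>)" using X'E by blast
    then show "C \<in> cell ` Pow G" using complexD(2)[OF cx sliceD(2)] by blast
  qed
  then have fin: "finite X'" using finG finite_subset by blast
  have "polyhedral_complex X'"
    unfolding polyhedral_complex_def
  proof (intro conjI exI[of _ k] ballI)
    show "finite X'" by (rule fin)
    show "polytope C" "aff_dim C = int k" if "C \<in> X'" for C using ZV_polytope_imp_polytope[OF ZV[OF that]] X'E[OF that] by auto
    fix C D assume "C \<in> X'" "D \<in> X'"
    then obtain \<sigma> \<tau> where s: "\<sigma> \<in> S" "C = cell (supp \<sigma>)" and t: "\<tau> \<in> S" "D = cell (supp \<tau>)" using X'E by meson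
    show "C \<inter> D face_of C" "C \<inter> D face_of D"
      unfolding s t cell_Int by (rule cell_face[OF sliceD(2)[OF s(1)]] cell_face[OF sliceD(2)[OF t(1)]], simp)+
  qed
  moreover have "refines_complex X' X"
    unfolding refines_complex_def
  proof (intro conjI ballI equalityI)
    show sub: "\<exists>Q\<in>X. C \<subseteq> Q" if "C \<in> X'" for C using X'E[OF that] by blast
    then show "\<Union>X' \<subseteq> \<Union>X" by blast
    show "\<Union>X \<subseteq> \<Union>X'"
    proof
      fix x assume "x \<in> \<Union>X"
      then obtain P where P: "P \<in> X" "x \<in> P" by blast
      obtain E where E: "E \<subseteq> F" "P = {x. \<forall>f\<in>E. 0 \<le> fst f + snd f \<bullet> x}" using forms[OF P(1)] by blast
      define \<Q> where "\<Q> = {cell (supp \<sigma>) |\<sigma>. \<sigma> \<in> S \<and> cell (supp \<sigma>) \<subseteq> P}"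
      have "\<Q> \<subseteq> cell ` Pow G"
      proof
        fix C assume "C \<in> \<Q>"
        then obtain \<sigma> where "\<sigma> \<in> S" "C = cell (supp \<sigma>)" unfolding \<Q>_def by blast
        then show "C \<in> cell ` Pow G" using complexD(2)[OF cx sliceD(2)] by blast
      qed
      then have finQ: "finite \<Q>" using finG finite_subset by blast
      have clQ: "closed Q" if "Q \<in> \<Q>" for Q using that closed_cell[OF sliceD(2)] unfolding \<Q>_def by blast
      have cov: "P \<subseteq> \<Union>\<Q>"
      proof
        fix y assume y: "y \<in> P"
        obtain \<sigma> where s: "\<sigma> \<in> S" "point G r \<sigma> = y" using cover[of y] box[OF P(1) y] by blast
        have "cell (supp \<sigma>) \<subseteq> P"
        proof
          fix z assume "z \<in> cell (supp \<sigma>)"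
          then obtain \<beta> where b: "\<beta> \<in> S" "supp \<beta> \<subseteq> supp \<sigma>" "z = point G r \<beta>" unfolding cell_def by blast
          have "0 \<le> fst f + snd f \<bullet> z" if "f \<in> E" for f
            unfolding b(3) by (rule signs[OF _ s(1) b(1,2)]) (use that E y s(2) in auto)
          then show "z \<in> P" unfolding E(2) by blast
        qed
        moreover have "y \<in> cell (supp \<sigma>)" using s by (auto simp: cell_def)
        ultimately show "y \<in> \<Union>\<Q>" using s(1) unfolding \<Q>_def by blast
      qed
      have "\<exists>Q\<in>\<Q>. x \<in> Q \<and> P \<subseteq> affine hull Q"
        by (rule cover_by_full[OF polytope_imp_convex finQ clQ cov P(2)]) (use k[OF P(1)] in simp)
      then obtain \<sigma> where s: "\<sigma> \<in> S" "cell (supp \<sigma>) \<subseteq> P" "x \<in> cell (supp \<sigma>)" "P \<subseteq> affine hull (cell (supp \<sigma>))"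
        unfolding \<Q>_def by blast
      have "aff_dim P \<le> aff_dim (cell (supp \<sigma>))" using aff_dim_subset[OF s(4)] by simp
      then have "aff_dim (cell (supp \<sigma>)) = int k" using aff_dim_subset[OF s(2)] k[OF P(1)] by simp
      then show "x \<in> \<Union>X'" using s P(1) unfolding X'_def by blast
    qed
  qed
  ultimately show ?thesis using ZV semi by blast
qed

theorem theorem4p5p2:
  fixes V :: "real set" and X :: "(real^'n) set set"
  assumes "rat_subspace V"
    and "polyhedral_complex X"
    and "\<forall>P\<in>X. ZV_polytope V P"
  shows "\<exists>X'. polyhedral_complex X' \<and> refines_complex X' X \<and>
           (\<forall>P\<in>X'. ZV_polytope V P \<and> product_of_semistable_simplices V P)"
proof (cases "\<exists>v\<in>V. 0 < v")
  \<comment> \<open>Without positive elements \<open>V\<close> is zero, no box of positive size is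
    available, and \<open>X\<close> itself is already a refinement as required.\<close>
  case False
  have "v = 0" if "v \<in> V" for v using False that rat_subspace_minus[OF assms(1) that] by (metis linorder_neqE neg_0_less_iff_less)
  then have "V = {0}" using rat_subspace_0[OF assms(1)] by blast
  then have "\<forall>P\<in>X. product_of_semistable_simplices V P" using trivial_polytope assms(3) by blast
  then show ?thesis using assms(2,3) by (intro exI[of _ X]) (auto simp: refines_complex_def)
next
  case True
  then obtain v where v: "v \<in> V" "0 < v" by blast
  have finX: "finite X" using assms(2) by (simp add: polyhedral_complex_def)
  have "bounded (\<Union>X)" using finX assms(3) by (intro bounded_Union) (auto simp: ZV_polytope_def)
  then obtain C where C: "\<And>x. x \<in> \<Union>X \<Longrightarrow> norm x \<le> C" by (auto simp: bounded_iff)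
  obtain m :: nat where m: "C / v < real m" using reals_Archimedean2 by blast
  \<comment> \<open>A multiple of \<open>v\<close>, so that the box inequalities have constant term
    in \<open>V\<close>, and large enough that the box contains all of \<open>X\<close>. The
    successor keeps it positive.\<close>
  define c where "c = real (Suc m) * v"
  have c0: "0 < c" using v(2) by (simp add: c_def)
  have cV: "c \<in> V" unfolding c_def by (rule rat_subspace_scale[OF assms(1) _ v(1)]) simp
  have "C \<le> real m * v" using m v(2) by (simp add: pos_divide_less_eq)
  then have Cc: "C \<le> c" using v(2) by (simp add: c_def algebra_simps)
  have "\<forall>P\<in>X. \<exists>E :: 'n form set. finite E \<and> (\<forall>f\<in>E. fst f \<in> V \<and> (\<forall>i. snd f $ i \<in> \<int>)) \<and> P = {x. \<forall>f\<in>E. 0 \<le> fst f + snd f \<bullet> x}"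
    by (intro ballI polytope_forms) (rule bspec[OF assms(3)])
  from bchoice[OF this] obtain E :: "(real^'n) set \<Rightarrow> 'n form set" where
    E: "\<forall>P\<in>X. finite (E P) \<and> (\<forall>f\<in>E P. fst f \<in> V \<and> (\<forall>i. snd f $ i \<in> \<int>)) \<and> P = {x. \<forall>f\<in>E P. 0 \<le> fst f + snd f \<bullet> x}"
    by (elim exE) (rule that)
  define F where "F = (\<Union>P\<in>X. E P) \<union> range (\<lambda>i. (c, axis i 1 :: real^'n)) \<union> range (\<lambda>i. (c, - axis i 1))"
  have "\<exists>G \<K> b t r. polystable_complex V c F G \<K> b t r"
  proof (rule polystable_complex_exists[OF assms(1)])
    show "finite F" unfolding F_def using finX E by auto
    show "fst f \<in> V" if "f \<in> F" for f using that E cV by (auto simp: F_def)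
    have "snd f $ i \<in> \<int>" if "f \<in> F" for f i using that E by (auto simp: F_def axis_def)
    then show "snd f $ i \<in> \<rat>" if "f \<in> F" for f i using that Ints_subset_Rats by blast
  qed (use c0 in \<open>auto simp: F_def\<close>)
  then obtain G \<K> b t r where "polystable_complex V c F G \<K> b t r" by blast
  then interpret polystable_complex V c F G \<K> b t r .
  show ?thesis
  proof (rule refinement[OF assms(2) c0])
    show "\<bar>x $ i\<bar> \<le> c" if "P \<in> X" "x \<in> P" for P x i
      using order_trans[OF component_le_norm_cart order_trans[OF C Cc]] that by blast
    show "\<exists>E\<subseteq>F. P = {x. \<forall>f\<in>E. 0 \<le> fst f + snd f \<bullet> x}" if P: "P \<in> X" for P
      using bspec[OF E P] P by (intro exI[of _ "E P"]) (auto simp: F_def)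
  qed
qed

end
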